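(* Suppose that Assumptions 1, 2 and 3 (stated in the context) hold. Let $\gamma_1^N$ be the estimator produced by the Adaptive Multilevel Splitting (AMS) algorithm with $N\ge2$ particles described in the context. Then for any $\varphi\in C_b(\{\xi=1\})$ (continuous bounded real function on $\{\xi=1\}$), $$\mathbb E\left[\left(\gamma_1^N(\varphi)-\gamma_1(\varphi)\right)^2\right]\le\frac{6\,\|\varphi\|_\infty^2}{N}.$$
   Context: **Setting.** $E$ is a Polish space, $\xi:E\to\mathbb R$ a level function, $\{\xi\in I\}=\xi^{-1}(I)$, $A\subset E$ a Borel set, $(Y_s)_{s\ge0}$ a time-homogeneous Markov process in $E$ with continuous trajectories, definable from any initial condition; $\mathbb P_y,\mathbb E_y$ refer to $Y_0=y$, and $\mathbb P,\mathbb E$ to $Y_0\sim\eta_0$. For $t\ge0$, $S_t=\inf\{s\ge0:\xi(Y_s)>t\}\in[0,+\infty]$, and for $B\subset E$, $S_B=\inf\{s\ge0:Y_s\in B\}\in[0,+\infty]$ (with $\inf\emptyset=+\infty$). $\mathring A,\bar A$ are the interior and closure of $A$. It is assumed that $\mathbb P(S_1<S_A)>0$. **Assumption 1.** $E$ is locally compact, $\xi$ is continuous, $\eta_0(\xi=0)=1$, $A\subset\{\xi<0\}$, and $Y$ is a Feller process with continuous trajectories (i.e. for all $\varphi\in C_0(E)$, $s\ge0$, $y\mapsto\mathbb E_y[\varphi(Y_s)]$ is in $C_0(E)$, the continuous functions vanishing at infinity). **Assumption 2.** For any $t\in[0,1]$ and $y$ with $\xi(y)=t$, $\mathbb P_y(S_t=0)=1$;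 and for all $y\in\{\xi=0\}$, $\mathbb P_y(S_{\bar A}=S_{\mathring A})=1$. **Assumption 3.** Almost surely $S_A\wedge S_1<+\infty$ (i.e. $\mathbb P_y$-almost surely for every $y\in\{0\le\xi\le1\}$), and $\inf_{y\in\{\xi=0\}}\mathbb P_y(S_1<S_A)>0$. **AMS algorithm** ($N\ge2$ particles). Draw $Y_0^{1,0},\dots,Y_0^{N,0}$ i.i.d. from $\eta_0$ and from each simulate independently a trajectory $(Y^{n,0}_s)$ of the process $Y$, stopped at $S_A\wedge S_1$. Set $\tau_0=0$ and iterate on $j\ge1$: (i) The score of particle $n$ is $\sup_{0\le s\le S_A^{n,j-1}\wedge S_1^{n,j-1}}\xi(Y_s^{n,j-1})$ (the times being those of trajectory $Y^{n,j-1}$). Let $N_j$ be the index of the particle with smallest score and $\tau_j$ its score. (ii) Stop if $\tau_j=1$. (iii) For $n\ne N_j$ set $Y^{n,j}=Y^{n,j-1}$. (iv) Branching: pick $M_j$ uniformly in $\{1,\dots,N\}\setminus\{N_j\}$, set $\sigma_j=\inf\{s\ge0:\xi(Y_s^{M_j,j})>\tau_j\}$; set $Y^{N_j,j}_s=Y^{M_j,j}_s$ for $s<\sigma_j$, and for $s\ge\sigma_j$ simulate a new independent piece of trajectory with the law of $Y$ started from $Y^{M_j,j}_{\sigma_j}$, stopped when the trajectory hits $A$ or $\{\xi>1\}$. For $t\in[0,1]$, $J_t$ is the number of branchings between level $0$ and level $t$, i.e. the largest $j$ such that the $j$-th branching is performed and $\tau_j\le t$ ($0$ if none). Let $S_t^n=\inf\{s\ge0:\xi(Y_s^{n,J_t})>t\}$,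 the entrance time at level $t$ of particle $n$ (equivalently its hitting time of $\{\xi=t\}$ under Assumption 2), and $X_t^n=Y^{n,J_t}_{S_t^n}$. **Estimators.** $\eta_t^N(\varphi)=\frac1N\sum_{n=1}^N\varphi(X_t^n)$, $p_t^N=(1-\frac1N)^{J_t}$, $\gamma_t^N(\varphi)=p_t^N\eta_t^N(\varphi)$. **Limit.** $\gamma_1(\varphi)=\mathbb E[\varphi(Y_{S_1})\mathbf 1_{S_1<S_A}]$. *)

theory Defs
  imports "HOL-Probability.Probability"
begin

section \<open>Continuous Markov processes\<close>

type_synonym 'e path = "real \<Rightarrow> 'e"

text \<open>Continuous trajectories \<open>[0,\<infinity>) \<rightarrow> E\<close> with the \<open>\<sigma>\<close>-algebra generated by the coordinates.
  A path is \<open>undefined\<close> at negative times.\<close>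

definition path_space :: "'e::polish_space path measure" where
  "path_space = restrict_space (\<Pi>\<^sub>M s\<in>{0..}. borel) {w. continuous_on {0..} w}"

definition shift :: "real \<Rightarrow> 'e path \<Rightarrow> 'e path" where
  "shift s w = (\<lambda>u\<in>{0..}. w (s + u))"

definition natural_filtration :: "real \<Rightarrow> 'e::polish_space path measure" where
  "natural_filtration s =
     vimage_algebra (space path_space) (\<lambda>w. restrict w {0..s}) (\<Pi>\<^sub>M u\<in>{0..s}. borel)"

text \<open>\<open>P y\<close> is the law on path space of the process started from \<open>y\<close>.\<close>

definition markov_process :: "('e::polish_space \<Rightarrow> 'e path measure) \<Rightarrow> bool" where
  "markov_process P \<longleftrightarrow>
     P \<in> borel \<rightarrow>\<^sub>M prob_algebra path_space \<and>
     (\<forall>y. AE w in P y. w 0 = y) \<and>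
     (\<forall>y. \<forall>s\<ge>0. \<forall>B\<in>sets (natural_filtration s). \<forall>C\<in>sets path_space.
        emeasure (P y) {w\<in>B. shift s w \<in> C} = (\<integral>\<^sup>+w\<in>B. emeasure (P (w s)) C \<partial>P y))"

definition C0 :: "('e::topological_space \<Rightarrow> real) set" where
  "C0 = {f. continuous_on UNIV f \<and> (\<forall>\<epsilon>>0. compact {x. \<epsilon> \<le> \<bar>f x\<bar>})}"

definition feller :: "('e::polish_space \<Rightarrow> 'e path measure) \<Rightarrow> bool" where
  "feller P \<longleftrightarrow> (\<forall>f\<in>C0. \<forall>s\<ge>0. (\<lambda>y. LINT w|P y. f (w s)) \<in> C0)"

text \<open>\<open>hit_time B w\<close> is \<open>S\<^sub>B\<close> and \<open>level_time \<xi> t w\<close> is \<open>S\<^sub>t\<close>; the infimum of the empty set is \<open>\<infinity>\<close>.\<close>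

definition hit_time :: "'e set \<Rightarrow> 'e path \<Rightarrow> ereal" where
  "hit_time B w = Inf {ereal s | s. 0 \<le> s \<and> w s \<in> B}"

definition level_time :: "('e \<Rightarrow> real) \<Rightarrow> real \<Rightarrow> 'e path \<Rightarrow> ereal" where
  "level_time \<xi> t w = Inf {ereal s | s. 0 \<le> s \<and> \<xi> (w s) > t}"

text \<open>Since \<open>A\<close> is only a Borel set, \<open>hit_time A\<close> need not be measurable for the coordinate
  \<open>\<sigma>\<close>-algebra. Probabilities of events involving it are therefore taken in the completed measure.\<close>

definition success_event :: "('e::polish_space \<Rightarrow> real) \<Rightarrow> 'e set \<Rightarrow> 'e path set" where
  "success_event \<xi> A = {w\<in>space path_space. level_time \<xi> 1 w < hit_time A w}"

definition success_prob ::
  "('e::polish_space \<Rightarrow> real) \<Rightarrow> 'e set \<Rightarrow> 'e path measure \<Rightarrow> real" where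
  "success_prob \<xi> A Q = measure (completion Q) (success_event \<xi> A)"

definition assumption1 ::
  "('e::polish_space \<Rightarrow> 'e path measure) \<Rightarrow> 'e measure \<Rightarrow> ('e \<Rightarrow> real) \<Rightarrow> 'e set \<Rightarrow> bool" where
  "assumption1 P \<eta>0 \<xi> A \<longleftrightarrow>
     locally compact (UNIV :: 'e set) \<and> continuous_on UNIV \<xi> \<and>
     measure \<eta>0 {y. \<xi> y = 0} = 1 \<and> A \<subseteq> {y. \<xi> y < 0} \<and> feller P"

definition assumption2 ::
  "('e::polish_space \<Rightarrow> 'e path measure) \<Rightarrow> ('e \<Rightarrow> real) \<Rightarrow> 'e set \<Rightarrow> bool" where
  "assumption2 P \<xi> A \<longleftrightarrow>
     (\<forall>t\<in>{0..1}. \<forall>y. \<xi> y = t \<longrightarrow> (AE w in P y. level_time \<xi> t w = 0)) \<and>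
     (\<forall>y. \<xi> y = 0 \<longrightarrow> (AE w in P y. hit_time (closure A) w = hit_time (interior A) w))"

definition assumption3 ::
  "('e::polish_space \<Rightarrow> 'e path measure) \<Rightarrow> ('e \<Rightarrow> real) \<Rightarrow> 'e set \<Rightarrow> bool" where
  "assumption3 P \<xi> A \<longleftrightarrow>
     (\<forall>y. 0 \<le> \<xi> y \<and> \<xi> y \<le> 1 \<longrightarrow> (AE w in P y. min (hit_time A w) (level_time \<xi> 1 w) < \<infinity>)) \<and>
     (INF y\<in>{y. \<xi> y = 0}. success_prob \<xi> A (P y)) > 0"

definition limit_gamma1 ::
  "('e::polish_space \<Rightarrow> 'e path measure) \<Rightarrow> 'e measure \<Rightarrow> ('e \<Rightarrow> real) \<Rightarrow> 'e set \<Rightarrow>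
    ('e \<Rightarrow> real) \<Rightarrow> real" where
  "limit_gamma1 P \<eta>0 \<xi> A \<phi> =
     (LINT w|completion (\<eta>0 \<bind> P).
        \<phi> (w (real_of_ereal (level_time \<xi> 1 w))) * indicator (success_event \<xi> A) w)"


section \<open>Adaptive multilevel splitting\<close>

text \<open>The state of the algorithm is the family of the \<open>N\<close> trajectories, indexed by \<open>{1..N}\<close>.
  A trajectory \<open>w\<close> is kept beyond the time \<open>S\<^sub>A \<and> S\<^sub>1\<close> at which its simulation is stopped, so that
  \<open>S\<^sub>1\<close> remains the entrance time into \<open>{\<xi> > 1}\<close>; the scores, the branching times and the final
  positions only depend, almost surely, on the part of \<open>w\<close> up to \<open>S\<^sub>A \<and> S\<^sub>1\<close>.\<close>

definition score :: "('e \<Rightarrow> real) \<Rightarrow> 'e set \<Rightarrow> 'e path \<Rightarrow> real" where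
  "score \<xi> A w =
     (SUP s\<in>{s. 0 \<le> s \<and> ereal s \<le> min (hit_time A w) (level_time \<xi> 1 w)}. \<xi> (w s))"

definition min_score :: "nat \<Rightarrow> ('e \<Rightarrow> real) \<Rightarrow> 'e set \<Rightarrow> (nat \<Rightarrow> 'e path) \<Rightarrow> real" where
  "min_score N \<xi> A Y = Min ((\<lambda>n. score \<xi> A (Y n)) ` {1..N})"

text \<open>Under the assumptions, ties between scores below 1 have probability 0; they are broken by the smallest index.\<close>

definition lowest :: "nat \<Rightarrow> ('e \<Rightarrow> real) \<Rightarrow> 'e set \<Rightarrow> (nat \<Rightarrow> 'e path) \<Rightarrow> nat" where
  "lowest N \<xi> A Y = (LEAST n. n \<in> {1..N} \<and> score \<xi> A (Y n) = min_score N \<xi> A Y)"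

definition splice :: "'e path \<Rightarrow> ereal \<Rightarrow> 'e path \<Rightarrow> 'e path" where
  "splice w \<sigma> z = (\<lambda>s\<in>{0..}. if ereal s < \<sigma> then w s else z (s - real_of_ereal \<sigma>))"

text \<open>One iteration, with \<open>m\<close> the index of the particle to copy and \<open>z\<close> the new piece of
  trajectory. Once the minimal score is 1 the state no longer changes.\<close>

definition ams_step ::
  "nat \<Rightarrow> ('e \<Rightarrow> real) \<Rightarrow> 'e set \<Rightarrow> nat \<Rightarrow> 'e path \<Rightarrow> (nat \<Rightarrow> 'e path) \<Rightarrow> (nat \<Rightarrow> 'e path)" where
  "ams_step N \<xi> A m z Y =
     (let \<tau> = min_score N \<xi> A Y in
      if \<tau> = 1 then Y
      else Y(lowest N \<xi> A Y := splice (Y m) (level_time \<xi> \<tau> (Y m)) z))"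

text \<open>A run of the algorithm is determined by the random draws: the initial trajectories \<open>Y0 n\<close>, the
  indices \<open>pick j\<close> (that is, \<open>M\<^sub>j\<close>) and the new pieces \<open>piece j\<close>, \<open>j \<ge> 1\<close>, the latter being
  parametrised from their own time 0. Below, \<open>particles N \<xi> A Y0 pick piece j n\<close> is \<open>Y\<^bsup>n,j\<^esup>\<close> and
  \<open>\<tau>\<^sub>j\<close> is \<open>tau N \<xi> A Y0 pick piece j\<close>.\<close>

fun particles ::
  "nat \<Rightarrow> ('e \<Rightarrow> real) \<Rightarrow> 'e set \<Rightarrow> (nat \<Rightarrow> 'e path) \<Rightarrow> (nat \<Rightarrow> nat) \<Rightarrow> (nat \<Rightarrow> 'e path) \<Rightarrow>
    nat \<Rightarrow> nat \<Rightarrow> 'e path" where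
  "particles N \<xi> A Y0 pick piece 0 = Y0"
| "particles N \<xi> A Y0 pick piece (Suc j) =
     ams_step N \<xi> A (pick (Suc j)) (piece (Suc j)) (particles N \<xi> A Y0 pick piece j)"

definition tau ::
  "nat \<Rightarrow> ('e \<Rightarrow> real) \<Rightarrow> 'e set \<Rightarrow> (nat \<Rightarrow> 'e path) \<Rightarrow> (nat \<Rightarrow> nat) \<Rightarrow> (nat \<Rightarrow> 'e path) \<Rightarrow>
    nat \<Rightarrow> real" where
  "tau N \<xi> A Y0 pick piece j =
     (if j = 0 then 0 else min_score N \<xi> A (particles N \<xi> A Y0 pick piece (j - 1)))"

text \<open>As the state is frozen after the stop, the \<open>j\<close>-th branching is performed iff \<open>\<tau>\<^sub>j \<noteq> 1\<close>.
  Under the assumptions, the set below is almost surely finite.\<close>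

definition branchings ::
  "nat \<Rightarrow> ('e \<Rightarrow> real) \<Rightarrow> 'e set \<Rightarrow> (nat \<Rightarrow> 'e path) \<Rightarrow> (nat \<Rightarrow> nat) \<Rightarrow> (nat \<Rightarrow> 'e path) \<Rightarrow>
    real \<Rightarrow> nat" where
  "branchings N \<xi> A Y0 pick piece t =
     Max (insert 0 {j. 1 \<le> j \<and> tau N \<xi> A Y0 pick piece j \<noteq> 1 \<and> tau N \<xi> A Y0 pick piece j \<le> t})"

definition entrance_point ::
  "nat \<Rightarrow> ('e \<Rightarrow> real) \<Rightarrow> 'e set \<Rightarrow> (nat \<Rightarrow> 'e path) \<Rightarrow> (nat \<Rightarrow> nat) \<Rightarrow> (nat \<Rightarrow> 'e path) \<Rightarrow>
    real \<Rightarrow> nat \<Rightarrow> 'e" where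
  "entrance_point N \<xi> A Y0 pick piece t n =
     (let w = particles N \<xi> A Y0 pick piece (branchings N \<xi> A Y0 pick piece t) n
      in w (real_of_ereal (level_time \<xi> t w)))"

definition eta_est ::
  "nat \<Rightarrow> ('e \<Rightarrow> real) \<Rightarrow> 'e set \<Rightarrow> (nat \<Rightarrow> 'e path) \<Rightarrow> (nat \<Rightarrow> nat) \<Rightarrow> (nat \<Rightarrow> 'e path) \<Rightarrow>
    real \<Rightarrow> ('e \<Rightarrow> real) \<Rightarrow> real" where
  "eta_est N \<xi> A Y0 pick piece t \<phi> =
     (\<Sum>n=1..N. \<phi> (entrance_point N \<xi> A Y0 pick piece t n)) / real N"

definition p_est ::
  "nat \<Rightarrow> ('e \<Rightarrow> real) \<Rightarrow> 'e set \<Rightarrow> (nat \<Rightarrow> 'e path) \<Rightarrow> (nat \<Rightarrow> nat) \<Rightarrow> (nat \<Rightarrow> 'e path) \<Rightarrow>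
    real \<Rightarrow> real" where
  "p_est N \<xi> A Y0 pick piece t = (1 - 1 / real N) ^ branchings N \<xi> A Y0 pick piece t"

definition gamma_est ::
  "nat \<Rightarrow> ('e \<Rightarrow> real) \<Rightarrow> 'e set \<Rightarrow> (nat \<Rightarrow> 'e path) \<Rightarrow> (nat \<Rightarrow> nat) \<Rightarrow> (nat \<Rightarrow> 'e path) \<Rightarrow>
    real \<Rightarrow> ('e \<Rightarrow> real) \<Rightarrow> real" where
  "gamma_est N \<xi> A Y0 pick piece t \<phi> =
     p_est N \<xi> A Y0 pick piece t * eta_est N \<xi> A Y0 pick piece t \<phi>"

text \<open>The \<open>\<sigma>\<close>-algebra generated by the initial trajectories, the first \<open>k\<close> picks and the first
  \<open>i\<close> pieces.\<close>

definition past ::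
  "'w measure \<Rightarrow> nat \<Rightarrow> (nat \<Rightarrow> 'w \<Rightarrow> 'e::polish_space path) \<Rightarrow> (nat \<Rightarrow> 'w \<Rightarrow> nat) \<Rightarrow>
    (nat \<Rightarrow> 'w \<Rightarrow> 'e path) \<Rightarrow> nat \<Rightarrow> nat \<Rightarrow> 'w measure" where
  "past M N Y0 pick piece k i = sigma (space M)
     ({Y0 n -` B \<inter> space M | n B. n \<in> {1..N} \<and> B \<in> sets path_space} \<union>
      {pick j -` B \<inter> space M | j B. j \<in> {1..k} \<and> B \<in> sets (count_space UNIV)} \<union>
      {piece j -` B \<inter> space M | j B. j \<in> {1..i} \<and> B \<in> sets path_space})"

text \<open>\<open>ams_run\<close>: on the probability space \<open>M\<close>, the draws have the joint law prescribed by the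
  algorithm, expressed through the conditional law of each draw given the preceding ones. The
  draws made after the stop are not used, hence not constrained.\<close>

definition ams_run ::
  "('e::polish_space \<Rightarrow> 'e path measure) \<Rightarrow> 'e measure \<Rightarrow> ('e \<Rightarrow> real) \<Rightarrow> 'e set \<Rightarrow> nat \<Rightarrow>
    'w measure \<Rightarrow> (nat \<Rightarrow> 'w \<Rightarrow> 'e path) \<Rightarrow> (nat \<Rightarrow> 'w \<Rightarrow> nat) \<Rightarrow> (nat \<Rightarrow> 'w \<Rightarrow> 'e path) \<Rightarrow> bool" where
  "ams_run P \<eta>0 \<xi> A N M Y0 pick piece \<longleftrightarrow>
     prob_space M \<and>
     (\<forall>j\<ge>1. pick j \<in> M \<rightarrow>\<^sub>M count_space UNIV) \<and>
     (\<forall>j\<ge>1. piece j \<in> M \<rightarrow>\<^sub>M path_space) \<and>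
     prob_space.indep_vars M (\<lambda>_. path_space) Y0 {1..N} \<and>
     (\<forall>n\<in>{1..N}. distr M path_space (Y0 n) = \<eta>0 \<bind> P) \<and>
     (let Y = (\<lambda>\<omega>. particles N \<xi> A (\<lambda>n. Y0 n \<omega>) (\<lambda>j. pick j \<omega>) (\<lambda>j. piece j \<omega>));
          \<tau> = (\<lambda>j \<omega>. tau N \<xi> A (\<lambda>n. Y0 n \<omega>) (\<lambda>j. pick j \<omega>) (\<lambda>j. piece j \<omega>) j)
      in \<forall>j\<ge>1.
        (\<forall>m\<in>{1..N}. AE \<omega> in M. \<tau> j \<omega> \<noteq> 1 \<longrightarrow>
           real_cond_exp M (past M N Y0 pick piece (j - 1) (j - 1))
             (\<lambda>\<omega>. indicator {m} (pick j \<omega>)) \<omega>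
           = (if m = lowest N \<xi> A (Y \<omega> (j - 1)) then 0 else 1 / real (N - 1))) \<and>
        (\<forall>C\<in>sets path_space. AE \<omega> in M. \<tau> j \<omega> \<noteq> 1 \<longrightarrow>
           real_cond_exp M (past M N Y0 pick piece j (j - 1))
             (\<lambda>\<omega>. indicator C (piece j \<omega>)) \<omega>
           = (let w = Y \<omega> (j - 1) (pick j \<omega>)
              in measure (P (w (real_of_ereal (level_time \<xi> (\<tau> j \<omega>) w)))) C)))"

end

theory Submission
  imports Defs
begin

text \<open>Let \<open>h y\<close> be the mean of \<open>\<phi>(Y\<^bsub>S\<^sub>1\<^esub>) 1\<^bsub>S\<^sub>1<S\<^sub>A\<^esub>\<close> under \<open>P\<^sub>y\<close>, \<open>\<gamma>\<close> its mean under \<open>\<eta>\<^sub>0\<close>, \<open>C = \<parallel>\<phi>\<parallel>\<close>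
  and \<open>b = 1 - 1/N\<close>. The score of a trajectory is the level at which the others are restarted, and by
  the strong Markov property (at the optional times \<open>S\<^sub>t\<close>, from the Feller property) their parts beyond
  their entrance in \<open>{\<xi> > \<tau>\<^sub>j}\<close> are again independent copies of the process, started from points
  \<open>x\<^sub>1, \<dots>, x\<^sub>N\<close> of \<open>{\<xi> = \<tau>\<^sub>j}\<close>. Counting a stopped run with its final value, the product of \<open>b\<^sup>j\<close> with
  the mean of the \<open>h(x\<^sub>n)\<close> is therefore a martingale, so that the estimator has mean \<open>\<gamma>\<close>. For the second moment
  one keeps only the off-diagonal products: with \<open>V(x) = N\<^sup>-\<^sup>2 \<Sum>\<^bsub>n\<noteq>m\<^esub> h(x\<^sub>n) h(x\<^sub>m) + C\<^sup>2/N\<close>,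
  \<open>b\<^bsup>2j\<^esup> V\<close> is a supermartingale which dominates the square of the estimator in the mean, and initially its
  mean is at most \<open>\<gamma>\<^sup>2 + C\<^sup>2/N\<close>. Hence the variance is at most \<open>C\<^sup>2/N\<close>. The run stops almost surely, since in
  each iteration all particles reach level 1 with probability at least \<open>\<delta>\<^sup>N\<close>, where \<open>\<delta> > 0\<close> is the infimum
  in Assumption 3.\<close>

section \<open>Path space\<close>

text \<open>The restart level is a score, hence random and dependent on all particles. Given the
  whole trajectory of the lowest particle it is a constant; the other particles are independent of
  that trajectory, and the strong Markov property is applied to each of them at this constant level.
  For this the lowest particle must be unique, which holds because a level that is touched is at
  once exceeded, so that scores have no atoms below 1. As \<open>A\<close> is only Borel, its
  hitting time is replaced by that of its closure, almost surely equal to it once the condition on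
  interior and closure has been carried from level 0 to all nonnegative levels. The run is known
  only through conditional expectations of its draws; the independence of the remaining parts is
  therefore carried through the induction as an identity of expectations. The diagonal is left out
  of \<open>V\<close> because the square of one payoff is not controlled by the square of its mean;
  the constant \<open>C^2/N\<close> bounds the diagonal at the end and also pays for the loss in the
  selection step.\<close>

lemma space_path_space:
  "space path_space = {w. w \<in> extensional {0..} \<and> continuous_on {0..} w}"
  by (auto simp: path_space_def space_restrict_space space_PiM PiE_def)

lemma path_space_continuous: "w \<in> space path_space \<Longrightarrow> continuous_on {0..} w"
  by (simp add: space_path_space)

lemma measurable_eval_path: "0 \<le> s \<Longrightarrow> (\<lambda>w. w s) \<in> path_space \<rightarrow>\<^sub>M borel"
  unfolding path_space_def by (rule measurable_restrict_space1) (rule measurable_component_singleton, simp)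

lemma measurable_path_spaceI:
  assumes "\<And>x. x \<in> space M \<Longrightarrow> f x \<in> space path_space"
    and "\<And>s. 0 \<le> s \<Longrightarrow> (\<lambda>x. f x s) \<in> M \<rightarrow>\<^sub>M borel"
  shows "f \<in> M \<rightarrow>\<^sub>M path_space"
  unfolding path_space_def
proof (rule measurable_restrict_space2)
  show "f \<in> space M \<rightarrow> {w. continuous_on {0..} w}"
    using assms(1) by (auto simp: space_path_space)
  show "f \<in> M \<rightarrow>\<^sub>M Pi\<^sub>M {0..} (\<lambda>s. borel)"
    using assms by (intro measurable_PiM_single') (auto simp: space_path_space PiE_def)
qed

text \<open>The random time is approximated from above by times on the dyadic grid, where only
  countably many coordinates occur; continuity of the paths gives the limit.\<close>

lemma measurable_eval_joint:
  fixes g :: "'a \<Rightarrow> 'e::polish_space path"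
  assumes f: "f \<in> borel_measurable M" and g: "g \<in> M \<rightarrow>\<^sub>M path_space"
    and pos: "\<And>x. x \<in> space M \<Longrightarrow> 0 \<le> f x"
  shows "(\<lambda>x. g x (f x)) \<in> M \<rightarrow>\<^sub>M borel"
proof (rule borel_measurable_LIMSEQ_metric)
  define r where "r k x = real (nat \<lceil>f x * 2 ^ k\<rceil>) / 2 ^ k" for k x
  have r_nonneg: "0 \<le> r k x" for k x unfolding r_def by (intro divide_nonneg_pos of_nat_0_le_iff) simp
  show "(\<lambda>x. g x (r k x)) \<in> borel_measurable M" for k
  proof -
    have "(\<lambda>x. nat \<lceil>f x * 2 ^ k\<rceil>) \<in> M \<rightarrow>\<^sub>M count_space UNIV"
      using f by measurable
    moreover have "(\<lambda>x. g x (real i / 2 ^ k)) \<in> M \<rightarrow>\<^sub>M borel" for i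
      using measurable_compose[OF g measurable_eval_path] by simp
    ultimately show ?thesis
      unfolding r_def by (rule measurable_compose_countable[rotated])
  qed
  fix x assume x: "x \<in> space M"
  have "(\<lambda>k. r k x) \<longlonglongrightarrow> f x"
  proof (rule real_tendsto_sandwich)
    have up: "r k x \<le> f x + 1 / 2 ^ k" and lo: "f x \<le> r k x" for k
    proof -
      have e: "r k x = of_int \<lceil>f x * 2 ^ k\<rceil> / 2 ^ k"
        using pos[OF x] unfolding r_def by simp
      have "of_int \<lceil>f x * 2 ^ k\<rceil> \<le> f x * 2 ^ k + 1" "f x * 2 ^ k \<le> of_int \<lceil>f x * 2 ^ k\<rceil>" 
        by linarith+
      then have "of_int \<lceil>f x * 2 ^ k\<rceil> / 2 ^ k \<le> (f x * 2 ^ k + 1) / 2 ^ k"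
        "f x * 2 ^ k / 2 ^ k \<le> of_int \<lceil>f x * 2 ^ k\<rceil> / 2 ^ k"
        by (intro divide_right_mono; simp)+
      then show "r k x \<le> f x + 1 / 2 ^ k" "f x \<le> r k x"
        unfolding e by (simp_all add: add_divide_distrib)
    qed
    then show "\<forall>\<^sub>F k in sequentially. f x \<le> r k x" "\<forall>\<^sub>F k in sequentially. r k x \<le> f x + 1 / 2 ^ k" by auto
    have "(\<lambda>k. f x + (1/2) ^ k) \<longlonglongrightarrow> f x + 0"
      by (intro tendsto_intros LIMSEQ_realpow_zero) auto
    then show "(\<lambda>k. f x + 1 / 2 ^ k) \<longlonglongrightarrow> f x" by (simp add: power_divide)
  qed simp
  moreover have "continuous_on {0..} (g x)"
    using measurable_space[OF g x] by (rule path_space_continuous)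
  ultimately show "(\<lambda>k. g x (r k x)) \<longlonglongrightarrow> g x (f x)"
    by (intro continuous_on_tendsto_compose[of "{0..}" "g x"] always_eventually allI)
      (use pos[OF x] r_nonneg in auto)
qed

lemma shift_in_path_space: "0 \<le> s \<Longrightarrow> w \<in> space path_space \<Longrightarrow> shift s w \<in> space path_space"
proof -
  assume s: "0 \<le> s" and w: "w \<in> space path_space"
  have "continuous_on {0..} (\<lambda>u. w (s + u))"
    using s by (intro continuous_on_compose2[OF path_space_continuous[OF w]] continuous_intros) auto
  then have "continuous_on {0..} (shift s w)"
    by (rule continuous_on_eq) (auto simp: shift_def)
  then show ?thesis by (simp add: space_path_space shift_def)
qed

lemma shift_apply: "0 \<le> u \<Longrightarrow> shift s w u = w (s + u)"
  by (simp add: shift_def)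

lemma measurable_shift_joint:
  assumes f: "f \<in> borel_measurable M" and g: "g \<in> M \<rightarrow>\<^sub>M path_space"
    and pos: "\<And>x. x \<in> space M \<Longrightarrow> 0 \<le> f x"
  shows "(\<lambda>x. shift (f x) (g x)) \<in> M \<rightarrow>\<^sub>M path_space"
proof (rule measurable_path_spaceI)
  show "shift (f x) (g x) \<in> space path_space" if "x \<in> space M" for x
    by (intro shift_in_path_space pos measurable_space[OF g] that)
  show "(\<lambda>x. shift (f x) (g x) s) \<in> M \<rightarrow>\<^sub>M borel" if "0 \<le> s" for s
  proof -
    have "(\<lambda>x. g x (f x + s)) \<in> M \<rightarrow>\<^sub>M borel"
    proof (rule measurable_eval_joint[OF _ g])
      show "(\<lambda>x. f x + s) \<in> borel_measurable M" by (intro borel_measurable_add f measurable_const) simp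
      show "0 \<le> f x + s" if "x \<in> space M" for x using pos[OF that] \<open>0 \<le> s\<close> by simp
    qed
    then show ?thesis by (simp only: shift_apply[OF that])
  qed
qed

lemma space_natural_filtration: "space (natural_filtration s) = space path_space"
  by (simp add: natural_filtration_def)

lemma measurable_natural_filtration_eval:
  assumes "0 \<le> u" "u \<le> s"
  shows "(\<lambda>w. w u) \<in> natural_filtration s \<rightarrow>\<^sub>M borel"
proof -
  have "(\<lambda>w. restrict w {0..s}) \<in> natural_filtration s \<rightarrow>\<^sub>M (\<Pi>\<^sub>M u\<in>{0..s}. borel)"
    unfolding natural_filtration_def by (rule measurable_vimage_algebra1) (auto simp: space_PiM)
  from measurable_compose[OF this measurable_component_singleton[of u]] assms
  show ?thesis by simp
qed

lemma measurable_natural_filtrationI: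
  assumes "f \<in> space M \<rightarrow> space path_space" "\<And>u. 0 \<le> u \<Longrightarrow> u \<le> s \<Longrightarrow> (\<lambda>x. f x u) \<in> M \<rightarrow>\<^sub>M borel"
  shows "f \<in> M \<rightarrow>\<^sub>M natural_filtration s"
  unfolding natural_filtration_def
  by (rule measurable_vimage_algebra2) (use assms in \<open>auto intro!: measurable_restrict\<close>)

text \<open>Inclusion of sigma-algebras on one space as measurability of the identity, so that for
  path spaces only the coordinates have to be checked.\<close>

lemma sets_subset_if_measurable_id:
  assumes "(\<lambda>w. w) \<in> N \<rightarrow>\<^sub>M L" and "space N = space L"
  shows "sets L \<subseteq> sets N"
proof
  fix B assume B: "B \<in> sets L"
  then have "(\<lambda>w. w) -` B \<inter> space N = B" using assms(2) sets.sets_into_space[OF B] by auto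
  then show "B \<in> sets N" using measurable_sets[OF assms(1) B] by simp
qed

lemma sets_natural_filtration_mono:
  assumes "s \<le> t" shows "sets (natural_filtration s) \<subseteq> sets (natural_filtration t)"
proof -
  have "(\<lambda>w. w) \<in> natural_filtration t \<rightarrow>\<^sub>M natural_filtration s"
    using assms by (intro measurable_natural_filtrationI measurable_natural_filtration_eval)
      (auto simp: space_natural_filtration)
  then show ?thesis by (rule sets_subset_if_measurable_id) (simp add: space_natural_filtration)
qed

lemma sets_natural_filtration_path_space: "sets (natural_filtration s) \<subseteq> sets path_space"
proof -
  have "(\<lambda>w. w) \<in> path_space \<rightarrow>\<^sub>M natural_filtration s"
    by (intro measurable_natural_filtrationI measurable_eval_path) auto
  then show ?thesis by (rule sets_subset_if_measurable_id) (simp add: space_natural_filtration)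
qed

section \<open>Hitting times\<close>

lemma hit_time_less: "hit_time B w < s \<longleftrightarrow> (\<exists>u\<ge>0. ereal u < s \<and> w u \<in> B)"
  unfolding hit_time_def by (auto simp: Inf_less_iff)

lemma hit_time_le: "0 \<le> u \<Longrightarrow> w u \<in> B \<Longrightarrow> hit_time B w \<le> ereal u"
  unfolding hit_time_def by (auto intro: Inf_lower)

lemma hit_time_nonneg: "0 \<le> hit_time B w"
  unfolding hit_time_def by (auto intro: Inf_greatest)

lemma hit_time_mono: "B \<subseteq> C \<Longrightarrow> hit_time C w \<le> hit_time B w"
  unfolding hit_time_def by (auto intro!: Inf_superset_mono)

lemma not_hit_before: "0 \<le> u \<Longrightarrow> ereal u < hit_time B w \<Longrightarrow> w u \<notin> B"
  using hit_time_le by fastforce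

lemma level_time_eq_hit_time: "level_time \<xi> t = hit_time {x. t < \<xi> x}"
  by (simp add: level_time_def hit_time_def fun_eq_iff)

text \<open>Additivity of hitting times along a path that avoids the set before
  \<open>\<sigma>\<close>; the later statements on shifted, advanced and spliced trajectories rest
  on it. The tail may have hitting time infinity.\<close>

lemma hit_time_after:
  assumes "0 \<le> \<sigma>" and no: "\<And>u. 0 \<le> u \<Longrightarrow> u < \<sigma> \<Longrightarrow> w u \<notin> B"
    and tail: "\<And>u. 0 \<le> u \<Longrightarrow> w (\<sigma> + u) = z u"
  shows "hit_time B w = ereal \<sigma> + hit_time B z"
proof (rule antisym)
  show "ereal \<sigma> + hit_time B z \<le> hit_time B w"
  proof (rule ccontr)
    assume "\<not> ?thesis"
    then obtain u where u: "0 \<le> u" "ereal u < ereal \<sigma> + hit_time B z" "w u \<in> B"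
      by (auto simp: not_le hit_time_less)
    then have "\<sigma> \<le> u" using no by force
    then have "z (u - \<sigma>) \<in> B" using tail[of "u - \<sigma>"] u by simp
    then have "hit_time B z \<le> ereal (u - \<sigma>)" using \<open>\<sigma> \<le> u\<close> by (intro hit_time_le) auto
    then have "ereal \<sigma> + hit_time B z \<le> ereal \<sigma> + ereal (u - \<sigma>)" by (rule add_left_mono)
    with u show False by simp
  qed
  show "hit_time B w \<le> ereal \<sigma> + hit_time B z"
  proof (rule ccontr)
    assume "\<not> ?thesis"
    then have *: "ereal \<sigma> + hit_time B z < hit_time B w" by simp
    then have "hit_time B z < hit_time B w - ereal \<sigma>"
      by (simp add: ereal_less_minus add.commute)
    then obtain u where u: "0 \<le> u" "ereal u < hit_time B w - ereal \<sigma>" "z u \<in> B"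
      by (auto simp: hit_time_less)
    then have "w (\<sigma> + u) \<in> B" using tail by simp
    then have "hit_time B w \<le> ereal (\<sigma> + u)" using u assms by (intro hit_time_le) auto
    with u show False by (simp add: ereal_less_minus add.commute)
  qed
qed

lemma path_open_rational:
  fixes w :: "real \<Rightarrow> 'a::topological_space"
  assumes w: "continuous_on {0..} w" and U: "open U" and u: "0 \<le> u" "u < s" "w u \<in> U"
  shows "\<exists>q\<in>\<rat>. 0 \<le> q \<and> q < s \<and> w q \<in> U"
proof -
  have "((w \<longlongrightarrow> w u) (at u within {0..}))"
    using w u by (auto simp: continuous_on_def)
  then have "\<forall>\<^sub>F x in at u within {0..}. w x \<in> U" using U u by (auto simp: tendsto_def)
  then obtain d where d: "d > 0" "\<And>x. x \<ge> 0 \<Longrightarrow> x \<noteq> u \<Longrightarrow> dist x u < d \<Longrightarrow> w x \<in> U"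
    by (auto simp: eventually_at)
  obtain q where q: "q \<in> \<rat>" "u < q" "q < min s (u + d)"
    using Rats_dense_in_real[of u "min s (u + d)"] u d by auto
  then show ?thesis using d u by (intro bexI[of _ q]) (auto simp: dist_real_def)
qed

lemma hit_open_less_iff:
  assumes w: "w \<in> space path_space" and U: "open U"
  shows "hit_time U w < ereal s \<longleftrightarrow> (\<exists>q\<in>\<rat>\<inter>{0..<s}. w q \<in> U)"
  using path_open_rational[OF path_space_continuous[OF w] U] unfolding hit_time_less by force

text \<open>On a compact interval the path attains the minimum of \<open>f\<close>, and rational
  times come arbitrarily close to it. A rational endpoint \<open>q\<close> below \<open>s\<close>
  keeps the condition countable and confined to times before \<open>s\<close>.\<close>

lemma hit_closed_less_iff:
  fixes f :: "'e::polish_space \<Rightarrow> real"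
  assumes w: "w \<in> space path_space" and f: "continuous_on UNIV f"
  shows "hit_time {x. f x \<le> 0} w < ereal s \<longleftrightarrow>
    (\<exists>q\<in>\<rat>\<inter>{0..<s}. \<forall>k::nat. \<exists>r\<in>\<rat>\<inter>{0..q}. f (w r) < 1 / Suc k)" (is "?L \<longleftrightarrow> ?R")
proof
  assume ?L
  then obtain u where u: "0 \<le> u" "u < s" "f (w u) \<le> 0" by (auto simp: hit_time_less)
  obtain q where q: "q \<in> \<rat>" "u < q" "q < s" using Rats_dense_in_real[of u s] u by auto
  have "\<exists>r\<in>\<rat>\<inter>{0..q}. f (w r) < 1 / Suc k" for k :: nat
  proof -
    have "open {x. f x < 1 / Suc k}" using f by (intro open_Collect_less continuous_intros)
    from path_open_rational[OF path_space_continuous[OF w] this, of u q] u q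
    show ?thesis by (force simp: le_less_trans[OF u(3)])
  qed
  then show ?R using q u by (intro bexI[of _ q]) auto
next
  assume ?R
  then obtain q where q: "0 \<le> q" "q < s" and r: "\<And>k::nat. \<exists>r\<in>\<rat>\<inter>{0..q}. f (w r) < 1 / Suc k" by auto
  have "continuous_on {0..q} (\<lambda>r. f (w r))"
    by (rule continuous_on_compose2[OF f]) (auto intro: continuous_on_subset[OF path_space_continuous[OF w]])
  then obtain u where u: "u \<in> {0..q}" "\<And>r. r \<in> {0..q} \<Longrightarrow> f (w u) \<le> f (w r)"
    using continuous_attains_inf[of "{0..q}" "\<lambda>r. f (w r)"] q by auto
  have "f (w u) \<le> 1 / Suc k" for k using r[of k] u(2) by force
  then have "f (w u) \<le> 0"
    by (intro LIMSEQ_le_const[OF LIMSEQ_Suc[OF lim_const_over_n[of 1]]]) (auto intro!: exI[of _ 0])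
  then show ?L using u q by (auto simp: hit_time_less intro!: exI[of _ u])
qed

lemma hit_closed_attained:
  assumes w: "w \<in> space path_space" and B: "closed B" and T: "hit_time B w = ereal s"
  shows "0 \<le> s" "w s \<in> B"
proof -
  show s: "0 \<le> s" using hit_time_nonneg[of B w] T by simp
  show "w s \<in> B"
  proof (rule ccontr)
    assume *: "w s \<notin> B"
    have "((w \<longlongrightarrow> w s) (at s within {0..}))"
      using path_space_continuous[OF w] s by (auto simp: continuous_on_def)
    then have "\<forall>\<^sub>F x in at s within {0..}. w x \<in> - B" using B * by (auto simp: tendsto_def)
    then obtain d where d: "d > 0" "\<And>x. x \<ge> 0 \<Longrightarrow> x \<noteq> s \<Longrightarrow> dist x s < d \<Longrightarrow> w x \<notin> B"
      by (auto simp: eventually_at)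
    have "hit_time B w < ereal (s + d)" using T d by simp
    then obtain u where u: "0 \<le> u" "u < s + d" "w u \<in> B" by (auto simp: hit_time_less)
    have "s \<le> u" using hit_time_le[of u w B] u T by simp
    then show False using u d(2)[of u] * by (cases "u = s") (auto simp: dist_real_def)
  qed
qed

lemma closed_as_sublevel:
  fixes B :: "'e::metric_space set"
  assumes "closed B" obtains f :: "'e \<Rightarrow> real" where "continuous_on UNIV f" "B = {x. f x \<le> 0}"
proof (cases "B = {}")
  \<comment> \<open>The distance \<open>infdist\<close> to the empty set is 0 by convention, hence
    the separate function.\<close>
  case True then show ?thesis using that[of "\<lambda>_. 1"] by auto
next
  case False
  have "x \<in> B \<longleftrightarrow> infdist x B \<le> 0" for x
    using assms False in_closed_iff_infdist_zero[of B x] infdist_nonneg[of x B] by auto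
  then show ?thesis by (intro that[of "\<lambda>x. infdist x B"]) (auto intro!: continuous_intros)
qed

text \<open>The inequality \<open>T w < s\<close> is strict on purpose: these are the stopping times
  of the right-continuous filtration. Entrance times into open sets are of this kind, but in general
  not stopping times of the natural filtration itself.\<close>

definition optional_time :: "('e::polish_space path \<Rightarrow> ereal) \<Rightarrow> bool" where
  "optional_time T \<longleftrightarrow> (\<forall>w. 0 \<le> T w) \<and>
     (\<forall>s. {w\<in>space path_space. T w < ereal s} \<in> sets (natural_filtration s))"

lemma optional_hit_open:
  fixes U :: "'e::polish_space set"
  assumes U: "open U" shows "optional_time (hit_time U)"
  unfolding optional_time_def
proof (intro conjI allI hit_time_nonneg)
  fix s :: real
  have "{w\<in>space path_space. hit_time U w < ereal s} =
      (\<Union>q\<in>\<rat>\<inter>{0..<s}. {w\<in>space (natural_filtration s). w q \<in> U})"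
    by (simp add: space_natural_filtration hit_open_less_iff[OF _ U] set_eq_iff Bex_def cong: conj_cong)
  also have "\<dots> \<in> sets (natural_filtration s)"
  proof (rule sets.countable_UN'')
    show "countable (\<rat> \<inter> {0..<s})" using countable_rat by blast
    fix q assume "q \<in> \<rat>\<inter>{0..<s}"
    then show "{w\<in>space (natural_filtration s). w q \<in> U} \<in> sets (natural_filtration s)"
      using measurable_sets[OF measurable_natural_filtration_eval[of q s], of U] U
      by (auto simp: vimage_def Int_def conj_commute)
  qed
  finally show "{w\<in>space path_space. hit_time U w < ereal s} \<in> sets (natural_filtration s)" .
qed

lemma optional_hit_closed:
  fixes B :: "'e::polish_space set"
  assumes B: "closed B" shows "optional_time (hit_time B)"
  unfolding optional_time_def
proof (intro conjI allI hit_time_nonneg)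
  fix s :: real
  obtain f :: "'e \<Rightarrow> real" where f: "continuous_on UNIV f" "B = {x. f x \<le> 0}"
    using closed_as_sublevel[OF B] .
  have "{w\<in>space path_space. hit_time B w < ereal s} =
      (\<Union>q\<in>\<rat>\<inter>{0..<s}. \<Inter>k::nat. \<Union>r\<in>\<rat>\<inter>{0..q}. {w\<in>space (natural_filtration s). f (w r) < 1 / Suc k})"
    unfolding f(2) by (simp add: space_natural_filtration hit_closed_less_iff[OF _ f(1)] set_eq_iff cong: conj_cong)
  also have "\<dots> \<in> sets (natural_filtration s)"
  proof (intro sets.countable_UN'' sets.countable_INT UNIV_not_empty)
    show "range (\<lambda>k. \<Union>r\<in>\<rat> \<inter> {0..q}. {w \<in> space (natural_filtration s). f (w r) < 1 / real (Suc k)})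
        \<subseteq> sets (natural_filtration s)" if q: "q \<in> \<rat>\<inter>{0..<s}" for q
    proof (intro image_subsetI sets.countable_UN'')
      show "countable (\<rat> \<inter> {0..q})" using countable_rat by blast
      fix r :: real and k :: nat assume r: "r \<in> \<rat>\<inter>{0..q}"
      have "open {x. f x < 1 / Suc k}" using f by (intro open_Collect_less continuous_intros)
      then show "{w\<in>space (natural_filtration s). f (w r) < 1 / Suc k} \<in> sets (natural_filtration s)"
        using measurable_sets[OF measurable_natural_filtration_eval[of r s], of "{x. f x < 1 / Suc k}"] q r
        by (auto simp: vimage_def Int_def conj_commute)
    qed
    show "countable (\<rat> \<inter> {0..<s})" using countable_rat by blast
  qed
  finally show "{w\<in>space path_space. hit_time B w < ereal s} \<in> sets (natural_filtration s)" .
qed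

lemma optional_time_less_sets:
  "optional_time T \<Longrightarrow> {w\<in>space path_space. T w < ereal s} \<in> sets path_space"
  using sets_natural_filtration_path_space[of s] by (auto simp: optional_time_def)

lemma optional_time_measurable:
  assumes "optional_time T" shows "T \<in> borel_measurable path_space"
proof (rule borel_measurableI_less)
  fix y
  show "{w \<in> space path_space. T w < y} \<in> sets path_space"
  proof (cases y)
    case (real r)
    then show ?thesis using optional_time_less_sets[OF assms] by simp
  next
    case PInf
    have "{w \<in> space path_space. T w < y} = (\<Union>n::nat. {w \<in> space path_space. T w < ereal n})"
      unfolding PInf using less_PInf_Ex_of_nat by (auto simp: less_top[symmetric])
    also have "\<dots> \<in> sets path_space"
      by (intro sets.countable_UN) (auto intro: optional_time_less_sets[OF assms])
    finally show ?thesis .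
  qed simp
qed

section \<open>Kernels\<close>

lemma (in finite_measure) integrable_bounded:
  fixes f :: "'a \<Rightarrow> real"
  assumes "f \<in> borel_measurable M" "\<And>x. x \<in> space M \<Longrightarrow> \<bar>f x\<bar> \<le> c"
  shows "integrable M f"
  using assms by (intro integrable_const_bound[where B=c]) auto

lemma abs_integral_le:
  fixes f :: "'a \<Rightarrow> real"
  assumes "prob_space M" "\<And>x. x \<in> space M \<Longrightarrow> \<bar>f x\<bar> \<le> c" "0 \<le> c"
  shows "\<bar>\<integral>x. f x \<partial>M\<bar> \<le> c"
proof (cases "integrable M f")
  case True
  interpret prob_space M by fact
  have "\<bar>\<integral>x. f x \<partial>M\<bar> \<le> (\<integral>x. \<bar>f x\<bar> \<partial>M)" by (rule integral_abs_bound)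
  also have "\<dots> \<le> (\<integral>x. c \<partial>M)" using True assms by (intro integral_mono) auto
  finally show ?thesis by (simp add: prob_space)
qed (use assms in \<open>simp add: not_integrable_integral_eq\<close>)

lemma kernel_prob:
  assumes "\<kappa> \<in> M \<rightarrow>\<^sub>M prob_algebra N" "x \<in> space M"
  shows "prob_space (\<kappa> x)" "sets (\<kappa> x) = sets N" "space (\<kappa> x) = space N"
  using measurable_space[OF assms] by (auto simp: space_prob_algebra dest: sets_eq_imp_space_eq)

lemma measurable_kernel_integral:
  fixes F :: "'b \<Rightarrow> real"
  assumes "\<kappa> \<in> M \<rightarrow>\<^sub>M prob_algebra N" "F \<in> borel_measurable N"
  shows "(\<lambda>x. \<integral>z. F z \<partial>\<kappa> x) \<in> borel_measurable M"
  by (rule measurable_compose[OF measurable_prob_algebraD[OF assms(1)] integral_measurable_subprob_algebra[OF assms(2)]])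

text \<open>Uniqueness of finite measures on an intersection-stable generator: if
  \<open>\<kappa>\<close> gives the conditional law of \<open>T\<close> on \<open>B\<close> for the
  sets of the generator, it does so for all bounded measurable functions. Both Markov properties,
  the law of a new piece and the law of the whole configuration are obtained in this way.\<close>

lemma kernel_integral_eq:
  fixes F :: "'b \<Rightarrow> real"
  assumes fin: "finite_measure M" and T: "T \<in> M \<rightarrow>\<^sub>M N" and K: "\<kappa> \<in> M \<rightarrow>\<^sub>M prob_algebra N"
    and B: "B \<in> sets M"
    and G: "sets N = sigma_sets (space N) G" "Int_stable G" "G \<subseteq> Pow (space N)" "space N \<in> G"
    and eq: "\<And>C. C \<in> G \<Longrightarrow> (\<integral>x. indicator B x * indicator C (T x) \<partial>M) =
      (\<integral>x. indicator B x * measure (\<kappa> x) C \<partial>M)"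
    and F: "F \<in> borel_measurable N" "\<And>x. x \<in> space N \<Longrightarrow> \<bar>F x\<bar> \<le> c"
  shows "(\<integral>x. indicator B x * F (T x) \<partial>M) = (\<integral>x. indicator B x * (\<integral>z. F z \<partial>\<kappa> x) \<partial>M)"
proof -
  interpret finite_measure M by fact
  \<comment> \<open>\<open>Q\<close> is \<open>M\<close> restricted to \<open>B\<close>; what has to
    be shown is that \<open>distr Q N T\<close> and the mixture of the \<open>\<kappa> x\<close>
    over \<open>Q\<close> coincide.\<close>
  define Q where "Q = density M (\<lambda>x. ennreal (indicator B x))"
  have [measurable]: "T \<in> M \<rightarrow>\<^sub>M N" "B \<in> sets M" "F \<in> borel_measurable N" by fact+
  have sQ[simp, measurable_cong]: "sets Q = sets M" "space Q = space M" by (auto simp: Q_def)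
  have finQ: "finite_measure Q"
    by (rule finite_measureI) (simp add: Q_def emeasure_density ennreal_indicator)
  have Ks: "\<kappa> \<in> M \<rightarrow>\<^sub>M subprob_algebra N" using K by (rule measurable_prob_algebraD)
  then have KQ: "\<kappa> \<in> Q \<rightarrow>\<^sub>M subprob_algebra N" by (simp cong: measurable_cong_sets)
  have "(\<integral>x. indicator B x * F (T x) \<partial>M) = (\<integral>x. F (T x) \<partial>Q)"
    unfolding Q_def by (subst integral_density) auto
  also have "\<dots> = (\<integral>y. F y \<partial>distr Q N T)"
    by (rule integral_distr[symmetric]) (auto cong: measurable_cong_sets)
  also have "\<dots> = (\<integral>y. F y \<partial>(Q \<bind> \<kappa>))"
  proof (cases "space M = {}")
    case True
    then have "Q \<bind> \<kappa> = count_space {}" by (simp add: bind_empty)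
    moreover have "emeasure (distr Q N T) (space N) = 0"
      using True T by (subst emeasure_distr) (auto cong: measurable_cong_sets)
    then have "AE x in distr Q N T. F x = 0" 
      by (intro AE_I[where N="space N"]) auto
    then have "(\<integral>y. F y \<partial>distr Q N T) = 0" by (rule integral_eq_zero_AE)
    ultimately show ?thesis by (simp add: lebesgue_integral_count_space_finite)
  next
    case False
    have "distr Q N T = Q \<bind> \<kappa>"
    proof (rule measure_eqI_generator_eq[OF G(2) G(3)])
      fix C assume C: "C \<in> G"
      then have Cs[measurable]: "C \<in> sets N" using G(1) by (simp add: sigma_sets.Basic)
      have m: "(\<lambda>x. measure (\<kappa> x) C) \<in> borel_measurable M"
        using K by measurable
      have le: "measure (\<kappa> x) C \<le> 1" if "x \<in> space M" for x
        using prob_space.prob_le_1 kernel_prob[OF K that] by blast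
      have "emeasure (distr Q N T) C = emeasure Q (T -` C \<inter> space M)"
        by (subst emeasure_distr) (auto cong: measurable_cong_sets)
      also have "\<dots> = (\<integral>\<^sup>+x. ennreal (indicator B x * indicator C (T x)) \<partial>M)"
        unfolding Q_def by (subst emeasure_density)
          (auto intro!: nn_integral_cong split: split_indicator)
      also have "\<dots> = ennreal (\<integral>x. indicator B x * indicator C (T x) \<partial>M)"
        by (intro nn_integral_eq_integral integrable_bounded[where c=1]) (auto split: split_indicator)
      also have "\<dots> = ennreal (\<integral>x. indicator B x * measure (\<kappa> x) C \<partial>M)" using eq[OF C] by simp
      also have "\<dots> = (\<integral>\<^sup>+x. ennreal (indicator B x * measure (\<kappa> x) C) \<partial>M)"
        using m le
        by (intro nn_integral_eq_integral[symmetric] integrable_bounded[where c=1]) (auto split: split_indicator)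
      also have "\<dots> = (\<integral>\<^sup>+x. emeasure (\<kappa> x) C \<partial>Q)"
      proof -
        have "(\<integral>\<^sup>+x. emeasure (\<kappa> x) C \<partial>Q) = (\<integral>\<^sup>+x. ennreal (indicator B x) * emeasure (\<kappa> x) C \<partial>M)"
          unfolding Q_def using Ks by (subst nn_integral_density) auto
        also have "\<dots> = (\<integral>\<^sup>+x. ennreal (indicator B x * measure (\<kappa> x) C) \<partial>M)"
          using kernel_prob(1)[OF K]
          by (intro nn_integral_cong) (simp add: ennreal_mult' finite_measure.emeasure_eq_measure prob_space_def)
        finally show ?thesis by simp
      qed
      also have "\<dots> = emeasure (Q \<bind> \<kappa>) C"
        using False KQ by (subst emeasure_bind[where N=N]) auto
      finally show "emeasure (distr Q N T) C = emeasure (Q \<bind> \<kappa>) C" .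
    next
      show "sets (distr Q N T) = sigma_sets (space N) G" using G(1) by simp
      show "sets (Q \<bind> \<kappa>) = sigma_sets (space N) G"
        using sets_bind[of Q \<kappa> N] KQ False subprob_measurableD(2)[OF KQ] G(1) by auto
      show "range (\<lambda>_::nat. space N) \<subseteq> G" "(\<Union>_::nat. space N) = space N" using G(4) by auto
      have "finite_measure (distr Q N T)"
        using finQ by (intro finite_measure.finite_measure_distr) (auto cong: measurable_cong_sets)
      then show "emeasure (distr Q N T) (space N) \<noteq> \<infinity>" 
        using finite_measure.emeasure_finite[of "distr Q N T" "space N"] by (simp add: infinity_ennreal_def)
    qed
    then show ?thesis by simp
  qed
  also have "\<dots> = (\<integral>x. (\<integral>z. F z \<partial>\<kappa> x) \<partial>Q)"
    using F KQ finQ kernel_prob[OF K]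
    by (intro integral_bind[where K=N and B'=1 and B=c]) (auto intro!: AE_I2 prob_space.emeasure_le_1)
  also have "\<dots> = (\<integral>x. indicator B x * (\<integral>z. F z \<partial>\<kappa> x) \<partial>M)"
    unfolding Q_def using measurable_kernel_integral[OF K F(1)]
    by (subst integral_density) auto
  finally show ?thesis .
qed

section \<open>Compact cylinders\<close>

lemma locally_compact_nbhd:
  fixes x :: "'e::metric_space"
  assumes "locally compact (UNIV :: 'e set)" "open W" "x \<in> W"
  obtains U K where "open U" "compact K" "x \<in> U" "U \<subseteq> K" "K \<subseteq> W"
  using assms unfolding locally_def by (metis open_openin subtopology_UNIV openin_open_eq open_UNIV)

text \<open>Each point of \<open>W\<close> has a neighbourhood contained in a compact subset of
  \<open>W\<close>, and by Lindelof countably many of these neighbourhoods cover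
  \<open>W\<close>.\<close>

lemma open_countable_union_compact:
  fixes W :: "'e::polish_space set"
  assumes lc: "locally compact (UNIV :: 'e set)" and W: "open W"
  shows "\<exists>\<K>. countable \<K> \<and> (\<forall>K\<in>\<K>. compact K) \<and> W = \<Union>\<K>"
proof -
  define \<F> where "\<F> = {U. open U \<and> (\<exists>K. compact K \<and> U \<subseteq> K \<and> K \<subseteq> W)}"
  obtain \<F>' where F': "\<F>' \<subseteq> \<F>" "countable \<F>'" "\<Union>\<F>' = \<Union>\<F>"
    using Lindelof[of \<F>] by (auto simp: \<F>_def)
  have "\<Union>\<F> = W"
  proof
    show "W \<subseteq> \<Union>\<F>"
    proof
      fix x assume "x \<in> W"
      then obtain U K where "open U" "compact K" "x \<in> U" "U \<subseteq> K" "K \<subseteq> W"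
        by (rule locally_compact_nbhd[OF lc W])
      then show "x \<in> \<Union>\<F>" unfolding \<F>_def by blast
    qed
  qed (auto simp: \<F>_def)
  have "\<forall>U\<in>\<F>'. \<exists>K. compact K \<and> U \<subseteq> K \<and> K \<subseteq> W" using F'(1) by (auto simp: \<F>_def)
  then obtain k where k: "\<And>U. U \<in> \<F>' \<Longrightarrow> compact (k U) \<and> U \<subseteq> k U \<and> k U \<subseteq> W" by metis
  have "W = \<Union>\<F>'" using F'(3) \<open>\<Union>\<F> = W\<close> by simp
  also have "\<dots> \<subseteq> \<Union>(k ` \<F>')" using k by fast
  finally have "W = \<Union>(k ` \<F>')" using k by (intro equalityI) auto
  then show ?thesis using F'(2) k by (intro exI[of _ "k ` \<F>'"] conjI ballI) auto
qed

lemma borel_sigma_compact: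
  assumes lc: "locally compact (UNIV :: 'e::polish_space set)"
  shows "(borel :: 'e measure) = sigma UNIV {K. compact K}"
proof -
  have "(borel :: 'e measure) = sigma UNIV ((\<lambda>K. K) ` {K. compact K})"
proof (rule borel_eq_sigmaI1[OF borel_def])
  fix W :: "'e set" assume "W \<in> {S. open S}"
  then obtain \<K> where K: "countable \<K>" "\<forall>K\<in>\<K>. compact K" "W = \<Union>\<K>"
    using open_countable_union_compact[OF lc] by auto
  show "W \<in> sets (sigma UNIV ((\<lambda>K. K) ` {K. compact K}))"
    unfolding K(3) by (intro sets.countable_Union[OF K(1)]) (use K(2) in auto)
qed (auto intro: borel_compact)
  then show ?thesis by simp
qed

section \<open>Functions vanishing at infinity and compact cylinders\<close>

lemma C0_D: "f \<in> C0 \<Longrightarrow> continuous_on UNIV f"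
  by (simp add: C0_def)

lemma C0_bounded:
  fixes f :: "'e::topological_space \<Rightarrow> real"
  assumes "f \<in> C0" obtains c where "0 \<le> c" "\<And>x. \<bar>f x\<bar> \<le> c"
proof -
  have "compact {x. 1 \<le> \<bar>f x\<bar>}" using assms by (simp add: C0_def)
  then have "compact ((\<lambda>x. \<bar>f x\<bar>) ` {x. 1 \<le> \<bar>f x\<bar>})"
    using C0_D[OF assms] by (intro compact_continuous_image continuous_intros)
      (auto intro: continuous_on_subset)
  from compact_imp_bounded[OF this] obtain c where "\<forall>y\<in>(\<lambda>x. \<bar>f x\<bar>) ` {x. 1 \<le> \<bar>f x\<bar>}. norm y \<le> c"
    unfolding bounded_iff by blast
  then have c: "1 \<le> \<bar>f x\<bar> \<Longrightarrow> \<bar>f x\<bar> \<le> c" for x by force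
  show ?thesis
  proof (rule that[of "max 1 c"])
    fix x show "\<bar>f x\<bar> \<le> max 1 c" using c[of x] by (cases "1 \<le> \<bar>f x\<bar>") auto
  qed auto
qed

lemma compact_closed_subset:
  fixes V :: "'e::topological_space set"
  assumes "compact V" "closed S" "S \<subseteq> V" shows "compact S"
  using compact_Int_closed[OF assms(1,2)] assms(3) by (simp add: Int_absorb1)

lemma C0_mult_bounded:
  fixes f h :: "'e::t2_space \<Rightarrow> real"
  assumes f: "f \<in> C0" and h: "continuous_on UNIV h" "\<And>x. \<bar>h x\<bar> \<le> c"
  shows "(\<lambda>x. f x * h x) \<in> C0"
  unfolding C0_def
proof (intro CollectI conjI allI impI)
  show cont: "continuous_on UNIV (\<lambda>x. f x * h x)" using C0_D[OF f] h by (intro continuous_intros)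
  fix e :: real assume e: "0 < e"
  define d where "d = max 1 c"
  have "compact {x. e / d \<le> \<bar>f x\<bar>}" using f e by (simp add: C0_def d_def)
  moreover have "closed {x. e \<le> \<bar>f x * h x\<bar>}"
    by (intro closed_Collect_le continuous_on_const continuous_on_rabs cont)
  moreover have "{x. e \<le> \<bar>f x * h x\<bar>} \<subseteq> {x. e / d \<le> \<bar>f x\<bar>}"
  proof
    fix x assume "x \<in> {x. e \<le> \<bar>f x * h x\<bar>}"
    then have "e \<le> \<bar>f x\<bar> * \<bar>h x\<bar>" by (simp add: abs_mult)
    also have "\<dots> \<le> \<bar>f x\<bar> * d" using h(2)[of x] by (intro mult_left_mono) (auto simp: d_def)
    finally show "x \<in> {x. e / d \<le> \<bar>f x\<bar>}" by (simp add: d_def divide_le_eq)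
  qed
  ultimately show "compact {x. e \<le> \<bar>f x * h x\<bar>}"
    by (rule compact_closed_subset)
qed

text \<open>The functions \<open>max 0 (1 - k * infdist x K)\<close> decrease to the indicator of
  \<open>K\<close>. Local compactness puts some \<open>e\<close>-neighbourhood of \<open>K\<close>
  inside a compact set \<open>V\<close>, so that for large \<open>k\<close> they have compact
  support.\<close>

lemma compact_indicator_limit_C0:
  fixes K :: "'e::metric_space set"
  assumes lc: "locally compact (UNIV :: 'e set)" and K: "compact K"
  obtains f :: "nat \<Rightarrow> 'e \<Rightarrow> real" where "\<And>k. f k \<in> C0" "\<And>k x. 0 \<le> f k x \<and> f k x \<le> 1"
    "\<And>x. (\<lambda>k. f k x) \<longlonglongrightarrow> indicator K x"
proof (cases "K = {}")
  case True
  then show ?thesis by (intro that[of "\<lambda>_ _. 0"]) (auto simp: C0_def)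
next
  case False
  define \<F> :: "'e set set" where "\<F> = {U. open U \<and> (\<exists>V. compact V \<and> U \<subseteq> V)}"
  have "K \<subseteq> \<Union>\<F>"
  proof
    fix x assume "x \<in> K"
    obtain U V where "open U" "compact V" "x \<in> U" "U \<subseteq> V"
      by (rule locally_compact_nbhd[OF lc open_UNIV UNIV_I])
    then show "x \<in> \<Union>\<F>" unfolding \<F>_def by blast
  qed
  then obtain \<D> where D: "finite \<D>" "\<D> \<subseteq> \<F>" "K \<subseteq> \<Union>\<D>"
  proof (rule compactE[OF K])
    show "\<And>B. B \<in> \<F> \<Longrightarrow> open B" by (simp add: \<F>_def)
  qed auto
  have "\<forall>U\<in>\<D>. \<exists>V. compact V \<and> U \<subseteq> V" using D by (auto simp: \<F>_def)
  then obtain v where v: "\<And>U. U \<in> \<D> \<Longrightarrow> compact (v U) \<and> U \<subseteq> v U" by metis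
  define V where "V = \<Union>(v ` \<D>)"
  have V: "compact V" unfolding V_def using D v by (intro compact_Union) auto
  have "open (\<Union>\<D>)" using D by (auto simp: \<F>_def)
  then obtain e where e: "0 < e" "(\<Union>x\<in>K. ball x e) \<subseteq> \<Union>\<D>"
    using compact_subset_open_imp_ball_epsilon_subset[OF K _ D(3)] by blast
  have near: "x \<in> V" if "infdist x K < e" for x
  proof -
    have "\<exists>a\<in>K. dist x a < e"
      using that False by (simp add: infdist_notempty cINF_less_iff)
    then obtain a where "a \<in> K" "x \<in> ball a e" by (auto simp: dist_commute)
    then have "x \<in> \<Union>\<D>" using e(2) by blast
    then show ?thesis using v by (auto simp: V_def)
  qed
  define g where "g k x = max 0 (1 - real k * infdist x K)" for k x
  \<comment> \<open>From \<open>n * e > 1\<close> on, \<open>g k\<close> vanishes outside the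
    \<open>e\<close>-neighbourhood of \<open>K\<close>; the sequence is therefore started at
    \<open>n\<close>.\<close>
  obtain n where n: "1 < real n * e" using reals_Archimedean3[OF e(1)] by blast
  then have npos: "0 < n" by (cases n) auto
  have gC0: "g k \<in> C0" if k: "n \<le> k" for k
    unfolding C0_def
  proof (intro CollectI conjI allI impI)
    show cont: "continuous_on UNIV (g k)" unfolding g_def by (intro continuous_intros)
    fix d :: real assume d: "0 < d"
    have "{x. d \<le> \<bar>g k x\<bar>} \<subseteq> V"
    proof
      fix x assume "x \<in> {x. d \<le> \<bar>g k x\<bar>}"
      then have "real k * infdist x K < 1" using d by (auto simp: g_def split: if_splits)
      moreover have "real n * infdist x K \<le> real k * infdist x K"
        using k by (intro mult_right_mono) (auto simp: infdist_nonneg)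
      ultimately have "real n * infdist x K < real n * e" using n by linarith
      then show "x \<in> V" using npos by (intro near) simp
    qed
    moreover have "closed {x. d \<le> \<bar>g k x\<bar>}"
      by (intro closed_Collect_le continuous_on_const continuous_on_rabs cont)
    ultimately show "compact {x. d \<le> \<bar>g k x\<bar>}" using V by (metis compact_closed_subset)
  qed
  show ?thesis
  proof (rule that[of "\<lambda>k. g (k + n)"])
    show "g (k + n) \<in> C0" for k by (rule gC0) simp
    show "0 \<le> g (k + n) x \<and> g (k + n) x \<le> 1" for k x by (simp add: g_def infdist_nonneg)
    show "(\<lambda>k. g (k + n) x) \<longlonglongrightarrow> indicator K x" for x
    proof (cases "x \<in> K")
      case True then show ?thesis by (simp add: g_def)
    next
      case xK: False
      then have pos: "0 < infdist x K"
        using False K infdist_pos_not_in_closed[of K x] compact_imp_closed by blast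
      obtain m where m: "1 < real m * infdist x K" using reals_Archimedean3[OF pos] by blast
      have "\<forall>\<^sub>F k in sequentially. g (k + n) x = 0"
      proof (rule eventually_sequentiallyI[of m])
        fix k assume "m \<le> k"
        then have "real m * infdist x K \<le> real (k + n) * infdist x K"
          using pos by (intro mult_right_mono) auto
        then show "g (k + n) x = 0" using m by (simp add: g_def)
      qed
      then show ?thesis using xK by (simp add: tendsto_eventually)
    qed
  qed
qed

text \<open>Compact sides are chosen because the indicators of these sets are limits of products of
  \<open>C0\<close> functions, the only functions on which the Feller property speaks.\<close>

definition cylinders :: "'e::polish_space path set set" where
  "cylinders = {{w\<in>space path_space. \<forall>s\<in>I. w s \<in> K s} | I K. finite I \<and> I \<subseteq> {0..} \<and> (\<forall>s\<in>I. compact (K s))}"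

lemma cylinders_space: "space path_space \<in> cylinders"
  unfolding cylinders_def by (intro CollectI exI[of _ "{}"]) auto

lemma cylinders_Pow: "cylinders \<subseteq> Pow (space path_space)"
  unfolding cylinders_def by auto

lemma cylinders_Int_stable: "Int_stable cylinders"
proof (rule Int_stableI)
  fix a b :: "'a path set" assume "a \<in> cylinders" "b \<in> cylinders"
  then obtain I K J L where *:
    "a = {w\<in>space path_space. \<forall>s\<in>I. w s \<in> K s}" "finite I" "I \<subseteq> {0..}" "\<forall>s\<in>I. compact (K s)"
    "b = {w\<in>space path_space. \<forall>s\<in>J. w s \<in> L s}" "finite J" "J \<subseteq> {0..}" "\<forall>s\<in>J. compact (L s)"
    unfolding cylinders_def by auto
  define H where "H s = (if s \<in> I then if s \<in> J then K s \<inter> L s else K s else L s)" for s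
  have "a \<inter> b = {w\<in>space path_space. \<forall>s\<in>I \<union> J. w s \<in> H s}"
    unfolding * H_def by auto
  moreover have "\<forall>s\<in>I \<union> J. compact (H s)" using * by (auto simp: H_def compact_Int)
  ultimately show "a \<inter> b \<in> cylinders"
    unfolding cylinders_def using * by (intro CollectI exI[of _ "I \<union> J"] exI[of _ H]) auto
qed

lemma cylinders_generate:
  assumes lc: "locally compact (UNIV :: 'e::polish_space set)"
  shows "sets (path_space :: 'e path measure) = sigma_sets (space path_space) cylinders"
proof (rule equalityI)
  define S :: "'e path measure" where "S = sigma (space path_space) cylinders"
  have S: "space S = space path_space" "sets S = sigma_sets (space path_space) cylinders"
    unfolding S_def by (simp_all only: space_measure_of[OF cylinders_Pow] sets_measure_of[OF cylinders_Pow])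
  have "(\<lambda>w. w) \<in> S \<rightarrow>\<^sub>M path_space"
  proof (rule measurable_path_spaceI)
    fix s :: real assume s: "0 \<le> s"
    have "(\<lambda>w. w s) \<in> S \<rightarrow>\<^sub>M sigma UNIV {K. compact K}"
    proof (rule measurable_measure_of)
      fix K :: "'e set" assume "K \<in> {K. compact K}"
      then have "{w\<in>space path_space. \<forall>u\<in>{s}. w u \<in> K} \<in> cylinders"
        unfolding cylinders_def using s by (intro CollectI exI[of _ "{s}"] exI[of _ "\<lambda>_. K"]) auto
      moreover have "(\<lambda>w. w s) -` K \<inter> space S = {w\<in>space path_space. \<forall>u\<in>{s}. w u \<in> K}"
        by (auto simp: S(1))
      ultimately show "(\<lambda>w. w s) -` K \<inter> space S \<in> sets S"
        by (simp add: S(2) sigma_sets.Basic)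
    qed auto
    then show "(\<lambda>w. w s) \<in> S \<rightarrow>\<^sub>M borel" by (simp only: borel_sigma_compact[OF lc])
  qed (simp add: S(1))
  then have "sets path_space \<subseteq> sets S" by (rule sets_subset_if_measurable_id) (rule S(1))
  then show "sets path_space \<subseteq> sigma_sets (space path_space) (cylinders :: 'e path set set)"
    by (simp only: S(2))
  show "sigma_sets (space path_space) (cylinders :: 'e path set set) \<subseteq> sets path_space"
  proof (rule sets.sigma_sets_subset, rule subsetI)
    fix a :: "'e path set" assume "a \<in> cylinders"
    then obtain I K where *: "a = {w\<in>space path_space. \<forall>s\<in>I. w s \<in> K s}" "finite I" "I \<subseteq> {0..}" "\<forall>s\<in>I. compact (K s)"
      unfolding cylinders_def by auto
    have "{w\<in>space path_space. w s \<in> K s} \<in> sets path_space" if "s \<in> I" for s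
      using measurable_sets[OF measurable_eval_path[of s], of "K s"] that * borel_compact[of "K s"]
      by (auto simp: vimage_def Int_def conj_commute)
    then show "a \<in> sets path_space" unfolding *(1) using *(2) by (intro sets.sets_Collect_finite_All) auto
  qed
qed

section \<open>The strong Markov property\<close>

lemma space_in_natural_filtration: "space path_space \<in> sets (natural_filtration s)"
  using sets.top[of "natural_filtration s"] by (simp add: space_natural_filtration)

locale feller_process =
  fixes P :: "'e::polish_space \<Rightarrow> 'e path measure"
  assumes markov: "markov_process P" and feller: "feller P"
    and lc: "locally compact (UNIV :: 'e set)"
begin

lemma kernel: "P \<in> borel \<rightarrow>\<^sub>M prob_algebra path_space"
  using markov by (simp add: markov_process_def)

lemma prob_P: "prob_space (P y)" and sets_P[measurable_cong, simp]: "sets (P y) = sets path_space"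
  and space_P[simp]: "space (P y) = space path_space"
  using kernel_prob[OF kernel, of y] by auto

lemma finite_P: "finite_measure (P y)"
  using prob_P by (simp add: prob_space_def)

lemma start: "AE w in P y. w 0 = y"
  using markov by (simp add: markov_process_def)

lemma AE_P_space: "AE w in P y. w \<in> space path_space"
  using AE_space[of "P y"] by simp

lemma measurable_P: "f \<in> path_space \<rightarrow>\<^sub>M N \<Longrightarrow> f \<in> P y \<rightarrow>\<^sub>M N"
  by (simp cong: measurable_cong_sets)

lemma measurable_E:
  fixes F :: "'e path \<Rightarrow> real"
  assumes "F \<in> borel_measurable path_space"
  shows "(\<lambda>y. \<integral>w. F w \<partial>P y) \<in> borel_measurable borel"
  using kernel assms by (rule measurable_kernel_integral)

lemma abs_E_le:
  fixes F :: "'e path \<Rightarrow> real"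
  assumes "\<And>w. w \<in> space path_space \<Longrightarrow> \<bar>F w\<bar> \<le> c"
  shows "\<bar>\<integral>w. F w \<partial>P y\<bar> \<le> c"
proof (rule abs_integral_le[OF prob_P])
  interpret prob_space "P y" by (rule prob_P)
  have "space path_space \<noteq> ({} :: 'e path set)" using not_empty by simp
  then obtain w :: "'e path" where w: "w \<in> space path_space" by blast
  from assms[OF w] show "0 \<le> c" by simp
qed (use assms in simp)

lemma simple_markov:
  fixes F :: "'e path \<Rightarrow> real"
  assumes s: "0 \<le> s" and B: "B \<in> sets (natural_filtration s)"
    and F: "F \<in> borel_measurable path_space" "\<And>w. w \<in> space path_space \<Longrightarrow> \<bar>F w\<bar> \<le> c"
  shows "(\<integral>w. indicator B w * F (shift s w) \<partial>P y) = (\<integral>w. indicator B w * (\<integral>z. F z \<partial>P (w s)) \<partial>P y)"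
proof (rule kernel_integral_eq[where \<kappa>="\<lambda>w. P (w s)" and G="sets path_space"])
  have Bs: "B \<in> sets path_space" using B sets_natural_filtration_path_space by blast
  have sh: "shift s \<in> path_space \<rightarrow>\<^sub>M path_space"
    using s by (intro measurable_shift_joint) auto
  have k: "(\<lambda>w. P (w s)) \<in> path_space \<rightarrow>\<^sub>M prob_algebra path_space"
    using measurable_eval_path[OF s] kernel by (rule measurable_compose)
  show "shift s \<in> P y \<rightarrow>\<^sub>M path_space" "(\<lambda>w. P (w s)) \<in> P y \<rightarrow>\<^sub>M prob_algebra path_space"
    "B \<in> sets (P y)"
    using sh k Bs by (auto intro: measurable_P)
  fix C :: "'e path set" assume C: "C \<in> sets path_space"
  interpret prob_space "P y" by (rule prob_P)
  have CP: "(\<lambda>w. measure (P (w s)) C) \<in> borel_measurable (P y)"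
    using measurable_compose[OF k measurable_measure_prob_algebra[OF C]] by (rule measurable_P)
  have set: "{w\<in>B. shift s w \<in> C} \<in> sets (P y)"
  proof -
    have "{w\<in>B. shift s w \<in> C} = B \<inter> (shift s -` C \<inter> space path_space)"
      using sets.sets_into_space[OF Bs] by auto
    then show ?thesis using Bs measurable_sets[OF sh C] by simp
  qed
  have "ennreal (\<integral>w. indicator B w * indicator C (shift s w) \<partial>P y) = emeasure (P y) {w\<in>B. shift s w \<in> C}"
  proof -
    have "(\<integral>w. indicator B w * indicator C (shift s w) \<partial>P y) = (\<integral>w. (indicator {w\<in>B. shift s w \<in> C} w :: real) \<partial>P y)"
      by (intro Bochner_Integration.integral_cong) (auto split: split_indicator)
    also have "\<dots> = measure (P y) {w\<in>B. shift s w \<in> C}"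
      using set by simp
    finally show ?thesis using emeasure_eq_measure by simp
  qed
  also have "\<dots> = (\<integral>\<^sup>+w\<in>B. emeasure (P (w s)) C \<partial>P y)"
    using markov s B C by (simp add: markov_process_def)
  also have "\<dots> = (\<integral>\<^sup>+w. ennreal (indicator B w * measure (P (w s)) C) \<partial>P y)"
    using finite_measure.emeasure_eq_measure[OF finite_P]
    by (intro nn_integral_cong) (auto split: split_indicator)
  also have "\<dots> = ennreal (\<integral>w. indicator B w * measure (P (w s)) C \<partial>P y)"
    using CP Bs prob_space.prob_le_1[OF prob_P]
    by (intro nn_integral_eq_integral integrable_bounded[where c=1] AE_I2)
       (auto split: split_indicator)
  finally show "(\<integral>w. indicator B w * indicator C (shift s w) \<partial>P y) =
      (\<integral>w. indicator B w * measure (P (w s)) C \<partial>P y)"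
    by (simp add: integral_nonneg_AE)
qed (use F finite_P in \<open>auto simp: sets.sigma_sets_eq sets.Int_stable sets.space_closed\<close>)

text \<open>The test functions of the strong Markov property: their expectations are continuous in
  the starting point, and their limits include the indicators of the compact cylinders.\<close>

definition coord_prod :: "real set \<Rightarrow> (real \<Rightarrow> 'e \<Rightarrow> real) \<Rightarrow> 'e path \<Rightarrow> real" where
  "coord_prod I f w = (\<Prod>s\<in>I. f s (w s))"

lemma coord_prod_measurable:
  assumes "I \<subseteq> {0..}" "\<And>s. s \<in> I \<Longrightarrow> f s \<in> C0"
  shows "coord_prod I f \<in> borel_measurable path_space"
  unfolding coord_prod_def
proof (rule borel_measurable_prod)
  fix s assume s: "s \<in> I"
  then have "0 \<le> s" using assms by auto
  moreover have "f s \<in> borel_measurable borel"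
    by (intro borel_measurable_continuous_onI C0_D assms(2) s)
  ultimately show "(\<lambda>w. f s (w s)) \<in> borel_measurable path_space"
    by (rule measurable_compose[OF measurable_eval_path])
qed

lemma coord_prod_bounded:
  assumes "\<And>s. s \<in> I \<Longrightarrow> f s \<in> C0"
  shows "\<exists>c. \<forall>w. \<bar>coord_prod I f w\<bar> \<le> c"
proof -
  have "\<exists>c. 0 \<le> c \<and> (\<forall>x. \<bar>f s x\<bar> \<le> c)" if "s \<in> I" for s
    by (rule C0_bounded[OF assms[OF that]]) blast
  then obtain c where c: "\<And>s. s \<in> I \<Longrightarrow> 0 \<le> c s \<and> (\<forall>x. \<bar>f s x\<bar> \<le> c s)" by metis
  show ?thesis
    by (rule exI[of _ "\<Prod>s\<in>I. c s"]) (auto simp: coord_prod_def abs_prod c intro!: prod_mono)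
qed

lemma coord_prod_Min:
  fixes I :: "real set" and f :: "real \<Rightarrow> 'e \<Rightarrow> real"
  assumes "finite I" "I \<noteq> {}"
  defines "d \<equiv> Min I"
  shows "coord_prod I f w = f d (w d) *
    coord_prod ((\<lambda>s. s - d) ` (I - {d})) (\<lambda>u. f (u + d)) (shift d w)"
proof -
  have d: "d \<in> I" "\<And>s. s \<in> I \<Longrightarrow> d \<le> s" using assms by auto
  have "coord_prod I f w = f d (w d) * (\<Prod>s\<in>I - {d}. f s (w s))"
    unfolding coord_prod_def using assms(1) d(1) by (rule prod.remove)
  also have "(\<Prod>s\<in>I - {d}. f s (w s)) = (\<Prod>s\<in>I - {d}. f ((s - d) + d) (shift d w (s - d)))"
    using d by (intro prod.cong) (auto simp: shift_apply)
  also have "\<dots> = coord_prod ((\<lambda>s. s - d) ` (I - {d})) (\<lambda>u. f (u + d)) (shift d w)"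
    unfolding coord_prod_def by (subst prod.reindex) (auto simp: inj_on_def)
  finally show ?thesis .
qed

text \<open>Conditioning at the smallest time reduces the number of factors; the remaining
  expectation is a bounded continuous function, so that the Feller property applies.\<close>

lemma coord_prod_continuous:
  assumes "finite I" "I \<subseteq> {0..}" "\<And>s. s \<in> I \<Longrightarrow> f s \<in> C0"
  shows "continuous_on UNIV (\<lambda>y. \<integral>w. coord_prod I f w \<partial>P y)"
  using assms
proof (induction "card I" arbitrary: I f)
  case 0
  then have "I = {}" by simp
  then show ?case using prob_space.prob_space[OF prob_P] by (simp add: coord_prod_def)
next
  case (Suc n)
  define d where "d = Min I"
  have ne: "I \<noteq> {}" using Suc.hyps(2) by auto
  have d: "d \<in> I" "\<And>s. s \<in> I \<Longrightarrow> d \<le> s" "0 \<le> d" using Suc.prems ne Min_in[of I] by (auto simp: d_def)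
  define J where "J = (\<lambda>s. s - d) ` (I - {d})"
  define g where "g u = f (u + d)" for u
  have J: "finite J" "J \<subseteq> {0..}" "\<And>u. u \<in> J \<Longrightarrow> g u \<in> C0"
    using Suc.prems d by (auto simp: J_def g_def)
  have "card J = n"
    unfolding J_def using Suc.hyps(2) Suc.prems(1) d(1) by (subst card_image) (auto simp: inj_on_def)
  then have cont: "continuous_on UNIV (\<lambda>y. \<integral>w. coord_prod J g w \<partial>P y)"
    using Suc.hyps(1) J by blast
  obtain c where c: "\<And>w. \<bar>coord_prod J g w\<bar> \<le> c" using coord_prod_bounded[of J g, OF J(3)] by auto
  define h where "h x = (\<integral>w. coord_prod J g w \<partial>P x)" for x
  have h: "\<bar>h x\<bar> \<le> c" for x unfolding h_def by (rule abs_E_le) (rule c)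
  have fd: "f d \<in> C0" using Suc.prems d by auto
  have "\<exists>e\<ge>0. \<forall>x. \<bar>f d x\<bar> \<le> e" by (rule C0_bounded[OF fd]) blast
  then obtain e where e: "0 \<le> e" "\<And>x. \<bar>f d x\<bar> \<le> e" by auto
  have fdm: "f d \<in> borel_measurable borel" using C0_D[OF fd] by (rule borel_measurable_continuous_onI)
  \<comment> \<open>The value at time \<open>d\<close> is the starting value of the shifted path;
    with this factor inside \<open>F\<close>, the whole product is a functional of the path shifted
    by \<open>d\<close>.\<close>
  define F where "F w = f d (w 0) * coord_prod J g w" for w
  have Fm: "F \<in> borel_measurable path_space"
    unfolding F_def using measurable_compose[OF measurable_eval_path fdm, of 0] coord_prod_measurable[of J g] J
    by (intro borel_measurable_times) auto
  have Fb: "\<bar>F w\<bar> \<le> e * c" for w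
    unfolding F_def abs_mult using e c[of w] by (intro mult_mono) auto
  have "(\<integral>w. coord_prod I f w \<partial>P y) = (\<integral>w. f d (w d) * h (w d) \<partial>P y)" for y
  proof -
    have "(\<integral>w. coord_prod I f w \<partial>P y) = (\<integral>w. indicator (space path_space) w * F (shift d w) \<partial>P y)"
      using coord_prod_Min[OF Suc.prems(1) ne, of f] d(3)
      by (intro Bochner_Integration.integral_cong)
         (auto simp: F_def d_def[symmetric] J_def[symmetric] g_def[symmetric] shift_apply)
    also have "\<dots> = (\<integral>w. indicator (space path_space) w * (\<integral>z. F z \<partial>P (w d)) \<partial>P y)"
      using d(3) Fm Fb by (intro simple_markov[where c="e * c"] space_in_natural_filtration)
    also have "\<dots> = (\<integral>w. f d (w d) * h (w d) \<partial>P y)"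
    proof (intro Bochner_Integration.integral_cong refl)
      fix w assume w: "w \<in> space (P y)"
      have "(\<integral>z. F z \<partial>P (w d)) = (\<integral>z. f d (w d) * coord_prod J g z \<partial>P (w d))"
      proof (rule integral_cong_AE)
        show "F \<in> borel_measurable (P (w d))" using Fm by (rule measurable_P)
        show "(\<lambda>z. f d (w d) * coord_prod J g z) \<in> borel_measurable (P (w d))"
          using J by (intro measurable_P borel_measurable_times borel_measurable_const coord_prod_measurable)
        show "AE z in P (w d). F z = f d (w d) * coord_prod J g z"
          using start[of "w d"] by eventually_elim (simp add: F_def)
      qed
      then show "indicator (space path_space) w * (\<integral>z. F z \<partial>P (w d)) = f d (w d) * h (w d)"
        using w by (simp add: h_def)
    qed
    finally show ?thesis .
  qed
  \<comment> \<open>\<open>h\<close> is bounded and continuous by induction but need not vanish at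
    infinity; the factor \<open>f d\<close> brings the product into \<open>C0\<close>, where the
    Feller property applies.\<close>
  moreover have "(\<lambda>x. f d x * h x) \<in> C0"
    using fd cont h unfolding h_def by (rule C0_mult_bounded)
  from feller[unfolded feller_def, THEN bspec, OF this] d(3)
  have "(\<lambda>y. \<integral>w. f d (w d) * h (w d) \<partial>P y) \<in> C0" by simp
  ultimately show ?case using C0_D by fastforce
qed

end

lemma dyadic_cell:
  fixes t :: real
  assumes "0 \<le> t"
  shows "t \<in> {real i / 2 ^ k ..< real (Suc i) / 2 ^ k} \<longleftrightarrow> i = nat \<lfloor>t * 2 ^ k\<rfloor>"
proof -
  have "t \<in> {real i / 2 ^ k ..< real (Suc i) / 2 ^ k} \<longleftrightarrow> real i \<le> t * 2 ^ k \<and> t * 2 ^ k < real i + 1"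
    by (auto simp: field_simps)
  also have "\<dots> \<longleftrightarrow> \<lfloor>t * 2 ^ k\<rfloor> = int i" by (auto simp: floor_eq_iff)
  also have "\<dots> \<longleftrightarrow> i = nat \<lfloor>t * 2 ^ k\<rfloor>" using assms by auto
  finally show ?thesis .
qed

lemma dyadic_upper_tendsto:
  fixes t :: real
  assumes "0 \<le> t"
  shows "(\<lambda>k. real (Suc (nat \<lfloor>t * 2 ^ k\<rfloor>)) / 2 ^ k) \<longlonglongrightarrow> t"
proof (rule real_tendsto_sandwich)
  have "t \<in> {real (nat \<lfloor>t * 2 ^ k\<rfloor>) / 2 ^ k ..< real (Suc (nat \<lfloor>t * 2 ^ k\<rfloor>)) / 2 ^ k}" for k
    using dyadic_cell[OF assms] by simp
  then have *: "t \<le> real (Suc (nat \<lfloor>t * 2 ^ k\<rfloor>)) / 2 ^ k \<and> real (Suc (nat \<lfloor>t * 2 ^ k\<rfloor>)) / 2 ^ k \<le> t + 1 / 2 ^ k" for k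
    by (auto simp: add_divide_distrib add_ac intro: less_imp_le)
  show "\<forall>\<^sub>F k in sequentially. t \<le> real (Suc (nat \<lfloor>t * 2 ^ k\<rfloor>)) / 2 ^ k"
    "\<forall>\<^sub>F k in sequentially. real (Suc (nat \<lfloor>t * 2 ^ k\<rfloor>)) / 2 ^ k \<le> t + 1 / 2 ^ k"
    using * by (auto intro: always_eventually)
  have "(\<lambda>k. t + (1/2) ^ k) \<longlonglongrightarrow> t + 0"
    by (intro tendsto_intros LIMSEQ_realpow_zero) auto
  then show "(\<lambda>k. t + 1 / 2 ^ k) \<longlonglongrightarrow> t" by (simp add: power_divide)
qed simp

context feller_process
begin

text \<open>\<open>T\<close> is approximated from above by grid times. On the event that the grid
  time has a given value the simple Markov property applies, and the limit is taken with the
  continuity of the paths and of the expectation \<open>h\<close>.\<close>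

lemma strong_markov_coord_prod:
  assumes T: "optional_time T"
    and B: "B \<subseteq> {w\<in>space path_space. T w < \<infinity>}"
      "\<And>s. B \<inter> {w. T w < ereal s} \<in> sets (natural_filtration s)"
    and I: "finite I" "I \<subseteq> {0..}" "\<And>s. s \<in> I \<Longrightarrow> f s \<in> C0"
  defines "\<theta> \<equiv> \<lambda>w. real_of_ereal (T w)"
  shows "(\<integral>w. indicator B w * coord_prod I f (shift (\<theta> w) w) \<partial>P y) =
    (\<integral>w. indicator B w * (\<integral>z. coord_prod I f z \<partial>P (w (\<theta> w))) \<partial>P y)"
proof -
  let ?F = "coord_prod I f"
  define h where "h x = (\<integral>w. ?F w \<partial>P x)" for x
  have Fm: "?F \<in> borel_measurable path_space" using I by (intro coord_prod_measurable)
  obtain c where c: "\<And>w. \<bar>?F w\<bar> \<le> c" using coord_prod_bounded[of I f, OF I(3)] by auto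
  have h: "\<bar>h x\<bar> \<le> c" for x unfolding h_def by (rule abs_E_le) (rule c)
  have hm: "h \<in> borel_measurable borel" unfolding h_def using Fm by (rule measurable_E)
  have hc: "continuous_on UNIV h" unfolding h_def using I by (intro coord_prod_continuous) auto
  interpret prob_space "P y" by (rule prob_P)
  have \<theta>: "T w = ereal (\<theta> w)" "0 \<le> \<theta> w" if "w \<in> B" for w
  proof -
    have "0 \<le> T w" using T by (simp add: optional_time_def)
    moreover have "T w < \<infinity>" using subsetD[OF B(1) that] by (rule CollectE) (rule conjunct2)
    ultimately
    show "T w = ereal (\<theta> w)" "0 \<le> \<theta> w" by (cases "T w"; simp add: \<theta>_def)+
  qed
  have \<theta>0: "0 \<le> \<theta> w" for w
    using T by (simp add: \<theta>_def optional_time_def real_of_ereal_pos)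
  have \<theta>m: "\<theta> \<in> borel_measurable path_space"
    unfolding \<theta>_def using optional_time_measurable[OF T] by measurable
  define idx where "idx k w = nat \<lfloor>\<theta> w * 2 ^ k\<rfloor>" for k w
  \<comment> \<open>The successor makes the grid time strictly larger than \<open>T\<close>, as the
    strict inequality in \<open>optional_time\<close> demands: that the grid time is
    \<open>(i + 1) / 2 ^ k\<close> is known at that time.\<close>
  define r where "r k w = real (Suc (idx k w)) / 2 ^ k" for k w
  have rm: "r k \<in> borel_measurable path_space" for k
    unfolding r_def idx_def using \<theta>m by measurable
  have r0: "0 \<le> r k w" for k w by (simp add: r_def)
  define A where "A k i = B \<inter> {w. T w < ereal (real (Suc i) / 2 ^ k)} - B \<inter> {w. T w < ereal (real i / 2 ^ k)}"
    for k i
  have A: "A k i = {w\<in>B. idx k w = i}" for k i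
  proof -
    have "w \<in> A k i \<longleftrightarrow> w \<in> B \<and> \<theta> w \<in> {real i / 2 ^ k ..< real (Suc i) / 2 ^ k}" for w
      using \<theta>[of w] unfolding A_def by auto
    then have "w \<in> A k i \<longleftrightarrow> w \<in> B \<and> i = idx k w" for w
      by (simp only: dyadic_cell[OF \<theta>0] idx_def)
    then show ?thesis by auto
  qed
  have Ak: "A k i \<in> sets (natural_filtration (real (Suc i) / 2 ^ k))" for k i
  proof -
    have "sets (natural_filtration (real i / 2 ^ k)) \<subseteq> sets (natural_filtration (real (Suc i) / 2 ^ k) :: 'e path measure)"
      by (intro sets_natural_filtration_mono divide_right_mono) auto
    then show ?thesis unfolding A_def by (intro sets.Diff B(2) subsetD[OF _ B(2)])
  qed
  have As: "A k i \<in> sets (P y)" for k i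
    using Ak[of k i] sets_natural_filtration_path_space by auto
  have UA: "(\<Union>i. A k i) = B" for k by (auto simp: A)
  have Bs: "B \<in> sets (P y)"
    unfolding UA[of 0, symmetric] by (intro sets.countable_UN image_subsetI As)
  have sh: "(\<lambda>w. shift (\<rho> w) w) \<in> path_space \<rightarrow>\<^sub>M path_space"
    if "\<rho> \<in> borel_measurable path_space" "\<And>w. 0 \<le> \<rho> w" for \<rho> :: "'e path \<Rightarrow> real"
    using that by (intro measurable_shift_joint measurable_ident_sets[OF refl])
  have ev: "(\<lambda>w. w (\<rho> w)) \<in> path_space \<rightarrow>\<^sub>M borel"
    if "\<rho> \<in> borel_measurable path_space" "\<And>w. 0 \<le> \<rho> w" for \<rho> :: "'e path \<Rightarrow> real"
    using that by (rule measurable_eval_joint[OF _ measurable_ident_sets[OF refl]])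
  have Fm': "(\<lambda>w. ?F (shift (\<rho> w) w)) \<in> borel_measurable (P y)"
    if "\<rho> \<in> borel_measurable path_space" "\<And>w. 0 \<le> \<rho> w" for \<rho> :: "'e path \<Rightarrow> real"
    using measurable_compose[OF sh[OF that] Fm] by (rule measurable_P)
  have hm': "(\<lambda>w. h (w (\<rho> w))) \<in> borel_measurable (P y)"
    if "\<rho> \<in> borel_measurable path_space" "\<And>w. 0 \<le> \<rho> w" for \<rho> :: "'e path \<Rightarrow> real"
    using measurable_compose[OF ev[OF that] hm] by (rule measurable_P)
  \<comment> \<open>\<open>r k\<close> is constant on each \<open>A k i\<close>, where the simple
    Markov property is used at that constant; the countably many pieces are then summed.\<close>
  have disc: "(\<integral>w. indicator B w * ?F (shift (r k w) w) \<partial>P y) = (\<integral>w. indicator B w * h (w (r k w)) \<partial>P y)" for k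
  proof -
    have split: "(\<integral>w. indicator B w * g w \<partial>P y) = (\<Sum>i. (\<integral>w. indicator (A k i) w * g w \<partial>P y))"
      if "g \<in> borel_measurable (P y)" "\<And>w. \<bar>g w\<bar> \<le> c" for g :: "'e path \<Rightarrow> real"
    proof -
      have "set_integrable (P y) (\<Union>i. A k i) g"
        unfolding set_integrable_def UA using that Bs
        by (intro integrable_bounded[where c=c]) (auto split: split_indicator intro: order_trans[OF abs_ge_zero])
      from lebesgue_integral_countable_add[OF As _ this] show ?thesis
        unfolding set_lebesgue_integral_def UA by (auto simp: A)
    qed
    have "(\<integral>w. indicator (A k i) w * ?F (shift (r k w) w) \<partial>P y) =
          (\<integral>w. indicator (A k i) w * h (w (r k w)) \<partial>P y)" for i
    proof -
      let ?s = "real (Suc i) / 2 ^ k"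
      have "(\<integral>w. indicator (A k i) w * ?F (shift (r k w) w) \<partial>P y) =
        (\<integral>w. indicator (A k i) w * ?F (shift ?s w) \<partial>P y)"
        by (intro Bochner_Integration.integral_cong) (auto simp: A r_def split: split_indicator)
      also have "\<dots> = (\<integral>w. indicator (A k i) w * (\<integral>z. ?F z \<partial>P (w ?s)) \<partial>P y)"
        using Ak Fm c by (intro simple_markov) auto
      also have "\<dots> = (\<integral>w. indicator (A k i) w * h (w (r k w)) \<partial>P y)"
        by (intro Bochner_Integration.integral_cong) (auto simp: A r_def h_def split: split_indicator)
      finally show ?thesis .
    qed
    then show ?thesis
      using split[OF Fm'[OF rm r0] c] split[OF hm'[OF rm r0] h] by simp
  qed
  have c0: "0 \<le> c" using order_trans[OF abs_ge_zero c] .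
  have rlim: "(\<lambda>k. r k w) \<longlonglongrightarrow> \<theta> w" for w
    unfolding r_def idx_def by (rule dyadic_upper_tendsto[OF \<theta>0])
  have path: "(\<lambda>k. w (r k w + u)) \<longlonglongrightarrow> w (\<theta> w + u)" if "w \<in> space path_space" "0 \<le> u" for w :: "'e path" and u
    using path_space_continuous[OF that(1)] that(2) \<theta>0 r0 rlim[of w]
    by (intro continuous_on_tendsto_compose[of "{0..}" w] tendsto_add tendsto_const always_eventually) auto
  have "(\<lambda>k. \<integral>w. indicator B w * ?F (shift (r k w) w) \<partial>P y) \<longlonglongrightarrow> (\<integral>w. indicator B w * ?F (shift (\<theta> w) w) \<partial>P y)"
  proof (rule integral_dominated_convergence[where w="\<lambda>_. c"])
    show "AE w in P y. (\<lambda>k. indicator B w * ?F (shift (r k w) w)) \<longlonglongrightarrow> indicator B w * ?F (shift (\<theta> w) w)"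
    proof (rule AE_I2, intro tendsto_mult tendsto_const)
      fix w assume w: "w \<in> space (P y)"
      show "(\<lambda>k. ?F (shift (r k w) w)) \<longlonglongrightarrow> ?F (shift (\<theta> w) w)"
        unfolding coord_prod_def
      proof (rule tendsto_prod)
        fix s assume s: "s \<in> I"
        then have s0: "0 \<le> s" using I by auto
        have "(\<lambda>k. f s (w (r k w + s))) \<longlonglongrightarrow> f s (w (\<theta> w + s))"
          using path[OF _ s0, of w] w C0_D[OF I(3)[OF s]]
          by (intro continuous_on_tendsto_compose[of UNIV "f s"]) auto
        then show "(\<lambda>k. f s (shift (r k w) w s)) \<longlonglongrightarrow> f s (shift (\<theta> w) w s)"
          by (simp add: shift_apply[OF s0])
      qed
    qed
    show "AE w in P y. norm (indicator B w * ?F (shift (r k w) w)) \<le> c" for k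
      using c c0 by (intro AE_I2) (simp split: split_indicator)
  qed (intro borel_measurable_times borel_measurable_indicator Bs Fm' rm r0 \<theta>m \<theta>0 integrable_const)+
  \<comment> \<open>Here the Feller property enters: \<open>h\<close> is continuous, so its values
    at the grid times converge to its value at \<open>T\<close>.\<close>
  moreover have "(\<lambda>k. \<integral>w. indicator B w * h (w (r k w)) \<partial>P y) \<longlonglongrightarrow> (\<integral>w. indicator B w * h (w (\<theta> w)) \<partial>P y)"
  proof (rule integral_dominated_convergence[where w="\<lambda>_. c"])
    show "AE w in P y. (\<lambda>k. indicator B w * h (w (r k w))) \<longlonglongrightarrow> indicator B w * h (w (\<theta> w))"
    proof (rule AE_I2, intro tendsto_mult tendsto_const)
      fix w assume w: "w \<in> space (P y)"
      show "(\<lambda>k. h (w (r k w))) \<longlonglongrightarrow> h (w (\<theta> w))"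
        using path[of w 0] w hc by (intro continuous_on_tendsto_compose[of UNIV h]) auto
    qed
    show "AE w in P y. norm (indicator B w * h (w (r k w))) \<le> c" for k
      using h c0 by (intro AE_I2) (simp split: split_indicator)
  qed (intro borel_measurable_times borel_measurable_indicator Bs hm' rm r0 \<theta>m \<theta>0 integrable_const)+
  ultimately show ?thesis
    unfolding disc h_def by (rule LIMSEQ_unique)
qed

text \<open>Indicators of compact cylinders are limits of products of \<open>C0\<close> functions,
  and the cylinders generate; the bounded functionals follow by uniqueness of measures.\<close>

theorem strong_markov:
  fixes F :: "'e path \<Rightarrow> real"
  assumes T: "optional_time T"
    and B: "B \<subseteq> {w\<in>space path_space. T w < \<infinity>}"
      "\<And>s. B \<inter> {w. T w < ereal s} \<in> sets (natural_filtration s)"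
    and F: "F \<in> borel_measurable path_space" "\<And>w. w \<in> space path_space \<Longrightarrow> \<bar>F w\<bar> \<le> c"
  defines "\<theta> \<equiv> \<lambda>w. real_of_ereal (T w)"
  shows "(\<integral>w. indicator B w * F (shift (\<theta> w) w) \<partial>P y) =
    (\<integral>w. indicator B w * (\<integral>z. F z \<partial>P (w (\<theta> w))) \<partial>P y)"
proof (rule kernel_integral_eq[where \<kappa>="\<lambda>w. P (w (\<theta> w))" and G=cylinders])
  have \<theta>0: "0 \<le> \<theta> w" for w
    using T by (simp add: \<theta>_def optional_time_def real_of_ereal_pos)
  have \<theta>m: "\<theta> \<in> borel_measurable path_space"
    unfolding \<theta>_def using optional_time_measurable[OF T] by measurable
  have sh: "(\<lambda>w. shift (\<theta> w) w) \<in> path_space \<rightarrow>\<^sub>M path_space"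
    using \<theta>m \<theta>0 by (intro measurable_shift_joint measurable_ident_sets[OF refl])
  have ev: "(\<lambda>w. w (\<theta> w)) \<in> path_space \<rightarrow>\<^sub>M borel"
    using \<theta>m \<theta>0 by (rule measurable_eval_joint[OF _ measurable_ident_sets[OF refl]])
  show shP: "(\<lambda>w. shift (\<theta> w) w) \<in> P y \<rightarrow>\<^sub>M path_space" using sh by (rule measurable_P)
  show kP: "(\<lambda>w. P (w (\<theta> w))) \<in> P y \<rightarrow>\<^sub>M prob_algebra path_space"
    using measurable_compose[OF ev kernel] by (rule measurable_P)
  have "B = (\<Union>n::nat. B \<inter> {w. T w < ereal n})"
    using B(1) less_PInf_Ex_of_nat by (fastforce simp: less_top[symmetric])
  also have "\<dots> \<in> sets (P y)"
    using B(2) sets_natural_filtration_path_space by (intro sets.countable_UN) auto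
  finally show Bs: "B \<in> sets (P y)" .
  show "finite_measure (P y)" by (rule finite_P)
  interpret prob_space "P y" by (rule prob_P)
  fix C :: "'e path set" assume "C \<in> cylinders"
  then obtain I K where C: "C = {w\<in>space path_space. \<forall>s\<in>I. w s \<in> K s}"
    and I: "finite I" "I \<subseteq> {0..}" and K: "\<forall>s\<in>I. compact (K s)"
    unfolding cylinders_def by auto
  have "\<exists>f. (\<forall>k. f k \<in> C0) \<and> (\<forall>k x. 0 \<le> f k x \<and> f k x \<le> 1) \<and>
      (\<forall>x. (\<lambda>k. f k x) \<longlonglongrightarrow> (indicator (K s) x :: real))" if "s \<in> I" for s
    by (rule compact_indicator_limit_C0[OF lc bspec[OF K that]]) blast
  then obtain f where f: "\<And>s k. s \<in> I \<Longrightarrow> f s k \<in> C0" "\<And>s k x. s \<in> I \<Longrightarrow> 0 \<le> f s k x \<and> f s k x \<le> 1"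
      "\<And>s x. s \<in> I \<Longrightarrow> (\<lambda>k. f s k x) \<longlonglongrightarrow> (indicator (K s) x :: real)"
    by metis
  define G where "G k = coord_prod I (\<lambda>s. f s k)" for k
  have Gm: "G k \<in> borel_measurable path_space" for k
    unfolding G_def using I f(1) by (intro coord_prod_measurable) auto
  have G1: "\<bar>G k w\<bar> \<le> 1" for k w
    unfolding G_def coord_prod_def abs_prod using f(2) by (intro prod_le_1) auto
  have Glim: "(\<lambda>k. G k w) \<longlonglongrightarrow> indicator C w" if "w \<in> space path_space" for w
  proof -
    have "(\<lambda>k. G k w) \<longlonglongrightarrow> (\<Prod>s\<in>I. indicator (K s) (w s))"
      unfolding G_def coord_prod_def using f(3) by (intro tendsto_prod)
    also have "(\<Prod>s\<in>I. indicator (K s) (w s)) = (indicator C w :: real)"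
      using that I(1) by (auto simp: C indicator_def prod_zero_iff)
    finally show ?thesis .
  qed
  have Cs: "C \<in> sets path_space"
    using \<open>C \<in> cylinders\<close> cylinders_generate[OF lc] by (simp add: sigma_sets.Basic)
  have "(\<lambda>k. \<integral>w. indicator B w * G k (shift (\<theta> w) w) \<partial>P y) \<longlonglongrightarrow> (\<integral>w. indicator B w * indicator C (shift (\<theta> w) w) \<partial>P y)"
    using Bs measurable_compose[OF shP Gm] measurable_compose[OF shP borel_measurable_indicator[OF Cs]] G1
    by (intro integral_dominated_convergence[where w="\<lambda>_. 1"] AE_I2 tendsto_mult tendsto_const Glim
        borel_measurable_times borel_measurable_indicator integrable_const shift_in_path_space \<theta>0)
      (auto split: split_indicator)
  moreover have "(\<lambda>k. \<integral>w. indicator B w * (\<integral>z. G k z \<partial>P (w (\<theta> w))) \<partial>P y) \<longlonglongrightarrow>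
      (\<integral>w. indicator B w * measure (P (w (\<theta> w))) C \<partial>P y)"
  proof (rule integral_dominated_convergence[where w="\<lambda>_. 1"])
    have "(\<lambda>k. \<integral>z. G k z \<partial>P x) \<longlonglongrightarrow> measure (P x) C" for x
    proof -
      interpret x: prob_space "P x" by (rule prob_P)
      have "(\<lambda>k. \<integral>z. G k z \<partial>P x) \<longlonglongrightarrow> (\<integral>z. indicator C z \<partial>P x)"
        using Gm Cs G1 by (intro integral_dominated_convergence[where w="\<lambda>_. 1"] AE_I2 Glim measurable_P
            borel_measurable_indicator x.integrable_const) auto
      then show ?thesis using Cs by simp
    qed
    then show "AE w in P y. (\<lambda>k. indicator B w * (\<integral>z. G k z \<partial>P (w (\<theta> w)))) \<longlonglongrightarrow>
        indicator B w * measure (P (w (\<theta> w))) C"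
      by (intro AE_I2 tendsto_mult tendsto_const)
    show "AE w in P y. norm (indicator B w * (\<integral>z. G k z \<partial>P (w (\<theta> w)))) \<le> 1" for k
      using abs_E_le[of "G k" 1] G1 by (intro AE_I2) (auto split: split_indicator)
    show "(\<lambda>w. indicator B w * measure (P (w (\<theta> w))) C) \<in> borel_measurable (P y)"
      using Bs measurable_compose[OF kP measurable_measure_prob_algebra[OF Cs]]
      by (intro borel_measurable_times borel_measurable_indicator)
    show "(\<lambda>w. indicator B w * (\<integral>z. G k z \<partial>P (w (\<theta> w)))) \<in> borel_measurable (P y)" for k
      using Bs measurable_kernel_integral[OF kP Gm]
      by (intro borel_measurable_times borel_measurable_indicator)
  qed simp
  moreover have "(\<integral>w. indicator B w * G k (shift (\<theta> w) w) \<partial>P y) =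
      (\<integral>w. indicator B w * (\<integral>z. G k z \<partial>P (w (\<theta> w))) \<partial>P y)" for k
    unfolding G_def \<theta>_def by (rule strong_markov_coord_prod[OF T B I f(1)])
  ultimately show "(\<integral>w. indicator B w * indicator C (shift (\<theta> w) w) \<partial>P y) =
      (\<integral>w. indicator B w * measure (P (w (\<theta> w))) C \<partial>P y)"
    by (auto intro: LIMSEQ_unique)
qed (use F cylinders_Int_stable cylinders_Pow cylinders_space cylinders_generate[OF lc] in auto)

end

section \<open>Levels and scores along a path\<close>

text \<open>By the intermediate value theorem \<open>f\<close> vanishes at some time not later than
  the hitting time; this time already belongs to the set, so it is the hitting time.\<close>

lemma hit_sublevel_zero:
  fixes f :: "'e::polish_space \<Rightarrow> real"
  assumes w: "w \<in> space path_space" and f: "continuous_on UNIV f" and start: "0 \<le> f (w 0)"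
    and T: "hit_time {x. f x \<le> 0} w = ereal s"
  shows "f (w s) = 0"
proof -
  have cl: "closed {x. f x \<le> 0}" using f by (intro closed_Collect_le continuous_on_const)
  have s: "0 \<le> s" "f (w s) \<le> 0" using hit_closed_attained[OF w cl T] by auto
  \<comment> \<open>Paths are \<open>undefined\<close> at negative times; composing with
    \<open>max 0\<close> gives a function continuous on the whole line, as the intermediate value
    theorem requires.\<close>
  have "\<forall>x. 0 \<le> x \<and> x \<le> s \<longrightarrow> isCont (\<lambda>u. f (w (max 0 u))) x"
  proof (intro allI impI)
    fix x :: real
    have "continuous_on UNIV (\<lambda>u. f (w (max 0 u)))"
      by (rule continuous_on_compose2[OF f], rule continuous_on_compose2[OF path_space_continuous[OF w]])
        (auto intro!: continuous_intros)
    then show "isCont (\<lambda>u. f (w (max 0 u))) x" by (simp add: continuous_on_eq_continuous_at)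
  qed
  then obtain u where u: "0 \<le> u" "u \<le> s" "f (w u) = 0"
    using IVT2[of "\<lambda>u. f (w (max 0 u))" s 0 0] s start by auto
  then have "ereal s \<le> ereal u" using hit_time_le[of u w "{x. f x \<le> 0}"] T by simp
  then show ?thesis using u by simp
qed

text \<open>The path is not above \<open>r\<close> at its entrance time, since it stays at or below
  \<open>r\<close> before (or starts there), and not below \<open>r\<close>, since it exceeds
  \<open>r\<close> at times arbitrarily close to the entrance time.\<close>

lemma level_at_level_time:
  fixes \<xi> :: "'e::polish_space \<Rightarrow> real"
  assumes w: "w \<in> space path_space" and xi: "continuous_on UNIV \<xi>" and start: "\<xi> (w 0) \<le> r"
    and T: "level_time \<xi> r w = ereal s"
  shows "0 \<le> s" "\<xi> (w s) = r" "\<And>u. 0 \<le> u \<Longrightarrow> u \<le> s \<Longrightarrow> \<xi> (w u) \<le> r"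
proof -
  note T = T[unfolded level_time_eq_hit_time]
  show s: "0 \<le> s" using hit_time_nonneg[of "{x. r < \<xi> x}" w] T by simp
  have before: "\<xi> (w u) \<le> r" if "0 \<le> u" "u < s" for u
    using not_hit_before[of u "{x. r < \<xi> x}" w] T that by simp
  have cont: "continuous_on {0..} (\<lambda>u. \<xi> (w u))"
    by (rule continuous_on_compose2[OF xi path_space_continuous[OF w]]) auto
  have le: "\<xi> (w s) \<le> r"
  proof (rule ccontr)
    assume n: "\<not> ?thesis"
    then have s0: "0 < s" using s start by (cases "s = 0") auto
    have "((\<lambda>u. \<xi> (w u)) \<longlongrightarrow> \<xi> (w s)) (at s within {0..})" using cont s by (auto simp: continuous_on_def)
    moreover have "r < \<xi> (w s)" using n by simp
    ultimately have "\<forall>\<^sub>F u in at s within {0..}. r < \<xi> (w u)" by (rule order_tendstoD)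
    then obtain d where d: "d > 0" "\<And>x. x \<ge> 0 \<Longrightarrow> x \<noteq> s \<Longrightarrow> dist x s < d \<Longrightarrow> r < \<xi> (w x)"
      by (auto simp: eventually_at)
    define u where "u = max 0 (s - d / 2)"
    have "0 \<le> u" "u < s" "dist u s < d" using d s0 by (auto simp: u_def dist_real_def)
    then show False using d(2)[of u] before[of u] by auto
  qed
  then show "\<And>u. 0 \<le> u \<Longrightarrow> u \<le> s \<Longrightarrow> \<xi> (w u) \<le> r" using before by (metis le_less)
  have "r \<le> \<xi> (w s)"
  proof (rule ccontr)
    assume "\<not> ?thesis"
    then have lt: "\<xi> (w s) < r" by simp
    have "((\<lambda>u. \<xi> (w u)) \<longlongrightarrow> \<xi> (w s)) (at s within {0..})" using cont s by (auto simp: continuous_on_def)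
    then have "\<forall>\<^sub>F u in at s within {0..}. \<xi> (w u) < r" using lt by (rule order_tendstoD)
    then obtain d where d: "d > 0" "\<And>x. x \<ge> 0 \<Longrightarrow> x \<noteq> s \<Longrightarrow> dist x s < d \<Longrightarrow> \<xi> (w x) < r"
      by (auto simp: eventually_at)
    have "hit_time {x. r < \<xi> x} w < ereal (s + d)" using T d(1) by simp
    then obtain u where u: "0 \<le> u" "u < s + d" "r < \<xi> (w u)" by (auto simp: hit_time_less)
    have "s \<le> u" using hit_time_le[of u w "{x. r < \<xi> x}"] u T by simp
    then show False using u lt d(2)[of u] by (cases "u = s") (auto simp: dist_real_def)
  qed
  then show "\<xi> (w s) = r" using le by simp
qed

lemma level_time_mono: "r \<le> t \<Longrightarrow> level_time \<xi> r w \<le> level_time \<xi> t w"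
  unfolding level_time_eq_hit_time by (rule hit_time_mono) auto

text \<open>Evaluates the success probability, whose event need not be measurable, through a
  measurable event almost surely equal to it.\<close>

lemma measure_completion_cong:
  assumes S: "S \<in> sets M" and eq: "AE w in M. w \<in> S \<longleftrightarrow> w \<in> S'" and S': "S' \<subseteq> space M"
  shows "measure (completion M) S' = measure M S"
proof -
  have "AE w in M. w \<notin> (S' - S) \<union> (S - S')" using eq by eventually_elim auto
  then obtain N where N: "{w\<in>space M. \<not> w \<notin> (S' - S) \<union> (S - S')} \<subseteq> N" "N \<in> null_sets M"
    unfolding eventually_ae_filter by blast
  have "(S' - S) \<union> (S - S') \<subseteq> N" using N(1) S' sets.sets_into_space[OF S] by auto
  then have n: "S' - S \<in> null_sets (completion M)" "S - S' \<in> null_sets (completion M)"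
    using null_sets_completion_subset[OF _ null_sets_completionI[OF N(2)]] by auto
  have Sc: "S \<in> sets (completion M)" using S by simp
  have "S' = (S - (S - S')) \<union> (S' - S)" by auto
  also have "emeasure (completion M) \<dots> = emeasure (completion M) (S - (S - S'))"
    by (rule emeasure_Un_null_set[OF sets.Diff[OF Sc null_setsD2[OF n(2)]] n(1)])
  also have "\<dots> = emeasure (completion M) S"
    by (rule emeasure_Diff_null_set[OF n(2) Sc])
  finally show ?thesis using S by (simp add: measure_def)
qed

lemma measure_completion_eq_0:
  assumes "AE w in M. w \<notin> S" "S \<subseteq> space M"
  shows "measure (completion M) S = 0"
  using measure_completion_cong[of "{}" M S] assms by simp

section \<open>The assumptions on the process and their extension from level 0 to higher
  levels\<close>

locale ams_process = feller_process P for P :: "'e::polish_space \<Rightarrow> 'e path measure" +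
  fixes \<xi> :: "'e \<Rightarrow> real" and A :: "'e set"
  assumes xi_cont: "continuous_on UNIV \<xi>" and A_neg: "A \<subseteq> {y. \<xi> y < 0}"
    and a2: "assumption2 P \<xi> A" and a3: "assumption3 P \<xi> A"
    and level0: "\<exists>y. \<xi> y = 0"
begin

abbreviation L :: "real \<Rightarrow> 'e path \<Rightarrow> ereal" where "L \<equiv> level_time \<xi>"
abbreviation H :: "'e path \<Rightarrow> ereal" where "H \<equiv> hit_time (closure A)"

definition \<delta> :: real where "\<delta> = (INF y\<in>{y. \<xi> y = 0}. success_prob \<xi> A (P y))"

lemma delta_pos: "0 < \<delta>"
  using a3 by (simp add: assumption3_def \<delta>_def)

lemma delta_le: "\<xi> y = 0 \<Longrightarrow> \<delta> \<le> success_prob \<xi> A (P y)"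
  unfolding \<delta>_def by (rule cINF_lower) (auto intro!: bdd_belowI2[where m=0] simp: success_prob_def)

lemma closure_nonpos: "closure A \<subseteq> {y. \<xi> y \<le> 0}"
  by (rule closure_minimal) (use A_neg xi_cont in \<open>auto intro!: closed_Collect_le continuous_on_const\<close>)

text \<open>Taking closures gives only \<open>\<xi> \<le> 0\<close>. From a point of the closure at
  level 0 the closure is hit at time 0, hence so is the interior by Assumption 2 and so is
  \<open>A\<close>; then success has probability 0, against the positive infimum in Assumption
  3.\<close>

lemma closure_neg: "closure A \<subseteq> {y. \<xi> y < 0}"
proof
  fix x assume x: "x \<in> closure A"
  have "\<xi> x \<noteq> 0"
  proof
    assume x0: "\<xi> x = 0"
    have "AE w in P x. H w = hit_time (interior A) w"
      using a2 x0 by (simp add: assumption2_def)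
    then have "AE w in P x. w \<notin> success_event \<xi> A"
      using start[of x]
    proof eventually_elim
      case (elim w)
      have "hit_time A w \<le> hit_time (interior A) w" by (rule hit_time_mono) (rule interior_subset)
      also have "\<dots> = H w" using elim by simp
      also have "H w \<le> ereal 0" using x elim by (intro hit_time_le) auto
      also have "ereal 0 \<le> L 1 w" using hit_time_nonneg by (simp add: level_time_eq_hit_time zero_ereal_def[symmetric])
      finally show ?case by (auto simp: success_event_def not_less)
    qed
    then have "success_prob \<xi> A (P x) = 0"
      unfolding success_prob_def by (rule measure_completion_eq_0) (simp add: success_event_def)
    then show False using delta_le[OF x0] delta_pos by simp
  qed
  then show "x \<in> {y. \<xi> y < 0}" using x closure_nonpos by fastforce
qed

lemma open_above: "open {x. t < \<xi> x}"
  by (intro open_Collect_less continuous_on_const xi_cont)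

lemma optional_L: "optional_time (L t)"
  unfolding level_time_eq_hit_time by (intro optional_hit_open open_above)

lemma optional_H: "optional_time H"
  by (intro optional_hit_closed closed_closure)

lemma L_nonneg: "0 \<le> L t w"
  by (simp add: level_time_eq_hit_time hit_time_nonneg)

lemma measurable_L: "L t \<in> borel_measurable path_space"
  by (rule optional_time_measurable[OF optional_L])

lemma measurable_H: "H \<in> borel_measurable path_space"
  by (rule optional_time_measurable[OF optional_H])

text \<open>Level and path vary together, since restarts take place at random levels. Exceeding an
  open level is detected at rational times for each path separately.\<close>

lemma measurable_L_joint:
  assumes r: "r \<in> borel_measurable M" and g: "g \<in> M \<rightarrow>\<^sub>M path_space"
  shows "(\<lambda>x. L (r x) (g x)) \<in> borel_measurable M"
proof (rule borel_measurableI_less)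
  have lt: "{x\<in>space M. L (r x) (g x) < ereal s} \<in> sets M" for s
  proof -
    have "{x\<in>space M. L (r x) (g x) < ereal s} =
        (\<Union>q\<in>\<rat>\<inter>{0..<s}. {x\<in>space M. r x < \<xi> (g x q)})"
    proof (intro set_eqI iffI)
      fix x assume "x \<in> {x\<in>space M. L (r x) (g x) < ereal s}"
      then show "x \<in> (\<Union>q\<in>\<rat>\<inter>{0..<s}. {x\<in>space M. r x < \<xi> (g x q)})"
        using hit_open_less_iff[OF measurable_space[OF g] open_above, of x "r x" s]
        by (auto simp: level_time_eq_hit_time)
    next
      fix x assume "x \<in> (\<Union>q\<in>\<rat>\<inter>{0..<s}. {x\<in>space M. r x < \<xi> (g x q)})"
      then show "x \<in> {x\<in>space M. L (r x) (g x) < ereal s}"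
        using hit_open_less_iff[OF measurable_space[OF g] open_above, of x "r x" s]
        by (auto simp: level_time_eq_hit_time)
    qed
    also have "\<dots> \<in> sets M"
    proof (rule sets.countable_UN'')
      show "countable (\<rat> \<inter> {0..<s})" using countable_rat by blast
      fix q assume "q \<in> \<rat>\<inter>{0..<s}"
      then have "(\<lambda>x. g x q) \<in> M \<rightarrow>\<^sub>M borel"
        using measurable_compose[OF g measurable_eval_path] by simp
      then have "(\<lambda>x. \<xi> (g x q)) \<in> borel_measurable M"
        using borel_measurable_continuous_onI[OF xi_cont] by (rule measurable_compose)
      then show "{x\<in>space M. r x < \<xi> (g x q)} \<in> sets M" using r by measurable
    qed
    finally show ?thesis .
  qed
  fix y show "{x \<in> space M. L (r x) (g x) < y} \<in> sets M"
  proof (cases y)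
    case (real s) then show ?thesis using lt by simp
  next
    case PInf
    have "{x \<in> space M. L (r x) (g x) < y} = (\<Union>n::nat. {x\<in>space M. L (r x) (g x) < ereal n})"
      unfolding PInf using less_PInf_Ex_of_nat by (auto simp: less_top[symmetric])
    also have "\<dots> \<in> sets M" by (intro sets.countable_UN image_subsetI lt)
    finally show ?thesis .
  qed simp
qed

text \<open>The strong Markov property for the indicator of the exceptional set of \<open>Q\<close>:
  a nonnegative integrand with integral 0 vanishes almost surely.\<close>

lemma strong_markov_AE:
  assumes T: "optional_time T" and Q: "{w\<in>space path_space. Q w} \<in> sets path_space"
    and AE: "AE w in P y. T w < \<infinity> \<longrightarrow> (AE z in P (w (real_of_ereal (T w))). Q z)"
  shows "AE w in P y. T w < \<infinity> \<longrightarrow> Q (shift (real_of_ereal (T w)) w)"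
proof -
  let ?B = "{w\<in>space path_space. T w < \<infinity>}"
  let ?\<theta> = "\<lambda>w. real_of_ereal (T w)"
  let ?N = "{w\<in>space path_space. \<not> Q w}"
  interpret prob_space "P y" by (rule prob_P)
  have N: "?N \<in> sets path_space" using sets.sets_Collect_neg[OF Q] by simp
  have Bs: "?B \<in> sets path_space" using optional_time_measurable[OF T] by measurable
  have "0 \<le> ?\<theta> w" for w using T by (simp add: optional_time_def real_of_ereal_pos)
  then have sh: "(\<lambda>w. shift (?\<theta> w) w) \<in> path_space \<rightarrow>\<^sub>M path_space"
    using optional_time_measurable[OF T]
    by (intro measurable_shift_joint measurable_ident_sets[OF refl] borel_measurable_real_of_ereal)
  have m: "(\<lambda>w. indicator ?B w * indicator ?N (shift (?\<theta> w) w) :: real) \<in> borel_measurable (P y)"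
    by (intro measurable_P borel_measurable_times borel_measurable_indicator Bs
      measurable_compose[OF sh borel_measurable_indicator[OF N]])
  have "(\<integral>w. indicator ?B w * indicator ?N (shift (?\<theta> w) w) \<partial>P y) =
      (\<integral>w. indicator ?B w * (\<integral>z. indicator ?N z \<partial>P (w (?\<theta> w))) \<partial>P y :: real)"
  proof (rule strong_markov[OF T, where c=1])
    fix s
    have "?B \<inter> {w. T w < ereal s} = {w\<in>space path_space. T w < ereal s}" by auto
    then show "?B \<inter> {w. T w < ereal s} \<in> sets (natural_filtration s)"
      using T by (simp add: optional_time_def)
  qed (use N in \<open>auto split: split_indicator\<close>)
  also have "\<dots> = 0"
  proof (rule integral_eq_zero_AE)
    show "AE w in P y. indicator ?B w * (\<integral>z. indicator ?N z \<partial>P (w (?\<theta> w))) = (0::real)"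
      using AE
    proof eventually_elim
      case (elim w)
      show ?case
      proof (cases "T w < \<infinity>")
        case True
        then have "AE z in P (w (?\<theta> w)). (indicator ?N z :: real) = 0"
          using elim by (auto elim!: eventually_mono split: split_indicator)
        then have i: "(\<integral>z. indicator ?N z \<partial>P (w (?\<theta> w))) = (0::real)" by (rule integral_eq_zero_AE)
        show ?thesis by (simp only: i mult_zero_right)
      qed simp
    qed
  qed
  finally have "(\<integral>w. indicator ?B w * indicator ?N (shift (?\<theta> w) w) \<partial>P y) = (0::real)" .
  then have "AE w in P y. indicator ?B w * indicator ?N (shift (?\<theta> w) w) = (0::real)"
    using m by (subst (asm) integral_nonneg_eq_0_iff_AE)
      (auto intro!: integrable_bounded[where c=1] split: split_indicator)
  then show ?thesis
    using AE_P_space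
  proof eventually_elim
    case (elim w)
    then show ?case
      using shift_in_path_space[OF \<open>\<And>w. 0 \<le> ?\<theta> w\<close>, of w w] by (auto split: split_indicator_asm)
  qed
qed

lemma real_of_ereal_time: "optional_time T \<Longrightarrow> T w < \<infinity> \<Longrightarrow> T w = ereal (real_of_ereal (T w)) \<and> 0 \<le> real_of_ereal (T w)"
  unfolding optional_time_def by (metis ereal_infty_less(1) ereal_real' less_eq_ereal_def real_of_ereal_pos abs_ereal_ge0)

text \<open>From any point of \<open>{0 \<le> \<xi> \<le> 1}\<close> the process meets \<open>{\<xi> = 0}\<close> before it can hit the closure
  of \<open>A\<close>; so what is assumed on \<open>{\<xi> = 0}\<close> extends by the strong Markov property.\<close>

abbreviation T0 :: "'e path \<Rightarrow> ereal" where "T0 \<equiv> hit_time {x. \<xi> x \<le> 0}"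

lemma optional_T0: "optional_time T0"
  by (intro optional_hit_closed closed_Collect_le continuous_on_const xi_cont)

lemma level_at_T0:
  assumes "w \<in> space path_space" "0 \<le> \<xi> (w 0)" "T0 w < \<infinity>"
  shows "\<xi> (w (real_of_ereal (T0 w))) = 0"
  using real_of_ereal_time[OF optional_T0 assms(3)] assms xi_cont by (intro hit_sublevel_zero) auto

lemma hit_after_T0:
  assumes "T0 w < \<infinity>" "B \<subseteq> {y. \<xi> y \<le> 0}"
  shows "hit_time B w = ereal (real_of_ereal (T0 w)) + hit_time B (shift (real_of_ereal (T0 w)) w)"
proof (rule hit_time_after)
  show "0 \<le> real_of_ereal (T0 w)" using real_of_ereal_time[OF optional_T0 assms(1)] by simp
  show "w u \<notin> B" if "0 \<le> u" "u < real_of_ereal (T0 w)" for u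
  proof -
    have t: "T0 w = ereal (real_of_ereal (T0 w))" using real_of_ereal_time[OF optional_T0 assms(1)] by simp
    have "ereal u < T0 w" by (subst t) (use that in simp)
    from not_hit_before[OF that(1) this] show ?thesis using assms(2) by auto
  qed
qed (simp add: shift_apply)

text \<open>At time \<open>T0\<close> the path is at level 0, where Assumption 2 applies to the
  shifted path, and neither set has been hit before. If \<open>T0\<close> is infinite, both hitting
  times are infinite.\<close>

lemma AE_H_interior:
  assumes y: "0 \<le> \<xi> y"
  shows "AE w in P y. H w = hit_time (interior A) w"
proof -
  have "AE w in P y. T0 w < \<infinity> \<longrightarrow> (AE z in P (w (real_of_ereal (T0 w))). H z = hit_time (interior A) z)"
    using start[of y] AE_P_space
  proof eventually_elim
    case (elim w)
    then show ?case using level_at_T0[of w] a2 y by (auto simp: assumption2_def)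
  qed
  moreover have "{w\<in>space path_space. H w = hit_time (interior A) w} \<in> sets path_space"
    using measurable_H optional_time_measurable[OF optional_hit_open[OF open_interior[of A]]] by measurable
  ultimately have "AE w in P y. T0 w < \<infinity> \<longrightarrow>
      H (shift (real_of_ereal (T0 w)) w) = hit_time (interior A) (shift (real_of_ereal (T0 w)) w)"
    using optional_T0 by (intro strong_markov_AE)
  then show ?thesis
  proof eventually_elim
    case (elim w)
    have i: "interior A \<subseteq> {y. \<xi> y \<le> 0}" using closure_nonpos interior_subset[of A] closure_subset[of A] by (meson subset_trans)
    show ?case
    proof (cases "T0 w < \<infinity>")
      case True
      then show ?thesis
        using hit_after_T0[OF True closure_nonpos] hit_after_T0[OF True i] elim by simp
    next
      case False
      then show ?thesis
        using hit_time_mono[OF closure_nonpos, of w] hit_time_mono[OF i, of w] by (auto simp: top_ereal_def)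
    qed
  qed
qed

text \<open>The hitting time of \<open>A\<close> lies between those of its closure and its interior.
  This is what replaces the possibly non-measurable \<open>hit_time A\<close> by
  \<open>H\<close>.\<close>

lemma AE_hit_A:
  assumes y: "0 \<le> \<xi> y"
  shows "AE w in P y. hit_time A w = H w"
  using AE_H_interior[OF y]
proof eventually_elim
  case (elim w)
  then show ?case
    using hit_time_mono[OF interior_subset, of A w] hit_time_mono[OF closure_subset, of A w] by auto
qed

lemma AE_finite_time:
  assumes "0 \<le> \<xi> y" "\<xi> y \<le> 1"
  shows "AE w in P y. min (H w) (L 1 w) < \<infinity>"
proof -
  have "AE w in P y. min (hit_time A w) (L 1 w) < \<infinity>" using a3 assms by (simp add: assumption3_def)
  then show ?thesis using AE_hit_A[OF assms(1)] by eventually_elim simp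
qed

definition succ :: "'e path set" where "succ = {w\<in>space path_space. L 1 w < H w}"

lemma succ_sets[measurable]: "succ \<in> sets path_space"
  unfolding succ_def using measurable_L measurable_H by measurable

lemma delta_le_succ0:
  assumes y: "\<xi> y = 0" shows "\<delta> \<le> measure (P y) succ"
proof -
  have "measure (completion (P y)) (success_event \<xi> A) = measure (P y) succ"
  proof (rule measure_completion_cong)
    show "AE w in P y. w \<in> succ \<longleftrightarrow> w \<in> success_event \<xi> A"
      using AE_hit_A[of y] y by (auto elim!: eventually_mono simp: succ_def success_event_def)
  qed (auto simp: success_event_def)
  then show ?thesis using delta_le[OF y] by (simp add: success_prob_def)
qed

text \<open>Let \<open>B\<close> be the event that level 0 is reached. On \<open>B\<close> the
  strong Markov property at \<open>T0\<close> gives success with conditional probability at least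
  \<open>\<delta>\<close>; off \<open>B\<close> the closure of \<open>A\<close> is never hit and
  success is certain because \<open>H\<close> or \<open>L 1\<close> is finite. As
  \<open>\<delta> \<le> 1\<close>, the mixture is at least \<open>\<delta>\<close>.\<close>

lemma delta_le_succ:
  assumes y: "0 \<le> \<xi> y" "\<xi> y \<le> 1" shows "\<delta> \<le> measure (P y) succ"
proof -
  let ?B = "{w\<in>space path_space. T0 w < \<infinity>}"
  let ?\<theta> = "\<lambda>w. real_of_ereal (T0 w)"
  interpret prob_space "P y" by (rule prob_P)
  have Bs: "?B \<in> sets path_space" using optional_time_measurable[OF optional_T0] by measurable
  obtain y0 where "\<xi> y0 = 0" using level0 by blast
  then have "\<delta> \<le> 1" using delta_le_succ0[of y0] prob_space.prob_le_1[OF prob_P, of y0 succ] by linarith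
  have \<theta>0: "0 \<le> ?\<theta> w" for w using optional_T0 by (simp add: optional_time_def real_of_ereal_pos)
  have \<theta>m: "?\<theta> \<in> borel_measurable path_space"
    using optional_time_measurable[OF optional_T0] by measurable
  have sh: "(\<lambda>w. shift (?\<theta> w) w) \<in> path_space \<rightarrow>\<^sub>M path_space"
    using \<theta>0 \<theta>m by (intro measurable_shift_joint measurable_ident_sets[OF refl])
  have ev: "(\<lambda>w. w (?\<theta> w)) \<in> path_space \<rightarrow>\<^sub>M borel"
    using \<theta>m \<theta>0 by (rule measurable_eval_joint[OF _ measurable_ident_sets[OF refl]])
  have m: "(\<lambda>w. indicator ?B w * indicator succ (shift (?\<theta> w) w) :: real) \<in> borel_measurable (P y)"
    by (intro measurable_P borel_measurable_times borel_measurable_indicator Bs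
      measurable_compose[OF sh borel_measurable_indicator[OF succ_sets]])
  have m2: "(\<lambda>w. indicator ?B w * measure (P (w (?\<theta> w))) succ :: real) \<in> borel_measurable (P y)"
    by (intro measurable_P borel_measurable_times borel_measurable_indicator Bs
      measurable_compose[OF measurable_compose[OF ev kernel] measurable_measure_prob_algebra[OF succ_sets]])
  have "\<delta> * prob ?B = (\<integral>w. indicator ?B w * \<delta> \<partial>P y)" using Bs by simp
  also have "\<dots> \<le> (\<integral>w. indicator ?B w * measure (P (w (?\<theta> w))) succ \<partial>P y)"
  proof (rule integral_mono_AE)
    show "integrable (P y) (\<lambda>w. indicator ?B w * \<delta>)"
      using Bs by (intro integrable_bounded[where c="\<bar>\<delta>\<bar>"]) (auto split: split_indicator)
    show "integrable (P y) (\<lambda>w. indicator ?B w * measure (P (w (?\<theta> w))) succ)"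
      using m2 prob_space.prob_le_1[OF prob_P]
      by (intro integrable_bounded[where c=1]) (auto split: split_indicator)
    show "AE w in P y. indicator ?B w * \<delta> \<le> indicator ?B w * measure (P (w (?\<theta> w))) succ"
      using start[of y] AE_P_space
    proof eventually_elim
      case (elim w)
      then show ?case using level_at_T0[of w] delta_le_succ0 y by (auto split: split_indicator)
    qed
  qed
  also have "\<dots> = (\<integral>w. indicator ?B w * (\<integral>z. indicator succ z \<partial>P (w (?\<theta> w))) \<partial>P y)"
    by simp
  also have "\<dots> = (\<integral>w. indicator ?B w * indicator succ (shift (?\<theta> w) w) \<partial>P y)"
  proof (rule strong_markov[OF optional_T0, where c=1, symmetric])
    fix s
    have "?B \<inter> {w. T0 w < ereal s} = {w\<in>space path_space. T0 w < ereal s}" by auto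
    then show "?B \<inter> {w. T0 w < ereal s} \<in> sets (natural_filtration s)"
      using optional_T0 by (simp add: optional_time_def)
  qed (auto split: split_indicator)
  finally have 1: "\<delta> * prob ?B \<le> (\<integral>w. indicator ?B w * indicator succ (shift (?\<theta> w) w) \<partial>P y)" .
  have "(\<integral>w. indicator ?B w * indicator succ (shift (?\<theta> w) w) + (1 - indicator ?B w) \<partial>P y) \<le> (\<integral>w. indicator succ w \<partial>P y :: real)"
  proof (rule integral_mono_AE)
    show "integrable (P y) (\<lambda>w. indicator ?B w * indicator succ (shift (?\<theta> w) w) + (1 - indicator ?B w) :: real)"
      using m Bs by (intro integrable_bounded[where c=1]) (auto split: split_indicator)
    show "integrable (P y) (indicator succ :: _ \<Rightarrow> real)"
      by (intro integrable_bounded[where c=1]) (auto split: split_indicator)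
    show "AE w in P y. indicator ?B w * indicator succ (shift (?\<theta> w) w) + (1 - indicator ?B w) \<le> (indicator succ w :: real)"
      using AE_finite_time[OF y] AE_P_space
    proof eventually_elim
      case (elim w)
      show ?case
      proof (cases "T0 w < \<infinity>")
        case True
        have t: "T0 w = ereal (?\<theta> w)" "0 \<le> ?\<theta> w" using real_of_ereal_time[OF optional_T0 True] by auto
        have "w \<in> succ" if z: "shift (?\<theta> w) w \<in> succ"
        proof -
          let ?z = "shift (?\<theta> w) w"
          have "L 1 ?z < H ?z" using z by (simp add: succ_def)
          then obtain u where u: "0 \<le> u" "ereal u < H ?z" "1 < \<xi> (?z u)"
            by (auto simp: level_time_eq_hit_time hit_time_less)
          then have "L 1 w \<le> ereal (?\<theta> w + u)"
            unfolding level_time_eq_hit_time using t by (intro hit_time_le) (auto simp: shift_apply)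
          also have "\<dots> < ereal (?\<theta> w) + H ?z"
            using u(2) by (cases "H ?z") auto
          also have "\<dots> = H w" using hit_after_T0[OF True closure_nonpos] by simp
          finally show ?thesis using elim by (simp add: succ_def)
        qed
        then show ?thesis using True elim by (auto split: split_indicator)
      next
        case False
        then have "H w = \<infinity>" using hit_time_mono[OF closure_nonpos, of w] by (auto simp: top_ereal_def)
        then have "w \<in> succ" using elim by (auto simp: succ_def)
        then show ?thesis using False by simp
      qed
    qed
  qed
  also have "(\<integral>w. indicator ?B w * indicator succ (shift (?\<theta> w) w) + (1 - indicator ?B w) \<partial>P y) =
     (\<integral>w. indicator ?B w * indicator succ (shift (?\<theta> w) w) \<partial>P y) + (1 - prob ?B)"
  proof (subst Bochner_Integration.integral_add)
    show "integrable (P y) (\<lambda>w. indicator ?B w * indicator succ (shift (?\<theta> w) w) :: real)"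
      using m by (intro integrable_bounded[where c=1]) (auto split: split_indicator)
    show "integrable (P y) (\<lambda>w. 1 - indicator ?B w :: real)"
      using Bs by (intro integrable_bounded[where c=1]) (auto split: split_indicator)
    have "integrable (P y) (indicator ?B :: _ \<Rightarrow> real)"
      using Bs by (intro integrable_bounded[where c=1]) (auto split: split_indicator)
    then show "(\<integral>w. indicator ?B w * indicator succ (shift (?\<theta> w) w) \<partial>P y) + (\<integral>w. 1 - indicator ?B w \<partial>P y) =
      (\<integral>w. indicator ?B w * indicator succ (shift (?\<theta> w) w) \<partial>P y) + (1 - prob ?B)"
      using Bs prob_space by simp
  qed
  finally have "(\<integral>w. indicator ?B w * indicator succ (shift (?\<theta> w) w) \<partial>P y) + (1 - prob ?B) \<le> prob succ"
    by simp
  moreover have "\<delta> * (1 - prob ?B) \<le> 1 - prob ?B"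
    using \<open>\<delta> \<le> 1\<close> prob_le_1[of ?B] by (simp add: mult_left_le_one_le delta_pos less_imp_le)
  ultimately show ?thesis using 1 by (simp add: right_diff_distrib)
qed

section \<open>Touching and exceeding a level; the score as a measurable function\<close>

lemma AE_level_touch:
  assumes y: "\<xi> y \<le> r" and r: "0 \<le> r" "r \<le> 1"
  shows "AE w in P y. hit_time {x. r \<le> \<xi> x} w < \<infinity> \<longrightarrow> L r w = hit_time {x. r \<le> \<xi> x} w"
proof -
  let ?T = "hit_time {x. r \<le> \<xi> x}"
  have T: "optional_time ?T"
    by (intro optional_hit_closed closed_Collect_le continuous_on_const xi_cont)
  \<comment> \<open>At the first time in \<open>{\<xi> \<ge> r}\<close> the path is exactly on level
    \<open>r\<close>, from where it exceeds \<open>r\<close> immediately by Assumption 2; the strong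
    Markov property at this time transfers this to the path itself.\<close>
  have "AE w in P y. ?T w < \<infinity> \<longrightarrow> (AE z in P (w (real_of_ereal (?T w))). L r z = 0)"
    using start[of y] AE_P_space
  proof eventually_elim
    case (elim w)
    show ?case
    proof
      assume fin: "?T w < \<infinity>"
      have "(\<lambda>x. r - \<xi> x) (w (real_of_ereal (?T w))) = 0"
        using real_of_ereal_time[OF T fin] elim xi_cont y
        by (intro hit_sublevel_zero) (auto intro!: continuous_intros)
      then have "\<xi> (w (real_of_ereal (?T w))) = r" by simp
      then show "AE z in P (w (real_of_ereal (?T w))). L r z = 0"
        using a2 r by (simp add: assumption2_def)
    qed
  qed
  moreover have "{w\<in>space path_space. L r w = 0} \<in> sets path_space"
    using measurable_L[of r] by measurable
  ultimately have "AE w in P y. ?T w < \<infinity> \<longrightarrow> L r (shift (real_of_ereal (?T w)) w) = 0"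
    using T by (intro strong_markov_AE)
  then show ?thesis
  proof eventually_elim
    case (elim w)
    show ?case
    proof
      assume fin: "?T w < \<infinity>"
      have t: "?T w = ereal (real_of_ereal (?T w))" "0 \<le> real_of_ereal (?T w)"
        using real_of_ereal_time[OF T fin] by auto
      have "hit_time {x. r < \<xi> x} w = ereal (real_of_ereal (?T w)) + hit_time {x. r < \<xi> x} (shift (real_of_ereal (?T w)) w)"
      proof (rule hit_time_after[OF t(2)])
        fix u assume u: "0 \<le> u" "u < real_of_ereal (?T w)"
        have "ereal u < ?T w" by (subst t(1)) (use u in simp)
        from not_hit_before[OF u(1) this] show "w u \<notin> {x. r < \<xi> x}" by auto
      qed (simp add: shift_apply)
      then show "L r w = ?T w" using elim fin t(1) by (simp add: level_time_eq_hit_time)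
    qed
  qed
qed

text \<open>Measurable substitute for the score, with \<open>H\<close> in place of the hitting time
  of \<open>A\<close>: the supremum of the levels below 1 that are exceeded before \<open>H\<close>,
  and 0 if there are none.\<close>

definition lev :: "'e path \<Rightarrow> real" where
  "lev w = Sup (insert 0 {t. 0 < t \<and> t < 1 \<and> L t w < H w})"

lemma lev_upper: "t \<in> insert 0 {t. 0 < t \<and> t < 1 \<and> L t w < H w} \<Longrightarrow> t \<le> lev w"
  unfolding lev_def by (rule cSup_upper) (auto intro!: bdd_aboveI[where M=1])

lemma lev_nonneg: "0 \<le> lev w"
  by (rule lev_upper) simp

lemma lev_le_1: "lev w \<le> 1"
  unfolding lev_def by (rule cSup_least) auto

text \<open>Strict inequalities on both sides: a path that exceeds \<open>t\<close> at some time
  before \<open>H\<close> also exceeds a slightly larger level at that time, so it does not matter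
  whether the supremum is attained.\<close>

lemma less_lev_iff:
  assumes t: "0 \<le> t" "t < 1"
  shows "t < lev w \<longleftrightarrow> L t w < H w"
proof
  assume "t < lev w"
  then obtain t' where t': "t < t'" "t' \<in> insert 0 {t. 0 < t \<and> t < 1 \<and> L t w < H w}"
    unfolding lev_def by (subst (asm) less_cSup_iff) (auto intro!: bdd_aboveI[where M=1])
  then have "L t' w < H w" using t by auto
  then show "L t w < H w" using level_time_mono[of t t' \<xi> w] t' by auto
next
  assume "L t w < H w"
  then obtain u where u: "0 \<le> u" "ereal u < H w" "t < \<xi> (w u)"
    by (auto simp: level_time_eq_hit_time hit_time_less)
  \<comment> \<open>A level strictly between \<open>t\<close> and the value reached; the minimum
    with 1 keeps it below 1, as \<open>lev\<close> considers only such levels.\<close>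
  define t' where "t' = (t + min 1 (\<xi> (w u))) / 2"
  have t': "t < t'" "t' < 1" "t' < \<xi> (w u)" using t u by (auto simp: t'_def min_def)
  have "L t' w \<le> ereal u" unfolding level_time_eq_hit_time using u t' by (intro hit_time_le) auto
  then have "L t' w < H w" using u(2) by (rule le_less_trans)
  then have "t' \<in> insert 0 {t. 0 < t \<and> t < 1 \<and> L t w < H w}" using t t' by simp
  from lev_upper[OF this] show "t < lev w" using t'(1) by simp
qed

lemma measurable_lev[measurable]: "lev \<in> borel_measurable path_space"
proof (rule borel_measurableI_greater)
  fix t :: real
  show "{w\<in>space path_space. t < lev w} \<in> sets path_space"
  proof (cases "0 \<le> t \<and> t < 1")
    case True
    then have "{w\<in>space path_space. t < lev w} = {w\<in>space path_space. L t w < H w}"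
      using less_lev_iff by auto
    then show ?thesis using measurable_L[of t] measurable_H by simp
  next
    case False
    then have "{w\<in>space path_space. t < lev w} = (if t < 0 then space path_space else {})"
      using lev_nonneg lev_le_1 by (auto intro: less_le_trans simp: not_less) (meson le_less_trans not_less)
    then show ?thesis by simp
  qed
qed

lemma H_pos: "w \<in> space path_space \<Longrightarrow> 0 \<le> \<xi> (w 0) \<Longrightarrow> 0 < H w"
proof (rule ccontr)
  assume w: "w \<in> space path_space" "0 \<le> \<xi> (w 0)" and "\<not> 0 < H w"
  then have "H w = ereal 0" using hit_time_nonneg[of "closure A" w] by (simp add: zero_ereal_def)
  then have "w 0 \<in> closure A" using hit_closed_attained[OF w(1) closed_closure] by blast
  then show False using closure_neg w by force
qed

text \<open>A trajectory whose score is \<open>r\<close> touches the level \<open>r\<close>, hence almost surely exceeds it.\<close>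

lemma AE_lev_reach:
  assumes y: "0 \<le> \<xi> y" "\<xi> y \<le> r" and r: "r \<le> 1"
  shows "AE w in P y. lev w = r \<longrightarrow> L r w < H w"
proof (cases "\<xi> y = r")
  case True
  then have "AE w in P y. L r w = 0" using a2 y r by (auto simp: assumption2_def)
  then show ?thesis
    using start[of y] AE_P_space by eventually_elim (use H_pos y in auto)
next
  case False
  let ?T = "hit_time {x. r \<le> \<xi> x}"
  have "AE w in P y. ?T w < \<infinity> \<longrightarrow> L r w = ?T w" using y r by (intro AE_level_touch) auto
  moreover have "AE w in P y. min (H w) (L 1 w) < \<infinity>" using y r by (intro AE_finite_time) auto
  ultimately show ?thesis
    using start[of y] AE_P_space
  proof eventually_elim
    case (elim w)
    show ?case
    proof
      assume lev: "lev w = r"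
      have below: "L t w < H w" if "0 \<le> t" "t < r" for t
        using less_lev_iff[of t w] lev that r by auto
      show "L r w < H w"
      proof (cases "H w = \<infinity>")
        case True
        then have "L 1 w < \<infinity>" using elim by auto
        then show ?thesis using True level_time_mono[OF r, of \<xi> w] by auto
      next
        case fin: False
        then obtain s where s: "H w = ereal s" using hit_time_nonneg[of "closure A" w] by (cases "H w") auto
        have at: "0 \<le> s" "w s \<in> closure A" using hit_closed_attained[OF elim(4) closed_closure s] by auto
        \<comment> \<open>The maximum of \<open>\<xi>\<close> up to the hitting time
          \<open>s\<close> of the closure is attained at \<open>v\<close>. All nonnegative levels
          below \<open>r\<close> are exceeded before \<open>s\<close>, so the maximum is at least
          \<open>r\<close>; and \<open>v < s\<close>, because \<open>\<xi>\<close> is negative at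
          \<open>s\<close> while \<open>r\<close> is positive.\<close>
        have "continuous_on {0..s} (\<lambda>u. \<xi> (w u))"
          by (rule continuous_on_compose2[OF xi_cont])
            (auto intro: continuous_on_subset[OF path_space_continuous[OF elim(4)]])
        then obtain v where v: "v \<in> {0..s}" "\<And>u. u \<in> {0..s} \<Longrightarrow> \<xi> (w u) \<le> \<xi> (w v)"
          using continuous_attains_sup[of "{0..s}" "\<lambda>u. \<xi> (w u)"] at by auto
        have "r \<le> \<xi> (w v)"
        proof (rule ccontr)
          assume "\<not> ?thesis"
          moreover have "0 \<le> \<xi> (w v)" using v(2)[of 0] at elim y by auto
          ultimately have "L (\<xi> (w v)) w < H w" using below by auto
          then obtain u where "0 \<le> u" "ereal u < H w" "\<xi> (w v) < \<xi> (w u)"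
            by (auto simp: level_time_eq_hit_time hit_time_less)
          then show False using v(2)[of u] s by auto
        qed
        moreover have "\<xi> (w s) < 0" using at(2) closure_neg by auto
        moreover have "0 < r" using y False by auto
        ultimately have "v < s" using v(1) by (cases "v = s") auto
        have "?T w \<le> ereal v" using v(1) \<open>r \<le> \<xi> (w v)\<close> by (intro hit_time_le) auto
        then have "?T w < H w" using s \<open>v < s\<close> by (auto intro: le_less_trans)
        moreover from this have "?T w < \<infinity>" by auto
        ultimately show ?thesis using elim by simp
      qed
    qed
  qed
qed

text \<open>Scores have no atoms below 1: a score equal to \<open>r\<close> would mean that
  \<open>r\<close> is exceeded before \<open>H\<close>, hence a score larger than \<open>r\<close>.
  Ties between particles are excluded by this.\<close>

lemma AE_lev_neq:
  assumes "0 \<le> \<xi> y" "\<xi> y \<le> r" "r < 1"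
  shows "AE w in P y. lev w \<noteq> r"
proof -
  have "AE w in P y. lev w = r \<longrightarrow> L r w < H w" using assms by (intro AE_lev_reach) auto
  then show ?thesis by eventually_elim (use less_lev_iff[of r] assms in auto)
qed

text \<open>The almost sure properties of a single trajectory, collected so that the comparison of
  the algorithm with its remaining parts is a deterministic argument.\<close>

definition good :: "'e path \<Rightarrow> bool" where
  "good w \<longleftrightarrow> w \<in> space path_space \<and> 0 \<le> \<xi> (w 0) \<and> \<xi> (w 0) \<le> 1 \<and> hit_time A w = H w \<and>
    min (H w) (L 1 w) < \<infinity> \<and> (lev w = 1 \<longrightarrow> L 1 w < H w)"

lemma AE_good:
  assumes y: "0 \<le> \<xi> y" "\<xi> y \<le> 1"
  shows "AE w in P y. good w"
  using AE_hit_A[OF y(1)] AE_finite_time[OF y] AE_lev_reach[OF y order_refl] start[of y] AE_P_space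
  by eventually_elim (use y in \<open>simp add: good_def\<close>)

lemma good_L1:
  assumes g: "good w" and u: "0 \<le> u" "ereal u \<le> L 1 w"
  shows "\<xi> (w u) \<le> 1"
proof (cases "L 1 w = \<infinity>")
  case True
  then show ?thesis using not_hit_before[of u "{x. 1 < \<xi> x}" w] u by (auto simp: level_time_eq_hit_time)
next
  case False
  then obtain s where s: "L 1 w = ereal s" using L_nonneg[of 1 w] by (cases "L 1 w") auto
  have w: "w \<in> space path_space" "\<xi> (w 0) \<le> 1" using g by (auto simp: good_def)
  show ?thesis using level_at_level_time(3)[OF w(1) xi_cont w(2) s u(1)] u(2) s by simp
qed

text \<open>A level strictly between \<open>lev w\<close> and a value reached at time
  \<open>u\<close> would be exceeded no later than \<open>u\<close>, and \<open>u < H w\<close>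
  because \<open>\<xi>\<close> is negative at \<open>H w\<close>; so it would lie below
  \<open>lev w\<close>.\<close>

lemma good_le_lev:
  assumes g: "good w" and u: "0 \<le> u" "ereal u \<le> min (H w) (L 1 w)"
  shows "\<xi> (w u) \<le> lev w"
proof (rule ccontr)
  assume "\<not> ?thesis"
  then obtain t where t: "lev w < t" "t < \<xi> (w u)" using dense[of "lev w" "\<xi> (w u)"] by auto
  have "\<xi> (w u) \<le> 1" using good_L1[OF g u(1)] u(2) by simp
  then have t01: "0 \<le> t" "t < 1" using t lev_nonneg[of w] by auto
  have Lt: "L t w \<le> ereal u" unfolding level_time_eq_hit_time using u t by (intro hit_time_le) auto
  have "H w \<noteq> ereal u"
  proof
    assume "H w = ereal u"
    moreover have "w \<in> space path_space" using g by (simp add: good_def)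
    ultimately have "w u \<in> closure A" using hit_closed_attained[OF _ closed_closure] by blast
    then have "\<xi> (w u) < 0" using closure_neg by auto
    then show False using t t01 by simp
  qed
  moreover have "ereal u \<le> H w" using u(2) by simp
  ultimately have "ereal u < H w" by simp
  with Lt have "L t w < H w" by (rule le_less_trans)
  then have "t < lev w" by (simp only: less_lev_iff[OF t01])
  then show False using t(1) by simp
qed

text \<open>If the time at which \<open>t\<close> is exceeded comes after \<open>L 1 w\<close>, the
  time \<open>L 1 w\<close> itself serves, where the level is 1.\<close>

lemma good_lev_approx:
  assumes g: "good w" and t: "0 \<le> t" "t < lev w"
  shows "\<exists>u\<ge>0. ereal u \<le> min (H w) (L 1 w) \<and> t < \<xi> (w u)"
proof -
  have "t < 1" using t lev_le_1[of w] by simp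
  then have "L t w < H w" using less_lev_iff t by auto
  then obtain u where u: "0 \<le> u" "ereal u < H w" "t < \<xi> (w u)"
    by (auto simp: level_time_eq_hit_time hit_time_less)
  show ?thesis
  proof (cases "ereal u \<le> L 1 w")
    case True then show ?thesis using u by auto
  next
    case False
    then obtain s where s: "L 1 w = ereal s" using L_nonneg[of 1 w] by (cases "L 1 w") auto
    have w: "w \<in> space path_space" "\<xi> (w 0) \<le> 1" using g by (auto simp: good_def)
    have "ereal s < ereal u" using False s by simp
    from less_trans[OF this u(2)] have "ereal s \<le> H w" by (rule less_imp_le)
    then show ?thesis
      using level_at_level_time(1,2)[OF w(1) xi_cont w(2) s] s \<open>t < 1\<close> by (intro exI[of _ s]) auto
  qed
qed

text \<open>\<open>follows Y \<theta> \<sigma>\<close>: the trajectory \<open>Y\<close> of the algorithm continues as \<open>\<theta>\<close> from time \<open>\<sigma>\<close> on,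
  and before \<open>\<sigma>\<close> it has neither exceeded the level of \<open>\<theta> 0\<close> nor hit \<open>A\<close>.\<close>

definition follows :: "'e path \<Rightarrow> 'e path \<Rightarrow> real \<Rightarrow> bool" where
  "follows Y \<theta> \<sigma> \<longleftrightarrow> 0 \<le> \<sigma> \<and> (\<forall>s. 0 \<le> s \<and> s < \<sigma> \<longrightarrow> \<xi> (Y s) \<le> \<xi> (\<theta> 0) \<and> Y s \<notin> A) \<and>
    (\<forall>u\<ge>0. Y (\<sigma> + u) = \<theta> u)"

lemma follows_refl: "follows w w 0"
  by (auto simp: follows_def)

lemma follows_L:
  assumes f: "follows Y \<theta> \<sigma>" and t: "\<xi> (\<theta> 0) \<le> t"
  shows "L t Y = ereal \<sigma> + L t \<theta>"
  unfolding level_time_eq_hit_time using f t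
  by (intro hit_time_after) (auto simp: follows_def not_less intro: order_trans)

lemma follows_hit_A:
  assumes f: "follows Y \<theta> \<sigma>"
  shows "hit_time A Y = ereal \<sigma> + hit_time A \<theta>"
  using f by (intro hit_time_after) (auto simp: follows_def)

lemma follows_at_L:
  assumes f: "follows Y \<theta> \<sigma>" and t: "\<xi> (\<theta> 0) \<le> t" and fin: "L t \<theta> < \<infinity>"
  shows "Y (real_of_ereal (L t Y)) = \<theta> (real_of_ereal (L t \<theta>))"
proof -
  have a: "L t \<theta> = ereal (real_of_ereal (L t \<theta>)) \<and> 0 \<le> real_of_ereal (L t \<theta>)"
    by (rule real_of_ereal_time[OF optional_L fin])
  have "L t Y = ereal (\<sigma> + real_of_ereal (L t \<theta>))"
    unfolding follows_L[OF f t] by (subst conjunct1[OF a]) simp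
  then have "real_of_ereal (L t Y) = \<sigma> + real_of_ereal (L t \<theta>)" "0 \<le> real_of_ereal (L t \<theta>)"
    using a by simp_all
  then show ?thesis using f by (simp add: follows_def)
qed

text \<open>The part of \<open>Y\<close> before \<open>\<sigma>\<close> stays at or below the level
  of \<open>\<theta> 0\<close>, which is at most \<open>lev \<theta>\<close>, and does not meet
  \<open>A\<close>; the supremum is therefore decided on the tail.\<close>

lemma follows_score:
  assumes f: "follows Y \<theta> \<sigma>" and g: "good \<theta>"
  shows "score \<xi> A Y = lev \<theta>"
proof -
  define S where "S = {s. 0 \<le> s \<and> ereal s \<le> min (hit_time A Y) (L 1 Y)}"
  define m where "m = min (H \<theta>) (L 1 \<theta>)"
  have \<sigma>: "0 \<le> \<sigma>" using f by (simp add: follows_def)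
  have g': "\<xi> (\<theta> 0) \<le> 1" "hit_time A \<theta> = H \<theta>" "0 \<le> \<xi> (\<theta> 0)" using g by (auto simp: good_def)
  have m0: "0 \<le> m" using hit_time_nonneg[of "closure A" \<theta>] L_nonneg[of 1 \<theta>] by (simp add: m_def)
  have min: "min (hit_time A Y) (L 1 Y) = ereal \<sigma> + m"
    unfolding m_def follows_hit_A[OF f] follows_L[OF f g'(1)] g'(2)
    by (auto simp: min_def ereal_add_le_add_iff)
  have S1: "\<sigma> + u \<in> S" if "0 \<le> u" "ereal u \<le> m" for u
  proof -
    have "ereal \<sigma> + ereal u \<le> ereal \<sigma> + m" using that(2) by (rule add_left_mono)
    then show ?thesis using that \<sigma> by (simp add: S_def min)
  qed
  have S2: "\<xi> (Y s) \<le> lev \<theta>" if "s \<in> S" for s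
  proof (cases "s < \<sigma>")
    case True
    then have "\<xi> (Y s) \<le> \<xi> (\<theta> 0)" using f that by (simp add: follows_def S_def)
    also have "\<dots> \<le> lev \<theta>" using m0 by (intro good_le_lev g) (auto simp: m_def zero_ereal_def)
    finally show ?thesis .
  next
    case False
    define u where "u = s - \<sigma>"
    have s: "s = \<sigma> + u" "0 \<le> u" using False by (auto simp: u_def)
    have "ereal \<sigma> + ereal u \<le> ereal \<sigma> + m" using that by (simp add: S_def min s)
    then have "ereal u \<le> m" by (simp only: ereal_add_le_add_iff) auto
    then have "\<xi> (\<theta> u) \<le> lev \<theta>" using s by (intro good_le_lev g) (auto simp: m_def)
    then show ?thesis using f s by (simp add: follows_def)
  qed
  have "Sup ((\<lambda>s. \<xi> (Y s)) ` S) = lev \<theta>"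
  proof (rule cSup_eq_non_empty)
    have "\<sigma> + 0 \<in> S" using m0 by (intro S1) (auto simp: zero_ereal_def)
    then show "(\<lambda>s. \<xi> (Y s)) ` S \<noteq> {}" by blast
    fix x assume ub: "\<And>y. y \<in> (\<lambda>s. \<xi> (Y s)) ` S \<Longrightarrow> y \<le> x"
    have "\<xi> (Y (\<sigma> + 0)) \<le> x" using \<open>\<sigma> + 0 \<in> S\<close> by (intro ub imageI)
    moreover have "Y (\<sigma> + 0) = \<theta> 0" using f unfolding follows_def by blast
    ultimately have x0: "0 \<le> x" using g'(3) by simp
    show "lev \<theta> \<le> x"
    proof (rule ccontr)
      assume "\<not> ?thesis"
      then have "x < lev \<theta>" by simp
      then obtain u where u: "0 \<le> u" "ereal u \<le> m" "x < \<xi> (\<theta> u)"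
        using good_lev_approx[OF g x0] by (auto simp: m_def)
      have "\<xi> (Y (\<sigma> + u)) \<le> x" by (intro ub imageI S1 u)
      then show False using f u by (simp add: follows_def)
    qed
  qed (use S2 in auto)
  then show ?thesis by (simp add: score_def S_def)
qed

section \<open>The part of a trajectory beyond a level\<close>

definition adv :: "real \<Rightarrow> 'e path \<Rightarrow> 'e path" where
  "adv r w = shift (real_of_ereal (L r w)) w"

lemma real_L_nonneg: "0 \<le> real_of_ereal (L r w)"
  using L_nonneg by (simp add: real_of_ereal_pos)

lemma adv_apply: "0 \<le> u \<Longrightarrow> adv r w u = w (real_of_ereal (L r w) + u)"
  by (simp add: adv_def shift_apply)

lemma adv_0: "adv r w 0 = w (real_of_ereal (L r w))"
  by (simp add: adv_apply)

lemma adv_space: "w \<in> space path_space \<Longrightarrow> adv r w \<in> space path_space"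
  unfolding adv_def by (rule shift_in_path_space[OF real_L_nonneg])

lemma measurable_adv:
  assumes "r \<in> borel_measurable M" "g \<in> M \<rightarrow>\<^sub>M path_space"
  shows "(\<lambda>x. adv (r x) (g x)) \<in> M \<rightarrow>\<^sub>M path_space"
  unfolding adv_def
  by (rule measurable_shift_joint[OF borel_measurable_real_of_ereal[OF measurable_L_joint[OF assms]] assms(2) real_L_nonneg])

text \<open>Since \<open>real_of_ereal\<close> sends infinity to 0, \<open>adv r w\<close> is the
  part beyond level \<open>r\<close> only if that level is exceeded; the condition
  \<open>L r w < H w\<close> ensures this.\<close>

lemma alive_time: "L r w < H w \<Longrightarrow> L r w = ereal (real_of_ereal (L r w))"
  using real_of_ereal_time[OF optional_L, of r w] less_le_trans[of "L r w" "H w" \<infinity>] by simp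

lemma xi_adv_0:
  assumes "w \<in> space path_space" "\<xi> (w 0) \<le> r" "L r w < H w"
  shows "\<xi> (adv r w 0) = r"
  unfolding adv_0 by (rule level_at_level_time(2)[OF assms(1) xi_cont assms(2) alive_time[OF assms(3)]])

lemma adv_L:
  assumes "L r w < H w" "r \<le> t"
  shows "L t w = L r w + L t (adv r w)"
proof -
  have t: "L r w = ereal (real_of_ereal (L r w))" by (rule alive_time[OF assms(1)])
  have "L t w = ereal (real_of_ereal (L r w)) + L t (adv r w)"
    unfolding level_time_eq_hit_time[of \<xi> t]
  proof (rule hit_time_after[OF real_L_nonneg])
    fix u assume u: "0 \<le> u" "u < real_of_ereal (L r w)"
    have "ereal u < L r w" by (subst t) (use u in simp)
    then have "ereal u < hit_time {x. r < \<xi> x} w" by (simp add: level_time_eq_hit_time)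
    from not_hit_before[OF u(1) this] show "w u \<notin> {x. t < \<xi> x}" using assms(2) by auto
  qed (simp add: adv_apply)
  then show ?thesis using t by simp
qed

lemma adv_H:
  assumes "L r w < H w"
  shows "H w = L r w + H (adv r w)"
proof -
  have t: "L r w = ereal (real_of_ereal (L r w))" by (rule alive_time[OF assms(1)])
  have "H w = ereal (real_of_ereal (L r w)) + H (adv r w)"
  proof (rule hit_time_after[OF real_L_nonneg])
    fix u assume u: "0 \<le> u" "u < real_of_ereal (L r w)"
    have "ereal u < L r w" by (subst t) (use u in simp)
    then have "ereal u < H w" using assms by simp
    from not_hit_before[OF u(1) this] show "w u \<notin> closure A" .
  qed (simp add: adv_apply)
  then show ?thesis using t by simp
qed

lemma follows_before:
  assumes f: "follows Y \<theta> \<sigma>" and g: "good \<theta>" and r: "\<xi> (\<theta> 0) \<le> r" and alive: "L r \<theta> < H \<theta>"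
    and s: "0 \<le> s" "s < \<sigma> + real_of_ereal (L r \<theta>)"
  shows "\<xi> (Y s) \<le> r" "Y s \<notin> A"
proof -
  have t: "L r \<theta> = ereal (real_of_ereal (L r \<theta>))" by (rule alive_time[OF alive])
  have "\<xi> (Y s) \<le> r \<and> Y s \<notin> A"
  proof (cases "s < \<sigma>")
    case True
    then show ?thesis using f r s by (auto simp: follows_def intro: order_trans)
  next
    case False
    define u where "u = s - \<sigma>"
    have u: "s = \<sigma> + u" "0 \<le> u" "u < real_of_ereal (L r \<theta>)" using False s by (auto simp: u_def)
    have lt: "ereal u < L r \<theta>" by (subst t) (use u in simp)
    then have "ereal u < hit_time {x. r < \<xi> x} \<theta>" by (simp add: level_time_eq_hit_time)
    from not_hit_before[OF u(2) this] have "\<xi> (\<theta> u) \<le> r" by simp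
    moreover have "ereal u < hit_time A \<theta>" using lt alive g by (simp add: good_def)
    from not_hit_before[OF u(2) this] have "\<theta> u \<notin> A" .
    ultimately show ?thesis using f u by (simp add: follows_def)
  qed
  then show "\<xi> (Y s) \<le> r" "Y s \<notin> A" by auto
qed

lemma follows_adv:
  assumes f: "follows Y \<theta> \<sigma>" and g: "good \<theta>" and r: "\<xi> (\<theta> 0) \<le> r" and alive: "L r \<theta> < H \<theta>"
  shows "follows Y (adv r \<theta>) (\<sigma> + real_of_ereal (L r \<theta>))"
proof -
  have w: "\<theta> \<in> space path_space" using g by (simp add: good_def)
  show ?thesis
    using follows_before[OF assms] f real_L_nonneg[of r \<theta>] xi_adv_0[OF w r alive]
    unfolding follows_def by (auto simp: adv_apply add.assoc)
qed

text \<open>Before the cut the spliced path is the copied one, which has stayed at or below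
  \<open>r\<close> and outside \<open>A\<close>; after it comes \<open>z\<close>, which starts on
  level \<open>r\<close>.\<close>

lemma follows_splice:
  assumes f: "follows Y \<theta> \<sigma>" and g: "good \<theta>" and r: "\<xi> (\<theta> 0) \<le> r" and alive: "L r \<theta> < H \<theta>"
    and z: "z 0 = adv r \<theta> 0"
  shows "follows (splice Y (L r Y) z) z (\<sigma> + real_of_ereal (L r \<theta>))"
proof -
  have w: "\<theta> \<in> space path_space" using g by (simp add: good_def)
  have t: "L r \<theta> = ereal (real_of_ereal (L r \<theta>))" by (rule alive_time[OF alive])
  have LY: "L r Y = ereal (\<sigma> + real_of_ereal (L r \<theta>))"
    unfolding follows_L[OF f r] by (subst t) simp
  have "0 \<le> \<sigma>" using f by (simp add: follows_def)
  then show ?thesis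
    using follows_before[OF f g r alive] real_L_nonneg[of r \<theta>] xi_adv_0[OF w r alive] z
    unfolding follows_def splice_def LY by auto
qed

text \<open>Restriction to the trajectories that exceed \<open>r\<close> before hitting the closure
  of \<open>A\<close> is admissible: \<open>L r < H\<close> together with \<open>L r < s\<close>
  means \<open>L r < q \<le> H\<close> for some rational \<open>q \<le> s\<close>, which is known at
  time \<open>s\<close>.\<close>

lemma alive_markov:
  fixes F :: "'e path \<Rightarrow> real"
  assumes F: "F \<in> borel_measurable path_space" "\<And>w. w \<in> space path_space \<Longrightarrow> \<bar>F w\<bar> \<le> c"
  shows "(\<integral>w. indicator {w. L r w < H w} w * F (adv r w) \<partial>P y) =
    (\<integral>w. indicator {w. L r w < H w} w * (\<integral>z. F z \<partial>P (adv r w 0)) \<partial>P y)"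
proof -
  let ?B = "{w\<in>space path_space. L r w < H w}"
  have "(\<integral>w. indicator ?B w * F (shift (real_of_ereal (L r w)) w) \<partial>P y) =
    (\<integral>w. indicator ?B w * (\<integral>z. F z \<partial>P (w (real_of_ereal (L r w)))) \<partial>P y)"
  proof (rule strong_markov[OF optional_L _ _ F])
    show "?B \<subseteq> {w\<in>space path_space. L r w < \<infinity>}" by auto
    fix s
    have "?B \<inter> {w. L r w < ereal s} =
      (\<Union>q\<in>\<rat>\<inter>{..s}. {w\<in>space path_space. L r w < ereal q} - {w\<in>space path_space. H w < ereal q})"
    proof (intro set_eqI iffI)
      fix w assume w: "w \<in> ?B \<inter> {w. L r w < ereal s}"
      then have "L r w < min (H w) (ereal s)" by auto
      then obtain a where a: "L r w < ereal a" "ereal a < min (H w) (ereal s)"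
        using ereal_dense2 by blast
      have La: "L r w = ereal (real_of_ereal (L r w))" using w by (intro alive_time) auto
      have "real_of_ereal (L r w) < a" using a(1) by (subst (asm) La) simp
      then obtain q where q: "q \<in> \<rat>" "real_of_ereal (L r w) < q" "q < a"
        using Rats_dense_in_real by blast
      have "L r w < ereal q" by (subst La) (use q in simp)
      moreover have "ereal q < ereal a" using q by simp
      from less_trans[OF this a(2)] have "ereal q < H w" "q \<le> s" by simp_all
      ultimately show "w \<in> (\<Union>q\<in>\<rat>\<inter>{..s}. {w\<in>space path_space. L r w < ereal q} - {w\<in>space path_space. H w < ereal q})"
        using q w by (intro UN_I[of q]) auto
    next
      fix w assume "w \<in> (\<Union>q\<in>\<rat>\<inter>{..s}. {w\<in>space path_space. L r w < ereal q} - {w\<in>space path_space. H w < ereal q})"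
      then obtain q where q: "q \<le> s" "w \<in> space path_space" "L r w < ereal q" "ereal q \<le> H w" by auto
      have "ereal q \<le> ereal s" using q by simp
      then show "w \<in> ?B \<inter> {w. L r w < ereal s}" using q by (auto intro: less_le_trans)
    qed
    also have "\<dots> \<in> sets (natural_filtration s)"
    proof (rule sets.countable_UN'')
      show "countable (\<rat> \<inter> {..s})" using countable_rat by blast
      fix q assume q: "q \<in> \<rat>\<inter>{..s}"
      have "sets (natural_filtration q) \<subseteq> sets (natural_filtration s :: 'e path measure)"
        using q by (intro sets_natural_filtration_mono) auto
      moreover have "{w\<in>space path_space. L r w < ereal q} \<in> sets (natural_filtration q)"
        "{w\<in>space path_space. H w < ereal q} \<in> sets (natural_filtration q)"
        using optional_L[of r] optional_H by (simp_all add: optional_time_def)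
      ultimately show "{w\<in>space path_space. L r w < ereal q} - {w\<in>space path_space. H w < ereal q} \<in> sets (natural_filtration s)"
        by (intro sets.Diff) auto
    qed
    finally show "?B \<inter> {w. L r w < ereal s} \<in> sets (natural_filtration s)" .
  qed
  moreover have "(\<integral>w. indicator {w. L r w < H w} w * G w \<partial>P y) = (\<integral>w. indicator ?B w * G w \<partial>P y)"
    for G :: "'e path \<Rightarrow> real"
    by (intro Bochner_Integration.integral_cong) (auto split: split_indicator)
  ultimately show ?thesis by (simp add: adv_def shift_apply)
qed

end

section \<open>The payoff of a trajectory\<close>

locale ams_payoff = ams_process P \<xi> A
  for P :: "'e::polish_space \<Rightarrow> 'e path measure" and \<xi> :: "'e \<Rightarrow> real" and A :: "'e set" +
  fixes \<phi> :: "'e \<Rightarrow> real"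
  assumes phi_cont: "continuous_on {x. \<xi> x = 1} \<phi>" and phi_bdd: "bounded (\<phi> ` {x. \<xi> x = 1})"
begin

definition C :: real where "C = (SUP x\<in>{x. \<xi> x = 1}. \<bar>\<phi> x\<bar>)"

text \<open>Continuity and boundedness of \<open>\<phi>\<close> are given on
  \<open>{\<xi> = 1}\<close> only; the extension by 0 is Borel and bounded everywhere.\<close>

definition \<phi>1 :: "'e \<Rightarrow> real" where "\<phi>1 x = (if \<xi> x = 1 then \<phi> x else 0)"

definition pay :: "'e path \<Rightarrow> real" where
  "pay w = (if L 1 w < H w then \<phi>1 (w (real_of_ereal (L 1 w))) else 0)"

definition h :: "'e \<Rightarrow> real" where "h y = (\<integral>w. pay w \<partial>P y)"

lemma phi_le_C: "\<xi> x = 1 \<Longrightarrow> \<bar>\<phi> x\<bar> \<le> C"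
  unfolding C_def
proof (rule cSUP_upper)
  show "bdd_above ((\<lambda>x. \<bar>\<phi> x\<bar>) ` {x. \<xi> x = 1})"
  proof -
    obtain a where "\<forall>x\<in>\<phi> ` {x. \<xi> x = 1}. norm x \<le> a" using phi_bdd unfolding bounded_iff by blast
    then show ?thesis by (intro bdd_aboveI2[where M=a]) auto
  qed
qed simp

text \<open>A successful path is on level 1 at its entrance time, and from level 0 success has
  positive probability. So the supremum \<open>C\<close> is over a nonempty set.\<close>

lemma level1: "\<exists>x. \<xi> x = 1"
proof (rule ccontr)
  assume no: "\<not> ?thesis"
  obtain y where y: "\<xi> y = 0" using level0 by blast
  have "AE w in P y. w \<notin> succ"
    using start[of y] AE_P_space
  proof eventually_elim
    case (elim w)
    show ?case
    proof
      assume "w \<in> succ"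
      then have "\<xi> (adv 1 w 0) = 1" using elim y by (intro xi_adv_0) (auto simp: succ_def)
      then show False using no by blast
    qed
  qed
  then have "measure (P y) succ = 0" 
    using measure_completion_eq_0[of succ "P y"] sets.sets_into_space[OF succ_sets] by simp
  then show False using delta_le_succ0[OF y] delta_pos by simp
qed

lemma C_nonneg: "0 \<le> C"
proof -
  obtain x where "\<xi> x = 1" using level1 by blast
  from phi_le_C[OF this] show ?thesis by linarith
qed

lemma phi1_le_C: "\<bar>\<phi>1 x\<bar> \<le> C"
  using phi_le_C C_nonneg by (simp add: \<phi>1_def)

lemma phi1_measurable: "\<phi>1 \<in> borel_measurable borel"
proof -
  have "closed {x. \<xi> x = 1}" by (intro closed_Collect_eq continuous_on_const xi_cont)
  then have "(\<lambda>x. if x \<in> {x. \<xi> x = 1} then \<phi> x else 0) \<in> borel_measurable borel"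
    using phi_cont by (intro borel_measurable_continuous_on_if) auto
  then show ?thesis by (simp add: \<phi>1_def[abs_def])
qed

lemma pay_le_C: "\<bar>pay w\<bar> \<le> C"
  by (simp add: pay_def phi1_le_C C_nonneg)

lemma pay_measurable[measurable]: "pay \<in> borel_measurable path_space"
proof -
  have "(\<lambda>w. w (real_of_ereal (L 1 w))) \<in> path_space \<rightarrow>\<^sub>M borel"
    using borel_measurable_real_of_ereal[OF measurable_L[of 1]] real_L_nonneg
    by (rule measurable_eval_joint[OF _ measurable_ident_sets[OF refl]])
  then have "(\<lambda>w. \<phi>1 (w (real_of_ereal (L 1 w)))) \<in> borel_measurable path_space"
    using phi1_measurable by (rule measurable_compose)
  then show ?thesis unfolding pay_def using measurable_L[of 1] measurable_H by measurable
qed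

lemma h_le_C: "\<bar>h y\<bar> \<le> C"
  unfolding h_def by (rule abs_E_le) (rule pay_le_C)

lemma h_measurable[measurable]: "h \<in> borel_measurable borel"
  unfolding h_def by (rule measurable_E) (rule pay_measurable)

lemma pay_adv:
  assumes "L r w < H w" "r \<le> 1"
  shows "pay (adv r w) = pay w"
proof -
  let ?s = "real_of_ereal (L r w)"
  have t: "L r w = ereal ?s" by (rule alive_time[OF assms(1)])
  have 1: "L 1 w = ereal ?s + L 1 (adv r w)" using adv_L[OF assms] t by simp
  have 2: "H w = ereal ?s + H (adv r w)" using adv_H[OF assms(1)] t by simp
  have iff: "L 1 w < H w \<longleftrightarrow> L 1 (adv r w) < H (adv r w)"
    unfolding 1 2 by (cases "L 1 (adv r w)"; cases "H (adv r w)") auto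
  show ?thesis
  proof (cases "L 1 (adv r w) < H (adv r w)")
    case True
    have u: "L 1 (adv r w) = ereal (real_of_ereal (L 1 (adv r w)))" by (rule alive_time[OF True])
    have "L 1 w = ereal (?s + real_of_ereal (L 1 (adv r w)))"
      unfolding 1 by (subst u) simp
    then have "real_of_ereal (L 1 w) = ?s + real_of_ereal (L 1 (adv r w))" by simp
    then show ?thesis using True iff by (simp add: pay_def adv_apply real_L_nonneg)
  qed (use iff in \<open>simp add: pay_def\<close>)
qed

text \<open>A trajectory with score below 1 does not succeed. In particular the discarded particle
  contributes nothing to any payoff sum.\<close>

lemma pay_dead:
  assumes "lev w < 1"
  shows "pay w = 0"
proof -
  have "\<not> L (lev w) w < H w" using less_lev_iff[of "lev w" w] assms lev_nonneg[of w] by simp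
  moreover have "L (lev w) w \<le> L 1 w" using assms by (intro level_time_mono) simp
  ultimately show ?thesis by (auto simp: pay_def)
qed

end

section \<open>Integration on finite products\<close>

text \<open>The law of the pair of \<open>x\<close> and a \<open>z\<close> drawn from
  \<open>\<kappa> x\<close> depends measurably on \<open>x\<close>, which covers integrands
  involving both.\<close>

lemma measurable_kernel_integral2:
  fixes f :: "'a \<Rightarrow> 'b \<Rightarrow> real"
  assumes K: "\<kappa> \<in> M \<rightarrow>\<^sub>M prob_algebra N" and f: "(\<lambda>(x, z). f x z) \<in> borel_measurable (M \<Otimes>\<^sub>M N)"
  shows "(\<lambda>x. \<integral>z. f x z \<partial>\<kappa> x) \<in> borel_measurable M"
proof -
  have Ks: "\<kappa> \<in> M \<rightarrow>\<^sub>M subprob_algebra N" using K by (rule measurable_prob_algebraD)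
  have "(\<lambda>x. distr (\<kappa> x) (M \<Otimes>\<^sub>M N) (\<lambda>z. (x, z))) \<in> M \<rightarrow>\<^sub>M subprob_algebra (M \<Otimes>\<^sub>M N)"
    by (rule measurable_distr2[OF _ Ks]) simp
  from measurable_compose[OF this integral_measurable_subprob_algebra[OF f]]
  have "(\<lambda>x. \<integral>p. (case p of (x, z) \<Rightarrow> f x z) \<partial>distr (\<kappa> x) (M \<Otimes>\<^sub>M N) (\<lambda>z. (x, z))) \<in> borel_measurable M" .
  also have "?this \<longleftrightarrow> ?thesis"
  proof (rule measurable_cong)
    fix x assume x: "x \<in> space M"
    have "(\<lambda>z. (x, z)) \<in> \<kappa> x \<rightarrow>\<^sub>M M \<Otimes>\<^sub>M N"
      using kernel_prob(2)[OF K x] x by (auto cong: measurable_cong_sets)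
    then show "(\<integral>p. (case p of (x, z) \<Rightarrow> f x z) \<partial>distr (\<kappa> x) (M \<Otimes>\<^sub>M N) (\<lambda>z. (x, z))) = (\<integral>z. f x z \<partial>\<kappa> x)"
      using f by (subst integral_distr) auto
  qed
  finally show ?thesis .
qed

text \<open>Fubini with one coordinate singled out; this will be the trajectory of the lowest
  particle.\<close>

lemma PiM_integral_insert:
  fixes f :: "('i \<Rightarrow> 'a) \<Rightarrow> real"
  assumes M: "\<And>i. prob_space (M i)" and J: "finite J" "i \<notin> J"
    and f: "f \<in> borel_measurable (PiM (insert i J) M)" "\<And>w. w \<in> space (PiM (insert i J) M) \<Longrightarrow> \<bar>f w\<bar> \<le> c"
  shows "(\<integral>w. f w \<partial>PiM (insert i J) M) = (\<integral>y. (\<integral>X. f (X(i := y)) \<partial>PiM J M) \<partial>M i)"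
proof -
  interpret Mi: prob_space "M i" by (rule M)
  interpret PJ: prob_space "PiM J M" by (intro prob_space_PiM M)
  interpret pair_sigma_finite "M i" "PiM J M" ..
  interpret PP: prob_space "M i \<Otimes>\<^sub>M PiM J M" by (intro prob_space_pair) unfold_locales
  have up: "(\<lambda>(x, X). X(i := x)) \<in> M i \<Otimes>\<^sub>M PiM J M \<rightarrow>\<^sub>M PiM (insert i J) M"
    by (subst split_beta', rule measurable_fun_upd[where J=J]) (auto intro: measurable_fst measurable_snd)
  have "(\<integral>w. f w \<partial>PiM (insert i J) M) =
      (\<integral>w. f w \<partial>distr (M i \<Otimes>\<^sub>M PiM J M) (PiM (insert i J) M) (\<lambda>(x, X). X(i := x)))"
    by (subst distr_pair_PiM_eq_PiM[OF M M]) simp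
  also have "\<dots> = (\<integral>p. f ((\<lambda>(x, X). X(i := x)) p) \<partial>(M i \<Otimes>\<^sub>M PiM J M))"
    by (rule integral_distr[OF up f(1)])
  also have "\<dots> = (\<integral>y. (\<integral>X. f ((\<lambda>(x, X). X(i := x)) (y, X)) \<partial>PiM J M) \<partial>M i)"
  proof (rule integral_fst'[symmetric])
    show "integrable (M i \<Otimes>\<^sub>M PiM J M) (\<lambda>p. f ((\<lambda>(x, X). X(i := x)) p))"
      using measurable_compose[OF up f(1)] f(2)[OF measurable_space[OF up]]
      by (rule PP.integrable_bounded)
  qed
  finally show ?thesis by simp
qed

lemma PiM_integral_prod:
  fixes f :: "'i \<Rightarrow> 'a \<Rightarrow> real"
  assumes M: "\<And>i. prob_space (M i)" and I: "finite I"
    and f: "\<And>i. i \<in> I \<Longrightarrow> f i \<in> borel_measurable (M i)" "\<And>i w. i \<in> I \<Longrightarrow> w \<in> space (M i) \<Longrightarrow> \<bar>f i w\<bar> \<le> c i"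
  shows "(\<integral>w. (\<Prod>i\<in>I. f i (w i)) \<partial>PiM I M) = (\<Prod>i\<in>I. \<integral>w. f i w \<partial>M i)"
proof -
  interpret product_sigma_finite M
    by (rule product_sigma_finite.intro) (rule prob_space_imp_sigma_finite[OF M])
  show ?thesis
  proof (rule product_integral_prod[OF I])
    fix i assume "i \<in> I"
    interpret prob_space "M i" by (rule M)
    show "integrable (M i) (f i)" using f[OF \<open>i \<in> I\<close>] by (rule integrable_bounded)
  qed
qed

lemma PiM_integral_single:
  fixes f :: "'a \<Rightarrow> real"
  assumes M: "\<And>i. prob_space (M i)" and I: "finite I" "n \<in> I"
    and f: "f \<in> borel_measurable (M n)" "\<And>w. w \<in> space (M n) \<Longrightarrow> \<bar>f w\<bar> \<le> c"
  shows "(\<integral>w. f (w n) \<partial>PiM I M) = (\<integral>w. f w \<partial>M n)"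
proof -
  define u where "u i = (if i = n then f else (\<lambda>_. 1))" for i
  have "(\<integral>w. (\<Prod>i\<in>I. u i (w i)) \<partial>PiM I M) = (\<Prod>i\<in>I. \<integral>w. u i w \<partial>M i)"
    using f by (intro PiM_integral_prod[OF M I(1), where c="\<lambda>i. max 1 c"]) (auto simp: u_def le_max_iff_disj)
  moreover have "(\<Prod>i\<in>I. u i (w i)) = f (w n)" for w
    using I by (subst prod.remove[of I n]) (auto simp: u_def)
  moreover have "(\<Prod>i\<in>I. \<integral>w. u i w \<partial>M i) = (\<integral>w. f w \<partial>M n)"
    using I M by (subst prod.remove[of I n]) (auto simp: u_def prob_space.prob_space)
  ultimately show ?thesis by simp
qed

lemma PiM_integral_pair:
  fixes f g :: "'a \<Rightarrow> real"
  assumes M: "\<And>i. prob_space (M i)" and I: "finite I" "n \<in> I" "m \<in> I" "n \<noteq> m"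
    and f: "f \<in> borel_measurable (M n)" "\<And>w. w \<in> space (M n) \<Longrightarrow> \<bar>f w\<bar> \<le> c"
    and g: "g \<in> borel_measurable (M m)" "\<And>w. w \<in> space (M m) \<Longrightarrow> \<bar>g w\<bar> \<le> c"
  shows "(\<integral>w. f (w n) * g (w m) \<partial>PiM I M) = (\<integral>w. f w \<partial>M n) * (\<integral>w. g w \<partial>M m)"
proof -
  define u where "u i = (if i = n then f else if i = m then g else (\<lambda>_. 1))" for i
  have "(\<integral>w. (\<Prod>i\<in>I. u i (w i)) \<partial>PiM I M) = (\<Prod>i\<in>I. \<integral>w. u i w \<partial>M i)"
    using f g by (intro PiM_integral_prod[OF M I(1), where c="\<lambda>i. max 1 c"]) (auto simp: u_def le_max_iff_disj)
  moreover have split: "(\<Prod>i\<in>I. v i) = v n * (v m * (\<Prod>i\<in>I - {n} - {m}. v i))" for v :: "_ \<Rightarrow> real"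
    using I by (subst prod.remove[of I n], simp_all, subst prod.remove[of "I - {n}" m], auto)
  have "(\<Prod>i\<in>I. u i (w i)) = f (w n) * g (w m)" for w
    using I unfolding split by (auto simp: u_def)
  moreover have "(\<Prod>i\<in>I. \<integral>w. u i w \<partial>M i) = (\<integral>w. f w \<partial>M n) * (\<integral>w. g w \<partial>M m)"
    using I M unfolding split by (auto simp: u_def prob_space.prob_space)
  ultimately show ?thesis by simp
qed

lemma measurable_PiM_kernel:
  assumes I: "finite I" and K: "\<kappa> \<in> S \<rightarrow>\<^sub>M prob_algebra N"
  shows "(\<lambda>x. PiM I (\<lambda>i. \<kappa> (x i))) \<in> PiM I (\<lambda>_. S) \<rightarrow>\<^sub>M prob_algebra (PiM I (\<lambda>_. N))"
proof (rule measurable_prob_algebra_generated)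
  show "sets (PiM I (\<lambda>_. N)) = sigma_sets (\<Pi>\<^sub>E i\<in>I. space N) (prod_algebra I (\<lambda>_. N))"
    by (rule sets_PiM)
  show "Int_stable (prod_algebra I (\<lambda>_. N))" by (rule Int_stable_prod_algebra)
  show "prod_algebra I (\<lambda>_. N) \<subseteq> Pow (\<Pi>\<^sub>E i\<in>I. space N)" by (rule prod_algebra_sets_into_space)
next
  fix x assume x: "x \<in> space (PiM I (\<lambda>_. S))"
  have k: "i \<in> I \<Longrightarrow> prob_space (\<kappa> (x i)) \<and> sets (\<kappa> (x i)) = sets N" for i
    using kernel_prob[OF K] x by (auto simp: space_PiM PiE_iff)
  then show "prob_space (PiM I (\<lambda>i. \<kappa> (x i)))" by (intro prob_space_PiM) auto
  show "sets (PiM I (\<lambda>i. \<kappa> (x i))) = sets (PiM I (\<lambda>_. N))" using k by (intro sets_PiM_cong) auto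
next
  fix A assume "A \<in> prod_algebra I (\<lambda>_. N)"
  then obtain X where X: "A = Pi\<^sub>E I X" "\<forall>i\<in>I. X i \<in> sets N"
    by (rule prod_algebraE_all) auto
  have "(\<lambda>x. \<Prod>i\<in>I. emeasure (\<kappa> (x i)) (X i)) \<in> borel_measurable (PiM I (\<lambda>_. S))"
  proof (rule borel_measurable_prod_ennreal)
    fix i assume i: "i \<in> I"
    have "(\<lambda>x. \<kappa> (x i)) \<in> PiM I (\<lambda>_. S) \<rightarrow>\<^sub>M subprob_algebra N"
      by (rule measurable_compose[OF measurable_component_singleton[OF i] measurable_prob_algebraD[OF K]])
    then show "(\<lambda>x. emeasure (\<kappa> (x i)) (X i)) \<in> borel_measurable (PiM I (\<lambda>_. S))"
      using X i by (intro measurable_compose[OF _ measurable_emeasure_subprob_algebra]) auto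
  qed
  also have "?this \<longleftrightarrow> (\<lambda>x. emeasure (PiM I (\<lambda>i. \<kappa> (x i))) A) \<in> borel_measurable (PiM I (\<lambda>_. S))"
  proof (rule measurable_cong)
    fix x assume x: "x \<in> space (PiM I (\<lambda>_. S))"
    \<comment> \<open>The product measure theory asks for probability measures at all indices, but
      outside \<open>I\<close> the argument \<open>x\<close> is \<open>undefined\<close>; a point
      mass is put there.\<close>
    define M where "M i = (if i \<in> I then \<kappa> (x i) else return (count_space UNIV) undefined)" for i
    have k: "i \<in> I \<Longrightarrow> prob_space (\<kappa> (x i)) \<and> sets (\<kappa> (x i)) = sets N" for i
      using kernel_prob[OF K] x by (auto simp: space_PiM PiE_iff)
    then have "prob_space (M i)" for i by (auto simp: M_def intro!: prob_space_return)
    then interpret product_sigma_finite M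
      by (intro product_sigma_finite.intro prob_space_imp_sigma_finite)
    have eq: "PiM I (\<lambda>i. \<kappa> (x i)) = PiM I M" by (intro PiM_cong) (auto simp: M_def)
    show "(\<Prod>i\<in>I. emeasure (\<kappa> (x i)) (X i)) = emeasure (PiM I (\<lambda>i. \<kappa> (x i))) A"
      unfolding eq X(1) using k X(2) I by (subst emeasure_PiM) (auto simp: M_def)
  qed
  finally show "(\<lambda>x. emeasure (PiM I (\<lambda>i. \<kappa> (x i))) A) \<in> borel_measurable (PiM I (\<lambda>_. S))" .
qed

lemma sum_square_offdiag:
  fixes a :: "'i \<Rightarrow> real"
  assumes "finite J"
  shows "(\<Sum>n\<in>J. a n)\<^sup>2 - (\<Sum>n\<in>J. (a n)\<^sup>2) = (\<Sum>n\<in>J. \<Sum>m\<in>J - {n}. a n * a m)"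
proof -
  have "(\<Sum>n\<in>J. a n)\<^sup>2 = (\<Sum>n\<in>J. \<Sum>m\<in>J. a n * a m)"
    by (simp add: power2_eq_square sum_product)
  also have "\<dots> = (\<Sum>n\<in>J. (a n)\<^sup>2 + (\<Sum>m\<in>J - {n}. a n * a m))"
    using assms by (intro sum.cong refl) (subst sum.remove[of J], auto simp: power2_eq_square)
  finally show ?thesis by (simp add: sum.distrib)
qed

text \<open>The selection step replaces \<open>s = \<Sum>a\<close> by \<open>s + a\<^sub>m\<close> with \<open>m\<close> uniform.\<close>

lemma selection_mean:
  fixes a :: "'i \<Rightarrow> real"
  assumes J: "finite J" "card J = N - 1" and N: "2 \<le> N"
  shows "(1 - 1 / real N) * ((\<Sum>m\<in>J. ((\<Sum>n\<in>J. a n) + a m) / N) / (real N - 1)) = (\<Sum>n\<in>J. a n) / N"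
proof -
  let ?s = "\<Sum>n\<in>J. a n"
  have "(\<Sum>m\<in>J. (?s + a m) / N) = (real (N - 1) * ?s + ?s) / N"
    using J by (simp add: sum_divide_distrib[symmetric] sum.distrib)
  also have "\<dots> = ?s" using N by (simp add: of_nat_diff field_simps)
  finally have "(\<Sum>m\<in>J. (?s + a m) / N) = ?s" .
  then show ?thesis using N by (simp add: field_simps)
qed

text \<open>With \<open>s\<close> and \<open>u\<close> the sums of the \<open>a n\<close> and of
  their squares and \<open>k = N\<close>, the new off-diagonal sum is
  \<open>s^2 - u + 2 * s * a m\<close>, with average \<open>s^2 - u + 2 * s^2 / (k - 1)\<close>. As
  \<open>(1 - 1/k)^2 * (1 + 2/(k - 1)) = 1 - 1/k^2\<close>, the part in \<open>s^2\<close> does not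
  grow. The part \<open>- u\<close> shrinks to \<open>- b^2 * u\<close>, a loss of
  \<open>(1 - b^2) * u / k^2\<close>, which is at most \<open>(1 - b^2) * C^2 / k\<close> since
  \<open>u \<le> k * C^2\<close>: just what the constant term gives up under the factor
  \<open>b^2\<close>.\<close>

lemma selection_square:
  fixes a :: "'i \<Rightarrow> real"
  assumes J: "finite J" "card J = N - 1" and N: "2 \<le> N" and a: "\<And>n. n \<in> J \<Longrightarrow> \<bar>a n\<bar> \<le> C"
  shows "(1 - 1 / real N)\<^sup>2 * ((\<Sum>m\<in>J. (((\<Sum>n\<in>J. a n) + a m)\<^sup>2 - ((\<Sum>n\<in>J. (a n)\<^sup>2) + (a m)\<^sup>2)) / (real N)\<^sup>2 + C\<^sup>2 / N) / (real N - 1))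
    \<le> ((\<Sum>n\<in>J. a n)\<^sup>2 - (\<Sum>n\<in>J. (a n)\<^sup>2)) / (real N)\<^sup>2 + C\<^sup>2 / N"
proof -
  define s where "s = (\<Sum>n\<in>J. a n)"
  define u where "u = (\<Sum>n\<in>J. (a n)\<^sup>2)"
  define b where "b = 1 - 1 / real N"
  define k where "k = real N"
  have k: "2 \<le> k" using N by (simp add: k_def)
  have b: "0 \<le> b" "b \<le> 1" "b = (k - 1) / k" using k by (auto simp: b_def k_def field_simps)
  have cJ: "real (card J) = k - 1" using J N by (simp add: k_def of_nat_diff)
  have "u \<le> (\<Sum>n\<in>J. C\<^sup>2)" unfolding u_def
    using a by (intro sum_mono) (metis abs_ge_zero power2_abs power_mono)
  then have u: "u \<le> (k - 1) * C\<^sup>2" using cJ by simp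
  have u2: "u \<le> k * C\<^sup>2" using u by (rule order_trans) (simp add: algebra_simps)
  have "(\<Sum>m\<in>J. ((s + a m)\<^sup>2 - (u + (a m)\<^sup>2)) / k\<^sup>2 + C\<^sup>2 / k) =
      (\<Sum>m\<in>J. (s\<^sup>2 - u) / k\<^sup>2 + C\<^sup>2 / k + (2 * s / k\<^sup>2) * a m)"
    by (intro sum.cong refl) (simp add: power2_eq_square add_divide_distrib diff_divide_distrib algebra_simps)
  also have "\<dots> = (\<Sum>m\<in>J. (s\<^sup>2 - u) / k\<^sup>2 + C\<^sup>2 / k) + (2 * s / k\<^sup>2) * (\<Sum>m\<in>J. a m)"
    by (simp only: sum.distrib sum_distrib_left)
  also have "\<dots> = (k - 1) * ((s\<^sup>2 - u) / k\<^sup>2 + C\<^sup>2 / k) + (2 * s / k\<^sup>2) * s"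
    using cJ by (simp add: s_def)
  finally have "b\<^sup>2 * ((\<Sum>m\<in>J. ((s + a m)\<^sup>2 - (u + (a m)\<^sup>2)) / k\<^sup>2 + C\<^sup>2 / k) / (k - 1))
     = b\<^sup>2 * ((s\<^sup>2 - u) / k\<^sup>2 + C\<^sup>2 / k + 2 * s\<^sup>2 / (k\<^sup>2 * (k - 1)))"
    using k by (simp add: add_divide_distrib power2_eq_square)
  also have "\<dots> = s\<^sup>2 / k\<^sup>2 - s\<^sup>2 / k ^ 4 - b\<^sup>2 * u / k\<^sup>2 + b\<^sup>2 * C\<^sup>2 / k"
  proof -
    have "b\<^sup>2 * (s\<^sup>2 / k\<^sup>2 + 2 * s\<^sup>2 / (k\<^sup>2 * (k - 1))) = s\<^sup>2 / k\<^sup>2 - s\<^sup>2 / k ^ 4"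
    proof -
      have "b\<^sup>2 * (s\<^sup>2 / k\<^sup>2 + 2 * s\<^sup>2 / (k\<^sup>2 * (k - 1))) = s\<^sup>2 / k\<^sup>2 * (b\<^sup>2 * (1 + 2 / (k - 1)))"
        by (simp add: algebra_simps)
      also have "b\<^sup>2 * (1 + 2 / (k - 1)) = (k - 1) * (k + 1) / k\<^sup>2"
      proof -
        have "1 + 2 / (k - 1) = (k + 1) / (k - 1)" using k by (simp add: field_simps)
        then show ?thesis unfolding b(3) using k by (simp add: power_divide power2_eq_square)
      qed
      also have "(k - 1) * (k + 1) / k\<^sup>2 = 1 - 1 / k\<^sup>2"
        using k by (simp add: field_simps power2_eq_square)
      finally show ?thesis by (simp add: right_diff_distrib power4_eq_xxxx power2_eq_square)
    qed
    then show ?thesis by (simp add: algebra_simps diff_divide_distrib)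
  qed
  also have "\<dots> \<le> s\<^sup>2 / k\<^sup>2 - b\<^sup>2 * u / k\<^sup>2 + b\<^sup>2 * C\<^sup>2 / k" using k by simp
  also have "\<dots> \<le> (s\<^sup>2 - u) / k\<^sup>2 + C\<^sup>2 / k"
  proof -
    have "b\<^sup>2 \<le> 1" using b by (simp add: power_le_one)
    then have "(1 - b\<^sup>2) * u \<le> (1 - b\<^sup>2) * (k * C\<^sup>2)" using u2 by (intro mult_left_mono) auto
    then have "(1 - b\<^sup>2) * u / k\<^sup>2 \<le> (1 - b\<^sup>2) * (k * C\<^sup>2) / k\<^sup>2" by (rule divide_right_mono) simp
    also have "\<dots> = (1 - b\<^sup>2) * C\<^sup>2 / k" using k by (simp add: power2_eq_square)
    finally show ?thesis by (simp add: algebra_simps diff_divide_distrib)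
  qed
  finally show ?thesis by (simp add: s_def u_def b_def k_def)
qed

section \<open>One step of the particle system\<close>

locale ams_particles = ams_payoff P \<xi> A \<phi>
  for P :: "'e::polish_space \<Rightarrow> 'e path measure" and \<xi> :: "'e \<Rightarrow> real" and A :: "'e set"
    and \<phi> :: "'e \<Rightarrow> real" +
  fixes N :: nat
  assumes N2: "2 \<le> N"
begin

definition I :: "nat set" where "I = {1..N}"
abbreviation PS :: "(nat \<Rightarrow> 'e path) measure" where "PS \<equiv> PiM I (\<lambda>_. path_space)"
abbreviation ES :: "(nat \<Rightarrow> 'e) measure" where "ES \<equiv> PiM I (\<lambda>_. borel)"

definition K :: "(nat \<Rightarrow> 'e) \<Rightarrow> (nat \<Rightarrow> 'e path) measure" where
  "K x = PiM I (\<lambda>n. P (x n))"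

definition mn :: "(nat \<Rightarrow> 'e path) \<Rightarrow> real" where "mn w = Min ((\<lambda>n. lev (w n)) ` I)"
definition low :: "(nat \<Rightarrow> 'e path) \<Rightarrow> nat" where "low w = (LEAST n. n \<in> I \<and> lev (w n) = mn w)"
definition st :: "(nat \<Rightarrow> 'e path) \<Rightarrow> (nat \<Rightarrow> 'e)" where "st w = (\<lambda>n\<in>I. w n 0)"
definition move :: "'e path \<Rightarrow> (nat \<Rightarrow> 'e path) \<Rightarrow> (nat \<Rightarrow> 'e path)" where
  "move z w = (\<lambda>n\<in>I. if n = low w then z else adv (mn w) (w n))"
definition branch :: "nat \<Rightarrow> (nat \<Rightarrow> 'e path) \<Rightarrow> (nat \<Rightarrow> 'e)" where
  "branch m w = (\<lambda>n\<in>I. adv (mn w) (w (if n = low w then m else n)) 0)"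
text \<open>The conditional mean of \<open>F\<close> at the next configuration: the copied index is
  uniform among the \<open>N - 1\<close> others, and the new piece starts from the entrance point of
  the copied particle. The value 0 after the stop corresponds to integrating only over runs that
  perform the branching.\<close>

definition S :: "((nat \<Rightarrow> 'e path) \<Rightarrow> real) \<Rightarrow> (nat \<Rightarrow> 'e path) \<Rightarrow> real" where
  "S F w = (if mn w < 1 then (\<Sum>m\<in>I. if m = low w then 0 else
     (\<integral>z. F (move z w) \<partial>P (adv (mn w) (w m) 0))) / (real N - 1) else 0)"

text \<open>Particle \<open>i\<close> is required to be strictly lowest, which makes these events
  disjoint. Together with the stopped configurations they cover everything except ties below level
  1.\<close>

definition Elow :: "nat \<Rightarrow> (nat \<Rightarrow> 'e path) set" where
  "Elow i = {w\<in>space PS. lev (w i) < 1 \<and> (\<forall>n\<in>I - {i}. lev (w i) < lev (w n))}"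

text \<open>The invariant of the run: the starting points of the remaining parts lie on one common
  level, at first 0 and later the last restart level.\<close>

definition levels :: "(nat \<Rightarrow> 'e) \<Rightarrow> bool" where
  "levels x \<longleftrightarrow> (\<exists>t. 0 \<le> t \<and> t < 1 \<and> (\<forall>n\<in>I. \<xi> (x n) = t))"

section \<open>Independent particles and the lowest of them\<close>

lemma I_facts[simp]: "finite I" "I \<noteq> {}" "card I = N"
  using N2 by (auto simp: I_def)

lemma card_remove: "i \<in> I \<Longrightarrow> card (I - {i}) = N - 1"
  using I_facts by simp

lemma K_kernel: "K \<in> ES \<rightarrow>\<^sub>M prob_algebra PS"
  unfolding K_def[abs_def] by (rule measurable_PiM_kernel[OF I_facts(1) kernel])

lemma prob_K: "prob_space (K x)"
  unfolding K_def by (intro prob_space_PiM prob_P)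

lemma sets_K[measurable_cong, simp]: "sets (K x) = sets PS"
  unfolding K_def by (intro sets_PiM_cong) auto

lemma space_K[simp]: "space (K x) = space PS"
  by (rule sets_eq_imp_space_eq) (rule sets_K)

lemma measurable_K: "f \<in> PS \<rightarrow>\<^sub>M M \<Longrightarrow> f \<in> K x \<rightarrow>\<^sub>M M"
  by (simp cong: measurable_cong_sets)

lemma integrable_K:
  fixes F :: "(nat \<Rightarrow> 'e path) \<Rightarrow> real"
  assumes "F \<in> borel_measurable PS" "\<And>w. w \<in> space PS \<Longrightarrow> \<bar>F w\<bar> \<le> c"
  shows "integrable (K x) F"
proof -
  interpret prob_space "K x" by (rule prob_K)
  show ?thesis using assms by (intro integrable_bounded[where c=c] measurable_K) auto
qed

lemma AE_K_component:
  assumes "n \<in> I" "AE w in P (x n). Q w"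
  shows "AE w in K x. Q (w n)"
  unfolding K_def by (rule AE_PiM_component[of I "\<lambda>n. P (x n)"]) (use assms prob_P in auto)

lemma AE_K_space: "AE w in K x. w \<in> space PS"
  using AE_space[of "K x"] by simp

lemma PS_component: "w \<in> space PS \<Longrightarrow> n \<in> I \<Longrightarrow> w n \<in> space path_space"
  by (auto simp: space_PiM PiE_iff)

lemma measurable_component: "n \<in> I \<Longrightarrow> (\<lambda>w. w n) \<in> PS \<rightarrow>\<^sub>M path_space"
  by (rule measurable_component_singleton)

lemma mn_le: "n \<in> I \<Longrightarrow> mn w \<le> lev (w n)"
  unfolding mn_def by (intro Min_le) auto

lemma mn_attained: "\<exists>n\<in>I. lev (w n) = mn w"
proof -
  have "mn w \<in> (\<lambda>n. lev (w n)) ` I" unfolding mn_def using I_facts by (intro Min_in) auto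
  then show ?thesis by auto
qed

lemma low_in: "low w \<in> I" and lev_low: "lev (w (low w)) = mn w"
proof -
  have "low w \<in> I \<and> lev (w (low w)) = mn w"
    unfolding low_def by (rule LeastI_ex) (use mn_attained[of w] in blast)
  then show "low w \<in> I" "lev (w (low w)) = mn w" by auto
qed

lemma mn_bounds: "0 \<le> mn w" "mn w \<le> 1"
  using lev_low[of w] lev_nonneg[of "w (low w)"] lev_le_1[of "w (low w)"] by auto

lemma mn_measurable[measurable]: "mn \<in> borel_measurable PS"
proof (rule borel_measurableI_greater)
  fix t
  have "{w\<in>space PS. t < mn w} = {w\<in>space PS. \<forall>n\<in>I. t < lev (w n)}"
    unfolding mn_def using I_facts(1,2) by (simp add: Min_gr_iff)
  also have "\<dots> \<in> sets PS"
  proof (rule sets.sets_Collect_finite_All)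
    fix n assume "n \<in> I"
    then have "(\<lambda>w. lev (w n)) \<in> borel_measurable PS"
      by (intro measurable_compose[OF measurable_component measurable_lev])
    then show "{w\<in>space PS. t < lev (w n)} \<in> sets PS" by measurable
  qed simp
  finally show "{w\<in>space PS. t < mn w} \<in> sets PS" .
qed

lemma lev_component_measurable: "n \<in> I \<Longrightarrow> (\<lambda>w. lev (w n)) \<in> borel_measurable PS"
  by (intro measurable_compose[OF measurable_component measurable_lev])

lemma low_measurable[measurable]: "low \<in> PS \<rightarrow>\<^sub>M count_space UNIV"
  unfolding low_def[abs_def]
proof (rule measurable_Least)
  fix n
  show "(\<lambda>w. n \<in> I \<and> lev (w n) = mn w) \<in> PS \<rightarrow>\<^sub>M count_space UNIV"
  proof (cases "n \<in> I")
    case True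
    then show ?thesis
      using borel_measurable_eq[OF lev_component_measurable[OF True] mn_measurable] by (simp add: pred_def)
  qed simp
qed

lemma Elow_sets: "i \<in> I \<Longrightarrow> Elow i \<in> sets PS"
proof -
  assume i: "i \<in> I"
  have "{w\<in>space PS. \<forall>n\<in>I - {i}. lev (w i) < lev (w n)} \<in> sets PS"
  proof (rule sets.sets_Collect_finite_All)
    fix n assume "n \<in> I - {i}"
    then show "{w\<in>space PS. lev (w i) < lev (w n)} \<in> sets PS"
      using lev_component_measurable[OF i] lev_component_measurable[of n] by (intro borel_measurable_less) auto
  qed simp
  moreover have "{w\<in>space PS. lev (w i) < 1} \<in> sets PS"
    using lev_component_measurable[OF i] by (intro borel_measurable_less) auto
  moreover have "Elow i = {w\<in>space PS. lev (w i) < 1} \<inter> {w\<in>space PS. \<forall>n\<in>I - {i}. lev (w i) < lev (w n)}"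
    by (auto simp: Elow_def)
  ultimately show ?thesis by simp
qed

lemma Elow_low:
  assumes w: "w \<in> Elow i" and i: "i \<in> I"
  shows "low w = i" "mn w = lev (w i)" "mn w < 1"
proof -
  show "low w = i"
  proof (rule ccontr)
    assume "low w \<noteq> i"
    then have "lev (w i) < lev (w (low w))" using w low_in[of w] by (auto simp: Elow_def)
    then show False using mn_le[OF i, of w] lev_low[of w] by simp
  qed
  then show "mn w = lev (w i)" using lev_low[of w] by simp
  then show "mn w < 1" using w by (simp add: Elow_def)
qed

lemma Elow_alive:
  assumes w: "w \<in> Elow i" and n: "n \<in> I - {i}"
  shows "L (lev (w i)) (w n) < H (w n)"
  using w n less_lev_iff[OF lev_nonneg, of "w i" "w n"] by (auto simp: Elow_def)

text \<open>For a fixed trajectory of particle \<open>i\<close> its score is a constant below 1,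
  which the score of the independent particle \<open>n\<close> almost surely avoids by
  \<open>AE_lev_neq\<close>.\<close>

lemma AE_no_tie_pair:
  assumes x: "levels x" and i: "i \<in> I" "n \<in> I" "i \<noteq> n"
  shows "AE w in K x. lev (w i) < 1 \<longrightarrow> lev (w i) \<noteq> lev (w n)"
proof -
  obtain t where t: "0 \<le> t" "t < 1" "\<And>n. n \<in> I \<Longrightarrow> \<xi> (x n) = t" using x by (auto simp: levels_def)
  define J where "J = I - {i}"
  have J: "finite J" "i \<notin> J" "insert i J = I" "n \<in> J" using i by (auto simp: J_def)
  \<comment> \<open>The condition \<open>t \<le> lev (w i)\<close> is included because
    \<open>AE_lev_neq\<close> concerns levels not below the starting point; it holds almost surely,
    as a score is at least the starting level.\<close>
  define B where "B = {w\<in>space PS. t \<le> lev (w i) \<and> lev (w i) < 1 \<and> lev (w i) = lev (w n)}"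
  have B: "B \<in> sets PS"
    unfolding B_def using lev_component_measurable[OF i(1)] lev_component_measurable[OF i(2)]
    by (intro sets.sets_Collect_conj borel_measurable_le borel_measurable_less borel_measurable_eq) auto
  have "(\<integral>w. indicator B w \<partial>K x) = (\<integral>y. (\<integral>X. indicator B (X(i := y)) \<partial>PiM J (\<lambda>n. P (x n))) \<partial>P (x i) :: real)"
    unfolding K_def J(3)[symmetric]
  proof (rule PiM_integral_insert[OF prob_P J(1,2), where c=1])
    have "sets (PiM (insert i J) (\<lambda>n. P (x n))) = sets PS" unfolding J(3) by (intro sets_PiM_cong) auto
    then show "indicator B \<in> borel_measurable (PiM (insert i J) (\<lambda>n. P (x n)))"
      using B by (intro borel_measurable_indicator) simp
  qed (simp split: split_indicator)
  also have "\<dots> = (\<integral>y. 0 \<partial>P (x i))"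
  proof (rule Bochner_Integration.integral_cong[OF refl], rule integral_eq_zero_AE)
    fix y
    show "AE X in PiM J (\<lambda>n. P (x n)). indicator B (X(i := y)) = (0::real)"
    proof (cases "t \<le> lev y \<and> lev y < 1")
      case True
      have "AE z in P (x n). lev z \<noteq> lev y"
        using True t i by (intro AE_lev_neq) auto
      then have "AE X in PiM J (\<lambda>n. P (x n)). lev (X n) \<noteq> lev y"
        by (intro AE_PiM_component[of J "\<lambda>n. P (x n)"] prob_P J(4))
      then show ?thesis
        by eventually_elim (use i in \<open>simp add: B_def\<close>)
    qed (auto simp: B_def)
  qed
  finally have "(\<integral>w. indicator B w \<partial>K x) = (0::real)" by simp
  then have "measure (K x) B = 0" using B by simp
  then have "B \<in> null_sets (K x)"
    using B finite_measure.emeasure_eq_measure[of "K x" B] prob_K[of x] by (simp add: null_sets_def prob_space_def)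
  then have "AE w in K x. w \<notin> B" by (rule AE_not_in)
  moreover have "AE w in K x. good (w i) \<and> w i 0 = x i"
    using AE_K_component[OF i(1) AE_good, of x] AE_K_component[OF i(1) start, of x] t i
    by (auto elim: eventually_elim2)
  ultimately show ?thesis
    using AE_K_space
  proof eventually_elim
    case (elim w)
    have "\<xi> (w i 0) \<le> lev (w i)"
      using elim hit_time_nonneg[of "closure A" "w i"] L_nonneg[of 1 "w i"]
      by (intro good_le_lev) (auto simp: zero_ereal_def)
    then show ?case using elim t i by (auto simp: B_def)
  qed
qed

lemma AE_K_nice:
  assumes x: "levels x"
  shows "AE w in K x. (\<forall>n\<in>I. good (w n) \<and> w n 0 = x n) \<and>
    (\<forall>i\<in>I. \<forall>n\<in>I. i \<noteq> n \<longrightarrow> lev (w i) < 1 \<longrightarrow> lev (w i) \<noteq> lev (w n))"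
proof -
  obtain t where t: "0 \<le> t" "t < 1" "\<And>n. n \<in> I \<Longrightarrow> \<xi> (x n) = t" using x by (auto simp: levels_def)
  have 1: "AE w in K x. good (w n) \<and> w n 0 = x n" if "n \<in> I" for n
    using AE_K_component[OF that AE_good, of x] AE_K_component[OF that start, of x] t that
    by (auto elim: eventually_elim2)
  have "AE w in K x. \<forall>n\<in>I. good (w n) \<and> w n 0 = x n"
    using 1 by (intro AE_finite_allI) auto
  moreover have "AE w in K x. i \<noteq> n \<longrightarrow> lev (w i) < 1 \<longrightarrow> lev (w i) \<noteq> lev (w n)" if "i \<in> I" "n \<in> I" for i n
    using AE_no_tie_pair[OF x that] by (cases "i = n") auto
  then have "AE w in K x. \<forall>i\<in>I. \<forall>n\<in>I. i \<noteq> n \<longrightarrow> lev (w i) < 1 \<longrightarrow> lev (w i) \<noteq> lev (w n)"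
    by (intro AE_finite_allI) auto
  ultimately show ?thesis by eventually_elim auto
qed

text \<open>Without ties, exactly one of the events \<open>Elow i\<close> occurs when the
  configuration has not stopped, namely that of \<open>low w\<close>.\<close>

lemma sum_Elow:
  fixes f :: "nat \<Rightarrow> real"
  assumes w: "w \<in> space PS" and tie: "\<forall>i\<in>I. \<forall>n\<in>I. i \<noteq> n \<longrightarrow> lev (w i) < 1 \<longrightarrow> lev (w i) \<noteq> lev (w n)"
  shows "(\<Sum>i\<in>I. indicator (Elow i) w * f i) = (if mn w < 1 then f (low w) else 0)"
proof -
  have "indicator (Elow i) w = (if mn w < 1 \<and> i = low w then 1 else (0::real))" if i: "i \<in> I" for i
  proof -
    have "w \<in> Elow (low w)" if m: "mn w < 1"
    proof -
      have "lev (w (low w)) < lev (w n)" if n: "n \<in> I - {low w}" for n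
      proof -
        have "mn w \<le> lev (w n)" using n by (intro mn_le) auto
        moreover have "mn w \<noteq> lev (w n)"
          using tie[rule_format, of "low w" n] low_in[of w] lev_low[of w] n m by auto
        ultimately show ?thesis using lev_low[of w] by simp
      qed
      then show ?thesis using w m lev_low[of w] by (simp add: Elow_def)
    qed
    then have "w \<in> Elow i \<longleftrightarrow> mn w < 1 \<and> i = low w"
      using Elow_low[OF _ i, of w] by blast
    then show ?thesis by (auto simp: indicator_def)
  qed
  then have "(\<Sum>i\<in>I. indicator (Elow i) w * f i) = (\<Sum>i\<in>I. if low w = i then (if mn w < 1 then f i else 0) else 0)"
    by (intro sum.cong refl) auto
  also have "\<dots> = (if mn w < 1 then f (low w) else 0)" using low_in[of w] by (simp add: sum.delta)
  finally show ?thesis .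
qed

lemma prod_abs_le:
  fixes f :: "nat \<Rightarrow> real"
  assumes "\<And>n. n \<in> J \<Longrightarrow> \<bar>f n\<bar> \<le> c" shows "\<bar>\<Prod>n\<in>J. f n\<bar> \<le> c ^ card J"
proof -
  have "\<bar>\<Prod>n\<in>J. f n\<bar> \<le> (\<Prod>n\<in>J. c)" unfolding abs_prod by (intro prod_mono) (use assms in auto)
  then show ?thesis by simp
qed

text \<open>For fixed trajectory of the lowest particle its score is a deterministic level, at which the
  strong Markov property applies to each of the other particles independently.\<close>

lemma low_fubini:
  fixes v :: "real \<Rightarrow> nat \<Rightarrow> 'e path \<Rightarrow> real"
  assumes i: "i \<in> I"
    and vm: "\<And>n. n \<in> I - {i} \<Longrightarrow> (\<lambda>w. v (lev (w i)) n (w n)) \<in> borel_measurable PS"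
    and vr: "\<And>r n. n \<in> I - {i} \<Longrightarrow> v r n \<in> borel_measurable path_space"
    and vb: "\<And>r n z. n \<in> I - {i} \<Longrightarrow> z \<in> space path_space \<Longrightarrow> \<bar>v r n z\<bar> \<le> c"
  shows "(\<integral>w. indicator (Elow i) w * (\<Prod>n\<in>I - {i}. v (lev (w i)) n (w n)) \<partial>K x) =
    (\<integral>y. indicator {y. lev y < 1} y *
      (\<Prod>n\<in>I - {i}. \<integral>z. indicator {z. L (lev y) z < H z} z * v (lev y) n z \<partial>P (x n)) \<partial>P (x i))"
proof -
  define J where "J = I - {i}"
  have J: "finite J" "i \<notin> J" "insert i J = I" using i by (auto simp: J_def)
  define f where "f w = indicator (Elow i) w * (\<Prod>n\<in>J. v (lev (w i)) n (w n))" for w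
  have fm: "f \<in> borel_measurable PS"
    unfolding f_def using vm Elow_sets[OF i]
    by (intro borel_measurable_times borel_measurable_prod borel_measurable_indicator) (auto simp: J_def)
  have fb: "\<bar>f w\<bar> \<le> \<bar>c\<bar> ^ card J" if "w \<in> space PS" for w
  proof -
    have "\<bar>\<Prod>n\<in>J. v (lev (w i)) n (w n)\<bar> \<le> \<bar>c\<bar> ^ card J"
      using vb PS_component[OF that] by (intro prod_abs_le) (fastforce simp: J_def intro: order_trans[OF _ abs_ge_self])
    then show ?thesis by (auto simp: f_def split: split_indicator)
  qed
  have sPS: "sets (PiM (insert i J) (\<lambda>n. P (x n))) = sets PS" unfolding J(3) by (intro sets_PiM_cong) auto
  have "(\<integral>w. f w \<partial>K x) = (\<integral>y. (\<integral>X. f (X(i := y)) \<partial>PiM J (\<lambda>n. P (x n))) \<partial>P (x i))"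
    unfolding K_def J(3)[symmetric]
  proof (rule PiM_integral_insert[OF prob_P J(1,2)])
    show "f \<in> borel_measurable (PiM (insert i J) (\<lambda>n. P (x n)))"
      using fm by (simp add: measurable_cong_sets[OF sPS refl])
    show "\<bar>f w\<bar> \<le> \<bar>c\<bar> ^ card J" if "w \<in> space (PiM (insert i J) (\<lambda>n. P (x n)))" for w
      using fb[of w] that sets_eq_imp_space_eq[OF sPS] by simp
  qed
  also have "\<dots> = (\<integral>y. indicator {y. lev y < 1} y *
      (\<Prod>n\<in>J. \<integral>z. indicator {z. L (lev y) z < H z} z * v (lev y) n z \<partial>P (x n)) \<partial>P (x i))"
  proof (rule Bochner_Integration.integral_cong[OF refl])
    fix y assume y: "y \<in> space (P (x i))"
    let ?u = "\<lambda>n z. indicator {z. L (lev y) z < H z} z * v (lev y) n z"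
    have eq: "f (X(i := y)) = indicator {y. lev y < 1} y * (\<Prod>n\<in>J. ?u n (X n))"
      if X: "X \<in> space (PiM J (\<lambda>n. P (x n)))" for X
    proof -
      have "X(i := y) \<in> space PS"
        unfolding J(3)[symmetric] using X y J(2) by (auto simp: space_PiM PiE_iff extensional_def)
      then have "X(i := y) \<in> Elow i \<longleftrightarrow> lev y < 1 \<and> (\<forall>n\<in>J. lev y < lev (X n))"
        using J(2) by (auto simp: Elow_def J_def[symmetric])
      also have "\<dots> \<longleftrightarrow> lev y < 1 \<and> (\<forall>n\<in>J. L (lev y) (X n) < H (X n))"
        using less_lev_iff[OF lev_nonneg, of y] by auto
      finally have E: "indicator (Elow i) (X(i := y)) =
          indicator {y. lev y < 1} y * (\<Prod>n\<in>J. indicator {z. L (lev y) z < H z} (X n) :: real)"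
        using J(1) by (auto simp: indicator_def prod_zero_iff)
      have "(\<Prod>n\<in>J. v (lev ((X(i := y)) i)) n ((X(i := y)) n)) = (\<Prod>n\<in>J. v (lev y) n (X n))"
        using J(2) by (intro prod.cong) auto
      then show ?thesis unfolding f_def E by (simp add: prod.distrib)
    qed
    have "(\<integral>X. f (X(i := y)) \<partial>PiM J (\<lambda>n. P (x n))) =
        (\<integral>X. indicator {y. lev y < 1} y * (\<Prod>n\<in>J. ?u n (X n)) \<partial>PiM J (\<lambda>n. P (x n)))"
      by (intro Bochner_Integration.integral_cong refl eq)
    also have "\<dots> = indicator {y. lev y < 1} y * (\<integral>X. (\<Prod>n\<in>J. ?u n (X n)) \<partial>PiM J (\<lambda>n. P (x n)))"
      by simp
    also have "(\<integral>X. (\<Prod>n\<in>J. ?u n (X n)) \<partial>PiM J (\<lambda>n. P (x n))) = (\<Prod>n\<in>J. \<integral>z. ?u n z \<partial>P (x n))"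
    proof (rule PiM_integral_prod[OF prob_P J(1), where c="\<lambda>_. \<bar>c\<bar>"])
      fix n assume n: "n \<in> J"
      have "{z\<in>space path_space. L (lev y) z < H z} \<in> sets path_space"
        using measurable_L[of "lev y"] measurable_H by measurable
      then have "(indicator {z. L (lev y) z < H z} :: 'e path \<Rightarrow> real) \<in> borel_measurable path_space"
        by (subst borel_measurable_indicator_iff) (simp add: Int_def conj_commute)
      then show "?u n \<in> borel_measurable (P (x n))"
        using vr[of n "lev y"] n by (intro measurable_P borel_measurable_times) (auto simp: J_def)
      show "\<bar>?u n z\<bar> \<le> \<bar>c\<bar>" if "z \<in> space (P (x n))" for z
        using vb[of n z "lev y"] that n by (auto simp: J_def split: split_indicator intro: order_trans[OF _ abs_ge_self])
    qed
    finally show "(\<integral>X. f (X(i := y)) \<partial>PiM J (\<lambda>n. P (x n))) = indicator {y. lev y < 1} y *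
      (\<Prod>n\<in>J. \<integral>z. ?u n z \<partial>P (x n))" .
  qed
  finally show ?thesis by (simp add: f_def J_def)
qed

lemma adv_component_measurable:
  assumes "i \<in> I" "n \<in> I"
  shows "(\<lambda>w. adv (lev (w i)) (w n)) \<in> PS \<rightarrow>\<^sub>M path_space"
  using lev_component_measurable[OF assms(1)] measurable_component[OF assms(2)] by (rule measurable_adv)

lemma measurable_adv_fixed: "adv r \<in> path_space \<rightarrow>\<^sub>M path_space"
  by (rule measurable_adv[OF measurable_const measurable_ident_sets[OF refl]]) simp

lemma measurable_at_0: "(\<lambda>w. w 0) \<in> path_space \<rightarrow>\<^sub>M borel"
  by (rule measurable_eval_path) simp

text \<open>With \<open>low_fubini\<close> on both sides, only factors with a fixed level and the
  indicator of \<open>L r < H\<close> remain, and these are the subject of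
  \<open>alive_markov\<close>.\<close>

lemma low_markov:
  fixes u :: "nat \<Rightarrow> 'e path \<Rightarrow> real"
  assumes i: "i \<in> I" and um: "\<And>n. n \<in> I - {i} \<Longrightarrow> u n \<in> borel_measurable path_space"
    and ub: "\<And>n z. n \<in> I - {i} \<Longrightarrow> z \<in> space path_space \<Longrightarrow> \<bar>u n z\<bar> \<le> c"
  shows "(\<integral>w. indicator (Elow i) w * (\<Prod>n\<in>I - {i}. u n (adv (lev (w i)) (w n))) \<partial>K x) =
    (\<integral>w. indicator (Elow i) w * (\<Prod>n\<in>I - {i}. \<integral>z. u n z \<partial>P (adv (lev (w i)) (w n) 0)) \<partial>K x)"
proof -
  have "(\<integral>w. indicator (Elow i) w * (\<Prod>n\<in>I - {i}. u n (adv (lev (w i)) (w n))) \<partial>K x) =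
    (\<integral>y. indicator {y. lev y < 1} y *
      (\<Prod>n\<in>I - {i}. \<integral>z. indicator {z. L (lev y) z < H z} z * u n (adv (lev y) z) \<partial>P (x n)) \<partial>P (x i))"
  proof (rule low_fubini[OF i, where v="\<lambda>r n z. u n (adv r z)"])
    fix n assume n: "n \<in> I - {i}"
    show "(\<lambda>w. u n (adv (lev (w i)) (w n))) \<in> borel_measurable PS"
      using adv_component_measurable[OF i, of n] um[OF n] n by (intro measurable_compose[OF _ um[OF n]]) auto
    show "(\<lambda>z. u n (adv r z)) \<in> borel_measurable path_space" for r
      by (rule measurable_compose[OF measurable_adv_fixed um[OF n]])
    show "\<bar>u n (adv r z)\<bar> \<le> c" if "z \<in> space path_space" for r z
      using that by (intro ub n adv_space)
  qed
  also have "\<dots> = (\<integral>y. indicator {y. lev y < 1} y *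
      (\<Prod>n\<in>I - {i}. \<integral>z. indicator {z. L (lev y) z < H z} z * (\<integral>z'. u n z' \<partial>P (adv (lev y) z 0)) \<partial>P (x n)) \<partial>P (x i))"
    using alive_markov[OF um ub] by simp
  also have "\<dots> = (\<integral>w. indicator (Elow i) w * (\<Prod>n\<in>I - {i}. \<integral>z. u n z \<partial>P (adv (lev (w i)) (w n) 0)) \<partial>K x)"
  proof (rule low_fubini[OF i, where v="\<lambda>r n z. \<integral>z'. u n z' \<partial>P (adv r z 0)", symmetric])
    fix n assume n: "n \<in> I - {i}"
    note E = measurable_compose[OF measurable_at_0 measurable_E[OF um[OF n]]]
    show "(\<lambda>w. \<integral>z'. u n z' \<partial>P (adv (lev (w i)) (w n) 0)) \<in> borel_measurable PS"
      using adv_component_measurable[OF i, of n] n by (intro measurable_compose[OF _ E]) auto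
    show "(\<lambda>z. \<integral>z'. u n z' \<partial>P (adv r z 0)) \<in> borel_measurable path_space" for r
      by (rule measurable_compose[OF measurable_adv_fixed E])
    show "\<bar>\<integral>z'. u n z' \<partial>P (adv r z 0)\<bar> \<le> c" for r z
      using n by (intro abs_E_le ub)
  qed
  finally show ?thesis .
qed

abbreviation hx :: "nat \<Rightarrow> nat \<Rightarrow> (nat \<Rightarrow> 'e path) \<Rightarrow> real" where
  "hx i n w \<equiv> h (adv (lev (w i)) (w n) 0)"

lemma hx_measurable: "i \<in> I \<Longrightarrow> n \<in> I \<Longrightarrow> hx i n \<in> borel_measurable PS"
  by (intro measurable_compose[OF adv_component_measurable measurable_compose[OF measurable_at_0 h_measurable]])

lemma pay_component_measurable: "n \<in> I \<Longrightarrow> (\<lambda>w. pay (w n)) \<in> borel_measurable PS"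
  by (intro measurable_compose[OF measurable_component pay_measurable])

text \<open>The payoff of a survivor is that of its part beyond the score of the lowest particle,
  with conditional mean \<open>h\<close> at the entrance point; different survivors are
  conditionally independent. One index in \<open>D\<close> serves the mean, two the second
  moment.\<close>

lemma low_pay:
  assumes i: "i \<in> I" and D: "D \<subseteq> I - {i}"
  shows "(\<integral>w. indicator (Elow i) w * (\<Prod>n\<in>D. pay (w n)) \<partial>K x) =
    (\<integral>w. indicator (Elow i) w * (\<Prod>n\<in>D. hx i n w) \<partial>K x)"
proof -
  define u where "u n = (if n \<in> D then pay else (\<lambda>_. 1))" for n
  have restr: "(\<Prod>n\<in>I - {i}. if n \<in> D then f n else 1) = (\<Prod>n\<in>D. f n)" for f :: "nat \<Rightarrow> real"
    using D by (subst prod.inter_restrict[symmetric]) (auto simp: Int_absorb1)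
  have "(\<integral>w. indicator (Elow i) w * (\<Prod>n\<in>D. pay (w n)) \<partial>K x) =
     (\<integral>w. indicator (Elow i) w * (\<Prod>n\<in>I - {i}. u n (adv (lev (w i)) (w n))) \<partial>K x)"
  proof (rule Bochner_Integration.integral_cong[OF refl])
    fix w
    have "(\<Prod>n\<in>I - {i}. u n (adv (lev (w i)) (w n))) = (\<Prod>n\<in>I - {i}. if n \<in> D then pay (adv (lev (w i)) (w n)) else 1)"
      by (intro prod.cong refl) (simp add: u_def)
    also have "\<dots> = (\<Prod>n\<in>D. pay (adv (lev (w i)) (w n)))" by (rule restr)
    also have "\<dots> = (\<Prod>n\<in>D. pay (w n))" if w: "w \<in> Elow i"
      using D by (intro prod.cong refl pay_adv Elow_alive[OF w] lev_le_1) auto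
    finally show "indicator (Elow i) w * (\<Prod>n\<in>D. pay (w n)) =
        indicator (Elow i) w * (\<Prod>n\<in>I - {i}. u n (adv (lev (w i)) (w n)))"
      by (auto split: split_indicator)
  qed
  also have "\<dots> = (\<integral>w. indicator (Elow i) w * (\<Prod>n\<in>I - {i}. \<integral>z. u n z \<partial>P (adv (lev (w i)) (w n) 0)) \<partial>K x)"
    using pay_le_C by (intro low_markov[OF i, where c="max 1 C"]) (auto simp: u_def le_max_iff_disj)
  also have "\<dots> = (\<integral>w. indicator (Elow i) w * (\<Prod>n\<in>D. hx i n w) \<partial>K x)"
  proof (rule Bochner_Integration.integral_cong[OF refl])
    fix w
    have "(\<integral>z. u n z \<partial>P y) = (if n \<in> D then h y else 1)" for n y
      using prob_space.prob_space[OF prob_P, of y] by (simp add: u_def h_def)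
    then show "indicator (Elow i) w * (\<Prod>n\<in>I - {i}. \<integral>z. u n z \<partial>P (adv (lev (w i)) (w n) 0)) =
       indicator (Elow i) w * (\<Prod>n\<in>D. hx i n w)"
      by (simp add: restr)
  qed
  finally show ?thesis .
qed

end

lemma integral_double_sum:
  fixes f :: "'i \<Rightarrow> 'j \<Rightarrow> 'a \<Rightarrow> real"
  assumes "\<And>n m. n \<in> J \<Longrightarrow> m \<in> T n \<Longrightarrow> integrable M (f n m)"
  shows "(\<integral>w. (\<Sum>n\<in>J. \<Sum>m\<in>T n. f n m w) \<partial>M) = (\<Sum>n\<in>J. \<Sum>m\<in>T n. \<integral>w. f n m w \<partial>M)"
proof -
  have "(\<integral>w. (\<Sum>n\<in>J. \<Sum>m\<in>T n. f n m w) \<partial>M) = (\<Sum>n\<in>J. \<integral>w. (\<Sum>m\<in>T n. f n m w) \<partial>M)"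
    using assms by (intro Bochner_Integration.integral_sum Bochner_Integration.integrable_sum)
  also have "\<dots> = (\<Sum>n\<in>J. \<Sum>m\<in>T n. \<integral>w. f n m w \<partial>M)"
    using assms by (intro sum.cong refl Bochner_Integration.integral_sum)
  finally show ?thesis .
qed

context ams_particles
begin

section \<open>The one-step operator\<close>

lemma st_measurable: "st \<in> PS \<rightarrow>\<^sub>M ES"
  unfolding st_def[abs_def]
  by (intro measurable_restrict measurable_compose[OF measurable_component measurable_at_0])

lemma adv_mn_measurable:
  assumes "n \<in> I" shows "(\<lambda>w. adv (mn w) (w n)) \<in> PS \<rightarrow>\<^sub>M path_space"
  using mn_measurable measurable_component[OF assms] by (rule measurable_adv)

lemma move_measurable: "(\<lambda>p. move (snd p) (fst p)) \<in> PS \<Otimes>\<^sub>M path_space \<rightarrow>\<^sub>M PS"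
  unfolding move_def[abs_def]
proof (rule measurable_restrict)
  fix n assume n: "n \<in> I"
  show "(\<lambda>p. if n = low (fst p) then snd p else adv (mn (fst p)) (fst p n)) \<in> PS \<Otimes>\<^sub>M path_space \<rightarrow>\<^sub>M path_space"
  proof (rule measurable_If)
    show "(\<lambda>p. adv (mn (fst p)) (fst p n)) \<in> PS \<Otimes>\<^sub>M path_space \<rightarrow>\<^sub>M path_space"
      by (rule measurable_compose[OF measurable_fst adv_mn_measurable[OF n]])
    have "(\<lambda>p. low (fst p)) \<in> PS \<Otimes>\<^sub>M path_space \<rightarrow>\<^sub>M count_space UNIV"
      by (rule measurable_compose[OF measurable_fst low_measurable])
    from measurable_sets[OF this, of "{n}"]
    show "{p\<in>space (PS \<Otimes>\<^sub>M path_space). n = low (fst p)} \<in> sets (PS \<Otimes>\<^sub>M path_space)"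
      by (simp add: vimage_def Int_def conj_commute eq_commute)
  qed simp
qed

lemma move_space: "w \<in> space PS \<Longrightarrow> z \<in> space path_space \<Longrightarrow> move z w \<in> space PS"
  using measurable_space[OF move_measurable, of "(w, z)"] by (simp add: space_pair_measure)

lemma move_fixed_measurable: "w \<in> space PS \<Longrightarrow> (\<lambda>z. move z w) \<in> path_space \<rightarrow>\<^sub>M PS"
  using measurable_compose[OF measurable_Pair1' move_measurable, of w] by simp

lemma Pmn_measurable:
  assumes "m \<in> I" shows "(\<lambda>w. P (adv (mn w) (w m) 0)) \<in> PS \<rightarrow>\<^sub>M prob_algebra path_space"
  by (rule measurable_compose[OF measurable_compose[OF adv_mn_measurable[OF assms] measurable_at_0] kernel])

lemma S_measurable:
  assumes F: "F \<in> borel_measurable PS"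
  shows "S F \<in> borel_measurable PS"
proof -
  have low_eq: "{w\<in>space PS. m = low w} \<in> sets PS" for m
    using measurable_sets[OF low_measurable, of "{m}"] by (simp add: vimage_def Int_def conj_commute eq_commute)
  have "(\<lambda>w. if m = low w then 0 else \<integral>z. F (move z w) \<partial>P (adv (mn w) (w m) 0)) \<in> borel_measurable PS"
    if m: "m \<in> I" for m
  proof (rule measurable_If[OF _ _ low_eq])
    show "(\<lambda>w. \<integral>z. F (move z w) \<partial>P (adv (mn w) (w m) 0)) \<in> borel_measurable PS"
    proof (rule measurable_kernel_integral2[OF Pmn_measurable[OF m]])
      show "(\<lambda>(w, z). F (move z w)) \<in> borel_measurable (PS \<Otimes>\<^sub>M path_space)"
        using measurable_compose[OF move_measurable F] by (simp add: split_beta')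
    qed
  qed simp
  then have "(\<lambda>w. (\<Sum>m\<in>I. if m = low w then 0 else \<integral>z. F (move z w) \<partial>P (adv (mn w) (w m) 0)) / (real N - 1)) \<in> borel_measurable PS"
    by (intro borel_measurable_divide borel_measurable_sum borel_measurable_const)
  then show ?thesis
    unfolding S_def[abs_def] by (intro measurable_If) (auto intro!: borel_measurable_less)
qed

lemma S_bound:
  assumes F: "\<And>w. w \<in> space PS \<Longrightarrow> \<bar>F w\<bar> \<le> c" and w: "w \<in> space PS"
  shows "\<bar>S F w\<bar> \<le> c"
proof -
  have c: "0 \<le> c" using F[OF w] by linarith
  have "\<bar>\<Sum>m\<in>I. if m = low w then 0 else \<integral>z. F (move z w) \<partial>P (adv (mn w) (w m) 0)\<bar>
      \<le> (\<Sum>m\<in>I. if m = low w then 0 else c)"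
  proof (rule order_trans[OF sum_abs], rule sum_mono)
    fix m
    show "\<bar>if m = low w then 0 else \<integral>z. F (move z w) \<partial>P (adv (mn w) (w m) 0)\<bar> \<le> (if m = low w then 0 else c)"
      using abs_E_le[of "\<lambda>z. F (move z w)" c] F move_space[OF w] by auto
  qed
  also have "\<dots> = (\<Sum>m\<in>I - {low w}. c)"
    using low_in[of w] by (subst sum.remove[of I "low w"]) (auto intro!: sum.cong)
  also have "\<dots> = (real N - 1) * c" using card_remove[OF low_in[of w]] N2 by (simp add: of_nat_diff)
  finally show ?thesis using N2 c by (auto simp: S_def divide_le_eq mult.commute)
qed

text \<open>A new piece starts almost surely at the branching point, so for functions of the
  starting points the integration over it is trivial and only the average over the copied index
  remains.\<close>

lemma S_start:
  assumes G: "G \<in> borel_measurable ES" and w: "w \<in> space PS"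
  shows "S (\<lambda>w. G (st w)) w = (if mn w < 1 then (\<Sum>m\<in>I - {low w}. G (branch m w)) / (real N - 1) else 0)"
proof -
  have "(\<integral>z. G (st (move z w)) \<partial>P (adv (mn w) (w m) 0)) = G (branch m w)" for m
  proof -
    let ?y = "adv (mn w) (w m) 0"
    have "(\<integral>z. G (st (move z w)) \<partial>P ?y) = (\<integral>z. G (branch m w) \<partial>P ?y)"
    proof (rule integral_cong_AE)
      show "(\<lambda>z. G (st (move z w))) \<in> borel_measurable (P ?y)"
        by (intro measurable_P measurable_compose[OF measurable_compose[OF move_fixed_measurable[OF w] st_measurable] G])
      show "AE z in P ?y. G (st (move z w)) = G (branch m w)"
        using start[of ?y]
      proof eventually_elim
        case (elim z)
        then have "st (move z w) = branch m w"
          by (auto simp: st_def move_def branch_def fun_eq_iff)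
        then show ?case by simp
      qed
    qed simp
    then show ?thesis using prob_space.prob_space[OF prob_P, of ?y] by simp
  qed
  moreover have "(\<Sum>m\<in>I. if m = low w then 0 else f m) = (\<Sum>m\<in>I - {low w}. f m)" for f :: "nat \<Rightarrow> real"
    using low_in[of w] by (subst sum.remove[of I "low w"]) (auto intro!: sum.cong)
  ultimately show ?thesis by (simp add: S_def)
qed

section \<open>Mean and off-diagonal second moment through one step\<close>

definition Hm :: "(nat \<Rightarrow> 'e) \<Rightarrow> real" where "Hm x = (\<Sum>n\<in>I. h (x n)) / N"
text \<open>The off-diagonal sum is written as square minus diagonal, which is easier to update when
  one summand is replaced. The added constant bounds the omitted diagonal.\<close>

definition V :: "(nat \<Rightarrow> 'e) \<Rightarrow> real" where
  "V x = ((\<Sum>n\<in>I. h (x n))\<^sup>2 - (\<Sum>n\<in>I. (h (x n))\<^sup>2)) / (real N)\<^sup>2 + C\<^sup>2 / N"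
definition Gm :: "(nat \<Rightarrow> 'e path) \<Rightarrow> real" where "Gm w = (\<Sum>n\<in>I. pay (w n)) / N"

lemma h_component_measurable: "n \<in> I \<Longrightarrow> (\<lambda>x. h (x n)) \<in> borel_measurable ES"
proof -
  assume "n \<in> I"
  then have "(\<lambda>x. x n) \<in> ES \<rightarrow>\<^sub>M borel" by (rule measurable_component_singleton)
  then show ?thesis using h_measurable by (rule measurable_compose)
qed

lemma Hm_measurable: "Hm \<in> borel_measurable ES"
  unfolding Hm_def[abs_def]
  by (intro borel_measurable_divide borel_measurable_sum borel_measurable_const h_component_measurable)

lemma V_measurable: "V \<in> borel_measurable ES"
  unfolding V_def[abs_def]
  by (intro borel_measurable_divide borel_measurable_sum borel_measurable_const h_component_measurable
      borel_measurable_add borel_measurable_diff borel_measurable_power)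

lemma Gm_measurable: "Gm \<in> borel_measurable PS"
  unfolding Gm_def[abs_def]
  by (intro borel_measurable_divide borel_measurable_sum borel_measurable_const pay_component_measurable)

lemma mean_le:
  assumes "\<And>n. \<bar>f n\<bar> \<le> C" shows "\<bar>(\<Sum>n\<in>I. f n) / real N\<bar> \<le> C"
proof -
  have "\<bar>\<Sum>n\<in>I. f n\<bar> \<le> (\<Sum>n\<in>I. C)"
    by (rule order_trans[OF sum_abs sum_mono]) (rule assms)
  then show ?thesis using N2 by (simp add: abs_divide divide_le_eq mult.commute)
qed

lemma Hm_le: "\<bar>Hm x\<bar> \<le> C" unfolding Hm_def by (rule mean_le) (rule h_le_C)
lemma Gm_le: "\<bar>Gm w\<bar> \<le> C" unfolding Gm_def by (rule mean_le) (rule pay_le_C)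

lemma sum_square_le:
  assumes "\<And>n. \<bar>f n\<bar> \<le> C" shows "(\<Sum>n\<in>I. (f n)\<^sup>2) \<le> N * C\<^sup>2"
proof -
  have "(f n)\<^sup>2 \<le> C\<^sup>2" for n using power_mono[OF assms, of n 2] by simp
  then have "(\<Sum>n\<in>I. (f n)\<^sup>2) \<le> (\<Sum>n\<in>I. C\<^sup>2)" by (intro sum_mono)
  then show ?thesis by simp
qed

lemma quad_le:
  assumes f: "\<And>n. \<bar>f n\<bar> \<le> C"
  shows "\<bar>((\<Sum>n\<in>I. f n)\<^sup>2 - (\<Sum>n\<in>I. (f n)\<^sup>2)) / (real N)\<^sup>2 + C\<^sup>2 / N\<bar> \<le> 3 * C\<^sup>2"
proof -
  have a: "(\<Sum>n\<in>I. f n)\<^sup>2 / (real N)\<^sup>2 \<le> C\<^sup>2" "0 \<le> (\<Sum>n\<in>I. f n)\<^sup>2 / (real N)\<^sup>2"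
    using power_mono[OF mean_le[of f], of 2] f by (auto simp: power_divide)
  have "(\<Sum>n\<in>I. (f n)\<^sup>2) / (real N)\<^sup>2 \<le> N * C\<^sup>2 / (real N)\<^sup>2"
    by (intro divide_right_mono sum_square_le f) simp
  also have "\<dots> = C\<^sup>2 / N" using N2 by (simp add: power2_eq_square)
  finally have b: "(\<Sum>n\<in>I. (f n)\<^sup>2) / (real N)\<^sup>2 \<le> C\<^sup>2 / N" .
  \<comment> \<open>Together with the two preceding bounds, each of the three terms is at most
    \<open>C\<^sup>2\<close>, hence the factor 3; only boundedness matters later.\<close>
  have c: "C\<^sup>2 / N \<le> C\<^sup>2" using N2 by (simp add: divide_le_eq mult_le_cancel_left1)
  have d: "0 \<le> (\<Sum>n\<in>I. (f n)\<^sup>2) / (real N)\<^sup>2" "0 \<le> C\<^sup>2 / N" by (auto intro!: divide_nonneg_nonneg sum_nonneg)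
  show ?thesis unfolding diff_divide_distrib using a b c d by linarith
qed

lemma V_le: "\<bar>V x\<bar> \<le> 3 * C\<^sup>2"
  unfolding V_def by (rule quad_le) (rule h_le_C)

lemma branch_sum:
  assumes i: "i \<in> I" and w: "w \<in> Elow i" and m: "m \<in> I - {i}"
  shows "(\<Sum>n\<in>I. f (h (branch m w n))) = (\<Sum>n\<in>I - {i}. f (hx i n w)) + f (hx i m w)"
proof -
  have lw: "low w = i" "mn w = lev (w i)" using Elow_low[OF w i] by auto
  have "(\<Sum>n\<in>I. f (h (branch m w n))) = f (h (branch m w i)) + (\<Sum>n\<in>I - {i}. f (h (branch m w n)))"
    using i by (intro sum.remove) auto
  moreover have "f (h (branch m w i)) = f (hx i m w)" using i lw by (simp add: branch_def)
  moreover have "(\<Sum>n\<in>I - {i}. f (h (branch m w n))) = (\<Sum>n\<in>I - {i}. f (hx i n w))"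
    using lw by (intro sum.cong refl) (simp add: branch_def)
  ultimately show ?thesis by (simp add: add.commute)
qed

lemma pay_Elow: "w \<in> Elow i \<Longrightarrow> pay (w i) = 0"
  by (rule pay_dead) (simp add: Elow_def)

lemma sum_pay_Elow:
  assumes i: "i \<in> I" and w: "w \<in> Elow i" and f: "f 0 = (0::real)"
  shows "(\<Sum>n\<in>I. f (pay (w n))) = (\<Sum>n\<in>I - {i}. f (pay (w n)))"
  using i by (subst sum.remove[of I i]) (auto simp: pay_Elow[OF w] f)

lemma hx_le: "\<bar>hx i n w\<bar> \<le> C" by (rule h_le_C)

lemma integrable_low:
  fixes f :: "_ \<Rightarrow> real"
  assumes i: "i \<in> I" and f: "f \<in> borel_measurable PS" "\<And>w. \<bar>f w\<bar> \<le> c"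
  shows "integrable (K x) (\<lambda>w. indicator (Elow i) w * f w)"
proof (rule integrable_K)
  show "(\<lambda>w. indicator (Elow i) w * f w) \<in> borel_measurable PS"
    using Elow_sets[OF i] f(1) by (intro borel_measurable_times borel_measurable_indicator)
  show "\<bar>indicator (Elow i) w * f w\<bar> \<le> c" for w
    using f(2)[of w] by (auto split: split_indicator)
qed

lemma stopped_measurable: "(indicator {w. 1 \<le> mn w} :: _ \<Rightarrow> real) \<in> borel_measurable PS"
proof -
  have "{w\<in>space PS. 1 \<le> mn w} \<in> sets PS" using mn_measurable by (intro borel_measurable_le) auto
  then show ?thesis by (subst borel_measurable_indicator_iff) (simp add: Int_def conj_commute)
qed

lemma integrable_stopped:
  fixes f :: "_ \<Rightarrow> real"
  assumes f: "f \<in> borel_measurable PS" "\<And>w. \<bar>f w\<bar> \<le> c"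
  shows "integrable (K x) (\<lambda>w. indicator {w. 1 \<le> mn w} w * f w)"
proof (rule integrable_K)
  show "(\<lambda>w. indicator {w. 1 \<le> mn w} w * f w) \<in> borel_measurable PS"
    using stopped_measurable f(1) by (intro borel_measurable_times)
  show "\<bar>indicator {w. 1 \<le> mn w} w * f w\<bar> \<le> c" for w
    using f(2)[of w] by (auto split: split_indicator)
qed

lemma AE_partition:
  fixes f :: "_ \<Rightarrow> real"
  assumes x: "levels x"
  shows "AE w in K x. f w = indicator {w. 1 \<le> mn w} w * f w + (\<Sum>i\<in>I. indicator (Elow i) w * f w :: real)"
  using AE_K_nice[OF x] AE_K_space
proof eventually_elim
  case (elim w)
  then show ?case using sum_Elow[of w "\<lambda>_. f w"] by (auto split: split_indicator)
qed

lemma integral_partition: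
  fixes f :: "_ \<Rightarrow> real"
  assumes x: "levels x" and f: "f \<in> borel_measurable PS" "\<And>w. \<bar>f w\<bar> \<le> c"
  shows "(\<integral>w. f w \<partial>K x) = (\<integral>w. indicator {w. 1 \<le> mn w} w * f w \<partial>K x) +
    (\<Sum>i\<in>I. \<integral>w. indicator (Elow i) w * f w \<partial>K x)"
proof -
  have "(\<integral>w. f w \<partial>K x) = (\<integral>w. indicator {w. 1 \<le> mn w} w * f w + (\<Sum>i\<in>I. indicator (Elow i) w * f w) \<partial>K x)"
  proof (rule integral_cong_AE)
    show "f \<in> borel_measurable (K x)" using f(1) by (rule measurable_K)
    show "(\<lambda>w. indicator {w. 1 \<le> mn w} w * f w + (\<Sum>i\<in>I. indicator (Elow i) w * f w)) \<in> borel_measurable (K x)"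
      by (intro measurable_K borel_measurable_add borel_measurable_times borel_measurable_sum
        borel_measurable_indicator stopped_measurable Elow_sets f(1))
  qed (rule AE_partition[OF x])
  also have "\<dots> = (\<integral>w. indicator {w. 1 \<le> mn w} w * f w \<partial>K x) + (\<integral>w. (\<Sum>i\<in>I. indicator (Elow i) w * f w) \<partial>K x)"
    using f by (intro Bochner_Integration.integral_add integrable_stopped Bochner_Integration.integrable_sum integrable_low)
  also have "(\<integral>w. (\<Sum>i\<in>I. indicator (Elow i) w * f w) \<partial>K x) = (\<Sum>i\<in>I. \<integral>w. indicator (Elow i) w * f w \<partial>K x)"
    using f by (intro Bochner_Integration.integral_sum integrable_low)
  finally show ?thesis .
qed

text \<open>The off-diagonal sum of the payoffs, before normalisation.\<close>

definition Q :: "(nat \<Rightarrow> 'e path) \<Rightarrow> real" where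
  "Q w = (\<Sum>n\<in>I. pay (w n))\<^sup>2 - (\<Sum>n\<in>I. (pay (w n))\<^sup>2)"

lemma Q_measurable: "Q \<in> borel_measurable PS"
  unfolding Q_def[abs_def]
  by (intro borel_measurable_diff borel_measurable_power borel_measurable_sum pay_component_measurable)

definition obs :: "((nat \<Rightarrow> 'e path) \<Rightarrow> real) set" where
  "obs = {F. F \<in> borel_measurable PS \<and> (\<exists>c. \<forall>w\<in>space PS. \<bar>F w\<bar> \<le> c)}"

lemma obsI: "F \<in> borel_measurable PS \<Longrightarrow> (\<And>w. w \<in> space PS \<Longrightarrow> \<bar>F w\<bar> \<le> c) \<Longrightarrow> F \<in> obs"
  unfolding obs_def by blast

lemma obs_measurable: "F \<in> obs \<Longrightarrow> F \<in> borel_measurable PS"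
  by (simp add: obs_def)

lemma obs_bound:
  assumes "F \<in> obs"
  obtains c where "0 \<le> c" "\<And>w. w \<in> space PS \<Longrightarrow> \<bar>F w\<bar> \<le> c"
proof -
  obtain c where c: "\<forall>w\<in>space PS. \<bar>F w\<bar> \<le> c" using assms unfolding obs_def by blast
  show thesis by (rule that[of "\<bar>c\<bar>"]) (use c in \<open>auto intro: order_trans\<close>)
qed

lemma integrable_PiM:
  assumes R: "\<And>n. prob_space (R n)" "\<And>n. sets (R n) = sets path_space" and F: "F \<in> obs"
  shows "integrable (PiM I R) F"
proof -
  interpret prob_space "PiM I R" by (rule prob_space_PiM[OF R(1)])
  have s: "sets (PiM I R) = sets PS" by (rule sets_PiM_cong) (auto simp: R)
  obtain c where c: "\<And>w. w \<in> space PS \<Longrightarrow> \<bar>F w\<bar> \<le> c" using obs_bound[OF F] by blast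
  show ?thesis
    using obs_measurable[OF F] c sets_eq_imp_space_eq[OF s]
    by (intro integrable_bounded[where c=c]) (simp_all add: measurable_cong_sets[OF s refl])
qed

lemma obs_pay: "n \<in> I \<Longrightarrow> (\<lambda>w. pay (w n)) \<in> obs"
  by (rule obsI[OF pay_component_measurable pay_le_C])

lemma obs_pay_pair: "n \<in> I \<Longrightarrow> m \<in> I \<Longrightarrow> (\<lambda>w. pay (w n) * pay (w m)) \<in> obs"
  by (rule obsI[where c="C * C", OF borel_measurable_times[OF pay_component_measurable pay_component_measurable]])
    (auto simp: abs_mult pay_le_C C_nonneg intro!: mult_mono)

lemma integral_Gm_PiM:
  assumes R: "\<And>n. prob_space (R n)" "\<And>n. sets (R n) = sets path_space"
  shows "(\<integral>w. Gm w \<partial>PiM I R) = (\<Sum>n\<in>I. \<integral>w. pay w \<partial>R n) / N"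
proof -
  have m: "pay \<in> borel_measurable (R n)" for n by (simp add: measurable_cong_sets[OF R(2) refl] pay_measurable)
  have "(\<integral>w. Gm w \<partial>PiM I R) = (\<Sum>n\<in>I. \<integral>w. pay (w n) \<partial>PiM I R) / N"
    unfolding Gm_def integral_divide_zero
    by (intro arg_cong2[where f="(/)"] refl Bochner_Integration.integral_sum integrable_PiM R obs_pay)
  also have "\<dots> = (\<Sum>n\<in>I. \<integral>w. pay w \<partial>R n) / N"
    by (intro arg_cong2[where f="(/)"] sum.cong refl PiM_integral_single[where c=C] R m pay_le_C I_facts(1))
  finally show ?thesis .
qed

text \<open>Without the diagonal only products over two different indices occur, and independence
  factorises each of them exactly.\<close>

lemma integral_Q_PiM:
  assumes R: "\<And>n. prob_space (R n)" "\<And>n. sets (R n) = sets path_space"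
  shows "(\<integral>w. Q w \<partial>PiM I R) = (\<Sum>n\<in>I. \<integral>w. pay w \<partial>R n)\<^sup>2 - (\<Sum>n\<in>I. (\<integral>w. pay w \<partial>R n)\<^sup>2)"
proof -
  have m: "pay \<in> borel_measurable (R n)" for n by (simp add: measurable_cong_sets[OF R(2) refl] pay_measurable)
  have "(\<integral>w. Q w \<partial>PiM I R) = (\<integral>w. (\<Sum>n\<in>I. \<Sum>m\<in>I - {n}. pay (w n) * pay (w m)) \<partial>PiM I R)"
    unfolding Q_def by (subst sum_square_offdiag) simp_all
  also have "\<dots> = (\<Sum>n\<in>I. \<Sum>m\<in>I - {n}. \<integral>w. pay (w n) * pay (w m) \<partial>PiM I R)"
    by (intro integral_double_sum integrable_PiM R obs_pay_pair) auto
  also have "\<dots> = (\<Sum>n\<in>I. \<Sum>m\<in>I - {n}. (\<integral>w. pay w \<partial>R n) * (\<integral>w. pay w \<partial>R m))"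
    by (intro sum.cong refl PiM_integral_pair[where c=C] R m pay_le_C I_facts(1)) auto
  finally show ?thesis by (subst sum_square_offdiag) simp_all
qed

lemma integral_Gm: "(\<integral>w. Gm w \<partial>K x) = Hm x"
  unfolding K_def Hm_def h_def by (rule integral_Gm_PiM[OF prob_P sets_P])

lemma integral_Q: "(\<integral>w. Q w \<partial>K x) = (\<Sum>n\<in>I. h (x n))\<^sup>2 - (\<Sum>n\<in>I. (h (x n))\<^sup>2)"
  unfolding K_def h_def by (rule integral_Q_PiM[OF prob_P sets_P])

text \<open>Between two branchings the mean value \<open>Hm\<close> is a martingale, and the selection step
  compensates the factor \<open>1 - 1 / N\<close>.\<close>

lemma mean_step:
  assumes x: "levels x"
  shows "Hm x = (\<integral>w. indicator {w. 1 \<le> mn w} w * Gm w \<partial>K x) +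
    (1 - 1 / real N) * (\<integral>w. S (\<lambda>w. Hm (st w)) w \<partial>K x)"
proof -
  \<comment> \<open>On \<open>Elow i\<close> the branching duplicates one survivor; averaged over
    the choice and multiplied by \<open>1 - 1/N\<close>, the result is the survivors' sum by
    \<open>selection_mean\<close>.\<close>
  have A: "(1 - 1 / real N) * S (\<lambda>w. Hm (st w)) w = (\<Sum>n\<in>I - {i}. hx i n w) / N"
    if i: "i \<in> I" and w: "w \<in> Elow i" for i w
  proof -
    have lw: "low w = i" "mn w < 1" "w \<in> space PS" using Elow_low[OF w i] w by (auto simp: Elow_def)
    have "(\<Sum>m\<in>I - {i}. Hm (branch m w)) = (\<Sum>m\<in>I - {i}. ((\<Sum>n\<in>I - {i}. hx i n w) + hx i m w) / N)"
      unfolding Hm_def using branch_sum[OF i w, of _ "\<lambda>a. a"] by (intro sum.cong refl) simp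
    then show ?thesis
      using S_start[OF Hm_measurable lw(3)] lw selection_mean[of "I - {i}" N "\<lambda>n. hx i n w"] card_remove[OF i] N2
      by simp
  qed
  have B: "(1 - 1 / real N) * S (\<lambda>w. Hm (st w)) w = 0" if "1 \<le> mn w" for w
    using that by (simp add: S_def)
  have Sm: "(\<lambda>w. (1 - 1 / real N) * S (\<lambda>w. Hm (st w)) w) \<in> borel_measurable PS"
    by (intro borel_measurable_times borel_measurable_const S_measurable
        measurable_compose[OF st_measurable Hm_measurable])
  have low: "(\<integral>w. indicator (Elow i) w * ((1 - 1 / real N) * S (\<lambda>w. Hm (st w)) w) \<partial>K x) =
      (\<integral>w. indicator (Elow i) w * Gm w \<partial>K x)" if i: "i \<in> I" for i
  proof -
    have "(\<integral>w. indicator (Elow i) w * ((1 - 1 / real N) * S (\<lambda>w. Hm (st w)) w) \<partial>K x) =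
       (\<integral>w. (\<Sum>n\<in>I - {i}. indicator (Elow i) w * hx i n w) / N \<partial>K x)"
      by (intro Bochner_Integration.integral_cong refl, rename_tac w, case_tac "w \<in> Elow i") (simp_all add: A[OF i])
    also have "\<dots> = (\<Sum>n\<in>I - {i}. \<integral>w. indicator (Elow i) w * hx i n w \<partial>K x) / N"
      using i by (simp only: integral_divide_zero)
        (intro arg_cong2[where f="(/)"] refl Bochner_Integration.integral_sum integrable_low[where c=C] hx_measurable hx_le, auto)
    \<comment> \<open>Strong Markov property for one survivor at a time.\<close>
    also have "\<dots> = (\<Sum>n\<in>I - {i}. \<integral>w. indicator (Elow i) w * pay (w n) \<partial>K x) / N"
      using low_pay[OF i, of "{n}" x for n] by (intro arg_cong2[where f="(/)"] sum.cong refl) simp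
    also have "\<dots> = (\<integral>w. (\<Sum>n\<in>I - {i}. indicator (Elow i) w * pay (w n)) / N \<partial>K x)"
      using i by (simp only: integral_divide_zero)
        (intro arg_cong2[where f="(/)"] refl Bochner_Integration.integral_sum[symmetric] integrable_low[where c=C]
          pay_component_measurable pay_le_C, auto)
    \<comment> \<open>The lowest particle pays 0, so the sum over the survivors is the sum over all
      particles.\<close>
    also have "\<dots> = (\<integral>w. indicator (Elow i) w * Gm w \<partial>K x)"
      by (intro Bochner_Integration.integral_cong refl, rename_tac w, case_tac "w \<in> Elow i")
        (simp_all add: Gm_def sum_pay_Elow[OF i, of _ "\<lambda>a. a"])
    finally show ?thesis .
  qed
  have "(1 - 1 / real N) * (\<integral>w. S (\<lambda>w. Hm (st w)) w \<partial>K x) = (\<integral>w. (1 - 1 / real N) * S (\<lambda>w. Hm (st w)) w \<partial>K x)"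
    by simp
  \<comment> \<open>The factor \<open>indicator (space PS)\<close> changes no integral over
    \<open>K x\<close>; with it the bound asked for by \<open>integral_partition\<close> holds for
    all arguments.\<close>
  also have "\<dots> = (\<integral>w. indicator (space PS) w * ((1 - 1 / real N) * S (\<lambda>w. Hm (st w)) w) \<partial>K x)"
    by (intro Bochner_Integration.integral_cong) auto
  also have "\<dots> = (\<integral>w. indicator {w. 1 \<le> mn w} w * (indicator (space PS) w * ((1 - 1 / real N) * S (\<lambda>w. Hm (st w)) w)) \<partial>K x) +
      (\<Sum>i\<in>I. \<integral>w. indicator (Elow i) w * (indicator (space PS) w * ((1 - 1 / real N) * S (\<lambda>w. Hm (st w)) w)) \<partial>K x)"
  proof (rule integral_partition[OF x])
    show "(\<lambda>w. indicator (space PS) w * ((1 - 1 / real N) * S (\<lambda>w. Hm (st w)) w)) \<in> borel_measurable PS"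
      by (intro borel_measurable_times[OF _ Sm] borel_measurable_indicator sets.top)
    show "\<bar>indicator (space PS) w * ((1 - 1 / real N) * S (\<lambda>w. Hm (st w)) w)\<bar> \<le> C" for w
    proof (cases "w \<in> space PS")
      case True
      then have "\<bar>S (\<lambda>w. Hm (st w)) w\<bar> \<le> C" using Hm_le by (intro S_bound)
      moreover have "0 \<le> 1 - 1 / real N" "1 - 1 / real N \<le> 1" using N2 by auto
      ultimately have "\<bar>1 - 1 / real N\<bar> * \<bar>S (\<lambda>w. Hm (st w)) w\<bar> \<le> 1 * C" by (intro mult_mono) auto
      then show ?thesis using True by (simp add: abs_mult)
    qed (simp add: C_nonneg)
  qed
  also have "\<dots> = (\<Sum>i\<in>I. \<integral>w. indicator (Elow i) w * Gm w \<partial>K x)"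
  proof -
    have "(\<integral>w. indicator {w. 1 \<le> mn w} w * (indicator (space PS) w * ((1 - 1 / real N) * S (\<lambda>w. Hm (st w)) w)) \<partial>K x) = (\<integral>w. 0 \<partial>K x)"
      using B by (intro Bochner_Integration.integral_cong refl) (auto split: split_indicator)
    moreover have "(\<integral>w. indicator (Elow i) w * (indicator (space PS) w * ((1 - 1 / real N) * S (\<lambda>w. Hm (st w)) w)) \<partial>K x)
       = (\<integral>w. indicator (Elow i) w * Gm w \<partial>K x)" if "i \<in> I" for i
      unfolding low[OF that, symmetric] by (intro Bochner_Integration.integral_cong) auto
    ultimately show ?thesis by simp
  qed
  finally have "(\<integral>w. indicator {w. 1 \<le> mn w} w * Gm w \<partial>K x) + (1 - 1 / real N) * (\<integral>w. S (\<lambda>w. Hm (st w)) w \<partial>K x)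
     = (\<integral>w. Gm w \<partial>K x)"
    using integral_partition[OF x Gm_measurable Gm_le] by simp
  also have "\<dots> = Hm x" by (rule integral_Gm)
  finally show ?thesis by simp
qed

text \<open>After subtraction of the diagonal every term is a product over two different survivors,
  to which \<open>low_pay\<close> applies.\<close>

lemma low_Q:
  assumes i: "i \<in> I"
  shows "(\<integral>w. indicator (Elow i) w * ((\<Sum>n\<in>I - {i}. hx i n w)\<^sup>2 - (\<Sum>n\<in>I - {i}. (hx i n w)\<^sup>2)) \<partial>K x) =
    (\<integral>w. indicator (Elow i) w * Q w \<partial>K x)"
proof -
  have b: "\<bar>a * b\<bar> \<le> C * C" if "\<bar>a\<bar> \<le> C" "\<bar>b\<bar> \<le> C" for a b
    unfolding abs_mult using that C_nonneg by (intro mult_mono) auto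
  have "(\<integral>w. indicator (Elow i) w * ((\<Sum>n\<in>I - {i}. hx i n w)\<^sup>2 - (\<Sum>n\<in>I - {i}. (hx i n w)\<^sup>2)) \<partial>K x) =
    (\<integral>w. (\<Sum>n\<in>I - {i}. \<Sum>m\<in>I - {i} - {n}. indicator (Elow i) w * (hx i n w * hx i m w)) \<partial>K x)"
    by (subst sum_square_offdiag) (simp_all add: sum_distrib_left)
  also have "\<dots> = (\<Sum>n\<in>I - {i}. \<Sum>m\<in>I - {i} - {n}. \<integral>w. indicator (Elow i) w * (hx i n w * hx i m w) \<partial>K x)"
    using i by (intro integral_double_sum integrable_low[where c="C * C"] borel_measurable_times hx_measurable b hx_le) auto
  also have "\<dots> = (\<Sum>n\<in>I - {i}. \<Sum>m\<in>I - {i} - {n}. \<integral>w. indicator (Elow i) w * (pay (w n) * pay (w m)) \<partial>K x)"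
  proof (intro sum.cong refl)
    fix n m assume nm: "n \<in> I - {i}" "m \<in> I - {i} - {n}"
    then show "(\<integral>w. indicator (Elow i) w * (hx i n w * hx i m w) \<partial>K x) = (\<integral>w. indicator (Elow i) w * (pay (w n) * pay (w m)) \<partial>K x)"
      using low_pay[OF i, of "{n, m}" x] by auto
  qed
  also have "\<dots> = (\<integral>w. (\<Sum>n\<in>I - {i}. \<Sum>m\<in>I - {i} - {n}. indicator (Elow i) w * (pay (w n) * pay (w m))) \<partial>K x)"
    using i by (intro integral_double_sum[symmetric] integrable_low[where c="C * C"] borel_measurable_times
        pay_component_measurable b pay_le_C) auto
  also have "\<dots> = (\<integral>w. indicator (Elow i) w * Q w \<partial>K x)"
  proof (intro Bochner_Integration.integral_cong refl)
    fix w
    show "(\<Sum>n\<in>I - {i}. \<Sum>m\<in>I - {i} - {n}. indicator (Elow i) w * (pay (w n) * pay (w m))) = indicator (Elow i) w * Q w"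
    proof (cases "w \<in> Elow i")
      case True
      show ?thesis
        using sum_square_offdiag[of "I - {i}" "\<lambda>n. pay (w n)"] sum_pay_Elow[OF i True, of "\<lambda>a. a"]
          sum_pay_Elow[OF i True, of "\<lambda>a. a\<^sup>2"] True by (simp add: Q_def)
    qed simp
  qed
  finally show ?thesis .
qed

lemma S_partition:
  assumes x: "levels x" and F: "F \<in> borel_measurable PS" "\<And>w. w \<in> space PS \<Longrightarrow> \<bar>F w\<bar> \<le> c" and c: "0 \<le> c"
  shows "(\<integral>w. S F w \<partial>K x) = (\<Sum>i\<in>I. \<integral>w. indicator (Elow i) w * S F w \<partial>K x)"
proof -
  define f where "f w = indicator (space PS) w * S F w" for w
  have "(\<integral>w. S F w \<partial>K x) = (\<integral>w. f w \<partial>K x)"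
    unfolding f_def by (intro Bochner_Integration.integral_cong) auto
  also have "\<dots> = (\<integral>w. indicator {w. 1 \<le> mn w} w * f w \<partial>K x) + (\<Sum>i\<in>I. \<integral>w. indicator (Elow i) w * f w \<partial>K x)"
  proof (rule integral_partition[OF x])
    show "f \<in> borel_measurable PS"
      unfolding f_def[abs_def] by (intro borel_measurable_times S_measurable F borel_measurable_indicator sets.top)
    show "\<bar>f w\<bar> \<le> c" for w
      using S_bound[of F c w] F(2) c by (cases "w \<in> space PS") (auto simp: f_def)
  qed
  also have "(\<integral>w. indicator {w. 1 \<le> mn w} w * f w \<partial>K x) = (\<integral>w. 0 \<partial>K x)"
    by (intro Bochner_Integration.integral_cong refl) (auto simp: f_def S_def split: split_indicator)
  also have "(\<Sum>i\<in>I. \<integral>w. indicator (Elow i) w * f w \<partial>K x) = (\<Sum>i\<in>I. \<integral>w. indicator (Elow i) w * S F w \<partial>K x)"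
    unfolding f_def by (intro sum.cong refl Bochner_Integration.integral_cong) auto
  finally show ?thesis by simp
qed

text \<open>On \<open>Elow i\<close> the selection step is bounded by the survivors' functional
  \<open>R i\<close>, whose integral there equals that of \<open>QV\<close> by the strong Markov
  property. On stopped configurations the full square is at most \<open>QV\<close>, because its
  diagonal is at most \<open>C^2/N\<close>. Added up, the integral of \<open>QV\<close> is
  \<open>V x\<close>.\<close>

lemma square_step:
  assumes x: "levels x"
  shows "(\<integral>w. indicator {w. 1 \<le> mn w} w * (Gm w)\<^sup>2 \<partial>K x) +
    (1 - 1 / real N)\<^sup>2 * (\<integral>w. S (\<lambda>w. V (st w)) w \<partial>K x) \<le> V x"
proof -
  \<comment> \<open>The same expression as \<open>V\<close>, with the payoffs in place of their
    conditional means.\<close>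
  define QV where "QV w = Q w / (real N)\<^sup>2 + C\<^sup>2 / N" for w
  \<comment> \<open>The same expression for the survivors at their entrance points, without the
    discarded particle.\<close>
  define R where "R i w = ((\<Sum>n\<in>I - {i}. hx i n w)\<^sup>2 - (\<Sum>n\<in>I - {i}. (hx i n w)\<^sup>2)) / (real N)\<^sup>2 + C\<^sup>2 / N" for i w
  have QVm: "QV \<in> borel_measurable PS"
    unfolding QV_def[abs_def] by (intro borel_measurable_add borel_measurable_divide Q_measurable borel_measurable_const)
  have QVb: "\<bar>QV w\<bar> \<le> 3 * C\<^sup>2" for w
    unfolding QV_def Q_def by (rule quad_le) (rule pay_le_C)
  have Rm: "R i \<in> borel_measurable PS" if "i \<in> I" for i
    unfolding R_def[abs_def] using that
    by (intro borel_measurable_add borel_measurable_divide borel_measurable_const borel_measurable_diff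
        borel_measurable_power borel_measurable_sum hx_measurable) auto
  have Rb: "\<bar>R i w\<bar> \<le> 3 * C\<^sup>2" if i: "i \<in> I" for i w
  proof -
    let ?f = "\<lambda>n. if n = i then 0 else hx i n w"
    have "(\<Sum>n\<in>I - {i}. hx i n w) = (\<Sum>n\<in>I. ?f n)" "(\<Sum>n\<in>I - {i}. (hx i n w)\<^sup>2) = (\<Sum>n\<in>I. (?f n)\<^sup>2)"
      by (intro sum.mono_neutral_cong_left; auto)+
    then show ?thesis unfolding R_def using quad_le[of ?f] hx_le C_nonneg by simp
  qed
  have Vm: "(\<lambda>w. V (st w)) \<in> borel_measurable PS"
    by (rule measurable_compose[OF st_measurable V_measurable])
  have b: "\<bar>V (st w)\<bar> \<le> 3 * C\<^sup>2" for w by (rule V_le)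
  have SVi: "integrable (K x) (\<lambda>w. indicator (Elow i) w * S (\<lambda>w. V (st w)) w)" if i: "i \<in> I" for i
  proof (rule integrable_K)
    show "(\<lambda>w. indicator (Elow i) w * S (\<lambda>w. V (st w)) w) \<in> borel_measurable PS"
      by (intro borel_measurable_times borel_measurable_indicator Elow_sets[OF i] S_measurable Vm)
    show "\<bar>indicator (Elow i) w * S (\<lambda>w. V (st w)) w\<bar> \<le> 3 * C\<^sup>2" if "w \<in> space PS" for w
      using S_bound[OF b that] by (auto split: split_indicator)
  qed
  have le: "(1 - 1 / real N)\<^sup>2 * S (\<lambda>w. V (st w)) w \<le> R i w" if i: "i \<in> I" and w: "w \<in> Elow i" for i w
  proof -
    have lw: "low w = i" "mn w < 1" "w \<in> space PS" using Elow_low[OF w i] w by (auto simp: Elow_def)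
    have "(\<Sum>m\<in>I - {i}. V (branch m w)) = (\<Sum>m\<in>I - {i}.
       (((\<Sum>n\<in>I - {i}. hx i n w) + hx i m w)\<^sup>2 - ((\<Sum>n\<in>I - {i}. (hx i n w)\<^sup>2) + (hx i m w)\<^sup>2)) / (real N)\<^sup>2 + C\<^sup>2 / N)"
      unfolding V_def using branch_sum[OF i w, of _ "\<lambda>a. a"] branch_sum[OF i w, of _ "\<lambda>a. a\<^sup>2"]
      by (intro sum.cong refl) simp
    then show ?thesis
      unfolding R_def S_start[OF V_measurable lw(3)] using lw card_remove[OF i] N2
        selection_square[of "I - {i}" N "\<lambda>n. hx i n w" C] hx_le by simp
  qed
  have 1: "(1 - 1 / real N)\<^sup>2 * (\<integral>w. indicator (Elow i) w * S (\<lambda>w. V (st w)) w \<partial>K x) \<le>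
      (\<integral>w. indicator (Elow i) w * QV w \<partial>K x)" if i: "i \<in> I" for i
  proof -
    let ?J = "\<lambda>w. (\<Sum>n\<in>I - {i}. hx i n w)\<^sup>2 - (\<Sum>n\<in>I - {i}. (hx i n w)\<^sup>2)"
    have "(1 - 1 / real N)\<^sup>2 * (\<integral>w. indicator (Elow i) w * S (\<lambda>w. V (st w)) w \<partial>K x) =
        (\<integral>w. (1 - 1 / real N)\<^sup>2 * (indicator (Elow i) w * S (\<lambda>w. V (st w)) w) \<partial>K x)" by simp
    also have "\<dots> \<le> (\<integral>w. indicator (Elow i) w * R i w \<partial>K x)"
    proof (rule integral_mono)
      show "(1 - 1 / real N)\<^sup>2 * (indicator (Elow i) w * S (\<lambda>w. V (st w)) w) \<le> indicator (Elow i) w * R i w" for w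
        using le[OF i, of w] by (cases "w \<in> Elow i") simp_all
    qed (use SVi[OF i] integrable_low[OF i Rm[OF i] Rb[OF i]] in \<open>auto intro: integrable_mult_right\<close>)
    also have "\<dots> = (\<integral>w. indicator (Elow i) w * QV w \<partial>K x)"
    proof -
      interpret prob_space "K x" by (rule prob_K)
      have Es: "Elow i \<in> sets (K x)" using Elow_sets[OF i] by simp
      have J: "integrable (K x) (\<lambda>w. indicator (Elow i) w * ?J w)"
      proof -
        have "integrable (K x) (\<lambda>w. (real N)\<^sup>2 * (indicator (Elow i) w * R i w) - indicator (Elow i) w * (real N * C\<^sup>2))"
          using Es by (intro Bochner_Integration.integrable_diff integrable_mult_right integrable_low[OF i Rm[OF i] Rb[OF i]]
             integrable_mult_left integrable_real_indicator) (auto simp: emeasure_eq_measure)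
        also have "(\<lambda>w. (real N)\<^sup>2 * (indicator (Elow i) w * R i w) - indicator (Elow i) w * (real N * C\<^sup>2)) =
            (\<lambda>w. indicator (Elow i) w * ?J w)"
          using N2 by (auto simp: R_def fun_eq_iff power2_eq_square field_simps split: split_indicator)
        finally show ?thesis .
      qed
      have Qi: "integrable (K x) (\<lambda>w. indicator (Elow i) w * Q w)"
      proof -
        have "integrable (K x) (\<lambda>w. (real N)\<^sup>2 * (indicator (Elow i) w * QV w) - indicator (Elow i) w * (real N * C\<^sup>2))"
          using Es by (intro Bochner_Integration.integrable_diff integrable_mult_right integrable_low[OF i QVm QVb]
             integrable_mult_left integrable_real_indicator) (auto simp: emeasure_eq_measure)
        also have "(\<lambda>w. (real N)\<^sup>2 * (indicator (Elow i) w * QV w) - indicator (Elow i) w * (real N * C\<^sup>2)) =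
            (\<lambda>w. indicator (Elow i) w * Q w)"
          using N2 by (auto simp: QV_def fun_eq_iff power2_eq_square field_simps split: split_indicator)
        finally show ?thesis .
      qed
      have Ei: "integrable (K x) (\<lambda>w. indicator (Elow i) w * (C\<^sup>2 / real N))"
        using Es by (intro integrable_mult_left integrable_real_indicator) (auto simp: emeasure_eq_measure)
      have "(\<integral>w. indicator (Elow i) w * R i w \<partial>K x) =
          (\<integral>w. indicator (Elow i) w * ?J w / (real N)\<^sup>2 + indicator (Elow i) w * (C\<^sup>2 / real N) \<partial>K x)"
        unfolding R_def by (intro Bochner_Integration.integral_cong refl) (simp add: distrib_left)
      also have "\<dots> = (\<integral>w. indicator (Elow i) w * ?J w \<partial>K x) / (real N)\<^sup>2 + (\<integral>w. indicator (Elow i) w * (C\<^sup>2 / real N) \<partial>K x)"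
        using J Ei by (simp only: Bochner_Integration.integral_add[OF integrable_divide_zero] integral_divide_zero)
      also have "\<dots> = (\<integral>w. indicator (Elow i) w * Q w \<partial>K x) / (real N)\<^sup>2 + (\<integral>w. indicator (Elow i) w * (C\<^sup>2 / real N) \<partial>K x)"
        by (simp only: low_Q[OF i])
      also have "\<dots> = (\<integral>w. indicator (Elow i) w * Q w / (real N)\<^sup>2 + indicator (Elow i) w * (C\<^sup>2 / real N) \<partial>K x)"
        using Qi Ei by (simp only: Bochner_Integration.integral_add[OF integrable_divide_zero] integral_divide_zero)
      also have "\<dots> = (\<integral>w. indicator (Elow i) w * QV w \<partial>K x)"
        unfolding QV_def by (intro Bochner_Integration.integral_cong refl) (simp add: distrib_left)
      finally show ?thesis .
    qed
    finally show ?thesis .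
  qed
  have "(1 - 1 / real N)\<^sup>2 * (\<integral>w. S (\<lambda>w. V (st w)) w \<partial>K x) =
      (\<Sum>i\<in>I. (1 - 1 / real N)\<^sup>2 * (\<integral>w. indicator (Elow i) w * S (\<lambda>w. V (st w)) w \<partial>K x))"
    using b by (subst S_partition[OF x Vm, of "3 * C\<^sup>2"]) (auto simp: sum_distrib_left)
  also have "\<dots> \<le> (\<Sum>i\<in>I. \<integral>w. indicator (Elow i) w * QV w \<partial>K x)"
    by (intro sum_mono 1)
  finally have A: "(1 - 1 / real N)\<^sup>2 * (\<integral>w. S (\<lambda>w. V (st w)) w \<partial>K x) \<le> (\<Sum>i\<in>I. \<integral>w. indicator (Elow i) w * QV w \<partial>K x)" .
  have B: "(\<integral>w. indicator {w. 1 \<le> mn w} w * (Gm w)\<^sup>2 \<partial>K x) \<le> (\<integral>w. indicator {w. 1 \<le> mn w} w * QV w \<partial>K x)"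
  proof (rule integral_mono)
    show "integrable (K x) (\<lambda>w. indicator {w. 1 \<le> mn w} w * (Gm w)\<^sup>2)"
      using power_mono[OF Gm_le abs_ge_zero, of _ 2]
      by (intro integrable_stopped[where c="C\<^sup>2"] borel_measurable_power Gm_measurable) auto
    show "integrable (K x) (\<lambda>w. indicator {w. 1 \<le> mn w} w * QV w)"
      by (rule integrable_stopped[OF QVm QVb])
    fix w
    have "(\<Sum>n\<in>I. (pay (w n))\<^sup>2) / (real N)\<^sup>2 \<le> N * C\<^sup>2 / (real N)\<^sup>2"
      by (intro divide_right_mono sum_square_le pay_le_C) simp
    also have "\<dots> = C\<^sup>2 / N" using N2 by (simp add: power2_eq_square)
    finally have "(Gm w)\<^sup>2 \<le> QV w" by (simp add: Gm_def QV_def Q_def power_divide diff_divide_distrib)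
    then show "indicator {w. 1 \<le> mn w} w * (Gm w)\<^sup>2 \<le> indicator {w. 1 \<le> mn w} w * QV w"
      by (intro mult_left_mono) auto
  qed
  have "(\<integral>w. QV w \<partial>K x) = V x"
  proof -
    interpret prob_space "K x" by (rule prob_K)
    have "integrable (K x) Q"
    proof -
      have "integrable (K x) (\<lambda>w. (real N)\<^sup>2 * (QV w - C\<^sup>2 / N))"
        using QVb by (intro integrable_mult_right Bochner_Integration.integrable_diff integrable_K[OF QVm]) auto
      then show ?thesis using N2 by (simp add: QV_def)
    qed
    then have "(\<integral>w. QV w \<partial>K x) = (\<integral>w. Q w \<partial>K x) / (real N)\<^sup>2 + C\<^sup>2 / N"
      unfolding QV_def using prob_space by (simp add: Bochner_Integration.integral_add)
    then show ?thesis by (simp add: integral_Q V_def)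
  qed
  then show ?thesis using A B integral_partition[OF x QVm QVb] by linarith
qed

lemma lev_succ: "z \<in> succ \<Longrightarrow> lev z = 1"
proof (rule ccontr)
  assume z: "z \<in> succ" and "lev z \<noteq> 1"
  then have l: "lev z < 1" using lev_le_1[of z] by simp
  have "L (lev z) z \<le> L 1 z" using l by (intro level_time_mono) simp
  also have "L 1 z < H z" using z by (simp add: succ_def)
  finally show False using less_lev_iff[OF lev_nonneg l, of z] by simp
qed

lemma stop_prob:
  assumes x: "levels x"
  shows "(\<integral>w. indicator {w. mn w < 1} w \<partial>K x) \<le> 1 - \<delta> ^ N"
proof -
  interpret prob_space "K x" by (rule prob_K)
  obtain t where t: "0 \<le> t" "t < 1" "\<And>n. n \<in> I \<Longrightarrow> \<xi> (x n) = t" using x by (auto simp: levels_def)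
  have pm: "(\<lambda>w. \<Prod>n\<in>I. indicator succ (w n) :: real) \<in> borel_measurable PS"
    by (intro borel_measurable_prod measurable_compose[OF measurable_component borel_measurable_indicator[OF succ_sets]])
  have p1: "\<bar>\<Prod>n\<in>I. indicator succ (w n) :: real\<bar> \<le> 1" for w :: "nat \<Rightarrow> 'e path"
    using prod_abs_le[of I "\<lambda>n. indicator succ (w n)" 1] by (auto split: split_indicator)
  have "\<delta> ^ N = (\<Prod>n\<in>I. \<delta>)" by simp
  also have "\<dots> \<le> (\<Prod>n\<in>I. measure (P (x n)) succ)"
    using delta_pos t by (intro prod_mono conjI delta_le_succ) auto
  also have "\<dots> = (\<Prod>n\<in>I. \<integral>z. indicator succ z \<partial>P (x n))" by simp
  also have "\<dots> = (\<integral>w. (\<Prod>n\<in>I. indicator succ (w n)) \<partial>K x)"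
    unfolding K_def
  proof (rule PiM_integral_prod[OF prob_P, symmetric])
    show "(indicator succ :: _ \<Rightarrow> real) \<in> borel_measurable (P (x n))" for n
      by (rule measurable_P[OF borel_measurable_indicator[OF succ_sets]])
    show "\<bar>indicator succ z :: real\<bar> \<le> 1" for z by (simp split: split_indicator)
  qed simp
  also have "\<dots> \<le> (\<integral>w. 1 - indicator {w. mn w < 1} w \<partial>K x)"
  proof (rule integral_mono)
    show "integrable (K x) (\<lambda>w. \<Prod>n\<in>I. indicator succ (w n) :: real)" using pm p1 by (rule integrable_K)
    have "{w\<in>space PS. mn w < 1} \<in> sets PS" using mn_measurable by (intro borel_measurable_less) auto
    then have "(indicator {w. mn w < 1} :: _ \<Rightarrow> real) \<in> borel_measurable PS"
      by (subst borel_measurable_indicator_iff) (simp add: Int_def conj_commute)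
    then show "integrable (K x) (\<lambda>w. 1 - indicator {w. mn w < 1} w :: real)"
      by (intro integrable_K[where c=1] borel_measurable_diff borel_measurable_const) (auto split: split_indicator)
    fix w
    show "(\<Prod>n\<in>I. indicator succ (w n)) \<le> (1 - indicator {w. mn w < 1} w :: real)"
    proof (cases "mn w < 1")
      case True
      then have "w (low w) \<notin> succ" using lev_succ[of "w (low w)"] lev_low[of w] by auto
      then have z: "(\<Prod>n\<in>I. indicator succ (w n)) = (0::real)"
        using low_in[of w] by (subst prod_zero_iff) (auto intro!: bexI[of _ "low w"])
      show ?thesis unfolding z using True by simp
    qed (use p1[of w] in simp)
  qed
  also have "\<dots> = 1 - (\<integral>w. indicator {w. mn w < 1} w \<partial>K x)"
  proof -
    have "{w\<in>space PS. mn w < 1} \<in> sets PS" using mn_measurable by (intro borel_measurable_less) auto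
    then have "(indicator {w. mn w < 1} :: _ \<Rightarrow> real) \<in> borel_measurable PS"
      by (subst borel_measurable_indicator_iff) (simp add: Int_def conj_commute)
    then have "integrable (K x) (indicator {w. mn w < 1} :: _ \<Rightarrow> real)"
      by (rule integrable_K[where c=1]) (simp split: split_indicator)
    then show ?thesis using prob_space by (subst Bochner_Integration.integral_diff) auto
  qed
  finally show ?thesis by simp
qed

text \<open>Renewal of the product law: given the starting points after the branching, the
  survivors' parts are independent copies by the strong Markov property and the new piece by its own
  law. Boxes are used because \<open>low_markov\<close> handles products over the survivors.\<close>

lemma S_rect:
  assumes x: "levels x" and B: "\<And>n. n \<in> I \<Longrightarrow> B n \<in> sets path_space"
  defines "G \<equiv> \<lambda>x. \<Prod>n\<in>I. measure (P (x n)) (B n)"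
  shows "(\<integral>w. S (\<lambda>w. \<Prod>n\<in>I. indicator (B n) (w n)) w \<partial>K x) = (\<integral>w. S (\<lambda>w. G (st w)) w \<partial>K x)"
proof -
  define F where "F w = (\<Prod>n\<in>I. indicator (B n) (w n) :: real)" for w :: "nat \<Rightarrow> 'e path"
  have mb: "(\<lambda>y. measure (P y) (B n)) \<in> borel_measurable borel" if "n \<in> I" for n
    by (rule measurable_compose[OF kernel measurable_measure_prob_algebra[OF B[OF that]]])
  have Gm: "G \<in> borel_measurable ES"
    unfolding G_def
  proof (rule borel_measurable_prod)
    fix n assume n: "n \<in> I"
    then have "(\<lambda>x. x n) \<in> ES \<rightarrow>\<^sub>M borel" by (rule measurable_component_singleton)
    then show "(\<lambda>x. measure (P (x n)) (B n)) \<in> borel_measurable ES" using mb[OF n] by (rule measurable_compose)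
  qed
  have G1: "\<bar>G y\<bar> \<le> 1" for y
    using prod_abs_le[of I "\<lambda>n. measure (P (y n)) (B n)" 1] prob_space.prob_le_1[OF prob_P] by (simp add: G_def)
  have Fm: "F \<in> borel_measurable PS"
    unfolding F_def[abs_def]
    by (intro borel_measurable_prod measurable_compose[OF measurable_component borel_measurable_indicator] B)
  have F1: "\<bar>F w\<bar> \<le> 1" for w
    using prod_abs_le[of I "\<lambda>n. indicator (B n) (w n)" 1] by (auto simp: F_def split: split_indicator)
  \<comment> \<open>The new piece starts from the entrance point of survivor \<open>m\<close>. Its
    probability of lying in \<open>B i\<close> is a function of that point and is absorbed in the
    factor of \<open>m\<close>, which leaves a product over the survivors.\<close>
  define u where "u i m n z = indicator (B n) z * (if n = m then measure (P (z 0)) (B i) else 1)" for i m n and z :: "'e path"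
  have um: "u i m n \<in> borel_measurable path_space" if "i \<in> I" "n \<in> I" for i m n
    unfolding u_def using measurable_compose[OF measurable_at_0 mb[OF that(1)]] B[OF that(2)]
    by (cases "n = m") (simp_all add: borel_measurable_times)
  have u1: "\<bar>u i m n z\<bar> \<le> 1" for i m n z
    using prob_space.prob_le_1[OF prob_P, of "z 0" "B i"] by (auto simp: u_def split: split_indicator)
  have Eu: "(\<integral>z. u i m n z \<partial>P y) = measure (P y) (B n) * (if n = m then measure (P y) (B i) else 1)"
    if "i \<in> I" "n \<in> I" for i m n y
  proof -
    have "(\<integral>z. u i m n z \<partial>P y) = (\<integral>z. indicator (B n) z * (if n = m then measure (P y) (B i) else 1) \<partial>P y)"
    proof (rule integral_cong_AE)
      show "u i m n \<in> borel_measurable (P y)" by (rule measurable_P[OF um[OF that]])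
      show "(\<lambda>z. indicator (B n) z * (if n = m then measure (P y) (B i) else 1)) \<in> borel_measurable (P y)"
        using B[OF that(2)] by (intro measurable_P borel_measurable_times borel_measurable_indicator borel_measurable_const)
      show "AE z in P y. u i m n z = indicator (B n) z * (if n = m then measure (P y) (B i) else 1)"
        using start[of y] by eventually_elim (simp add: u_def)
    qed
    then show ?thesis using B[OF that(2)] by simp
  qed
  have main: "(\<integral>w. indicator (Elow i) w * S F w \<partial>K x) = (\<integral>w. indicator (Elow i) w * S (\<lambda>w. G (st w)) w \<partial>K x)"
    if i: "i \<in> I" for i
  proof -
    let ?J = "I - {i}"
    have lhs: "indicator (Elow i) w * S F w =
        (\<Sum>m\<in>?J. indicator (Elow i) w * (\<Prod>n\<in>?J. u i m n (adv (lev (w i)) (w n)))) / (real N - 1)" for w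
    proof (cases "w \<in> Elow i")
      case True
      have lw: "low w = i" "mn w = lev (w i)" "mn w < 1" using Elow_low[OF True i] by auto
      have "(\<integral>z. F (move z w) \<partial>P (adv (mn w) (w m) 0)) = (\<Prod>n\<in>?J. u i m n (adv (lev (w i)) (w n)))"
        if m: "m \<in> ?J" for m
      proof -
        let ?y = "adv (lev (w i)) (w m) 0"
        have "F (move z w) = indicator (B i) z * (\<Prod>n\<in>?J. indicator (B n) (adv (lev (w i)) (w n)))" for z
        proof -
          have "F (move z w) = indicator (B i) (move z w i) * (\<Prod>n\<in>?J. indicator (B n) (move z w n))"
            unfolding F_def using i by (intro prod.remove) auto
          also have "move z w i = z" using i lw by (simp add: move_def)
          also have "(\<Prod>n\<in>?J. indicator (B n) (move z w n)) = (\<Prod>n\<in>?J. indicator (B n) (adv (lev (w i)) (w n)) :: real)"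
            using lw by (intro prod.cong refl) (simp add: move_def)
          finally show ?thesis .
        qed
        then have "(\<integral>z. F (move z w) \<partial>P (adv (mn w) (w m) 0)) =
            measure (P ?y) (B i) * (\<Prod>n\<in>?J. indicator (B n) (adv (lev (w i)) (w n)))"
          using B[OF i] lw by simp
        also have "\<dots> = (\<Prod>n\<in>?J. indicator (B n) (adv (lev (w i)) (w n)) *
            (if n = m then measure (P (adv (lev (w i)) (w n) 0)) (B i) else 1))"
          using m by (simp add: prod.distrib prod.delta mult.commute)
        finally show ?thesis by (simp add: u_def)
      qed
      then have "(\<Sum>m\<in>?J. \<integral>z. F (move z w) \<partial>P (adv (mn w) (w m) 0)) = (\<Sum>m\<in>?J. \<Prod>n\<in>?J. u i m n (adv (lev (w i)) (w n)))"
        by (intro sum.cong refl)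
      moreover have "(\<Sum>m\<in>I. if m = low w then 0 else f m) = (\<Sum>m\<in>?J. f m)" for f :: "nat \<Rightarrow> real"
        using i lw by (subst sum.remove[of I i]) (auto intro!: sum.cong)
      ultimately show ?thesis using True lw by (simp add: S_def)
    qed simp
    have rhs: "indicator (Elow i) w * S (\<lambda>w. G (st w)) w =
        (\<Sum>m\<in>?J. indicator (Elow i) w * (\<Prod>n\<in>?J. \<integral>z. u i m n z \<partial>P (adv (lev (w i)) (w n) 0))) / (real N - 1)" for w
    proof (cases "w \<in> Elow i")
      case True
      have lw: "low w = i" "mn w = lev (w i)" "mn w < 1" "w \<in> space PS"
        using Elow_low[OF True i] True by (auto simp: Elow_def)
      have "G (branch m w) = (\<Prod>n\<in>?J. \<integral>z. u i m n z \<partial>P (adv (lev (w i)) (w n) 0))" if m: "m \<in> ?J" for m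
      proof -
        have "G (branch m w) = measure (P (branch m w i)) (B i) * (\<Prod>n\<in>?J. measure (P (branch m w n)) (B n))"
          unfolding G_def using i by (intro prod.remove) auto
        also have "branch m w i = adv (lev (w i)) (w m) 0" using i lw by (simp add: branch_def)
        also have "(\<Prod>n\<in>?J. measure (P (branch m w n)) (B n)) = (\<Prod>n\<in>?J. measure (P (adv (lev (w i)) (w n) 0)) (B n))"
          using lw by (intro prod.cong refl) (simp add: branch_def)
        also have "measure (P (adv (lev (w i)) (w m) 0)) (B i) * \<dots> =
          (\<Prod>n\<in>?J. measure (P (adv (lev (w i)) (w n) 0)) (B n) * (if n = m then measure (P (adv (lev (w i)) (w n) 0)) (B i) else 1))"
          using m by (simp add: prod.distrib prod.delta mult.commute)
        also have "\<dots> = (\<Prod>n\<in>?J. \<integral>z. u i m n z \<partial>P (adv (lev (w i)) (w n) 0))"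
          using Eu[OF i] by (intro prod.cong refl) auto
        finally show ?thesis .
      qed
      then have "(\<Sum>m\<in>?J. G (branch m w)) = (\<Sum>m\<in>?J. \<Prod>n\<in>?J. \<integral>z. u i m n z \<partial>P (adv (lev (w i)) (w n) 0))"
        by (intro sum.cong refl)
      then show ?thesis using True lw by (simp add: S_start[OF Gm])
    qed simp
    have int1: "integrable (K x) (\<lambda>w. indicator (Elow i) w * (\<Prod>n\<in>?J. u i m n (adv (lev (w i)) (w n))))" for m
    proof (rule integrable_low[OF i, where c=1])
      show "(\<lambda>w. \<Prod>n\<in>?J. u i m n (adv (lev (w i)) (w n))) \<in> borel_measurable PS"
        using i by (intro borel_measurable_prod measurable_compose[OF adv_component_measurable um]) auto
      show "\<bar>\<Prod>n\<in>?J. u i m n (adv (lev (w i)) (w n))\<bar> \<le> 1" for w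
        using prod_abs_le[of ?J "\<lambda>n. u i m n (adv (lev (w i)) (w n))" 1] u1 by simp
    qed
    have int2: "integrable (K x) (\<lambda>w. indicator (Elow i) w * (\<Prod>n\<in>?J. \<integral>z. u i m n z \<partial>P (adv (lev (w i)) (w n) 0)))" for m
    proof (rule integrable_low[OF i, where c=1])
      show "(\<lambda>w. \<Prod>n\<in>?J. \<integral>z. u i m n z \<partial>P (adv (lev (w i)) (w n) 0)) \<in> borel_measurable PS"
      proof (rule borel_measurable_prod)
        fix n assume n: "n \<in> ?J"
        then have nI: "n \<in> I" by simp
        note E = measurable_compose[OF measurable_at_0 measurable_E[OF um[OF i nI]]]
        show "(\<lambda>w. \<integral>z. u i m n z \<partial>P (adv (lev (w i)) (w n) 0)) \<in> borel_measurable PS"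
          by (rule measurable_compose[OF adv_component_measurable[OF i nI] E])
      qed
      have "\<bar>\<integral>z. u i m n z \<partial>P y\<bar> \<le> 1" for n y using u1 by (intro abs_E_le)
      then show "\<bar>\<Prod>n\<in>?J. \<integral>z. u i m n z \<partial>P (adv (lev (w i)) (w n) 0)\<bar> \<le> 1" for w
        using prod_abs_le[of ?J "\<lambda>n. \<integral>z. u i m n z \<partial>P (adv (lev (w i)) (w n) 0)" 1] by simp
    qed
    have "(\<integral>w. indicator (Elow i) w * S F w \<partial>K x) =
        (\<Sum>m\<in>?J. \<integral>w. indicator (Elow i) w * (\<Prod>n\<in>?J. u i m n (adv (lev (w i)) (w n))) \<partial>K x) / (real N - 1)"
      unfolding lhs integral_divide_zero using int1
      by (intro arg_cong2[where f="(/)"] refl Bochner_Integration.integral_sum)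
    also have "\<dots> = (\<Sum>m\<in>?J. \<integral>w. indicator (Elow i) w * (\<Prod>n\<in>?J. \<integral>z. u i m n z \<partial>P (adv (lev (w i)) (w n) 0)) \<partial>K x) / (real N - 1)"
      using um[OF i] u1 by (intro arg_cong2[where f="(/)"] refl sum.cong low_markov[OF i, where c=1]) auto
    also have "\<dots> = (\<integral>w. indicator (Elow i) w * S (\<lambda>w. G (st w)) w \<partial>K x)"
      unfolding rhs integral_divide_zero using int2
      by (intro arg_cong2[where f="(/)"] refl Bochner_Integration.integral_sum[symmetric])
    finally show ?thesis .
  qed
  have "(\<integral>w. S F w \<partial>K x) = (\<integral>w. S (\<lambda>w. G (st w)) w \<partial>K x)"
    using S_partition[OF x Fm, of 1] S_partition[OF x measurable_compose[OF st_measurable Gm], of 1] F1 G1 main by simp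
  then show ?thesis by (simp add: F_def[abs_def])
qed

section \<open>The run of the algorithm\<close>

text \<open>As \<open>hit_time A\<close> need not be measurable, \<open>good\<close> is replaced by a measurable condition implying it.\<close>

definition nice :: "(nat \<Rightarrow> 'e path) \<Rightarrow> bool" where
  "nice w \<longleftrightarrow> (\<forall>n\<in>I. 0 \<le> \<xi> (w n 0) \<and> \<xi> (w n 0) \<le> 1 \<and> hit_time (interior A) (w n) = H (w n) \<and>
      min (H (w n)) (L 1 (w n)) < \<infinity> \<and> (lev (w n) = 1 \<longrightarrow> L 1 (w n) < H (w n))) \<and>
    (\<forall>i\<in>I. \<forall>n\<in>I. i \<noteq> n \<longrightarrow> lev (w i) < 1 \<longrightarrow> lev (w i) \<noteq> lev (w n))"

lemma nice_good: "nice w \<Longrightarrow> w \<in> space PS \<Longrightarrow> n \<in> I \<Longrightarrow> good (w n)"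
proof -
  assume *: "nice w" "w \<in> space PS" "n \<in> I"
  have "hit_time A (w n) = H (w n)"
    using * hit_time_mono[OF interior_subset, of A "w n"] hit_time_mono[OF closure_subset, of A "w n"]
    by (auto simp: nice_def)
  then show ?thesis using * PS_component[OF *(2,3)] by (auto simp: good_def nice_def)
qed

lemma nice_sets: "{w\<in>space PS. nice w} \<in> sets PS"
proof -
  have c: "(\<lambda>w. f (w n)) \<in> borel_measurable PS" if "n \<in> I" "f \<in> borel_measurable path_space"
    for n and f :: "'e path \<Rightarrow> 'b::topological_space"
    using measurable_component[OF that(1)] that(2) by (rule measurable_compose)
  have x: "(\<lambda>z. \<xi> (z 0)) \<in> borel_measurable path_space"
    using measurable_at_0 borel_measurable_continuous_onI[OF xi_cont] by (rule measurable_compose)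
  note hi = optional_time_measurable[OF optional_hit_open[OF open_interior[of A]]]
  have 1: "{w\<in>space PS. 0 \<le> \<xi> (w n 0) \<and> \<xi> (w n 0) \<le> 1 \<and> hit_time (interior A) (w n) = H (w n) \<and>
      min (H (w n)) (L 1 (w n)) < \<infinity> \<and> (lev (w n) = 1 \<longrightarrow> L 1 (w n) < H (w n))} \<in> sets PS" if n: "n \<in> I" for n
  proof (intro sets.sets_Collect_conj sets.sets_Collect_imp)
    note m = c[OF n x] c[OF n hi] c[OF n measurable_H] c[OF n measurable_L[of 1]] c[OF n measurable_lev]
    show "{w\<in>space PS. 0 \<le> \<xi> (w n 0)} \<in> sets PS" "{w\<in>space PS. \<xi> (w n 0) \<le> 1} \<in> sets PS"
      by (rule borel_measurable_le[OF borel_measurable_const m(1)], rule borel_measurable_le[OF m(1) borel_measurable_const])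
    show "{w\<in>space PS. hit_time (interior A) (w n) = H (w n)} \<in> sets PS"
      by (rule borel_measurable_eq[OF m(2,3)])
    show "{w\<in>space PS. min (H (w n)) (L 1 (w n)) < \<infinity>} \<in> sets PS"
      unfolding min_less_iff_disj
      by (intro sets.sets_Collect_disj borel_measurable_less[OF m(3) borel_measurable_const]
          borel_measurable_less[OF m(4) borel_measurable_const])
    show "{w\<in>space PS. lev (w n) = 1} \<in> sets PS"
      by (rule borel_measurable_eq[OF m(5) borel_measurable_const])
    show "{w\<in>space PS. L 1 (w n) < H (w n)} \<in> sets PS"
      by (rule borel_measurable_less[OF m(4,3)])
  qed
  have 2: "{w\<in>space PS. i \<noteq> n \<longrightarrow> lev (w i) < 1 \<longrightarrow> lev (w i) \<noteq> lev (w n)} \<in> sets PS"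
    if "i \<in> I" "n \<in> I" for i n
  proof (intro sets.sets_Collect_imp sets.sets_Collect_neg)
    note m = c[OF that(1) measurable_lev] c[OF that(2) measurable_lev]
    show "{w\<in>space PS. lev (w i) < 1} \<in> sets PS" by (rule borel_measurable_less[OF m(1) borel_measurable_const])
    show "{w\<in>space PS. lev (w i) = lev (w n)} \<in> sets PS" by (rule borel_measurable_eq[OF m])
  qed (cases "i = n"; simp)
  show ?thesis
    unfolding nice_def
  proof (rule sets.sets_Collect_conj; rule sets.sets_Collect_finite_All[OF _ I_facts(1)])
    fix i assume i: "i \<in> I"
    show "{w\<in>space PS. \<forall>n\<in>I. i \<noteq> n \<longrightarrow> lev (w i) < 1 \<longrightarrow> lev (w i) \<noteq> lev (w n)} \<in> sets PS"
      by (rule sets.sets_Collect_finite_All[OF _ I_facts(1)]) (rule 2[OF i])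
  qed (rule 1)
qed

lemma AE_nice:
  assumes x: "levels x"
  shows "AE w in K x. nice w"
proof -
  obtain t where t: "0 \<le> t" "t < 1" "\<And>n. n \<in> I \<Longrightarrow> \<xi> (x n) = t" using x by (auto simp: levels_def)
  have "AE w in K x. H (w n) = hit_time (interior A) (w n)" if "n \<in> I" for n
    using t that by (intro AE_K_component AE_H_interior) auto
  then have "AE w in K x. \<forall>n\<in>I. H (w n) = hit_time (interior A) (w n)"
    by (intro AE_finite_allI) auto
  then show ?thesis
    using AE_K_nice[OF x] by eventually_elim (auto simp: nice_def good_def)
qed

lemma levels_le_mn:
  assumes w: "nice w" "w \<in> space PS" and x: "levels (st w)" and n: "n \<in> I"
  shows "\<xi> (w n 0) \<le> mn w"
proof -
  obtain t where t: "\<And>n. n \<in> I \<Longrightarrow> \<xi> (w n 0) = t" using x by (auto simp: levels_def st_def)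
  have "\<xi> (w (low w) 0) \<le> lev (w (low w))"
    using nice_good[OF w low_in] hit_time_nonneg[of "closure A" "w (low w)"] L_nonneg[of 1 "w (low w)"]
    by (intro good_le_lev) (auto simp: zero_ereal_def)
  then show ?thesis using t[OF n] t[OF low_in[of w]] lev_low[of w] by simp
qed

lemma nice_alive:
  assumes w: "nice w" and m: "mn w < 1" and n: "n \<in> I" "n \<noteq> low w"
  shows "L (mn w) (w n) < H (w n)"
proof -
  have "lev (w (low w)) \<noteq> lev (w n)"
  proof -
    have "\<forall>i\<in>I. \<forall>n\<in>I. i \<noteq> n \<longrightarrow> lev (w i) < 1 \<longrightarrow> lev (w i) \<noteq> lev (w n)"
      using w by (simp add: nice_def)
    from this[rule_format, OF low_in[of w] n(1)] show ?thesis using n(2) m lev_low[of w] by auto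
  qed
  then have "mn w < lev (w n)" using mn_le[OF n(1), of w] lev_low[of w] by simp
  then show ?thesis using less_lev_iff[OF mn_bounds(1) m] by blast
qed

lemma levels_move:
  assumes w: "nice w" "w \<in> space PS" "levels (st w)" and m: "mn w < 1"
    and k: "k \<in> I" "k \<noteq> low w" and z: "z 0 = adv (mn w) (w k) 0"
  shows "levels (st (move z w))"
proof -
  have "\<xi> (adv (mn w) (w n) 0) = mn w" if "n \<in> I" "n \<noteq> low w" for n
    using that levels_le_mn[OF w] nice_alive[OF w(1) m] PS_component[OF w(2)] by (intro xi_adv_0) auto
  then have "\<forall>n\<in>I. \<xi> (st (move z w) n) = mn w"
    using k z by (auto simp: st_def move_def)
  then show ?thesis using m mn_bounds(1)[of w] by (auto simp: levels_def)
qed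

definition follow_all :: "(nat \<Rightarrow> 'e path) \<Rightarrow> (nat \<Rightarrow> 'e path) \<Rightarrow> bool" where
  "follow_all Y w \<longleftrightarrow> (\<forall>n\<in>I. \<exists>\<sigma>. follows (Y n) (w n) \<sigma>)"

text \<open>Link between the algorithm, phrased with \<open>score\<close> and the hitting time of
  \<open>A\<close>, and the measurable quantities of the remaining parts.\<close>

lemma follow_all_score:
  assumes f: "follow_all Y w" and w: "nice w" "w \<in> space PS"
  shows "min_score N \<xi> A Y = mn w" "lowest N \<xi> A Y = low w"
proof -
  have s: "score \<xi> A (Y n) = lev (w n)" if "n \<in> I" for n
    using f that follows_score nice_good[OF w that] by (auto simp: follow_all_def)
  then have "(\<lambda>n. score \<xi> A (Y n)) ` I = (\<lambda>n. lev (w n)) ` I" by (intro image_cong) auto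
  then show m: "min_score N \<xi> A Y = mn w" by (simp add: min_score_def mn_def I_def)
  show "lowest N \<xi> A Y = low w"
    unfolding lowest_def low_def m using s by (intro arg_cong[where f=Least]) (auto simp: I_def fun_eq_iff)
qed

text \<open>Survivors are followed by their advanced parts, the replaced particle by its new piece.
  Since the copied particle is a survivor, its entrance time, where the cut is made, is
  finite.\<close>

lemma follow_all_move:
  assumes f: "follow_all Y w" and w: "nice w" "w \<in> space PS" "levels (st w)" and m: "mn w < 1"
    and k: "k \<in> I" "k \<noteq> low w" and z: "z 0 = adv (mn w) (w k) 0"
  shows "follow_all (ams_step N \<xi> A k z Y) (move z w)"
  unfolding follow_all_def
proof
  fix n assume n: "n \<in> I"
  have Y: "ams_step N \<xi> A k z Y = Y(low w := splice (Y k) (L (mn w) (Y k)) z)"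
    using m follow_all_score[OF f w(1,2)] by (simp add: ams_step_def Let_def)
  have a: "\<xi> (w n 0) \<le> mn w" "good (w n)" if "n \<in> I" for n
    using that levels_le_mn[OF w] nice_good[OF w(1,2)] by auto
  show "\<exists>\<sigma>. follows (ams_step N \<xi> A k z Y n) (move z w n) \<sigma>"
  proof (cases "n = low w")
    case True
    obtain \<sigma> where "follows (Y k) (w k) \<sigma>" using f k by (auto simp: follow_all_def)
    from follows_splice[where z=z, OF this a(2)[OF k(1)] a(1)[OF k(1)] nice_alive[OF w(1) m k] z] show ?thesis
      using True n by (auto simp: Y move_def)
  next
    case False
    obtain \<sigma> where "follows (Y n) (w n) \<sigma>" using f n by (auto simp: follow_all_def)
    from follows_adv[OF this a(2)[OF n] a(1)[OF n] nice_alive[OF w(1) m n False]] show ?thesis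
      using False n by (auto simp: Y move_def)
  qed
qed

end

locale ams_experiment = ams_particles P \<xi> A \<phi> N
  for P :: "'e::polish_space \<Rightarrow> 'e path measure" and \<xi> :: "'e \<Rightarrow> real" and A :: "'e set"
    and \<phi> :: "'e \<Rightarrow> real" and N :: nat +
  fixes \<eta>0 :: "'e measure" and M :: "'w measure"
    and Y0 piece :: "nat \<Rightarrow> 'w \<Rightarrow> 'e path" and pick :: "nat \<Rightarrow> 'w \<Rightarrow> nat"
  assumes eta0: "prob_space \<eta>0" "sets \<eta>0 = sets borel" and eta0_level: "AE y in \<eta>0. \<xi> y = 0"
    and run: "ams_run P \<eta>0 \<xi> A N M Y0 pick piece"
begin

sublocale prob_space M
  using run by (simp add: ams_run_def)

abbreviation Y :: "nat \<Rightarrow> 'w \<Rightarrow> nat \<Rightarrow> 'e path" where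
  "Y j \<omega> \<equiv> particles N \<xi> A (\<lambda>n. Y0 n \<omega>) (\<lambda>j. pick j \<omega>) (\<lambda>j. piece j \<omega>) j"

text \<open>\<open>\<theta> j \<omega> n\<close> is \<open>Y\<^bsup>n,j\<^esup>\<close> seen from its entrance in \<open>{\<xi> > \<tau>\<^sub>j}\<close> on.\<close>

primrec \<theta> :: "nat \<Rightarrow> 'w \<Rightarrow> nat \<Rightarrow> 'e path" where
  "\<theta> 0 \<omega> = (\<lambda>n\<in>I. Y0 n \<omega>)"
| "\<theta> (Suc j) \<omega> = (if mn (\<theta> j \<omega>) < 1 then move (piece (Suc j) \<omega>) (\<theta> j \<omega>) else \<theta> j \<omega>)"

declare \<theta>.simps(2)[simp del]

text \<open>Equivalent to all of the first \<open>j\<close> branchings being performed: a stopped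
  configuration is frozen, so \<open>mn\<close> stays at 1.\<close>

definition act :: "nat \<Rightarrow> 'w \<Rightarrow> bool" where
  "act j \<omega> \<longleftrightarrow> j = 0 \<or> mn (\<theta> (j - 1) \<omega>) < 1"

lemma act_0: "act 0 \<omega>" and act_Suc: "act (Suc j) \<omega> \<longleftrightarrow> mn (\<theta> j \<omega>) < 1"
  by (simp_all add: act_def)

lemma act_SucD: "act (Suc j) \<omega> \<Longrightarrow> act j \<omega>"
  by (cases j) (auto simp: act_Suc act_0 \<theta>.simps(2) split: if_splits)

section \<open>The filtration of the draws\<close>

lemma Y0_measurable: "n \<in> I \<Longrightarrow> Y0 n \<in> M \<rightarrow>\<^sub>M path_space"
  and pick_measurable: "1 \<le> j \<Longrightarrow> pick j \<in> M \<rightarrow>\<^sub>M count_space UNIV"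
  and piece_measurable: "1 \<le> j \<Longrightarrow> piece j \<in> M \<rightarrow>\<^sub>M path_space"
  using run by (auto simp: ams_run_def indep_vars_def I_def)

abbreviation G :: "nat \<Rightarrow> nat \<Rightarrow> 'w measure" where "G k i \<equiv> past M N Y0 pick piece k i"

definition past_generator :: "nat \<Rightarrow> nat \<Rightarrow> 'w set set" where
  "past_generator k i =
     {Y0 n -` B \<inter> space M | n B. n \<in> {1..N} \<and> B \<in> sets path_space} \<union>
      {pick j -` B \<inter> space M | j B. j \<in> {1..k} \<and> B \<in> sets (count_space UNIV)} \<union>
      {piece j -` B \<inter> space M | j B. j \<in> {1..i} \<and> B \<in> sets path_space}"

lemma G_eq: "G k i = sigma (space M) (past_generator k i)"
  by (simp add: past_def past_generator_def)

lemma past_generator_Pow: "past_generator k i \<subseteq> Pow (space M)"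
  by (auto simp: past_generator_def)

lemma space_G: "space (G k i) = space M"
  unfolding G_eq by (rule space_measure_of[OF past_generator_Pow])

lemma sets_G: "sets (G k i) = sigma_sets (space M) (past_generator k i)"
  unfolding G_eq by (rule sets_measure_of[OF past_generator_Pow])

lemma subalgebra_G: "subalgebra M (G k i)"
proof -
  have "past_generator k i \<subseteq> sets M"
    unfolding past_generator_def
  proof (intro Un_least subsetI)
    fix X assume "X \<in> {Y0 n -` B \<inter> space M | n B. n \<in> {1..N} \<and> B \<in> sets path_space}"
    then obtain n B where X: "X = Y0 n -` B \<inter> space M" "n \<in> I" "B \<in> sets path_space" by (auto simp: I_def)
    show "X \<in> sets M" unfolding X(1) by (rule measurable_sets[OF Y0_measurable[OF X(2)] X(3)])
  next
    fix X assume "X \<in> {pick j -` B \<inter> space M | j B. j \<in> {1..k} \<and> B \<in> sets (count_space UNIV)}"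
    then obtain j B where X: "X = pick j -` B \<inter> space M" "1 \<le> j" by auto
    show "X \<in> sets M" unfolding X(1) by (rule measurable_sets[OF pick_measurable[OF X(2)]]) simp
  next
    fix X assume "X \<in> {piece j -` B \<inter> space M | j B. j \<in> {1..i} \<and> B \<in> sets path_space}"
    then obtain j B where X: "X = piece j -` B \<inter> space M" "1 \<le> j" "B \<in> sets path_space" by auto
    show "X \<in> sets M" unfolding X(1) by (rule measurable_sets[OF piece_measurable[OF X(2)] X(3)])
  qed
  then show ?thesis unfolding subalgebra_def space_G sets_G by (simp add: sets.sigma_sets_subset)
qed

lemma G_cond: "sigma_finite_subalgebra M (G k i)"
  by (rule finite_measure_subalgebra_is_sigma_finite)
    (simp add: finite_measure_subalgebra_def finite_measure_subalgebra_axioms_def subalgebra_G finite_measure_axioms)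

lemma G_mono: "k \<le> k' \<Longrightarrow> i \<le> i' \<Longrightarrow> sets (G k i) \<subseteq> sets (G k' i')"
proof -
  assume "k \<le> k'" "i \<le> i'"
  then have le: "{1..k} \<subseteq> {1..k'}" "{1..i} \<subseteq> {1..i'}" by auto
  have "past_generator k i \<subseteq> past_generator k' i'"
    unfolding past_generator_def
  proof (intro Un_mono subset_refl)
    show "{pick j -` B \<inter> space M | j B. j \<in> {1..k} \<and> B \<in> sets (count_space UNIV)} \<subseteq>
        {pick j -` B \<inter> space M | j B. j \<in> {1..k'} \<and> B \<in> sets (count_space UNIV)}" using le(1) by blast
    show "{piece j -` B \<inter> space M | j B. j \<in> {1..i} \<and> B \<in> sets path_space} \<subseteq>
        {piece j -` B \<inter> space M | j B. j \<in> {1..i'} \<and> B \<in> sets path_space}" using le(2) by blast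
  qed
  then show ?thesis unfolding sets_G by (rule sigma_sets_mono')
qed

lemma G_measurable_mono:
  assumes f: "f \<in> G k i \<rightarrow>\<^sub>M R" and le: "k \<le> k'" "i \<le> i'"
  shows "f \<in> G k' i' \<rightarrow>\<^sub>M R"
  using f G_mono[OF le] by (auto simp: measurable_def space_G)

lemma G_measurable: "f \<in> G k i \<rightarrow>\<^sub>M R \<Longrightarrow> f \<in> M \<rightarrow>\<^sub>M R"
  by (rule measurable_from_subalg[OF subalgebra_G])

lemma Y0_G: "n \<in> I \<Longrightarrow> Y0 n \<in> G k i \<rightarrow>\<^sub>M path_space"
proof (rule measurableI)
  show "n \<in> I \<Longrightarrow> \<omega> \<in> space (G k i) \<Longrightarrow> Y0 n \<omega> \<in> space path_space" for \<omega>
    using measurable_space[OF Y0_measurable] by (simp add: space_G)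
  show "n \<in> I \<Longrightarrow> B \<in> sets path_space \<Longrightarrow> Y0 n -` B \<inter> space (G k i) \<in> sets (G k i)" for B
    unfolding sets_G space_G by (rule sigma_sets.Basic) (auto simp: past_generator_def I_def)
qed

lemma pick_G: "1 \<le> j \<Longrightarrow> j \<le> k \<Longrightarrow> pick j \<in> G k i \<rightarrow>\<^sub>M count_space UNIV"
proof (rule measurableI)
  show "1 \<le> j \<Longrightarrow> j \<le> k \<Longrightarrow> pick j -` B \<inter> space (G k i) \<in> sets (G k i)" for B
    unfolding sets_G space_G by (rule sigma_sets.Basic) (auto simp: past_generator_def)
qed simp

lemma piece_G: "1 \<le> j \<Longrightarrow> j \<le> i \<Longrightarrow> piece j \<in> G k i \<rightarrow>\<^sub>M path_space"
proof (rule measurableI)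
  show "1 \<le> j \<Longrightarrow> \<omega> \<in> space (G k i) \<Longrightarrow> piece j \<omega> \<in> space path_space" for \<omega>
    using measurable_space[OF piece_measurable] by (simp add: space_G)
  show "1 \<le> j \<Longrightarrow> j \<le> i \<Longrightarrow> B \<in> sets path_space \<Longrightarrow> piece j -` B \<inter> space (G k i) \<in> sets (G k i)" for B
    unfolding sets_G space_G by (rule sigma_sets.Basic) (auto simp: past_generator_def)
qed

lemma mn_less_sets: "f \<in> R \<rightarrow>\<^sub>M PS \<Longrightarrow> {\<omega>\<in>space R. mn (f \<omega>) < 1} \<in> sets R"
  using measurable_compose[OF _ mn_measurable, of f R] by (intro borel_measurable_less) auto

lemma theta_G: "\<theta> j \<in> G j j \<rightarrow>\<^sub>M PS"
proof (induction j)
  case 0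
  show ?case
    by (subst \<theta>.simps(1)[abs_def]) (intro measurable_restrict Y0_G)
next
  case (Suc j)
  have t: "\<theta> j \<in> G (Suc j) (Suc j) \<rightarrow>\<^sub>M PS" by (rule G_measurable_mono[OF Suc]) auto
  have p: "piece (Suc j) \<in> G (Suc j) (Suc j) \<rightarrow>\<^sub>M path_space" by (rule piece_G) auto
  have "(\<lambda>\<omega>. move (piece (Suc j) \<omega>) (\<theta> j \<omega>)) \<in> G (Suc j) (Suc j) \<rightarrow>\<^sub>M PS"
    using measurable_compose[OF measurable_Pair[OF t p] move_measurable] by simp
  then show ?case
    by (subst \<theta>.simps(2)[abs_def]) (intro measurable_If t mn_less_sets)
qed

lemma theta_measurable: "\<theta> j \<in> M \<rightarrow>\<^sub>M PS"
  by (rule G_measurable[OF theta_G])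

lemma theta_space: "\<omega> \<in> space M \<Longrightarrow> \<theta> j \<omega> \<in> space PS"
  by (rule measurable_space[OF theta_measurable])

definition D :: "nat \<Rightarrow> 'w set" where "D j = {\<omega>\<in>space M. act j \<omega>}"

lemma D_0: "D 0 = space M"
  by (simp add: D_def act_0)

lemma D_Suc_G: "D (Suc j) \<in> sets (G j j)"
  using mn_less_sets[OF theta_G[of j]] by (simp add: D_def act_Suc space_G)

lemma D_sets: "D j \<in> sets M"
  using D_Suc_G[of "j - 1"] subalgebra_G by (cases j) (auto simp: D_0 subalgebra_def)

lemma integrable_M:
  fixes f :: "'w \<Rightarrow> real"
  assumes "f \<in> borel_measurable M" "\<And>\<omega>. \<omega> \<in> space M \<Longrightarrow> \<bar>f \<omega>\<bar> \<le> c"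
  shows "integrable M f"
  using assms by (rule integrable_bounded)

text \<open>The position from which the \<open>Suc j\<close>-th new piece starts when particle \<open>m\<close> is copied.\<close>

definition bp :: "nat \<Rightarrow> nat \<Rightarrow> 'w \<Rightarrow> 'e" where
  "bp j m \<omega> = adv (mn (\<theta> j \<omega>)) (\<theta> j \<omega> m) 0"

text \<open>What must hold after \<open>j\<close> branchings for the prescribed laws of the next
  pick and piece, phrased with the full trajectories, to be expressed through the remaining parts
  \<open>\<theta> j\<close>.\<close>

definition ready :: "nat \<Rightarrow> bool" where
  "ready j \<longleftrightarrow> (AE \<omega> in M. act j \<omega> \<longrightarrow> follow_all (Y j \<omega>) (\<theta> j \<omega>) \<and> nice (\<theta> j \<omega>) \<and> levels (st (\<theta> j \<omega>)))"

lemma run_pick: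
  assumes "m \<in> I"
  shows "AE \<omega> in M. tau N \<xi> A (\<lambda>n. Y0 n \<omega>) (\<lambda>j. pick j \<omega>) (\<lambda>j. piece j \<omega>) (Suc j) \<noteq> 1 \<longrightarrow>
    real_cond_exp M (G j j) (\<lambda>\<omega>. indicator {m} (pick (Suc j) \<omega>)) \<omega> =
      (if m = lowest N \<xi> A (Y j \<omega>) then 0 else 1 / real (N - 1))"
  using run assms unfolding ams_run_def Let_def I_def
  by (elim conjE allE[where x="Suc j"]) (auto elim!: ballE[where x=m])

lemma run_piece:
  assumes "B \<in> sets path_space"
  shows "AE \<omega> in M. tau N \<xi> A (\<lambda>n. Y0 n \<omega>) (\<lambda>j. pick j \<omega>) (\<lambda>j. piece j \<omega>) (Suc j) \<noteq> 1 \<longrightarrow>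
    real_cond_exp M (G (Suc j) j) (\<lambda>\<omega>. indicator B (piece (Suc j) \<omega>)) \<omega> =
      (let w = Y j \<omega> (pick (Suc j) \<omega>) in
       measure (P (w (real_of_ereal (L (tau N \<xi> A (\<lambda>n. Y0 n \<omega>) (\<lambda>j. pick j \<omega>) (\<lambda>j. piece j \<omega>) (Suc j)) w)))) B)"
  using run assms unfolding ams_run_def Let_def
  by (elim conjE allE[where x="Suc j"]) (auto elim!: ballE[where x=B])

lemma tau_Suc: "tau N \<xi> A (\<lambda>n. Y0 n \<omega>) (\<lambda>j. pick j \<omega>) (\<lambda>j. piece j \<omega>) (Suc j) = min_score N \<xi> A (Y j \<omega>)"
  by (simp add: tau_def)

section \<open>Conditional laws of the picks and of the new pieces\<close>

lemma AE_pick: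
  assumes r: "ready j" and m: "m \<in> I"
  shows "AE \<omega> in M. \<omega> \<in> D (Suc j) \<longrightarrow>
    real_cond_exp M (G j j) (\<lambda>\<omega>. indicator {m} (pick (Suc j) \<omega>)) \<omega> =
      (if m = low (\<theta> j \<omega>) then 0 else 1 / (real N - 1))"
  using run_pick[OF m, of j] r[unfolded ready_def] AE_space[of M]
proof eventually_elim
  case (elim \<omega>)
  show ?case
  proof
    assume d: "\<omega> \<in> D (Suc j)"
    then have a: "mn (\<theta> j \<omega>) < 1" "act j \<omega>" using act_SucD by (auto simp: D_def act_Suc)
    have "min_score N \<xi> A (Y j \<omega>) = mn (\<theta> j \<omega>)" "lowest N \<xi> A (Y j \<omega>) = low (\<theta> j \<omega>)"
      using follow_all_score[of "Y j \<omega>" "\<theta> j \<omega>"] elim(2) a(2) theta_space[OF elim(3)] by auto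
    then show "real_cond_exp M (G j j) (\<lambda>\<omega>. indicator {m} (pick (Suc j) \<omega>)) \<omega> =
      (if m = low (\<theta> j \<omega>) then 0 else 1 / (real N - 1))"
      using elim(1) a(1) N2 by (simp add: tau_Suc of_nat_diff)
  qed
qed

lemma pick_law:
  fixes U :: "'w \<Rightarrow> real"
  assumes r: "ready j" and m: "m \<in> I" and U: "U \<in> borel_measurable (G j j)" "\<And>\<omega>. \<omega> \<in> space M \<Longrightarrow> \<bar>U \<omega>\<bar> \<le> c"
  shows "(\<integral>\<omega>. indicator (D (Suc j)) \<omega> * U \<omega> * indicator {m} (pick (Suc j) \<omega>) \<partial>M) =
    (\<integral>\<omega>. indicator (D (Suc j)) \<omega> * U \<omega> * (if m = low (\<theta> j \<omega>) then 0 else 1 / (real N - 1)) \<partial>M)"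
proof -
  interpret sigma_finite_subalgebra M "G j j" by (rule G_cond)
  let ?f = "\<lambda>\<omega>. indicator (D (Suc j)) \<omega> * U \<omega>"
  let ?g = "\<lambda>\<omega>. indicator {m} (pick (Suc j) \<omega>) :: real"
  have f: "?f \<in> borel_measurable (G j j)"
    by (intro borel_measurable_times borel_measurable_indicator D_Suc_G U)
  have g: "?g \<in> borel_measurable M"
    by (rule measurable_compose[OF pick_measurable]) simp_all
  have fM: "?f \<in> borel_measurable M" by (rule G_measurable[OF f])
  have fg: "\<bar>?f \<omega> * ?g \<omega>\<bar> \<le> \<bar>c\<bar>" if "\<omega> \<in> space M" for \<omega>
    using U(2)[OF that] by (auto split: split_indicator)
  have "(\<integral>\<omega>. ?f \<omega> * ?g \<omega> \<partial>M) = (\<integral>\<omega>. ?f \<omega> * real_cond_exp M (G j j) ?g \<omega> \<partial>M)"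
    by (rule real_cond_exp_intg(2)[OF integrable_M[OF borel_measurable_times[OF fM g] fg] f g, symmetric])
  also have "\<dots> = (\<integral>\<omega>. ?f \<omega> * (if m = low (\<theta> j \<omega>) then 0 else 1 / (real N - 1)) \<partial>M)"
  proof (rule integral_cong_AE)
    show "(\<lambda>\<omega>. ?f \<omega> * real_cond_exp M (G j j) ?g \<omega>) \<in> borel_measurable M"
      by (rule borel_measurable_times[OF fM borel_measurable_cond_exp2])
    have "(\<lambda>\<omega>. if m = low (\<theta> j \<omega>) then 0 else 1 / (real N - 1)) \<in> borel_measurable M"
      by (rule measurable_compose[OF measurable_compose[OF theta_measurable low_measurable]]) simp
    then show "(\<lambda>\<omega>. ?f \<omega> * (if m = low (\<theta> j \<omega>) then 0 else 1 / (real N - 1))) \<in> borel_measurable M"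
      by (rule borel_measurable_times[OF fM])
    show "AE \<omega> in M. ?f \<omega> * real_cond_exp M (G j j) ?g \<omega> = ?f \<omega> * (if m = low (\<theta> j \<omega>) then 0 else 1 / (real N - 1))"
      using AE_pick[OF r m]
    proof eventually_elim
      case (elim \<omega>)
      show ?case
      proof (cases "\<omega> \<in> D (Suc j)")
        case True
        from elim[rule_format, OF this] show ?thesis by (simp only:)
      qed simp
    qed
  qed
  finally show ?thesis .
qed

lemma bp_G: "m \<in> I \<Longrightarrow> bp j m \<in> G j j \<rightarrow>\<^sub>M borel"
  unfolding bp_def[abs_def]
  by (rule measurable_compose[OF theta_G measurable_compose[OF adv_mn_measurable measurable_at_0]])

text \<open>The new piece is prescribed to start at the entrance point along the full trajectory of
  the copied particle; \<open>follows_at_L\<close> identifies it with the one along the remaining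
  part.\<close>

lemma AE_piece:
  assumes r: "ready j" and B: "B \<in> sets path_space" and m: "m \<in> I"
  shows "AE \<omega> in M. \<omega> \<in> D (Suc j) \<longrightarrow> m \<noteq> low (\<theta> j \<omega>) \<longrightarrow> pick (Suc j) \<omega> = m \<longrightarrow>
    real_cond_exp M (G (Suc j) j) (\<lambda>\<omega>. indicator B (piece (Suc j) \<omega>)) \<omega> = measure (P (bp j m \<omega>)) B"
  using run_piece[OF B, of j] r[unfolded ready_def] AE_space[of M]
proof eventually_elim
  case (elim \<omega>)
  show ?case
  proof (intro impI)
    assume d: "\<omega> \<in> D (Suc j)" and ml: "m \<noteq> low (\<theta> j \<omega>)" and p: "pick (Suc j) \<omega> = m"
    then have a: "mn (\<theta> j \<omega>) < 1" "act j \<omega>" using act_SucD by (auto simp: D_def act_Suc)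
    have n: "follow_all (Y j \<omega>) (\<theta> j \<omega>)" "nice (\<theta> j \<omega>)" "\<theta> j \<omega> \<in> space PS" "levels (st (\<theta> j \<omega>))"
      using elim(2) a(2) theta_space[OF elim(3)] by auto
    have t: "min_score N \<xi> A (Y j \<omega>) = mn (\<theta> j \<omega>)" using follow_all_score[OF n(1-3)] by auto
    obtain \<sigma> where f: "follows (Y j \<omega> m) (\<theta> j \<omega> m) \<sigma>" using n(1) m by (auto simp: follow_all_def)
    have fin: "L (mn (\<theta> j \<omega>)) (\<theta> j \<omega> m) < \<infinity>"
      using less_le_trans[OF nice_alive[OF n(2) a(1) m ml], of \<infinity>] by simp
    have "Y j \<omega> m (real_of_ereal (L (mn (\<theta> j \<omega>)) (Y j \<omega> m))) = bp j m \<omega>"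
      unfolding bp_def adv_0 by (rule follows_at_L[OF f levels_le_mn[OF n(2-4) m] fin])
    then show "real_cond_exp M (G (Suc j) j) (\<lambda>\<omega>. indicator B (piece (Suc j) \<omega>)) \<omega> = measure (P (bp j m \<omega>)) B"
      using elim(1) a(1) p by (simp add: tau_Suc t Let_def)
  qed
qed

text \<open>Excluding the lowest index ensures that, in a \<open>nice\<close> configuration, the
  copied particle exceeds the restart level, so that \<open>bp j m\<close> is its entrance
  point.\<close>

definition Dm :: "nat \<Rightarrow> nat \<Rightarrow> 'w set" where
  "Dm j m = {\<omega>\<in>D (Suc j). m \<noteq> low (\<theta> j \<omega>) \<and> pick (Suc j) \<omega> = m}"

lemma Dm_G: "Dm j m \<in> sets (G (Suc j) j)"
proof -
  have t: "\<theta> j \<in> G (Suc j) j \<rightarrow>\<^sub>M PS" by (rule G_measurable_mono[OF theta_G]) auto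
  have "{\<omega>\<in>space (G (Suc j) j). m \<noteq> low (\<theta> j \<omega>)} \<in> sets (G (Suc j) j)"
    using measurable_sets[OF measurable_compose[OF t low_measurable], of "- {m}"]
    by (simp add: vimage_def Int_def conj_commute eq_commute)
  moreover have "{\<omega>\<in>space (G (Suc j) j). pick (Suc j) \<omega> = m} \<in> sets (G (Suc j) j)"
    using measurable_sets[OF pick_G[of "Suc j" "Suc j" j], of "{m}"]
    by (simp add: vimage_def Int_def conj_commute)
  moreover have "D (Suc j) \<in> sets (G (Suc j) j)" using D_Suc_G G_mono[of j "Suc j" j j] by auto
  moreover have "Dm j m = D (Suc j) \<inter> {\<omega>\<in>space (G (Suc j) j). m \<noteq> low (\<theta> j \<omega>)} \<inter> {\<omega>\<in>space (G (Suc j) j). pick (Suc j) \<omega> = m}"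
    by (auto simp: Dm_def D_def space_G)
  ultimately show ?thesis by (simp add: sets.Int)
qed

lemma Dm_sets: "Dm j m \<in> sets M"
  using Dm_G[of j m] subalgebra_G[of "Suc j" j] unfolding subalgebra_def by blast

text \<open>The run prescribes the conditional probability of each single event for the new piece.
  Rectangles generate the pairs of configuration and piece, so a functional of both may be
  integrated over the piece with the configuration held fixed.\<close>

lemma piece_law:
  fixes F :: "(nat \<Rightarrow> 'e path) \<times> 'e path \<Rightarrow> real"
  assumes r: "ready j" and m: "m \<in> I"
    and F: "F \<in> borel_measurable (PS \<Otimes>\<^sub>M path_space)" "\<And>p. p \<in> space (PS \<Otimes>\<^sub>M path_space) \<Longrightarrow> \<bar>F p\<bar> \<le> c"
  shows "(\<integral>\<omega>. indicator (Dm j m) \<omega> * F (\<theta> j \<omega>, piece (Suc j) \<omega>) \<partial>M) =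
    (\<integral>\<omega>. indicator (Dm j m) \<omega> * (\<integral>z. F (\<theta> j \<omega>, z) \<partial>P (bp j m \<omega>)) \<partial>M)"
proof -
  \<comment> \<open>Conditional law of the pair: the configuration is already determined, and only
    the piece is random.\<close>
  define \<kappa> where "\<kappa> \<omega> = distr (P (bp j m \<omega>)) (PS \<Otimes>\<^sub>M path_space) (\<lambda>z. (\<theta> j \<omega>, z))" for \<omega>
  have bpM: "bp j m \<in> M \<rightarrow>\<^sub>M borel" by (rule G_measurable[OF bp_G[OF m]])
  have pm: "piece (Suc j) \<in> M \<rightarrow>\<^sub>M path_space" by (rule piece_measurable) simp
  have Pb: "(\<lambda>\<omega>. P (bp j m \<omega>)) \<in> M \<rightarrow>\<^sub>M prob_algebra path_space"
    by (rule measurable_compose[OF bpM kernel])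
  have "(\<lambda>(\<omega>, z). (\<theta> j \<omega>, z)) \<in> M \<Otimes>\<^sub>M path_space \<rightarrow>\<^sub>M PS \<Otimes>\<^sub>M path_space"
    unfolding split_beta' by (intro measurable_Pair measurable_compose[OF measurable_fst theta_measurable] measurable_snd)
  then have k: "\<kappa> \<in> M \<rightarrow>\<^sub>M prob_algebra (PS \<Otimes>\<^sub>M path_space)"
    unfolding \<kappa>_def[abs_def] by (rule measurable_distr_prob_space2[OF Pb])
  have pair: "(\<lambda>z. (\<theta> j \<omega>, z)) \<in> P y \<rightarrow>\<^sub>M PS \<Otimes>\<^sub>M path_space" if "\<omega> \<in> space M" for \<omega> y
    by (rule measurable_P[OF measurable_Pair1'[OF theta_space[OF that]]])
  have T: "(\<lambda>\<omega>. (\<theta> j \<omega>, piece (Suc j) \<omega>)) \<in> M \<rightarrow>\<^sub>M PS \<Otimes>\<^sub>M path_space"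
    by (rule measurable_Pair[OF theta_measurable pm])
  have "(\<integral>\<omega>. indicator (Dm j m) \<omega> * F (\<theta> j \<omega>, piece (Suc j) \<omega>) \<partial>M) =
      (\<integral>\<omega>. indicator (Dm j m) \<omega> * (\<integral>p. F p \<partial>\<kappa> \<omega>) \<partial>M)"
  proof (rule kernel_integral_eq[OF finite_measure_axioms T k Dm_sets _ Int_stable_pair_measure_generator _ _ _ F])
    show "sets (PS \<Otimes>\<^sub>M path_space) = sigma_sets (space (PS \<Otimes>\<^sub>M path_space))
        {a \<times> b | a b. a \<in> sets PS \<and> b \<in> sets path_space}"
      by (simp add: sets_pair_measure space_pair_measure)
    show "{a \<times> b | a b. a \<in> sets PS \<and> b \<in> sets path_space} \<subseteq> Pow (space (PS \<Otimes>\<^sub>M path_space))"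
      unfolding space_pair_measure by (rule pair_measure_closed)
    show "space (PS \<Otimes>\<^sub>M path_space) \<in> {a \<times> b | a b. a \<in> sets PS \<and> b \<in> sets path_space}"
      unfolding space_pair_measure by blast
    fix R :: "((nat \<Rightarrow> 'e path) \<times> 'e path) set" assume "R \<in> {a \<times> b | a b. a \<in> sets PS \<and> b \<in> sets path_space}"
    then obtain a b where R: "R = a \<times> b" "a \<in> sets PS" "b \<in> sets path_space" by auto
    interpret S: sigma_finite_subalgebra M "G (Suc j) j" by (rule G_cond)
    let ?f = "\<lambda>\<omega>. indicator (Dm j m) \<omega> * indicator a (\<theta> j \<omega>) :: real"
    let ?g = "\<lambda>\<omega>. indicator b (piece (Suc j) \<omega>) :: real"
    have t: "\<theta> j \<in> G (Suc j) j \<rightarrow>\<^sub>M PS" by (rule G_measurable_mono[OF theta_G]) auto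
    have f: "?f \<in> borel_measurable (G (Suc j) j)"
      by (intro borel_measurable_times borel_measurable_indicator Dm_G measurable_compose[OF t borel_measurable_indicator[OF R(2)]])
    have g: "?g \<in> borel_measurable M" by (rule measurable_compose[OF pm borel_measurable_indicator[OF R(3)]])
    have fM: "?f \<in> borel_measurable M" by (rule G_measurable[OF f])
    have "(\<integral>\<omega>. indicator (Dm j m) \<omega> * indicator R (\<theta> j \<omega>, piece (Suc j) \<omega>) \<partial>M) = (\<integral>\<omega>. ?f \<omega> * ?g \<omega> \<partial>M)"
      by (intro Bochner_Integration.integral_cong refl) (simp add: R(1) indicator_times)
    also have "\<dots> = (\<integral>\<omega>. ?f \<omega> * real_cond_exp M (G (Suc j) j) ?g \<omega> \<partial>M)"
    proof (rule S.real_cond_exp_intg(2)[OF integrable_M[where c=1] f g, symmetric])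
      show "(\<lambda>\<omega>. ?f \<omega> * ?g \<omega>) \<in> borel_measurable M" by (rule borel_measurable_times[OF fM g])
    qed (simp split: split_indicator)
    also have "\<dots> = (\<integral>\<omega>. ?f \<omega> * measure (P (bp j m \<omega>)) b \<partial>M)"
    proof (rule integral_cong_AE)
      show "(\<lambda>\<omega>. ?f \<omega> * real_cond_exp M (G (Suc j) j) ?g \<omega>) \<in> borel_measurable M"
        by (rule borel_measurable_times[OF fM borel_measurable_cond_exp2])
      show "(\<lambda>\<omega>. ?f \<omega> * measure (P (bp j m \<omega>)) b) \<in> borel_measurable M"
        by (rule borel_measurable_times[OF fM measurable_compose[OF Pb measurable_measure_prob_algebra[OF R(3)]]])
      show "AE \<omega> in M. ?f \<omega> * real_cond_exp M (G (Suc j) j) ?g \<omega> = ?f \<omega> * measure (P (bp j m \<omega>)) b"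
        using AE_piece[OF r R(3) m]
      proof eventually_elim
        case (elim \<omega>)
        show ?case
        proof (cases "\<omega> \<in> Dm j m")
          case True
          then have "\<omega> \<in> D (Suc j)" "m \<noteq> low (\<theta> j \<omega>)" "pick (Suc j) \<omega> = m" by (auto simp: Dm_def)
          from elim[rule_format, OF this] show ?thesis by (simp only:)
        qed simp
      qed
    qed
    also have "\<dots> = (\<integral>\<omega>. indicator (Dm j m) \<omega> * measure (\<kappa> \<omega>) R \<partial>M)"
    proof (intro Bochner_Integration.integral_cong refl)
      fix \<omega> assume w: "\<omega> \<in> space M"
      have "measure (\<kappa> \<omega>) R = measure (P (bp j m \<omega>)) ((\<lambda>z. (\<theta> j \<omega>, z)) -` R \<inter> space (P (bp j m \<omega>)))"
        unfolding \<kappa>_def using R by (intro measure_distr[OF pair[OF w]]) auto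
      also have "(\<lambda>z. (\<theta> j \<omega>, z)) -` R \<inter> space (P (bp j m \<omega>)) = (if \<theta> j \<omega> \<in> a then b else {})"
        using sets.sets_into_space[OF R(3)] by (auto simp: R(1))
      finally show "indicator (Dm j m) \<omega> * indicator a (\<theta> j \<omega>) * measure (P (bp j m \<omega>)) b =
          indicator (Dm j m) \<omega> * measure (\<kappa> \<omega>) R" by simp
    qed
    finally show "(\<integral>\<omega>. indicator (Dm j m) \<omega> * indicator R (\<theta> j \<omega>, piece (Suc j) \<omega>) \<partial>M) =
      (\<integral>\<omega>. indicator (Dm j m) \<omega> * measure (\<kappa> \<omega>) R \<partial>M)" .
  qed
  also have "\<dots> = (\<integral>\<omega>. indicator (Dm j m) \<omega> * (\<integral>z. F (\<theta> j \<omega>, z) \<partial>P (bp j m \<omega>)) \<partial>M)"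
    unfolding \<kappa>_def by (intro Bochner_Integration.integral_cong refl) (simp add: integral_distr[OF pair F(1)])
  finally show ?thesis .
qed

text \<open>The prescribed conditional probabilities of the indices other than the lowest sum to 1.
  Hence almost surely the pick is one of them, although \<open>pick\<close> may take any natural
  number as value.\<close>

lemma AE_Dm:
  assumes r: "ready j"
  shows "AE \<omega> in M. \<omega> \<in> D (Suc j) \<longrightarrow> (\<exists>m\<in>I. \<omega> \<in> Dm j m)"
proof -
  have t: "\<theta> j \<in> M \<rightarrow>\<^sub>M PS" by (rule theta_measurable)
  have "measure M (Dm j m) = (\<integral>\<omega>. indicator (D (Suc j)) \<omega> * (if m = low (\<theta> j \<omega>) then 0 else 1 / (real N - 1)) \<partial>M)"
    if m: "m \<in> I" for m
  proof -
    let ?U = "\<lambda>\<omega>. if m = low (\<theta> j \<omega>) then 0 else 1 :: real"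
    have U: "?U \<in> borel_measurable (G j j)"
      by (rule measurable_compose[OF measurable_compose[OF theta_G low_measurable]]) simp
    have "measure M (Dm j m) = (\<integral>\<omega>. indicator (Dm j m) \<omega> \<partial>M)" using Dm_sets by simp
    also have "\<dots> = (\<integral>\<omega>. indicator (D (Suc j)) \<omega> * ?U \<omega> * indicator {m} (pick (Suc j) \<omega>) \<partial>M)"
      by (intro Bochner_Integration.integral_cong refl) (auto simp: Dm_def indicator_def)
    also have "\<dots> = (\<integral>\<omega>. indicator (D (Suc j)) \<omega> * ?U \<omega> * (if m = low (\<theta> j \<omega>) then 0 else 1 / (real N - 1)) \<partial>M)"
      by (rule pick_law[OF r m U, of 1]) simp
    also have "\<dots> = (\<integral>\<omega>. indicator (D (Suc j)) \<omega> * (if m = low (\<theta> j \<omega>) then 0 else 1 / (real N - 1)) \<partial>M)"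
      by (intro Bochner_Integration.integral_cong refl) auto
    finally show ?thesis .
  qed
  then have "(\<Sum>m\<in>I. measure M (Dm j m)) = (\<Sum>m\<in>I. \<integral>\<omega>. indicator (D (Suc j)) \<omega> * (if m = low (\<theta> j \<omega>) then 0 else 1 / (real N - 1)) \<partial>M)"
    by (intro sum.cong refl)
  also have "\<dots> = (\<integral>\<omega>. (\<Sum>m\<in>I. indicator (D (Suc j)) \<omega> * (if m = low (\<theta> j \<omega>) then 0 else 1 / (real N - 1))) \<partial>M)"
  proof (rule Bochner_Integration.integral_sum[symmetric], rule integrable_M[where c="1 / (real N - 1)"])
    fix m
    have "(\<lambda>\<omega>. if m = low (\<theta> j \<omega>) then 0 else 1 / (real N - 1)) \<in> borel_measurable M"
      by (rule measurable_compose[OF measurable_compose[OF theta_measurable low_measurable]]) simp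
    then show "(\<lambda>\<omega>. indicator (D (Suc j)) \<omega> * (if m = low (\<theta> j \<omega>) then 0 else 1 / (real N - 1))) \<in> borel_measurable M"
      by (intro borel_measurable_times borel_measurable_indicator D_sets)
  qed (use N2 in \<open>auto split: split_indicator\<close>)
  also have "\<dots> = (\<integral>\<omega>. indicator (D (Suc j)) \<omega> \<partial>M)"
  proof (intro Bochner_Integration.integral_cong refl)
    fix \<omega>
    have "(\<Sum>m\<in>I. if m = low (\<theta> j \<omega>) then 0 else 1 / (real N - 1)) = (\<Sum>m\<in>I - {low (\<theta> j \<omega>)}. 1 / (real N - 1))"
      using low_in[of "\<theta> j \<omega>"] by (subst sum.remove[of I "low (\<theta> j \<omega>)"]) (auto intro!: sum.cong)
    also have "\<dots> = 1" using card_remove[OF low_in[of "\<theta> j \<omega>"]] N2 by (simp add: of_nat_diff)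
    finally show "(\<Sum>m\<in>I. indicator (D (Suc j)) \<omega> * (if m = low (\<theta> j \<omega>) then 0 else 1 / (real N - 1))) = indicator (D (Suc j)) \<omega>"
      by (simp only: sum_distrib_left[symmetric] mult_1_right)
  qed
  also have "\<dots> = measure M (D (Suc j))" using D_sets by simp
  finally have s: "(\<Sum>m\<in>I. measure M (Dm j m)) = measure M (D (Suc j))" .
  have dis: "disjoint_family_on (Dm j) I" by (auto simp: disjoint_family_on_def Dm_def)
  have "measure M (\<Union>m\<in>I. Dm j m) = measure M (D (Suc j))"
    unfolding s[symmetric] using Dm_sets by (intro finite_measure_finite_Union dis) auto
  moreover have sub: "(\<Union>m\<in>I. Dm j m) \<subseteq> D (Suc j)" by (auto simp: Dm_def)
  moreover have Us: "(\<Union>m\<in>I. Dm j m) \<in> sets M" using Dm_sets by (intro sets.finite_UN) auto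
  ultimately have "measure M (D (Suc j) - (\<Union>m\<in>I. Dm j m)) = 0"
    using finite_measure_Diff[OF D_sets Us sub] by simp
  then have "D (Suc j) - (\<Union>m\<in>I. Dm j m) \<in> null_sets M"
    using D_sets Us by (simp add: null_sets_def emeasure_eq_measure sets.Diff)
  then have "AE \<omega> in M. \<omega> \<notin> D (Suc j) - (\<Union>m\<in>I. Dm j m)" by (rule AE_not_in)
  then show ?thesis by eventually_elim auto
qed

text \<open>The exceptional set involves both the configuration and the piece, so
  \<open>piece_law\<close> is applied to its indicator; under \<open>P y\<close> paths start at
  \<open>y\<close>.\<close>

lemma AE_piece_start:
  assumes r: "ready j" and m: "m \<in> I"
  shows "AE \<omega> in M. \<omega> \<in> Dm j m \<longrightarrow> piece (Suc j) \<omega> 0 = bp j m \<omega>"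
proof -
  define X where "X = {p\<in>space (PS \<Otimes>\<^sub>M path_space). snd p 0 \<noteq> adv (mn (fst p)) (fst p m) 0}"
  have X: "X \<in> sets (PS \<Otimes>\<^sub>M path_space)"
  proof -
    have 1: "(\<lambda>p. snd p 0 :: 'e) \<in> borel_measurable (PS \<Otimes>\<^sub>M path_space)"
      by (rule measurable_compose[OF measurable_snd measurable_at_0])
    have 2: "(\<lambda>p. adv (mn (fst p)) (fst p m) 0) \<in> borel_measurable (PS \<Otimes>\<^sub>M path_space)"
      by (rule measurable_compose[OF measurable_fst measurable_compose[OF adv_mn_measurable[OF m] measurable_at_0]])
    \<comment> \<open>Equality of points is expressed by a real-valued distance to obtain
      measurability.\<close>
    have "X = {p\<in>space (PS \<Otimes>\<^sub>M path_space). \<not> dist (snd p 0) (adv (mn (fst p)) (fst p m) 0) = 0}"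
      unfolding X_def by simp
    also have "\<dots> \<in> sets (PS \<Otimes>\<^sub>M path_space)"
      by (rule sets.sets_Collect_neg[OF borel_measurable_eq[OF borel_measurable_dist[OF 1 2] borel_measurable_const]])
    finally show ?thesis .
  qed
  have pm: "piece (Suc j) \<in> M \<rightarrow>\<^sub>M path_space" by (rule piece_measurable) simp
  let ?f = "\<lambda>\<omega>. indicator (Dm j m) \<omega> * indicator X (\<theta> j \<omega>, piece (Suc j) \<omega>) :: real"
  have fm: "?f \<in> borel_measurable M"
    by (intro borel_measurable_times borel_measurable_indicator Dm_sets
        measurable_compose[OF measurable_Pair[OF theta_measurable pm] borel_measurable_indicator[OF X]])
  have "(\<integral>\<omega>. ?f \<omega> \<partial>M) = (\<integral>\<omega>. indicator (Dm j m) \<omega> * (\<integral>z. indicator X (\<theta> j \<omega>, z) \<partial>P (bp j m \<omega>)) \<partial>M)"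
    by (rule piece_law[OF r m borel_measurable_indicator[OF X], of 1]) (simp split: split_indicator)
  also have "\<dots> = (\<integral>\<omega>. 0 \<partial>M)"
  proof (intro Bochner_Integration.integral_cong refl)
    fix \<omega>
    have "AE z in P (bp j m \<omega>). (indicator X (\<theta> j \<omega>, z) :: real) = 0"
      using start[of "bp j m \<omega>"] by eventually_elim (simp add: X_def bp_def)
    then have "(\<integral>z. indicator X (\<theta> j \<omega>, z) \<partial>P (bp j m \<omega>)) = (0::real)" by (rule integral_eq_zero_AE)
    then show "indicator (Dm j m) \<omega> * (\<integral>z. indicator X (\<theta> j \<omega>, z) \<partial>P (bp j m \<omega>)) = (0::real)"
      by (simp only: mult_zero_right)
  qed
  finally have "(\<integral>\<omega>. ?f \<omega> \<partial>M) = 0" by simp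
  moreover have "integrable M ?f" using fm by (rule integrable_M[where c=1]) (simp split: split_indicator)
  ultimately have "AE \<omega> in M. ?f \<omega> = 0"
    by (subst (asm) integral_nonneg_eq_0_iff_AE) (auto split: split_indicator)
  then show ?thesis
    using AE_space[of M]
  proof eventually_elim
    case (elim \<omega>)
    then show ?case
      using theta_space[OF elim(2)] measurable_space[OF pm elim(2)]
      by (auto simp: X_def bp_def space_pair_measure split: split_indicator_asm)
  qed
qed

text \<open>Decomposition by the copied index: \<open>piece_law\<close> integrates the new piece for
  a given pick, and \<open>pick_law\<close> then averages over the pick.\<close>

lemma one_step:
  assumes r: "ready j" and F: "F \<in> borel_measurable PS" "\<And>w. w \<in> space PS \<Longrightarrow> \<bar>F w\<bar> \<le> c"
  shows "(\<integral>\<omega>. indicator (D (Suc j)) \<omega> * F (\<theta> (Suc j) \<omega>) \<partial>M) = (\<integral>\<omega>. S F (\<theta> j \<omega>) \<partial>M)"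
proof -
  define E where "E m \<omega> = (\<integral>z. F (move z (\<theta> j \<omega>)) \<partial>P (bp j m \<omega>))" for m \<omega>
  have pm: "piece (Suc j) \<in> M \<rightarrow>\<^sub>M path_space" by (rule piece_measurable) simp
  have c: "0 \<le> c" using F(2)[OF theta_space] not_empty by fastforce
  have mF: "(\<lambda>p. F (move (snd p) (fst p))) \<in> borel_measurable (PS \<Otimes>\<^sub>M path_space)"
    by (rule measurable_compose[OF move_measurable F(1)])
  have bF: "\<bar>F (move z w)\<bar> \<le> c" if "w \<in> space PS" "z \<in> space path_space" for w z
    by (rule F(2)[OF move_space[OF that]])
  have bF': "\<bar>F (move (snd p) (fst p))\<bar> \<le> c" if "p \<in> space (PS \<Otimes>\<^sub>M path_space)" for p
    using that by (intro bF) (auto simp: space_pair_measure)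
  have EG: "E m \<in> borel_measurable (G j j)" if m: "m \<in> I" for m
  proof -
    have "(\<lambda>w. \<integral>z. F (move z w) \<partial>P (adv (mn w) (w m) 0)) \<in> borel_measurable PS"
      using mF by (intro measurable_kernel_integral2[OF Pmn_measurable[OF m]]) (simp add: split_beta')
    from measurable_compose[OF theta_G this] show ?thesis by (simp add: E_def[abs_def] bp_def)
  qed
  have Eb: "\<bar>E m \<omega>\<bar> \<le> c" if "\<omega> \<in> space M" for m \<omega>
    unfolding E_def by (intro abs_E_le bF theta_space that)
  have tS: "(\<lambda>\<omega>. F (\<theta> (Suc j) \<omega>)) \<in> borel_measurable M" by (rule measurable_compose[OF theta_measurable F(1)])
  have fam: "(\<lambda>\<omega>. indicator (Dm j m) \<omega> * F (\<theta> (Suc j) \<omega>)) \<in> borel_measurable M" for m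
    by (intro borel_measurable_times borel_measurable_indicator Dm_sets tS)
  have "(\<integral>\<omega>. indicator (D (Suc j)) \<omega> * F (\<theta> (Suc j) \<omega>) \<partial>M) =
      (\<integral>\<omega>. (\<Sum>m\<in>I. indicator (Dm j m) \<omega> * F (\<theta> (Suc j) \<omega>)) \<partial>M)"
  proof (rule integral_cong_AE)
    show "AE \<omega> in M. indicator (D (Suc j)) \<omega> * F (\<theta> (Suc j) \<omega>) = (\<Sum>m\<in>I. indicator (Dm j m) \<omega> * F (\<theta> (Suc j) \<omega>))"
      using AE_Dm[OF r]
    proof eventually_elim
      case (elim \<omega>)
      show ?case
      proof (cases "\<omega> \<in> D (Suc j)")
        case True
        then obtain m where m: "m \<in> I" "\<omega> \<in> Dm j m" using elim by blast
        then have "indicator (Dm j k) \<omega> = (if k = m then 1 else 0 :: real)" for k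
          by (auto simp: Dm_def indicator_def)
        then have "(\<Sum>k\<in>I. indicator (Dm j k) \<omega> * F (\<theta> (Suc j) \<omega>)) = (\<Sum>k\<in>I. if k = m then F (\<theta> (Suc j) \<omega>) else 0)"
          by (intro sum.cong refl) (simp del: \<theta>.simps)
        then show ?thesis using True m by (simp del: \<theta>.simps)
      next
        case False
        then have "\<omega> \<notin> Dm j m" for m by (auto simp: Dm_def)
        then show ?thesis using False by simp
      qed
    qed
  qed (intro borel_measurable_sum fam borel_measurable_times borel_measurable_indicator D_sets tS)+
  also have "\<dots> = (\<Sum>m\<in>I. \<integral>\<omega>. indicator (Dm j m) \<omega> * F (\<theta> (Suc j) \<omega>) \<partial>M)"
  proof (rule Bochner_Integration.integral_sum, rule integrable_M[OF fam])
    show "\<bar>indicator (Dm j m) \<omega> * F (\<theta> (Suc j) \<omega>)\<bar> \<le> c" if "\<omega> \<in> space M" for m \<omega>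
      using F(2)[OF theta_space[OF that]] c by (auto split: split_indicator)
  qed
  also have "\<dots> = (\<Sum>m\<in>I. \<integral>\<omega>. indicator (D (Suc j)) \<omega> * (if m = low (\<theta> j \<omega>) then 0 else E m \<omega>) / (real N - 1) \<partial>M)"
  proof (intro sum.cong refl)
    fix m assume m: "m \<in> I"
    let ?U = "\<lambda>\<omega>. if m = low (\<theta> j \<omega>) then 0 else E m \<omega>"
    have U: "?U \<in> borel_measurable (G j j)"
    proof (rule measurable_If)
      show "{\<omega>\<in>space (G j j). m = low (\<theta> j \<omega>)} \<in> sets (G j j)"
        using measurable_sets[OF measurable_compose[OF theta_G low_measurable], of "{m}" j]
        by (simp add: vimage_def Int_def conj_commute eq_commute)
    qed (simp_all add: EG[OF m])
    have "(\<integral>\<omega>. indicator (Dm j m) \<omega> * F (\<theta> (Suc j) \<omega>) \<partial>M) =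
        (\<integral>\<omega>. indicator (Dm j m) \<omega> * F (move (piece (Suc j) \<omega>) (\<theta> j \<omega>)) \<partial>M)"
      by (intro Bochner_Integration.integral_cong refl) (auto simp: Dm_def D_def act_Suc \<theta>.simps(2) split: split_indicator)
    also have "\<dots> = (\<integral>\<omega>. indicator (Dm j m) \<omega> * E m \<omega> \<partial>M)"
      using piece_law[OF r m mF bF'] by (simp add: E_def)
    also have "\<dots> = (\<integral>\<omega>. indicator (D (Suc j)) \<omega> * ?U \<omega> * indicator {m} (pick (Suc j) \<omega>) \<partial>M)"
      by (intro Bochner_Integration.integral_cong refl) (auto simp: Dm_def indicator_def)
    also have "\<dots> = (\<integral>\<omega>. indicator (D (Suc j)) \<omega> * ?U \<omega> * (if m = low (\<theta> j \<omega>) then 0 else 1 / (real N - 1)) \<partial>M)"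
    proof (rule pick_law[OF r m U])
      show "\<bar>if m = low (\<theta> j \<omega>) then 0 else E m \<omega>\<bar> \<le> c" if "\<omega> \<in> space M" for \<omega>
        using Eb[OF that, of m] c by simp
    qed
    also have "\<dots> = (\<integral>\<omega>. indicator (D (Suc j)) \<omega> * ?U \<omega> / (real N - 1) \<partial>M)"
      by (intro Bochner_Integration.integral_cong refl) auto
    finally show "(\<integral>\<omega>. indicator (Dm j m) \<omega> * F (\<theta> (Suc j) \<omega>) \<partial>M) =
      (\<integral>\<omega>. indicator (D (Suc j)) \<omega> * ?U \<omega> / (real N - 1) \<partial>M)" .
  qed
  also have "\<dots> = (\<integral>\<omega>. (\<Sum>m\<in>I. indicator (D (Suc j)) \<omega> * (if m = low (\<theta> j \<omega>) then 0 else E m \<omega>) / (real N - 1)) \<partial>M)"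
  proof (rule Bochner_Integration.integral_sum[symmetric])
    fix m assume m: "m \<in> I"
    have U: "(\<lambda>\<omega>. if m = low (\<theta> j \<omega>) then 0 else E m \<omega>) \<in> borel_measurable M"
    proof (rule measurable_If)
      show "{\<omega>\<in>space M. m = low (\<theta> j \<omega>)} \<in> sets M"
        using measurable_sets[OF measurable_compose[OF theta_measurable low_measurable], of "{m}" j]
        by (simp add: vimage_def Int_def conj_commute eq_commute)
    qed (simp_all add: G_measurable[OF EG[OF m]])
    have "integrable M (\<lambda>\<omega>. indicator (D (Suc j)) \<omega> * (if m = low (\<theta> j \<omega>) then 0 else E m \<omega>))"
    proof (rule integrable_M[where c=c])
      show "(\<lambda>\<omega>. indicator (D (Suc j)) \<omega> * (if m = low (\<theta> j \<omega>) then 0 else E m \<omega>)) \<in> borel_measurable M"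
        by (intro borel_measurable_times borel_measurable_indicator D_sets U)
      show "\<bar>indicator (D (Suc j)) \<omega> * (if m = low (\<theta> j \<omega>) then 0 else E m \<omega>)\<bar> \<le> c" if "\<omega> \<in> space M" for \<omega>
        using Eb[OF that, of m] c by (auto split: split_indicator)
    qed
    then show "integrable M (\<lambda>\<omega>. indicator (D (Suc j)) \<omega> * (if m = low (\<theta> j \<omega>) then 0 else E m \<omega>) / (real N - 1))"
      by (rule integrable_divide_zero)
  qed
  also have "\<dots> = (\<integral>\<omega>. S F (\<theta> j \<omega>) \<partial>M)"
  proof (intro Bochner_Integration.integral_cong refl)
    fix \<omega> assume w: "\<omega> \<in> space M"
    show "(\<Sum>m\<in>I. indicator (D (Suc j)) \<omega> * (if m = low (\<theta> j \<omega>) then 0 else E m \<omega>) / (real N - 1)) = S F (\<theta> j \<omega>)"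
    proof (cases "mn (\<theta> j \<omega>) < 1")
      case True
      then have "\<omega> \<in> D (Suc j)" using w by (simp add: D_def act_Suc)
      moreover have "S F (\<theta> j \<omega>) = (\<Sum>m\<in>I. if m = low (\<theta> j \<omega>) then 0 else E m \<omega>) / (real N - 1)"
        unfolding S_def E_def bp_def using True by simp
      ultimately show ?thesis by (simp add: sum_divide_distrib)
    next
      case False
      then have "\<omega> \<notin> D (Suc j)" by (simp add: D_def act_Suc)
      then show ?thesis using False by (simp add: S_def)
    qed
  qed
  finally show ?thesis .
qed

end

context ams_particles
begin

section \<open>Closure properties of the bounded test functions\<close>

lemma obs_add: "F \<in> obs \<Longrightarrow> G \<in> obs \<Longrightarrow> (\<lambda>w. F w + G w) \<in> obs"
proof -
  assume F: "F \<in> obs" and G: "G \<in> obs"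
  obtain c where c: "\<And>w. w \<in> space PS \<Longrightarrow> \<bar>F w\<bar> \<le> c" using obs_bound[OF F] by blast
  obtain d where d: "\<And>w. w \<in> space PS \<Longrightarrow> \<bar>G w\<bar> \<le> d" using obs_bound[OF G] by blast
  show ?thesis
    by (rule obsI[where c="c + d"])
      (use c d obs_measurable[OF F] obs_measurable[OF G] in \<open>auto intro: order_trans[OF abs_triangle_ineq add_mono]\<close>)
qed

lemma obs_scale: "F \<in> obs \<Longrightarrow> (\<lambda>w. a * F w) \<in> obs"
proof -
  assume F: "F \<in> obs"
  obtain c where c: "\<And>w. w \<in> space PS \<Longrightarrow> \<bar>F w\<bar> \<le> c" using obs_bound[OF F] by blast
  show ?thesis
    by (rule obsI[where c="\<bar>a\<bar> * c"])
      (use c obs_measurable[OF F] in \<open>auto simp: abs_mult intro: mult_left_mono\<close>)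
qed

lemma obs_stopped:
  assumes "F \<in> obs" shows "(\<lambda>w. indicator {w. 1 \<le> mn w} w * F w) \<in> obs"
proof -
  obtain c where c: "0 \<le> c" "\<And>w. w \<in> space PS \<Longrightarrow> \<bar>F w\<bar> \<le> c" using obs_bound[OF assms] by blast
  show ?thesis
    by (rule obsI[OF borel_measurable_times[OF stopped_measurable obs_measurable[OF assms]], of c])
      (use c in \<open>auto split: split_indicator\<close>)
qed

lemma obs_S:
  assumes "F \<in> obs" shows "S F \<in> obs"
proof -
  obtain c where c: "\<And>w. w \<in> space PS \<Longrightarrow> \<bar>F w\<bar> \<le> c" using obs_bound[OF assms] by blast
  show ?thesis by (rule obsI[OF S_measurable[OF obs_measurable[OF assms]] S_bound[OF c]])
qed

lemma KE_measurable: "F \<in> obs \<Longrightarrow> (\<lambda>x. \<integral>v. F v \<partial>K x) \<in> borel_measurable ES"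
  by (rule measurable_kernel_integral[OF K_kernel obs_measurable])

lemma obs_st:
  assumes "f \<in> borel_measurable ES" "\<And>x. \<bar>f x\<bar> \<le> c" shows "(\<lambda>w. f (st w)) \<in> obs"
  by (rule obsI[OF measurable_compose[OF st_measurable assms(1)] assms(2)])

lemma obs_KE:
  assumes "F \<in> obs" shows "(\<lambda>w. \<integral>v. F v \<partial>K (st w)) \<in> obs"
proof -
  obtain c where c: "0 \<le> c" "\<And>w. w \<in> space PS \<Longrightarrow> \<bar>F w\<bar> \<le> c" using obs_bound[OF assms] by blast
  show ?thesis
    by (rule obs_st[OF KE_measurable[OF assms] abs_integral_le[OF prob_K]]) (use c in auto)
qed

lemma obs_Gm: "Gm \<in> obs" and obs_Hm: "(\<lambda>w. Hm (st w)) \<in> obs" and obs_V: "(\<lambda>w. V (st w)) \<in> obs"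
  and obs_Gm2: "(\<lambda>w. (Gm w)\<^sup>2) \<in> obs"
proof -
  show "Gm \<in> obs" by (rule obsI[OF Gm_measurable Gm_le])
  show "(\<lambda>w. Hm (st w)) \<in> obs" by (rule obs_st[OF Hm_measurable Hm_le])
  show "(\<lambda>w. V (st w)) \<in> obs" by (rule obs_st[OF V_measurable V_le])
  show "(\<lambda>w. (Gm w)\<^sup>2) \<in> obs"
    by (rule obsI[where c="C\<^sup>2", OF borel_measurable_power[OF Gm_measurable]])
      (use power_mono[OF Gm_le abs_ge_zero, of _ 2] in simp)
qed

lemma prod_indicator_PiE:
  assumes "w \<in> space PS"
  shows "indicator (Pi\<^sub>E I B) w = (\<Prod>n\<in>I. indicator (B n) (w n) :: real)"
proof (cases "\<forall>n\<in>I. w n \<in> B n")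
  case True
  then have "w \<in> Pi\<^sub>E I B" using assms by (auto simp: space_PiM PiE_iff)
  moreover have "(\<Prod>n\<in>I. indicator (B n) (w n) :: real) = 1" using True by (intro prod.neutral) auto
  ultimately show ?thesis by simp
next
  case False
  then obtain n where n: "n \<in> I" "w n \<notin> B n" by blast
  then have "w \<notin> Pi\<^sub>E I B" by (auto simp: PiE_iff)
  moreover have "(\<Prod>n\<in>I. indicator (B n) (w n) :: real) = 0" using n by (intro prod_zero I_facts(1) bexI[of _ n]) auto
  ultimately show ?thesis by simp
qed

lemma obs_rect:
  assumes "\<And>n. n \<in> I \<Longrightarrow> B n \<in> sets path_space"
  shows "(\<lambda>w. \<Prod>n\<in>I. indicator (B n) (w n) :: real) \<in> obs"
proof (rule obsI[where c=1])
  show "(\<lambda>w. \<Prod>n\<in>I. indicator (B n) (w n) :: real) \<in> borel_measurable PS"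
    by (intro borel_measurable_prod measurable_compose[OF measurable_component borel_measurable_indicator] assms)
  show "\<bar>\<Prod>n\<in>I. indicator (B n) (w n) :: real\<bar> \<le> 1" for w :: "nat \<Rightarrow> 'e path"
    using prod_abs_le[of I "\<lambda>n. indicator (B n) (w n)" 1] by simp
qed

lemma K_rect:
  assumes "\<And>n. n \<in> I \<Longrightarrow> B n \<in> sets path_space"
  shows "measure (K x) (Pi\<^sub>E I B) = (\<Prod>n\<in>I. measure (P (x n)) (B n))"
proof -
  have "Pi\<^sub>E I B \<in> sets PS" by (rule sets_PiM_I_finite[OF I_facts(1) assms])
  then have "measure (K x) (Pi\<^sub>E I B) = (\<integral>w. indicator (Pi\<^sub>E I B) w \<partial>K x)" by simp
  also have "\<dots> = (\<integral>w. (\<Prod>n\<in>I. indicator (B n) (w n)) \<partial>K x)"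
    by (intro Bochner_Integration.integral_cong refl prod_indicator_PiE) simp
  also have "\<dots> = (\<Prod>n\<in>I. \<integral>z. indicator (B n) z \<partial>P (x n))"
    unfolding K_def using assms
    by (intro PiM_integral_prod[OF prob_P, where c="\<lambda>_. 1"]) (auto intro!: measurable_P)
  finally show ?thesis using assms by simp
qed

lemma measure_P_measurable: "B \<in> sets path_space \<Longrightarrow> (\<lambda>y. measure (P y) B) \<in> borel_measurable borel"
  by (rule measurable_compose[OF kernel measurable_measure_prob_algebra])

lemma rect_measure:
  assumes B: "\<And>n. n \<in> I \<Longrightarrow> B n \<in> sets path_space"
  shows "(\<lambda>x. \<Prod>n\<in>I. measure (P (x n)) (B n)) \<in> borel_measurable ES"
    "\<bar>\<Prod>n\<in>I. measure (P (x n)) (B n)\<bar> \<le> 1"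
proof -
  show "(\<lambda>x. \<Prod>n\<in>I. measure (P (x n)) (B n)) \<in> borel_measurable ES"
  proof (rule borel_measurable_prod)
    fix n assume n: "n \<in> I"
    from n have "(\<lambda>x. x n) \<in> ES \<rightarrow>\<^sub>M borel" by (rule measurable_component_singleton)
    then show "(\<lambda>x. measure (P (x n)) (B n)) \<in> borel_measurable ES"
      using measure_P_measurable[OF B[OF n]] by (rule measurable_compose)
  qed
  show "\<bar>\<Prod>n\<in>I. measure (P (x n)) (B n)\<bar> \<le> 1"
    using prod_abs_le[of I "\<lambda>n. measure (P (x n)) (B n)" 1] prob_space.prob_le_1[OF prob_P] by simp
qed

end

section \<open>The law of the particles\<close>

context ams_experiment
begin

definition mean :: "nat \<Rightarrow> ((nat \<Rightarrow> 'e path) \<Rightarrow> real) \<Rightarrow> real" where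
  "mean j F = (\<integral>\<omega>. indicator (D j) \<omega> * F (\<theta> j \<omega>) \<partial>M)"

text \<open>Independence of the remaining parts given their starting points, in integrated form: on
  the runs with \<open>j\<close> branchings, the distribution of \<open>\<theta> j\<close> is the
  mixture of the product laws \<open>K x\<close> over the starting points.\<close>

definition law :: "nat \<Rightarrow> bool" where
  "law j \<longleftrightarrow> (\<forall>F\<in>obs. mean j F = mean j (\<lambda>w. \<integral>v. F v \<partial>K (st w)))"

lemma integrable_mean:
  assumes F: "F \<in> obs" shows "integrable M (\<lambda>\<omega>. indicator (D j) \<omega> * F (\<theta> j \<omega>))"
proof -
  obtain c where c: "0 \<le> c" "\<And>w. w \<in> space PS \<Longrightarrow> \<bar>F w\<bar> \<le> c" using obs_bound[OF F] by blast
  show ?thesis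
  proof (rule integrable_M[where c=c])
    show "(\<lambda>\<omega>. indicator (D j) \<omega> * F (\<theta> j \<omega>)) \<in> borel_measurable M"
      by (intro borel_measurable_times borel_measurable_indicator D_sets
          measurable_compose[OF theta_measurable obs_measurable[OF F]])
    show "\<bar>indicator (D j) \<omega> * F (\<theta> j \<omega>)\<bar> \<le> c" if "\<omega> \<in> space M" for \<omega>
      using c(1) c(2)[OF theta_space[OF that]] by (auto split: split_indicator)
  qed
qed

lemma mean_add:
  assumes "F \<in> obs" "G' \<in> obs" shows "mean j (\<lambda>w. F w + G' w) = mean j F + mean j G'"
  unfolding mean_def distrib_left
  by (rule Bochner_Integration.integral_add[OF integrable_mean[OF assms(1)] integrable_mean[OF assms(2)]])

lemma mean_scale: "mean j (\<lambda>w. a * F w) = a * mean j F"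
  unfolding mean_def mult.left_commute[of _ a] by simp

lemma mean_mono:
  assumes "AE \<omega> in M. act j \<omega> \<longrightarrow> levels (st (\<theta> j \<omega>))" "F \<in> obs" "G' \<in> obs" "\<And>w. levels (st w) \<Longrightarrow> F w \<le> G' w"
  shows "mean j F \<le> mean j G'"
  unfolding mean_def
proof (rule integral_mono_AE[OF integrable_mean[OF assms(2)] integrable_mean[OF assms(3)]])
  show "AE \<omega> in M. indicator (D j) \<omega> * F (\<theta> j \<omega>) \<le> indicator (D j) \<omega> * G' (\<theta> j \<omega>)"
    using assms(1)
  proof eventually_elim
    case (elim \<omega>)
    then show ?case using assms(4)[of "\<theta> j \<omega>"] by (cases "\<omega> \<in> D j") (auto simp: D_def)
  qed
qed

lemma mean_cong:
  assumes "AE \<omega> in M. act j \<omega> \<longrightarrow> levels (st (\<theta> j \<omega>))" "F \<in> obs" "G' \<in> obs" "\<And>w. levels (st w) \<Longrightarrow> F w = G' w"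
  shows "mean j F = mean j G'"
proof (rule antisym)
  show "mean j F \<le> mean j G'" by (rule mean_mono[OF assms(1-3)]) (simp add: assms(4))
  show "mean j G' \<le> mean j F" by (rule mean_mono[OF assms(1,3,2)]) (simp add: assms(4))
qed

lemma mean_Suc:
  assumes r: "ready j" and l: "law j" and F: "F \<in> obs"
  shows "mean (Suc j) F = mean j (\<lambda>w. \<integral>v. S F v \<partial>K (st w))"
proof -
  obtain c where c: "\<And>w. w \<in> space PS \<Longrightarrow> \<bar>F w\<bar> \<le> c" using obs_bound[OF F] by blast
  have "mean (Suc j) F = (\<integral>\<omega>. S F (\<theta> j \<omega>) \<partial>M)"
    unfolding mean_def by (rule one_step[OF r obs_measurable[OF F] c])
  also have "\<dots> = mean j (S F)"
    unfolding mean_def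
  proof (intro Bochner_Integration.integral_cong refl)
    fix \<omega> assume "\<omega> \<in> space M"
    then show "S F (\<theta> j \<omega>) = indicator (D j) \<omega> * S F (\<theta> j \<omega>)"
      using act_SucD[of j \<omega>] by (cases "\<omega> \<in> D j") (auto simp: D_def act_Suc S_def)
  qed
  also have "\<dots> = mean j (\<lambda>w. \<integral>v. S F v \<partial>K (st w))"
    using l obs_S[OF F] unfolding law_def by blast
  finally show ?thesis .
qed

text \<open>Boxes form an intersection-stable generator of the product sigma-algebra, and
  \<open>K\<close> gives them the product of the single probabilities.\<close>

lemma law_rect:
  assumes rect: "\<And>B. (\<And>n. n \<in> I \<Longrightarrow> B n \<in> sets path_space) \<Longrightarrow>
    mean j (\<lambda>w. \<Prod>n\<in>I. indicator (B n) (w n)) = mean j (\<lambda>w. \<Prod>n\<in>I. measure (P (st w n)) (B n))"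
  shows "law j"
  unfolding law_def
proof
  fix F assume F: "F \<in> obs"
  obtain c where c: "\<And>w. w \<in> space PS \<Longrightarrow> \<bar>F w\<bar> \<le> c" using obs_bound[OF F] by blast
  have k: "(\<lambda>\<omega>. K (st (\<theta> j \<omega>))) \<in> M \<rightarrow>\<^sub>M prob_algebra PS"
    by (rule measurable_compose[OF measurable_compose[OF theta_measurable st_measurable] K_kernel])
  show "mean j F = mean j (\<lambda>w. \<integral>v. F v \<partial>K (st w))"
    unfolding mean_def
  proof (rule kernel_integral_eq[OF finite_measure_axioms theta_measurable k D_sets _ Int_stable_prod_algebra
        _ _ _ obs_measurable[OF F] c])
    show "sets PS = sigma_sets (space PS) (prod_algebra I (\<lambda>_. path_space :: 'e path measure))"
      by (simp add: sets_PiM space_PiM)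
    show "prod_algebra I (\<lambda>_. path_space :: 'e path measure) \<subseteq> Pow (space PS)"
      using prod_algebra_sets_into_space[of I "\<lambda>_. path_space :: 'e path measure"] by (simp add: space_PiM)
    show "space PS \<in> prod_algebra I (\<lambda>_. path_space :: 'e path measure)"
      unfolding space_PiM by (rule prod_algebraI_finite) auto
    fix X :: "(nat \<Rightarrow> 'e path) set" assume "X \<in> prod_algebra I (\<lambda>_. path_space)"
    then obtain B where B: "X = Pi\<^sub>E I B" "B \<in> (\<Pi> i\<in>I. sets path_space)"
      by (rule prod_algebraE_all)
    have Bs: "B n \<in> sets path_space" if "n \<in> I" for n using B(2) that by blast
    have kr: "measure (K x) (Pi\<^sub>E I B) = (\<Prod>n\<in>I. measure (P (x n)) (B n))" for x
      by (rule K_rect) (rule Bs)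
    have "(\<integral>\<omega>. indicator (D j) \<omega> * indicator X (\<theta> j \<omega>) \<partial>M) = mean j (\<lambda>w. \<Prod>n\<in>I. indicator (B n) (w n))"
      unfolding mean_def B(1)
      by (intro Bochner_Integration.integral_cong refl) (simp only: prod_indicator_PiE[OF theta_space])
    also have "\<dots> = mean j (\<lambda>w. \<Prod>n\<in>I. measure (P (st w n)) (B n))" by (rule rect[OF Bs])
    also have "\<dots> = (\<integral>\<omega>. indicator (D j) \<omega> * measure (K (st (\<theta> j \<omega>))) X \<partial>M)"
      unfolding mean_def B(1) kr ..
    finally show "(\<integral>\<omega>. indicator (D j) \<omega> * indicator X (\<theta> j \<omega>) \<partial>M) =
      (\<integral>\<omega>. indicator (D j) \<omega> * measure (K (st (\<theta> j \<omega>))) X \<partial>M)" .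
  qed
qed

text \<open>Both sides become means of one-step values by \<open>mean_Suc\<close>, the second for a
  function of the starting points only; on configurations with a common starting level
  \<open>S_rect\<close> makes them equal.\<close>

lemma law_Suc:
  assumes r: "ready j" and l: "law j" shows "law (Suc j)"
proof (rule law_rect)
  fix B :: "nat \<Rightarrow> 'e path set" assume B: "\<And>n. n \<in> I \<Longrightarrow> B n \<in> sets path_space"
  have lv: "AE \<omega> in M. act j \<omega> \<longrightarrow> levels (st (\<theta> j \<omega>))"
    using r unfolding ready_def by eventually_elim blast
  have o2: "(\<lambda>w. \<Prod>n\<in>I. measure (P (st w n)) (B n)) \<in> obs"
    by (rule obs_st[OF rect_measure[OF B]])
  have "mean (Suc j) (\<lambda>w. \<Prod>n\<in>I. indicator (B n) (w n)) =
      mean j (\<lambda>w. \<integral>v. S (\<lambda>w. \<Prod>n\<in>I. indicator (B n) (w n)) v \<partial>K (st w))"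
    by (rule mean_Suc[OF r l obs_rect[OF B]])
  also have "\<dots> = mean j (\<lambda>w. \<integral>v. S (\<lambda>w. \<Prod>n\<in>I. measure (P (st w n)) (B n)) v \<partial>K (st w))"
    by (rule mean_cong[OF lv obs_KE[OF obs_S[OF obs_rect[OF B]]] obs_KE[OF obs_S[OF o2]] S_rect[OF _ B]])
  also have "\<dots> = mean (Suc j) (\<lambda>w. \<Prod>n\<in>I. measure (P (st w n)) (B n))"
    by (rule mean_Suc[OF r l o2, symmetric])
  finally show "mean (Suc j) (\<lambda>w. \<Prod>n\<in>I. indicator (B n) (w n)) = mean (Suc j) (\<lambda>w. \<Prod>n\<in>I. measure (P (st w n)) (B n))" .
qed

section \<open>The initial configuration\<close>

definition \<pi> :: "'e path measure" where "\<pi> = \<eta>0 \<bind> P"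

lemma P_eta: "P \<in> \<eta>0 \<rightarrow>\<^sub>M prob_algebra path_space"
  using kernel eta0(2) by (simp cong: measurable_cong_sets)

lemma sets_pi[simp, measurable_cong]: "sets \<pi> = sets path_space"
  and prob_pi: "prob_space \<pi>"
proof -
  have ne: "space \<eta>0 \<noteq> {}" using eta0(1) by (rule prob_space.not_empty)
  show "sets \<pi> = sets path_space" unfolding \<pi>_def by (rule sets_bind[OF sets_P ne])
  have e: "\<eta>0 \<in> space (prob_algebra borel)" using eta0 by (simp add: space_prob_algebra)
  show "prob_space \<pi>" unfolding \<pi>_def by (rule prob_space_bind'[OF e kernel])
qed

lemma space_pi[simp]: "space \<pi> = space path_space"
  by (rule sets_eq_imp_space_eq) simp

lemma measurable_pi: "f \<in> path_space \<rightarrow>\<^sub>M R \<Longrightarrow> f \<in> \<pi> \<rightarrow>\<^sub>M R"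
  by (simp cong: measurable_cong_sets)

lemma integral_pi:
  fixes f :: "'e path \<Rightarrow> real"
  assumes f: "f \<in> borel_measurable path_space" "\<And>w. w \<in> space path_space \<Longrightarrow> \<bar>f w\<bar> \<le> c"
  shows "(\<integral>w. f w \<partial>\<pi>) = (\<integral>y. (\<integral>w. f w \<partial>P y) \<partial>\<eta>0)"
proof -
  interpret e: prob_space \<eta>0 by (rule eta0(1))
  show ?thesis unfolding \<pi>_def
  proof (rule integral_bind[where K=path_space and B'=1])
    show "\<bar>f w\<bar> \<le> c" if "w \<in> space path_space" for w by (rule f(2)[OF that])
    show "P \<in> \<eta>0 \<rightarrow>\<^sub>M subprob_algebra path_space" by (rule measurable_prob_algebraD[OF P_eta])
    show "AE x in \<eta>0. emeasure (P x) (space (P x)) \<le> ennreal 1"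
      by (rule AE_I2) (use prob_space.emeasure_space_1[OF prob_P] in simp)
  qed (use f(1) e.finite_measure_axioms in auto)
qed

lemma AE_pi:
  assumes "AE y in \<eta>0. AE w in P y. R w" "{w\<in>space path_space. R w} \<in> sets path_space"
  shows "AE w in \<pi>. R w"
  unfolding \<pi>_def
  by (subst AE_bind[OF measurable_prob_algebraD[OF P_eta]]) (use assms in \<open>auto simp: pred_def\<close>)

lemma distr_theta0: "distr M PS (\<theta> 0) = PiM I (\<lambda>_. \<pi>)"
proof -
  have ind: "indep_vars (\<lambda>_. path_space) Y0 I" and d: "\<And>n. n \<in> I \<Longrightarrow> distr M path_space (Y0 n) = \<pi>"
    using run by (auto simp: ams_run_def I_def \<pi>_def)
  have "distr M PS (\<lambda>\<omega>. \<lambda>n\<in>I. Y0 n \<omega>) = PiM I (\<lambda>n. distr M path_space (Y0 n))"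
    using ind by (subst (asm) indep_vars_iff_distr_eq_PiM') (auto intro: Y0_measurable)
  also have "\<dots> = PiM I (\<lambda>_. \<pi>)" by (intro PiM_cong refl d)
  finally show ?thesis by (subst \<theta>.simps(1)[abs_def])
qed

lemma mean_0:
  assumes "F \<in> obs" shows "mean 0 F = (\<integral>w. F w \<partial>PiM I (\<lambda>_. \<pi>))"
proof -
  have "mean 0 F = (\<integral>\<omega>. F (\<theta> 0 \<omega>) \<partial>M)"
    unfolding mean_def D_0 by (intro Bochner_Integration.integral_cong) auto
  also have "\<dots> = (\<integral>w. F w \<partial>PiM I (\<lambda>_. \<pi>))"
    unfolding distr_theta0[symmetric] by (rule integral_distr[OF theta_measurable obs_measurable[OF assms], symmetric])
  finally show ?thesis .
qed

lemma law_0: "law 0"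
proof (rule law_rect)
  fix B :: "nat \<Rightarrow> 'e path set" assume B: "\<And>n. n \<in> I \<Longrightarrow> B n \<in> sets path_space"
  have mB: "(\<lambda>w. measure (P (w 0)) (B n)) \<in> borel_measurable path_space" if "n \<in> I" for n
    by (rule measurable_compose[OF measurable_at_0 measure_P_measurable[OF B[OF that]]])
  have "(\<lambda>w. \<Prod>n\<in>I. measure (P (st w n)) (B n)) \<in> obs"
    by (rule obs_st[OF rect_measure[OF B]])
  then have "mean 0 (\<lambda>w. \<Prod>n\<in>I. measure (P (st w n)) (B n)) = (\<integral>w. (\<Prod>n\<in>I. measure (P (st w n)) (B n)) \<partial>PiM I (\<lambda>_. \<pi>))"
    by (rule mean_0)
  also have "\<dots> = (\<integral>w. (\<Prod>n\<in>I. measure (P (w n 0)) (B n)) \<partial>PiM I (\<lambda>_. \<pi>))"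
    by (simp add: st_def)
  also have "\<dots> = (\<Prod>n\<in>I. \<integral>w. measure (P (w 0)) (B n) \<partial>\<pi>)"
    using prob_space.prob_le_1[OF prob_P] mB
    by (intro PiM_integral_prod[OF prob_pi, where f="\<lambda>n w. measure (P (w 0)) (B n)" and c="\<lambda>_. 1"]) (auto intro!: measurable_pi)
  also have "\<dots> = (\<Prod>n\<in>I. \<integral>w. indicator (B n) w \<partial>\<pi>)"
  proof (intro prod.cong refl)
    fix n assume n: "n \<in> I"
    have "(\<integral>w. measure (P (w 0)) (B n) \<partial>\<pi>) = (\<integral>y. (\<integral>w. measure (P (w 0)) (B n) \<partial>P y) \<partial>\<eta>0)"
      using prob_space.prob_le_1[OF prob_P] by (intro integral_pi[OF mB[OF n], of 1]) auto
    also have "\<dots> = (\<integral>y. (\<integral>w. indicator (B n) w \<partial>P y) \<partial>\<eta>0)"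
    proof (rule Bochner_Integration.integral_cong[OF refl])
      fix y
      have "(\<integral>w. measure (P (w 0)) (B n) \<partial>P y) = (\<integral>w. measure (P y) (B n) \<partial>P y)"
        using start[of y] by (intro integral_cong_AE) (auto intro!: measurable_P mB n)
      also have "\<dots> = measure (P y) (B n)" by (simp add: prob_space.prob_space[OF prob_P, simplified])
      finally show "(\<integral>w. measure (P (w 0)) (B n) \<partial>P y) = (\<integral>w. indicator (B n) w \<partial>P y)" using B[OF n] by simp
    qed
    also have "\<dots> = (\<integral>w. indicator (B n) w \<partial>\<pi>)"
      by (intro integral_pi[symmetric, where c=1]) (use B[OF n] in \<open>auto split: split_indicator\<close>)
    finally show "(\<integral>w. measure (P (w 0)) (B n) \<partial>\<pi>) = (\<integral>w. indicator (B n) w \<partial>\<pi> :: real)" .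
  qed
  also have "\<dots> = (\<integral>w. (\<Prod>n\<in>I. indicator (B n) (w n)) \<partial>PiM I (\<lambda>_. \<pi>))"
    using B by (intro PiM_integral_prod[OF prob_pi, where c="\<lambda>_. 1", symmetric]) (auto intro!: measurable_pi)
  also have "\<dots> = mean 0 (\<lambda>w. \<Prod>n\<in>I. indicator (B n) (w n))"
    by (rule mean_0[OF obs_rect[OF B], symmetric])
  finally show "mean 0 (\<lambda>w. \<Prod>n\<in>I. indicator (B n) (w n)) = mean 0 (\<lambda>w. \<Prod>n\<in>I. measure (P (st w n)) (B n))" by simp
qed

text \<open>The part of \<open>ready\<close> that is proved trajectory by trajectory; the remaining
  condition \<open>nice\<close> comes from the law of the configuration.\<close>

definition tracked :: "nat \<Rightarrow> bool" where
  "tracked j \<longleftrightarrow> (AE \<omega> in M. act j \<omega> \<longrightarrow> follow_all (Y j \<omega>) (\<theta> j \<omega>) \<and> levels (st (\<theta> j \<omega>)))"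

lemma AE_Y0:
  assumes "n \<in> I" "AE w in \<pi>. R w" shows "AE \<omega> in M. R (Y0 n \<omega>)"
proof -
  have "distr M path_space (Y0 n) = \<pi>" using run assms(1) by (auto simp: ams_run_def I_def \<pi>_def)
  then show ?thesis using AE_distrD[OF Y0_measurable[OF assms(1)], of R] assms(2) by (simp only:)
qed

lemma AE_pi_start: "AE w in \<pi>. \<xi> (w 0) = 0"
proof (rule AE_pi)
  show "AE y in \<eta>0. AE w in P y. \<xi> (w 0) = 0"
    using eta0_level
  proof eventually_elim
    case (elim y)
    show ?case using start[of y] by eventually_elim (simp add: elim)
  qed
  have "(\<lambda>w. \<xi> (w 0)) \<in> borel_measurable path_space"
    by (rule measurable_compose[OF measurable_at_0 borel_measurable_continuous_onI[OF xi_cont]])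
  then show "{w\<in>space path_space. \<xi> (w 0) = 0} \<in> sets path_space"
    by (rule borel_measurable_eq) simp
qed

lemma tracked_0: "tracked 0"
proof -
  have "AE \<omega> in M. \<forall>n\<in>I. \<xi> (Y0 n \<omega> 0) = 0"
    by (intro AE_finite_allI I_facts(1) AE_Y0 AE_pi_start)
  then show ?thesis unfolding tracked_def
  proof eventually_elim
    case (elim \<omega>)
    have "levels (st (\<theta> 0 \<omega>))" using elim by (auto simp: levels_def st_def intro!: exI[of _ 0])
    moreover have "follow_all (Y 0 \<omega>) (\<theta> 0 \<omega>)"
      using follows_refl by (auto simp: follow_all_def)
    ultimately show ?case by blast
  qed
qed

text \<open>Under \<open>K x\<close> with starting points on a common level \<open>nice\<close>
  holds almost surely, and \<open>law j\<close> transfers this null set to the run.\<close>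

lemma ready_if:
  assumes t: "tracked j" and l: "law j" shows "ready j"
proof -
  let ?B = "{w\<in>space PS. \<not> nice w}"
  have B: "?B \<in> sets PS" by (rule sets.sets_Collect_neg[OF nice_sets])
  have o: "(indicator ?B :: _ \<Rightarrow> real) \<in> obs"
    by (rule obsI[where c=1]) (use B in \<open>auto split: split_indicator\<close>)
  have lv: "AE \<omega> in M. act j \<omega> \<longrightarrow> levels (st (\<theta> j \<omega>))"
    using t unfolding tracked_def by eventually_elim blast
  have "mean j (indicator ?B) = mean j (\<lambda>w. \<integral>v. indicator ?B v \<partial>K (st w))"
    using l o unfolding law_def by blast
  also have "\<dots> = mean j (\<lambda>_. 0)"
  proof (rule mean_cong[OF lv obs_KE[OF o]])
    show "(\<lambda>_. 0) \<in> obs" by (rule obsI[where c=0]) auto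
    fix w assume "levels (st w)"
    then have "AE v in K (st w). indicator ?B v = (0::real)"
      using AE_nice[of "st w"] by (auto elim!: eventually_mono)
    then show "(\<integral>v. indicator ?B v \<partial>K (st w)) = (0::real)" by (rule integral_eq_zero_AE)
  qed
  finally have "(\<integral>\<omega>. indicator (D j) \<omega> * indicator ?B (\<theta> j \<omega>) \<partial>M) = (0::real)"
    by (simp add: mean_def)
  then have "AE \<omega> in M. indicator (D j) \<omega> * indicator ?B (\<theta> j \<omega>) = (0::real)"
    by (subst (asm) integral_nonneg_eq_0_iff_AE[OF integrable_mean[OF o]]) auto
  then show ?thesis
    using t[unfolded tracked_def] AE_space[of M] unfolding ready_def
  proof eventually_elim
    case (elim \<omega>)
    show ?case
    proof
      assume a: "act j \<omega>"
      then have "\<omega> \<in> D j" using elim(3) by (simp add: D_def)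
      then have "nice (\<theta> j \<omega>)" using elim(1) theta_space[OF elim(3), of j] by (auto simp: indicator_def split: if_splits)
      then show "follow_all (Y j \<omega>) (\<theta> j \<omega>) \<and> nice (\<theta> j \<omega>) \<and> levels (st (\<theta> j \<omega>))" using elim(2) a by blast
    qed
  qed
qed

lemma tracked_Suc:
  assumes r: "ready j" shows "tracked (Suc j)"
proof -
  have "AE \<omega> in M. \<forall>m\<in>I. \<omega> \<in> Dm j m \<longrightarrow> piece (Suc j) \<omega> 0 = bp j m \<omega>"
    by (intro AE_finite_allI I_facts(1) AE_piece_start[OF r])
  then show ?thesis
    using AE_Dm[OF r] r[unfolded ready_def] AE_space[of M] unfolding tracked_def
  proof eventually_elim
    case (elim \<omega>)
    show ?case
    proof
      assume a: "act (Suc j) \<omega>"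
      then have m: "mn (\<theta> j \<omega>) < 1" "act j \<omega>" using act_SucD by (auto simp: act_Suc)
      have "\<omega> \<in> D (Suc j)" using a elim(4) by (simp add: D_def)
      then obtain k where k: "k \<in> I" "\<omega> \<in> Dm j k" using elim(2) by blast
      then have k2: "k \<noteq> low (\<theta> j \<omega>)" "pick (Suc j) \<omega> = k" by (auto simp: Dm_def)
      have z: "piece (Suc j) \<omega> 0 = adv (mn (\<theta> j \<omega>)) (\<theta> j \<omega> k) 0" using elim(1) k by (simp add: bp_def)
      have n: "follow_all (Y j \<omega>) (\<theta> j \<omega>)" "nice (\<theta> j \<omega>)" "\<theta> j \<omega> \<in> space PS" "levels (st (\<theta> j \<omega>))"
        using elim(3) m(2) theta_space[OF elim(4)] by auto
      have t: "\<theta> (Suc j) \<omega> = move (piece (Suc j) \<omega>) (\<theta> j \<omega>)" using m(1) by (simp add: \<theta>.simps(2))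
      show "follow_all (Y (Suc j) \<omega>) (\<theta> (Suc j) \<omega>) \<and> levels (st (\<theta> (Suc j) \<omega>))"
        unfolding t particles.simps(2) k2(2)
        using follow_all_move[where z="piece (Suc j) \<omega>", OF n m(1) k(1) k2(1) z] levels_move[where z="piece (Suc j) \<omega>", OF n(2-4) m(1) k(1) k2(1) z] by blast
    qed
  qed
qed

text \<open>The induction has to be joint: \<open>law (Suc j)\<close> rests on
  \<open>ready j\<close>, and \<open>ready (Suc j)\<close> on \<open>law (Suc j)\<close> together
  with the tracking derived from \<open>ready j\<close>.\<close>

lemma law: "law j" and ready: "ready j"
proof -
  have "law j \<and> ready j"
  proof (induction j)
    case 0
    show ?case using law_0 ready_if[OF tracked_0 law_0] by blast
  next
    case (Suc j)
    then have "law (Suc j)" using law_Suc by blast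
    then show ?case using Suc ready_if[OF tracked_Suc] by blast
  qed
  then show "law j" "ready j" by auto
qed

end

section \<open>Integrals under the completed measure\<close>

lemma (in complete_measure) measurable_AE_eq:
  assumes g: "g \<in> M \<rightarrow>\<^sub>M R" and eq: "AE x in M. f x = g x" and f: "f \<in> space M \<rightarrow> space R"
  shows "f \<in> M \<rightarrow>\<^sub>M R"
proof (rule measurableI)
  fix B assume B: "B \<in> sets R"
  show "f -` B \<inter> space M \<in> sets M"
  proof (rule in_sets_AE[OF _ measurable_sets[OF g B]])
    show "AE x in M. x \<in> g -` B \<inter> space M \<longleftrightarrow> x \<in> f -` B \<inter> space M"
      using eq by eventually_elim auto
  qed simp
qed (use f in auto)

text \<open>For functions that are only almost surely equal to a measurable one. The estimator and
  the limit are defined through the hitting time of \<open>A\<close> and may be of this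
  kind.\<close>

lemma integral_completion_AE:
  fixes f :: "'a \<Rightarrow> real"
  assumes g: "integrable M g" and eq: "AE x in M. f x = g x"
  shows "integrable (completion M) f" "(\<integral>x. f x \<partial>completion M) = (\<integral>x. g x \<partial>M)"
proof -
  have gm: "g \<in> borel_measurable (completion M)"
    using borel_measurable_integrable[OF g] by (rule measurable_completion)
  have eq': "AE x in completion M. f x = g x" using eq by (rule AE_completion)
  have fm: "f \<in> borel_measurable (completion M)"
    by (rule complete_measure.measurable_AE_eq[OF completion.complete_measure_axioms gm eq']) simp
  have gi: "integrable (completion M) g" using g by (simp add: integrable_completion[OF borel_measurable_integrable[OF g]])
  show "integrable (completion M) f"
    by (rule integrable_cong_AE_imp[OF gi fm]) (use eq' in eventually_elim, simp)
  have "(\<integral>x. f x \<partial>completion M) = (\<integral>x. g x \<partial>completion M)" by (rule integral_cong_AE[OF fm gm eq'])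
  then show "(\<integral>x. f x \<partial>completion M) = (\<integral>x. g x \<partial>M)"
    by (simp add: integral_completion[OF borel_measurable_integrable[OF g]])
qed

context ams_particles
begin

lemma obs_Q: "Q \<in> obs"
proof (rule obsI[OF Q_measurable])
  fix w
  have "\<bar>\<Sum>n\<in>I. pay (w n)\<bar> \<le> N * C"
    using order_trans[OF sum_abs sum_mono[of I "\<lambda>n. \<bar>pay (w n)\<bar>" "\<lambda>_. C"]] pay_le_C by simp
  from power_mono[OF this, of 2] have "(\<Sum>n\<in>I. pay (w n))\<^sup>2 \<le> (N * C)\<^sup>2" by simp
  moreover have "(\<Sum>n\<in>I. (pay (w n))\<^sup>2) \<le> N * C\<^sup>2" by (rule sum_square_le) (rule pay_le_C)
  moreover have "0 \<le> (\<Sum>n\<in>I. (pay (w n))\<^sup>2)" by (intro sum_nonneg) simp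
  moreover have "0 \<le> (\<Sum>n\<in>I. pay (w n))\<^sup>2" "0 \<le> (real N * C)\<^sup>2" "0 \<le> N * C\<^sup>2" by auto
  ultimately show "\<bar>Q w\<bar> \<le> (N * C)\<^sup>2 + N * C\<^sup>2" unfolding Q_def by linarith
qed

end

section \<open>Mean and variance of the estimator\<close>

context ams_experiment
begin

definition b :: real where "b = 1 - 1 / real N"

lemma b_bounds: "0 \<le> b" "b < 1"
  using N2 by (auto simp: b_def)

lemma AE_levels: "AE \<omega> in M. act j \<omega> \<longrightarrow> levels (st (\<theta> j \<omega>))"
  using ready[of j, unfolded ready_def] by eventually_elim blast

lemma mean_law: "F \<in> obs \<Longrightarrow> mean j F = mean j (\<lambda>w. \<integral>v. F v \<partial>K (st w))"
  using law[of j] unfolding law_def by blast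

text \<open>\<open>mean_step\<close> integrated over the run: the contribution of the runs that stop
  now, plus \<open>b\<close> times the value of those that go on.\<close>

lemma mean_Hm_step:
  "mean j (\<lambda>w. Hm (st w)) = mean j (\<lambda>w. indicator {w. 1 \<le> mn w} w * Gm w) + b * mean (Suc j) (\<lambda>w. Hm (st w))"
proof -
  note o = obs_KE[OF obs_stopped[OF obs_Gm]] obs_KE[OF obs_S[OF obs_Hm]]
  have "mean j (\<lambda>w. Hm (st w)) = mean j (\<lambda>w. (\<integral>v. indicator {w. 1 \<le> mn w} v * Gm v \<partial>K (st w)) +
      b * (\<integral>v. S (\<lambda>w. Hm (st w)) v \<partial>K (st w)))"
  proof (rule mean_cong[OF AE_levels obs_Hm obs_add[OF o(1) obs_scale[OF o(2)]]])
    fix w assume "levels (st w)"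
    then show "Hm (st w) = (\<integral>v. indicator {w. 1 \<le> mn w} v * Gm v \<partial>K (st w)) + b * (\<integral>v. S (\<lambda>w. Hm (st w)) v \<partial>K (st w))"
      unfolding b_def by (rule mean_step)
  qed
  also have "\<dots> = mean j (\<lambda>w. \<integral>v. indicator {w. 1 \<le> mn w} v * Gm v \<partial>K (st w)) +
      b * mean j (\<lambda>w. \<integral>v. S (\<lambda>w. Hm (st w)) v \<partial>K (st w))"
    unfolding mean_add[OF o(1) obs_scale[OF o(2)]] mean_scale ..
  also have "\<dots> = mean j (\<lambda>w. indicator {w. 1 \<le> mn w} w * Gm w) + b * mean (Suc j) (\<lambda>w. Hm (st w))"
    by (rule arg_cong2[where f="\<lambda>x y. x + b * y", OF mean_law[OF obs_stopped[OF obs_Gm], symmetric]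
        mean_Suc[OF ready law obs_Hm, symmetric]])
  finally show ?thesis .
qed

lemma mean_V_step:
  "mean j (\<lambda>w. indicator {w. 1 \<le> mn w} w * (Gm w)\<^sup>2) + b\<^sup>2 * mean (Suc j) (\<lambda>w. V (st w)) \<le> mean j (\<lambda>w. V (st w))"
proof -
  note o = obs_KE[OF obs_stopped[OF obs_Gm2]] obs_KE[OF obs_S[OF obs_V]]
  have "mean j (\<lambda>w. indicator {w. 1 \<le> mn w} w * (Gm w)\<^sup>2) + b\<^sup>2 * mean (Suc j) (\<lambda>w. V (st w)) =
      mean j (\<lambda>w. \<integral>v. indicator {w. 1 \<le> mn w} v * (Gm v)\<^sup>2 \<partial>K (st w)) +
      b\<^sup>2 * mean j (\<lambda>w. \<integral>v. S (\<lambda>w. V (st w)) v \<partial>K (st w))"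
    by (rule arg_cong2[where f="\<lambda>x y. x + b\<^sup>2 * y", OF mean_law[OF obs_stopped[OF obs_Gm2]]
        mean_Suc[OF ready law obs_V]])
  also have "\<dots> = mean j (\<lambda>w. (\<integral>v. indicator {w. 1 \<le> mn w} v * (Gm v)\<^sup>2 \<partial>K (st w)) +
      b\<^sup>2 * (\<integral>v. S (\<lambda>w. V (st w)) v \<partial>K (st w)))"
    unfolding mean_add[OF o(1) obs_scale[OF o(2)]] mean_scale ..
  also have "\<dots> \<le> mean j (\<lambda>w. V (st w))"
  proof (rule mean_mono[OF AE_levels obs_add[OF o(1) obs_scale[OF o(2)]] obs_V])
    fix w assume "levels (st w)"
    then show "(\<integral>v. indicator {w. 1 \<le> mn w} v * (Gm v)\<^sup>2 \<partial>K (st w)) + b\<^sup>2 * (\<integral>v. S (\<lambda>w. V (st w)) v \<partial>K (st w)) \<le> V (st w)"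
      unfolding b_def by (rule square_step)
  qed
  finally show ?thesis .
qed

lemma prob_D_Suc: "prob (D (Suc j)) \<le> (1 - \<delta> ^ N) * prob (D j)"
proof -
  have "{w\<in>space PS. mn w < 1} \<in> sets PS" using mn_measurable by (intro borel_measurable_less) auto
  then have m: "(indicator {w. mn w < 1} :: _ \<Rightarrow> real) \<in> borel_measurable PS"
    by (subst borel_measurable_indicator_iff) (simp add: Int_def conj_commute)
  have o: "(\<lambda>w. indicator {w. mn w < 1} w :: real) \<in> obs"
    by (rule obsI[OF m, of 1]) (simp split: split_indicator)
  have "prob (D (Suc j)) = (\<integral>\<omega>. indicator (D (Suc j)) \<omega> \<partial>M)" using D_sets by simp
  also have "\<dots> = mean j (\<lambda>w. indicator {w. mn w < 1} w)"
    unfolding mean_def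
  proof (intro Bochner_Integration.integral_cong refl)
    fix \<omega> assume "\<omega> \<in> space M"
    then show "indicator (D (Suc j)) \<omega> = indicator (D j) \<omega> * (indicator {w. mn w < 1} (\<theta> j \<omega>) :: real)"
      using act_SucD[of j \<omega>] by (auto simp: D_def act_Suc split: split_indicator)
  qed
  also have "\<dots> = mean j (\<lambda>w. \<integral>v. indicator {w. mn w < 1} v \<partial>K (st w))" by (rule mean_law[OF o])
  also have "\<dots> \<le> mean j (\<lambda>_. 1 - \<delta> ^ N)"
    by (rule mean_mono[OF AE_levels obs_KE[OF o] obsI[OF borel_measurable_const order_refl] stop_prob])
  also have "\<dots> = (1 - \<delta> ^ N) * prob (D j)" using D_sets by (simp add: mean_def)
  finally show ?thesis .
qed

lemma AE_stop: "AE \<omega> in M. \<exists>k. 1 \<le> mn (\<theta> k \<omega>)"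
proof -
  obtain y0 where "\<xi> y0 = 0" using level0 by blast
  then have "\<delta> \<le> 1" using delta_le_succ[of y0] prob_space.prob_le_1[OF prob_P, of y0 succ] by linarith
  then have q: "0 \<le> 1 - \<delta> ^ N" "1 - \<delta> ^ N < 1" using delta_pos by (auto simp: power_le_one)
  have p: "prob (D j) \<le> (1 - \<delta> ^ N) ^ j" for j
  proof (induction j)
    case (Suc j)
    have "prob (D (Suc j)) \<le> (1 - \<delta> ^ N) * prob (D j)" by (rule prob_D_Suc)
    also have "\<dots> \<le> (1 - \<delta> ^ N) * (1 - \<delta> ^ N) ^ j" using Suc q by (intro mult_left_mono)
    finally show ?case by simp
  qed simp
  have "prob (\<Inter>j. D j) \<le> (1 - \<delta> ^ N) ^ j" for j
    by (rule order_trans[OF finite_measure_mono[of "\<Inter>j. D j" "D j" for j, OF INT_lower[OF UNIV_I] D_sets] p])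
  moreover have "(\<lambda>j. (1 - \<delta> ^ N) ^ j) \<longlonglongrightarrow> 0" using q by (intro LIMSEQ_power_zero) auto
  ultimately have "prob (\<Inter>j. D j) \<le> 0" by (intro LIMSEQ_le_const) auto
  then have "prob (\<Inter>j. D j) = 0" by (simp add: measure_le_0_iff)
  then have "(\<Inter>j. D j) \<in> null_sets M" using D_sets by (auto simp: null_sets_def emeasure_eq_measure)
  then have "AE \<omega> in M. \<omega> \<notin> (\<Inter>j. D j)" by (rule AE_not_in)
  then show ?thesis
    using AE_space[of M]
  proof eventually_elim
    case (elim \<omega>)
    then obtain j where "\<not> act j \<omega>" by (auto simp: D_def)
    then show ?case by (cases j) (auto simp: act_0 act_Suc not_less)
  qed
qed

text \<open>Contribution of the runs that stop after exactly \<open>j\<close> branchings, with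
  weight \<open>b ^ j\<close>. At most one of these terms is nonzero, and their sum
  \<open>est\<close> is a measurable version of the estimator, with value 0 if the run never
  stops.\<close>

definition X :: "nat \<Rightarrow> 'w \<Rightarrow> real" where
  "X j \<omega> = b ^ j * (indicator (D j) \<omega> * (indicator {w. 1 \<le> mn w} (\<theta> j \<omega>) * Gm (\<theta> j \<omega>)))"

definition est :: "'w \<Rightarrow> real" where "est \<omega> = (\<Sum>j. X j \<omega>)"

lemma act_mono: "act (i + j) \<omega> \<Longrightarrow> act i \<omega>"
  by (induction j) (auto dest: act_SucD)

lemma X_first:
  assumes k: "\<omega> \<in> space M" "1 \<le> mn (\<theta> k \<omega>)" "\<And>i. i < k \<Longrightarrow> mn (\<theta> i \<omega>) < 1"
  shows "X j \<omega> = (if j = k then b ^ k * Gm (\<theta> k \<omega>) else 0)"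
proof -
  consider "j < k" | "j = k" | "k < j" by linarith
  then show ?thesis
  proof cases
    case 1
    then show ?thesis using k(3)[OF 1] by (simp add: X_def)
  next
    case 2
    have "act k \<omega>" using k(3)[of "k - 1"] by (cases k) (auto simp: act_0 act_Suc)
    then show ?thesis using 2 k by (simp add: X_def D_def)
  next
    case 3
    then obtain i where "j = Suc k + i" using less_iff_Suc_add[of k j] by auto
    then have "\<not> act j \<omega>" using act_mono[of "Suc k" i \<omega>] k(2) by (auto simp: act_Suc)
    then show ?thesis using 3 by (simp add: X_def D_def)
  qed
qed

lemma X_cases:
  assumes w: "\<omega> \<in> space M"
  obtains k c where "\<bar>c\<bar> \<le> C" "\<And>j. X j \<omega> = (if j = k then c else 0)"
proof (cases "\<exists>k. 1 \<le> mn (\<theta> k \<omega>)")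
  case True
  define k where "k = (LEAST k. 1 \<le> mn (\<theta> k \<omega>))"
  have k: "1 \<le> mn (\<theta> k \<omega>)" "\<And>i. i < k \<Longrightarrow> mn (\<theta> i \<omega>) < 1"
    using LeastI_ex[OF True] not_less_Least[of _ "\<lambda>k. 1 \<le> mn (\<theta> k \<omega>)"] by (auto simp: k_def not_le)
  have "\<bar>b ^ k\<bar> * \<bar>Gm (\<theta> k \<omega>)\<bar> \<le> 1 * C"
    using b_bounds Gm_le by (intro mult_mono) (auto simp: power_le_one)
  then show thesis using X_first[OF w k] by (intro that[of "b ^ k * Gm (\<theta> k \<omega>)" k]) (auto simp: abs_mult)
next
  case False
  then have "X j \<omega> = 0" for j by (simp add: X_def not_le)
  then show thesis using C_nonneg by (intro that[of 0 0]) auto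
qed

text \<open>As at most one term is nonzero, the partial sums are bounded by \<open>C\<close>, and
  the square of a partial sum has no cross terms.\<close>

lemma X_sum:
  assumes w: "\<omega> \<in> space M"
  shows "(\<lambda>J. \<Sum>j<J. X j \<omega>) \<longlonglongrightarrow> est \<omega>" "\<bar>\<Sum>j<J. X j \<omega>\<bar> \<le> C" "(\<Sum>j<J. X j \<omega>)\<^sup>2 = (\<Sum>j<J. (X j \<omega>)\<^sup>2)"
proof -
  obtain k c where k: "\<bar>c\<bar> \<le> C" and X: "\<And>j. X j \<omega> = (if j = k then c else 0)" using X_cases[OF w] by blast
  have "(\<lambda>j. X j \<omega>) sums c" unfolding X by (rule sums_single[where f="\<lambda>_. c"])
  then show "(\<lambda>J. \<Sum>j<J. X j \<omega>) \<longlonglongrightarrow> est \<omega>" unfolding est_def by (metis sums_def sums_unique)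
  show "\<bar>\<Sum>j<J. X j \<omega>\<bar> \<le> C" unfolding X using k C_nonneg by (simp add: sum.delta)
  have "(X j \<omega>)\<^sup>2 = (if j = k then c\<^sup>2 else 0)" for j unfolding X by simp
  then show "(\<Sum>j<J. X j \<omega>)\<^sup>2 = (\<Sum>j<J. (X j \<omega>)\<^sup>2)" unfolding X by (simp add: sum.delta)
qed

lemma X_measurable: "X j \<in> borel_measurable M"
  unfolding X_def[abs_def]
  by (intro borel_measurable_times borel_measurable_const
      borel_measurable_integrable[OF integrable_mean[OF obs_stopped[OF obs_Gm]]])

lemma est_measurable: "est \<in> borel_measurable M"
  unfolding est_def[abs_def] by (intro borel_measurable_suminf X_measurable)

lemma est_le: "\<omega> \<in> space M \<Longrightarrow> \<bar>est \<omega>\<bar> \<le> C"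
  by (rule LIMSEQ_le_const2[OF tendsto_rabs[OF X_sum(1)]]) (auto intro: X_sum(2))

lemma integral_X: "(\<integral>\<omega>. X j \<omega> \<partial>M) = b ^ j * mean j (\<lambda>w. indicator {w. 1 \<le> mn w} w * Gm w)"
  unfolding X_def mean_def by simp

lemma integral_X2: "(\<integral>\<omega>. (X j \<omega>)\<^sup>2 \<partial>M) = (b\<^sup>2) ^ j * mean j (\<lambda>w. indicator {w. 1 \<le> mn w} w * (Gm w)\<^sup>2)"
proof -
  have "(\<integral>\<omega>. (X j \<omega>)\<^sup>2 \<partial>M) = (\<integral>\<omega>. (b\<^sup>2) ^ j * (indicator (D j) \<omega> * (indicator {w. 1 \<le> mn w} (\<theta> j \<omega>) * (Gm (\<theta> j \<omega>))\<^sup>2)) \<partial>M)"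
    by (intro Bochner_Integration.integral_cong refl)
      (auto simp: X_def power_mult_distrib power_mult[symmetric] mult.commute split: split_indicator)
  then show ?thesis by (simp add: mean_def)
qed

lemma abs_X_le: "\<omega> \<in> space M \<Longrightarrow> \<bar>X j \<omega>\<bar> \<le> C"
  by (rule X_cases, assumption) (use C_nonneg in auto)

lemma integrable_X: "integrable M (X j)" and integrable_X2: "integrable M (\<lambda>\<omega>. (X j \<omega>)\<^sup>2)"
proof -
  show "integrable M (X j)" by (rule integrable_M[OF X_measurable abs_X_le])
  show "integrable M (\<lambda>\<omega>. (X j \<omega>)\<^sup>2)"
    by (rule integrable_M[where c="C\<^sup>2", OF borel_measurable_power[OF X_measurable]])
      (use power_mono[OF abs_X_le, of _ _ 2] in auto)
qed

lemma power_tendsto_0: "(\<And>j. \<bar>a j\<bar> \<le> c) \<Longrightarrow> \<bar>q\<bar> < 1 \<Longrightarrow> (\<lambda>j. q ^ j * a j) \<longlonglongrightarrow> (0::real)"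
proof -
  assume a: "\<And>j. \<bar>a j\<bar> \<le> c" and q: "\<bar>q\<bar> < 1"
  have "(\<lambda>j. q ^ j) \<longlonglongrightarrow> 0" using q by (intro LIMSEQ_power_zero) simp
  moreover have "Bfun a sequentially" using a by (intro BfunI[where K=c]) auto
  ultimately show ?thesis
    unfolding tendsto_Zfun_iff diff_0_right by (rule bounded_bilinear.Zfun_prod_Bfun[OF bounded_bilinear_mult])
qed

lemma mean_abs_le:
  assumes "F \<in> obs" "\<And>w. \<bar>F w\<bar> \<le> c" shows "\<bar>mean j F\<bar> \<le> c"
  unfolding mean_def
proof (rule abs_integral_le[OF prob_space_axioms])
  have "0 \<le> c" using assms(2)[of undefined] by linarith
  then show "0 \<le> c" "\<bar>indicator (D j) \<omega> * F (\<theta> j \<omega>)\<bar> \<le> c" for \<omega> using assms(2) by (auto split: split_indicator)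
qed

text \<open>The identities \<open>mean_Hm_step\<close> telescope after multiplication by
  \<open>b ^ j\<close>; the remainder tends to 0 because \<open>b < 1\<close> and \<open>Hm\<close>
  is bounded.\<close>

lemma integral_est: "(\<integral>\<omega>. est \<omega> \<partial>M) = mean 0 (\<lambda>w. Hm (st w))"
proof -
  have "(\<lambda>J. \<integral>\<omega>. (\<Sum>j<J. X j \<omega>) \<partial>M) \<longlonglongrightarrow> (\<integral>\<omega>. est \<omega> \<partial>M)"
  proof (rule integral_dominated_convergence[where w="\<lambda>_. C"])
    show "AE \<omega> in M. (\<lambda>J. \<Sum>j<J. X j \<omega>) \<longlonglongrightarrow> est \<omega>" by (rule AE_I2) (rule X_sum(1))
    show "AE \<omega> in M. norm (\<Sum>j<J. X j \<omega>) \<le> C" for J by (rule AE_I2) (simp add: X_sum(2))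
  qed (auto intro: est_measurable borel_measurable_sum X_measurable)
  moreover have "(\<integral>\<omega>. (\<Sum>j<J. X j \<omega>) \<partial>M) = mean 0 (\<lambda>w. Hm (st w)) - b ^ J * mean J (\<lambda>w. Hm (st w))" for J
  proof -
    have "(\<Sum>j<J. b ^ j * mean j (\<lambda>w. indicator {w. 1 \<le> mn w} w * Gm w)) =
        mean 0 (\<lambda>w. Hm (st w)) - b ^ J * mean J (\<lambda>w. Hm (st w))"
    proof (induction J)
      case (Suc J)
      then show ?case using mean_Hm_step[of J] by (simp add: algebra_simps)
    qed simp
    then show ?thesis by (simp add: Bochner_Integration.integral_sum[OF integrable_X] integral_X)
  qed
  moreover have "(\<lambda>J. mean 0 (\<lambda>w. Hm (st w)) - b ^ J * mean J (\<lambda>w. Hm (st w))) \<longlonglongrightarrow> mean 0 (\<lambda>w. Hm (st w)) - 0"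
    using b_bounds by (intro tendsto_diff tendsto_const power_tendsto_0[where c=C] mean_abs_le obs_Hm Hm_le) auto
  ultimately show ?thesis by (simp add: LIMSEQ_unique)
qed

text \<open>The square of \<open>est\<close> is the limit of sums of squares by
  \<open>X_sum\<close>, and the inequalities \<open>mean_V_step\<close> telescope with weights
  \<open>(b\<^sup>2) ^ j\<close>.\<close>

lemma integral_est2: "(\<integral>\<omega>. (est \<omega>)\<^sup>2 \<partial>M) \<le> mean 0 (\<lambda>w. V (st w))"
proof -
  have "(\<lambda>J. \<integral>\<omega>. (\<Sum>j<J. (X j \<omega>)\<^sup>2) \<partial>M) \<longlonglongrightarrow> (\<integral>\<omega>. (est \<omega>)\<^sup>2 \<partial>M)"
  proof (rule integral_dominated_convergence[where w="\<lambda>_. C\<^sup>2"])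
    show "AE \<omega> in M. (\<lambda>J. \<Sum>j<J. (X j \<omega>)\<^sup>2) \<longlonglongrightarrow> (est \<omega>)\<^sup>2"
      by (rule AE_I2) (simp only: X_sum(3)[symmetric] tendsto_power[OF X_sum(1)])
    show "AE \<omega> in M. norm (\<Sum>j<J. (X j \<omega>)\<^sup>2) \<le> C\<^sup>2" for J
      by (rule AE_I2) (use power_mono[OF X_sum(2), of _ J 2] in \<open>auto simp: X_sum(3)[symmetric]\<close>)
    show "(\<lambda>\<omega>. \<Sum>j<J. (X j \<omega>)\<^sup>2) \<in> borel_measurable M" for J
      by (intro borel_measurable_sum borel_measurable_power X_measurable)
    show "(\<lambda>\<omega>. (est \<omega>)\<^sup>2) \<in> borel_measurable M" by (rule borel_measurable_power[OF est_measurable])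
  qed simp
  moreover have "(\<integral>\<omega>. (\<Sum>j<J. (X j \<omega>)\<^sup>2) \<partial>M) \<le> mean 0 (\<lambda>w. V (st w)) - (b\<^sup>2) ^ J * mean J (\<lambda>w. V (st w))" for J
  proof -
    have "(\<Sum>j<J. (b\<^sup>2) ^ j * mean j (\<lambda>w. indicator {w. 1 \<le> mn w} w * (Gm w)\<^sup>2)) \<le>
        mean 0 (\<lambda>w. V (st w)) - (b\<^sup>2) ^ J * mean J (\<lambda>w. V (st w))"
    proof (induction J)
      case (Suc J)
      have "(b\<^sup>2) ^ J * (mean J (\<lambda>w. indicator {w. 1 \<le> mn w} w * (Gm w)\<^sup>2) + b\<^sup>2 * mean (Suc J) (\<lambda>w. V (st w)))
          \<le> (b\<^sup>2) ^ J * mean J (\<lambda>w. V (st w))"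
        by (intro mult_left_mono mean_V_step) simp
      then show ?case using Suc by (simp add: algebra_simps)
    qed simp
    then show ?thesis by (simp add: Bochner_Integration.integral_sum[OF integrable_X2] integral_X2)
  qed
  moreover have "(\<lambda>J. mean 0 (\<lambda>w. V (st w)) - (b\<^sup>2) ^ J * mean J (\<lambda>w. V (st w))) \<longlonglongrightarrow> mean 0 (\<lambda>w. V (st w)) - 0"
  proof (intro tendsto_diff tendsto_const power_tendsto_0[where c="3 * C\<^sup>2"] mean_abs_le obs_V V_le)
    show "\<bar>b\<^sup>2\<bar> < 1" using b_bounds by (simp add: power_less_one_iff)
  qed
  ultimately show ?thesis by (intro LIMSEQ_le[where X="\<lambda>J. \<integral>\<omega>. (\<Sum>j<J. (X j \<omega>)\<^sup>2) \<partial>M"]) auto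
qed

section \<open>Variance bound and identification with the estimator of the algorithm\<close>

definition \<gamma> :: real where "\<gamma> = (\<integral>w. pay w \<partial>\<pi>)"

lemma mean_0_Hm: "mean 0 (\<lambda>w. Hm (st w)) = \<gamma>"
proof -
  have "mean 0 (\<lambda>w. Hm (st w)) = mean 0 Gm" by (simp add: mean_law[OF obs_Gm] integral_Gm)
  also have "\<dots> = \<gamma>"
    unfolding mean_0[OF obs_Gm] using N2 by (subst integral_Gm_PiM) (auto intro: prob_pi simp: \<gamma>_def)
  finally show ?thesis .
qed

lemma mean_0_V: "mean 0 (\<lambda>w. V (st w)) \<le> \<gamma>\<^sup>2 + C\<^sup>2 / N"
proof -
  have o: "(\<lambda>_. C\<^sup>2 / N) \<in> obs" by (rule obsI[OF borel_measurable_const order_refl])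
  have "V x = (1 / (real N)\<^sup>2) * (\<integral>v. Q v \<partial>K x) + C\<^sup>2 / N" for x
    unfolding V_def integral_Q by simp
  then have "mean 0 (\<lambda>w. V (st w)) = (1 / (real N)\<^sup>2) * mean 0 Q + mean 0 (\<lambda>_. C\<^sup>2 / N)"
    using mean_add[OF obs_scale[OF obs_KE[OF obs_Q], of "1 / (real N)\<^sup>2"] o, of 0]
    by (simp only: mean_scale mean_law[OF obs_Q, of 0])
  also have "mean 0 (\<lambda>_. C\<^sup>2 / N) = C\<^sup>2 / N"
    unfolding mean_0[OF o] by (simp add: prob_space.prob_space[OF prob_space_PiM[OF prob_pi]])
  \<comment> \<open>There are \<open>N * (N - 1)\<close> ordered pairs of different initial
    particles, each contributing \<open>\<gamma>\<^sup>2\<close>.\<close>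
  also have "(1 / (real N)\<^sup>2) * mean 0 Q = \<gamma>\<^sup>2 - \<gamma>\<^sup>2 / N"
    unfolding mean_0[OF obs_Q] using N2
    by (subst integral_Q_PiM) (auto intro: prob_pi simp: \<gamma>_def[symmetric] field_simps power2_eq_square)
  finally show ?thesis using divide_nonneg_nonneg[of "\<gamma>\<^sup>2" "real N"] by simp
qed

lemma est_variance:
  "integrable M (\<lambda>\<omega>. (est \<omega> - \<gamma>)\<^sup>2)" "(\<integral>\<omega>. (est \<omega> - \<gamma>)\<^sup>2 \<partial>M) \<le> C\<^sup>2 / N"
proof -
  have i1: "integrable M est" by (rule integrable_M[OF est_measurable est_le])
  have i2: "integrable M (\<lambda>\<omega>. (est \<omega>)\<^sup>2)"
    by (rule integrable_M[where c="C\<^sup>2", OF borel_measurable_power[OF est_measurable]])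
      (use power_mono[OF est_le, of _ 2] in auto)
  have e: "(est \<omega> - \<gamma>)\<^sup>2 = (est \<omega>)\<^sup>2 + (\<gamma>\<^sup>2 + - (2 * \<gamma>) * est \<omega>)" for \<omega>
    by (simp add: power2_diff)
  show "integrable M (\<lambda>\<omega>. (est \<omega> - \<gamma>)\<^sup>2)" unfolding e using i1 i2 by (intro Bochner_Integration.integrable_add) auto
  have "(\<integral>\<omega>. (est \<omega> - \<gamma>)\<^sup>2 \<partial>M) = (\<integral>\<omega>. (est \<omega>)\<^sup>2 \<partial>M) + (\<gamma>\<^sup>2 + - (2 * \<gamma>) * (\<integral>\<omega>. est \<omega> \<partial>M))"
    unfolding e using i1 i2 prob_space by (subst Bochner_Integration.integral_add | simp)+
  also have "\<dots> \<le> C\<^sup>2 / N"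
    using integral_est2 mean_0_V unfolding integral_est mean_0_Hm by (simp add: power2_eq_square)
  finally show "(\<integral>\<omega>. (est \<omega> - \<gamma>)\<^sup>2 \<partial>M) \<le> C\<^sup>2 / N" .
qed

text \<open>With \<open>k\<close> the first index at which the minimal score is 1, exactly
  \<open>k\<close> branchings are performed. Then all particles have score 1, hence succeed, and the
  value of \<open>\<phi>\<close> at the entrance point is the payoff of the remaining part.\<close>

lemma gamma_est_eq:
  assumes w: "\<omega> \<in> space M" and r: "\<And>j. act j \<omega> \<Longrightarrow> follow_all (Y j \<omega>) (\<theta> j \<omega>) \<and> nice (\<theta> j \<omega>)"
    and fin: "\<exists>k. 1 \<le> mn (\<theta> k \<omega>)"
  shows "gamma_est N \<xi> A (\<lambda>n. Y0 n \<omega>) (\<lambda>j. pick j \<omega>) (\<lambda>j. piece j \<omega>) 1 \<phi> = est \<omega>"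
proof -
  define k where "k = (LEAST k. 1 \<le> mn (\<theta> k \<omega>))"
  have k: "1 \<le> mn (\<theta> k \<omega>)" "\<And>i. i < k \<Longrightarrow> mn (\<theta> i \<omega>) < 1"
    using LeastI_ex[OF fin] not_less_Least[of _ "\<lambda>k. 1 \<le> mn (\<theta> k \<omega>)"] by (auto simp: k_def not_le)
  have a: "act i \<omega>" if "i \<le> k" for i
    using k(2)[of "i - 1"] that by (cases i) (auto simp: act_0 act_Suc)
  have s: "min_score N \<xi> A (Y i \<omega>) = mn (\<theta> i \<omega>)" if "i \<le> k" for i
    using r[OF a[OF that]] follow_all_score(1)[OF _ _ theta_space[OF w]] by blast
  have k1: "mn (\<theta> k \<omega>) = 1" using k(1) mn_bounds(2)[of "\<theta> k \<omega>"] by simp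
  have frozen: "Y (k + i) \<omega> = Y k \<omega>" for i
    by (induction i) (use s[of k] k1 in \<open>simp_all add: ams_step_def\<close>)
  \<comment> \<open>The level with index \<open>Suc i\<close> is the minimal score after
    \<open>i\<close> branchings, and from \<open>Suc k\<close> on it is 1 as the state is frozen; so
    the branchings performed have the indices 1 to \<open>k\<close>.\<close>
  have t: "tau N \<xi> A (\<lambda>n. Y0 n \<omega>) (\<lambda>j. pick j \<omega>) (\<lambda>j. piece j \<omega>) (Suc i) =
      (if i < k then mn (\<theta> i \<omega>) else 1)" for i
    using s[of i] s[of k] k1 frozen[of "i - k"] by (auto simp: tau_Suc)
  have "{j. 1 \<le> j \<and> tau N \<xi> A (\<lambda>n. Y0 n \<omega>) (\<lambda>j. pick j \<omega>) (\<lambda>j. piece j \<omega>) j \<noteq> 1 \<and>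
      tau N \<xi> A (\<lambda>n. Y0 n \<omega>) (\<lambda>j. pick j \<omega>) (\<lambda>j. piece j \<omega>) j \<le> 1} = {1..k}"
  proof (intro set_eqI)
    fix j
    show "j \<in> {j. 1 \<le> j \<and> tau N \<xi> A (\<lambda>n. Y0 n \<omega>) (\<lambda>j. pick j \<omega>) (\<lambda>j. piece j \<omega>) j \<noteq> 1 \<and>
      tau N \<xi> A (\<lambda>n. Y0 n \<omega>) (\<lambda>j. pick j \<omega>) (\<lambda>j. piece j \<omega>) j \<le> 1} \<longleftrightarrow> j \<in> {1..k}"
    proof (cases j)
      case (Suc i)
      show ?thesis using k(2)[of i] unfolding Suc by (auto simp: t)
    qed simp
  qed
  moreover have "Max (insert 0 {1..k}) = k" by (cases "k = 0") (auto intro!: Max_eqI)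
  ultimately have br: "branchings N \<xi> A (\<lambda>n. Y0 n \<omega>) (\<lambda>j. pick j \<omega>) (\<lambda>j. piece j \<omega>) 1 = k"
    by (simp add: branchings_def)
  have "\<phi> (entrance_point N \<xi> A (\<lambda>n. Y0 n \<omega>) (\<lambda>j. pick j \<omega>) (\<lambda>j. piece j \<omega>) 1 n) = pay (\<theta> k \<omega> n)" if n: "n \<in> I" for n
  proof -
    have f: "follow_all (Y k \<omega>) (\<theta> k \<omega>)" and ni: "nice (\<theta> k \<omega>)" using r[OF a] by auto
    obtain \<sigma> where fo: "follows (Y k \<omega> n) (\<theta> k \<omega> n) \<sigma>" using f n by (auto simp: follow_all_def)
    have g: "good (\<theta> k \<omega> n)" by (rule nice_good[OF ni theta_space[OF w] n])
    have "lev (\<theta> k \<omega> n) = 1" using mn_le[OF n, of "\<theta> k \<omega>"] k1 lev_le_1[of "\<theta> k \<omega> n"] by simp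
    then have al: "L 1 (\<theta> k \<omega> n) < H (\<theta> k \<omega> n)" using g by (simp add: good_def)
    have st: "\<xi> (\<theta> k \<omega> n 0) \<le> 1" "\<theta> k \<omega> n \<in> space path_space" using g by (auto simp: good_def)
    have fi: "L 1 (\<theta> k \<omega> n) < \<infinity>" using al by auto
    have t: "L 1 (\<theta> k \<omega> n) = ereal (real_of_ereal (L 1 (\<theta> k \<omega> n)))"
      using real_of_ereal_time[of "L 1" "\<theta> k \<omega> n", OF optional_L fi] by (rule conjunct1)
    have "\<xi> (\<theta> k \<omega> n (real_of_ereal (L 1 (\<theta> k \<omega> n)))) = 1"
      by (rule level_at_level_time(2)[OF st(2) xi_cont st(1) t])
    then show ?thesis
      using al follows_at_L[OF fo st(1) fi] by (simp add: entrance_point_def br Let_def pay_def \<phi>1_def)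
  qed
  then have "gamma_est N \<xi> A (\<lambda>n. Y0 n \<omega>) (\<lambda>j. pick j \<omega>) (\<lambda>j. piece j \<omega>) 1 \<phi> = b ^ k * Gm (\<theta> k \<omega>)"
    by (simp add: gamma_est_def p_est_def eta_est_def br b_def Gm_def I_def)
  also have "\<dots> = est \<omega>"
  proof -
    have "(\<lambda>j. X j \<omega>) sums (b ^ k * Gm (\<theta> k \<omega>))"
      using sums_single[of k "\<lambda>_. b ^ k * Gm (\<theta> k \<omega>)"] by (simp only: X_first[of \<omega> k, OF w k])
    then show ?thesis unfolding est_def by (rule sums_unique)
  qed
  finally show ?thesis .
qed

lemma AE_gamma_est:
  "AE \<omega> in M. gamma_est N \<xi> A (\<lambda>n. Y0 n \<omega>) (\<lambda>j. pick j \<omega>) (\<lambda>j. piece j \<omega>) 1 \<phi> = est \<omega>"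
proof -
  have "AE \<omega> in M. \<forall>j. act j \<omega> \<longrightarrow> follow_all (Y j \<omega>) (\<theta> j \<omega>) \<and> nice (\<theta> j \<omega>)"
    unfolding AE_all_countable
  proof
    fix j
    show "AE \<omega> in M. act j \<omega> \<longrightarrow> follow_all (Y j \<omega>) (\<theta> j \<omega>) \<and> nice (\<theta> j \<omega>)"
      using ready[of j, unfolded ready_def] by eventually_elim blast
  qed
  then show ?thesis
    using AE_stop AE_space[of M]
  proof eventually_elim
    case (elim \<omega>)
    show ?case by (rule gamma_est_eq[OF elim(3) _ elim(2)]) (use elim(1) in blast)
  qed
qed

text \<open>The hitting time of \<open>A\<close> is again replaced by \<open>H\<close>, now under
  the law started from \<open>\<eta>0\<close>. On success the entrance point lies on level 1, where
  \<open>\<phi>1\<close> is \<open>\<phi>\<close>.\<close>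

lemma limit_gamma1_eq: "limit_gamma1 P \<eta>0 \<xi> A \<phi> = \<gamma>"
proof -
  interpret pi: prob_space \<pi> by (rule prob_pi)
  have i: "integrable \<pi> pay"
    by (rule pi.integrable_bounded[where c=C]) (auto intro: measurable_pi pay_measurable pay_le_C)
  have "AE w in \<pi>. hit_time (interior A) w = H w"
  proof (rule AE_pi)
    show "AE y in \<eta>0. AE w in P y. hit_time (interior A) w = H w"
      using eta0_level
    proof eventually_elim
      case (elim y)
      show ?case using AE_H_interior[of y] elim by (auto elim!: eventually_mono)
    qed
    show "{w\<in>space path_space. hit_time (interior A) w = H w} \<in> sets path_space"
      by (rule borel_measurable_eq[OF optional_time_measurable[OF optional_hit_open[OF open_interior]] measurable_H])
  qed
  then have "AE w in \<pi>. \<phi> (w (real_of_ereal (L 1 w))) * indicator (success_event \<xi> A) w = pay w"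
    using AE_pi_start AE_space[of \<pi>]
  proof eventually_elim
    case (elim w)
    have A: "hit_time A w = H w"
      using elim(1) hit_time_mono[OF interior_subset, of A w] hit_time_mono[OF closure_subset, of A w] by auto
    show ?case
    proof (cases "L 1 w < H w")
      case True
      then have fi: "L 1 w < \<infinity>" by auto
      have t: "L 1 w = ereal (real_of_ereal (L 1 w))"
        using real_of_ereal_time[of "L 1" w, OF optional_L fi] by (rule conjunct1)
      have "\<xi> (w (real_of_ereal (L 1 w))) = 1"
        using elim by (intro level_at_level_time(2)[OF _ xi_cont _ t]) auto
      then show ?thesis using True A elim by (simp add: success_event_def pay_def \<phi>1_def)
    qed (simp add: success_event_def pay_def A)
  qed
  from integral_completion_AE(2)[OF i this] show ?thesis
    by (simp add: limit_gamma1_def \<gamma>_def \<pi>_def)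
qed

end

theorem proposition2p6:
  fixes P :: "'e::polish_space \<Rightarrow> 'e path measure"
    and \<eta>0 :: "'e measure"
    and \<xi> \<phi> :: "'e \<Rightarrow> real"
    and A :: "'e set"
    and N :: nat
    and M :: "'w measure"
    and Y0 piece :: "nat \<Rightarrow> 'w \<Rightarrow> 'e path"
    and pick :: "nat \<Rightarrow> 'w \<Rightarrow> nat"
  assumes "markov_process P"
    and "prob_space \<eta>0" and "sets \<eta>0 = sets borel"
    and "A \<in> sets borel"
    and "success_prob \<xi> A (\<eta>0 \<bind> P) > 0"
    and "assumption1 P \<eta>0 \<xi> A"
    and "assumption2 P \<xi> A"
    and "assumption3 P \<xi> A"
    and "N \<ge> 2"
    and "ams_run P \<eta>0 \<xi> A N M Y0 pick piece"
    and "continuous_on {x. \<xi> x = 1} \<phi>"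
    and "bounded (\<phi> ` {x. \<xi> x = 1})"
  defines "err \<equiv> \<lambda>\<omega>.
      gamma_est N \<xi> A (\<lambda>n. Y0 n \<omega>) (\<lambda>j. pick j \<omega>) (\<lambda>j. piece j \<omega>) 1 \<phi>
      - limit_gamma1 P \<eta>0 \<xi> A \<phi>"
  shows "integrable (completion M) (\<lambda>\<omega>. (err \<omega>)\<^sup>2) \<and>
    (LINT \<omega>|completion M. (err \<omega>)\<^sup>2) \<le> 6 * (SUP x\<in>{x. \<xi> x = 1}. \<bar>\<phi> x\<bar>)\<^sup>2 / real N"
proof -
  have a1: "locally compact (UNIV :: 'e set)" "continuous_on UNIV \<xi>" "measure \<eta>0 {y. \<xi> y = 0} = 1"
      "A \<subseteq> {y. \<xi> y < 0}" "feller P"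
    using assms(6) by (auto simp: assumption1_def)
  have "{y. \<xi> y = 0} \<in> sets \<eta>0"
    using closed_Collect_eq[OF a1(2) continuous_on_const[of UNIV 0]] by (simp add: assms(3) borel_closed)
  then have lev: "AE y in \<eta>0. \<xi> y = 0"
    using prob_space.AE_in_set_eq_1[OF assms(2), of "{y. \<xi> y = 0}"] a1(3) by simp
  have lev0: "\<exists>y. \<xi> y = 0"
  proof (rule ccontr)
    assume "\<not> ?thesis"
    then have "{y. \<xi> y = 0} = {}" by auto
    then show False using a1(3) by simp
  qed
  interpret eta: prob_space \<eta>0 by fact
  interpret ams_experiment P \<xi> A \<phi> N \<eta>0 M Y0 piece pick
    by unfold_locales (fact a1 assms lev lev0)+
  \<comment> \<open>The error itself need not be measurable; its almost sure identity with the
    measurable \<open>est - \<gamma>\<close> gives integrability and value in the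
    completion.\<close>
  have "AE \<omega> in M. (err \<omega>)\<^sup>2 = (est \<omega> - \<gamma>)\<^sup>2"
    using AE_gamma_est by eventually_elim (simp add: err_def limit_gamma1_eq)
  note e = integral_completion_AE[OF est_variance(1) this]
  \<comment> \<open>The variance bound holds with constant 1; the factor 6 follows by
    monotonicity.\<close>
  have "C\<^sup>2 / N \<le> 6 * C\<^sup>2 / N" by (intro divide_right_mono) auto
  moreover have "(LINT \<omega>|completion M. (err \<omega>)\<^sup>2) \<le> C\<^sup>2 / N"
    unfolding e(2) by (rule est_variance(2))
  ultimately have "(LINT \<omega>|completion M. (err \<omega>)\<^sup>2) \<le> 6 * C\<^sup>2 / N"
    by (rule order_trans[rotated])
  with e(1) show ?thesis unfolding C_def by (rule conjI)
qed

end
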